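(* Let $\lambda,\beta>0$ and $0<\alpha<1$ be such that $\alpha<\lambda\wedge\beta=\min\{\lambda,\beta\}$. Let $f$ be a continuous function on $\mathbb{R}_+$ in $L_{(\lambda\wedge\beta)/2}$. The following assertions are equivalent. (i) $f\in C^\alpha_+$. (ii) For every $1\le p<\infty$ there exists $C_p>0$ such that $$\text{(M1)}\quad \frac{1}{|I|^{1+p\alpha}}\int_I|f(y)-f_I|^p\,dy\le C_p\quad\text{for every bounded interval } I\subset\mathbb{R}_+,$$ $$\text{(M2)}\quad \frac{1}{|I|^{1+p\alpha}}\int_I|f(y)|^p\,dy\le C_p\quad\text{for every } I=(0,b),\ b>0,$$ where $f_I=\frac1{|I|}\int_If(y)\,dy$. (iii) There is a constant $C$ such that $\|t^\beta\partial_t^\beta P_t^\lambda f\|_{L^\infty(\mathbb{R}_+)}\le Ct^\alpha$ for all $t>0$. (iv) $$[d\mu_f]_\alpha:=\sup_{I\subset\mathbb{R}_+}\frac{1}{|I|^{1+2\alpha}}\int_0^{|I|}\int_I\big|t^\beta\partial_t^\beta P_t^\lambda f(x)\big|^2\,\frac{dx\,dt}{t}<\infty,$$ where the supremum is taken over all bounded intervals $I$ in $\mathbb{R}_+$. Moreover, the quantities $\|f\|_{C^\alpha_+}$, $\inf\{C_p^{1/p}:\text{(M1) and (M2) hold}\}$ (for each $1\le p<\infty$), $\|t^{\beta-\alpha}\partial_t^\beta P_t^\lambda f\|_{L^\infty(\mathbb{R}_+\times(0,\infty))}$ and $[d\mu_f]_\alpha^{1/2}$ are equivalent (comparable up to positive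 multiplicative constants independent of $f$).
   Context: $\mathbb{R}_+=(0,\infty)$. For $0<\alpha<1$, $C^\alpha_+$ is the space of continuous functions $f$ on $\mathbb{R}_+$ with finite norm $\|f\|_{C^\alpha_+}=\sup_{x\ne y}\frac{|f(x)-f(y)|}{|x-y|^\alpha}+\sup_{x>0}x^{-\alpha}|f(x)|$. For $\rho>0$, $L_\rho=\{f:\mathbb{R}_+\to\mathbb{R}:\ \int_0^\infty|f(x)|(1+x)^{-1-2\rho}\,dx<\infty\}$. Kernels: for $x,y,t>0$, $W_t^\lambda(x,y)=\frac{\sqrt{xy}}{2t}I_{\lambda-1/2}(\frac{xy}{2t})e^{-(x^2+y^2)/(4t)}$ with $I_\nu$ the modified Bessel function of the first kind, $P_t^\lambda(x,y)=\frac{t}{2\sqrt\pi}\int_0^\infty\frac{e^{-t^2/(4s)}}{s^{3/2}}W_s^\lambda(x,y)\,ds$, and $P_t^\lambda f(x)=\int_0^\infty P_t^\lambda(x,y)f(y)\,dy$. Fractional derivative (Segovia–Wheeden): for $\beta>0$ and $m\in\mathbb{N}$ with $m-1\le\beta<m$, $$\partial_t^\beta F(x,t)=\frac{e^{-i\pi(m-\beta)}}{\Gamma(m-\beta)}\int_0^\infty\partial_t^mF(x,t+s)\,s^{m-\beta-1}\,ds.$$ $|I|$ denotes the length of the interval $I$. *)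

theory Defs
  imports "HOL-Analysis.Analysis" "HOL-Probability.Essential_Supremum"
begin

text \<open>
  Functions on \<open>\<real>\<^sub>+ = (0,\<infinity>)\<close> are functions on \<^typ>\<open>real\<close> of which only the values on
  \<^term>\<open>{0<..} :: real set\<close> are used. Norms, seminorms and suprema are valued in
  \<^typ>\<open>ennreal\<close>, so that they are defined, possibly infinite, for every function.
\<close>

subsection \<open>Function spaces\<close>

definition holder_norm :: "real \<Rightarrow> (real \<Rightarrow> real) \<Rightarrow> ennreal" where
  "holder_norm \<alpha> f =
     (SUP (x, y) \<in> {(x, y). 0 < x \<and> 0 < y \<and> x \<noteq> y}. ennreal (\<bar>f x - f y\<bar> / \<bar>x - y\<bar> powr \<alpha>))
     + (SUP x\<in>{0<..}. ennreal (x powr (- \<alpha>) * \<bar>f x\<bar>))"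

definition holder_space :: "real \<Rightarrow> (real \<Rightarrow> real) set" where
  "holder_space \<alpha> = {f. continuous_on {0<..} f \<and> holder_norm \<alpha> f < \<infinity>}"

text \<open>Stated without the absolute value, integrability also makes \<open>f\<close> measurable on \<open>\<real>\<^sub>+\<close>.\<close>

definition L_space :: "real \<Rightarrow> (real \<Rightarrow> real) set" where
  "L_space \<rho> = {f. set_integrable lborel {0<..} (\<lambda>x. f x * (1 + x) powr (- 1 - 2 * \<rho>))}"

subsection \<open>The Bessel heat and Poisson kernels\<close>

text \<open>The modified Bessel function of the first kind, for \<open>z > 0\<close>.\<close>

definition bessel_I :: "real \<Rightarrow> real \<Rightarrow> real" where
  "bessel_I \<nu> z = (\<Sum>k. (z / 2) powr (2 * real k + \<nu>) * rGamma (\<nu> + real k + 1) / fact k)"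

definition heat_kernel :: "real \<Rightarrow> real \<Rightarrow> real \<Rightarrow> real \<Rightarrow> real" where
  "heat_kernel lam t x y =
     sqrt (x * y) / (2 * t) * bessel_I (lam - 1 / 2) (x * y / (2 * t))
       * exp (- (x\<^sup>2 + y\<^sup>2) / (4 * t))"

definition poisson_kernel :: "real \<Rightarrow> real \<Rightarrow> real \<Rightarrow> real \<Rightarrow> real" where
  "poisson_kernel lam t x y =
     t / (2 * sqrt pi) *
       (LBINT s:{0<..}. exp (- t\<^sup>2 / (4 * s)) / s powr (3 / 2) * heat_kernel lam s x y)"

definition poisson_op :: "real \<Rightarrow> (real \<Rightarrow> real) \<Rightarrow> real \<Rightarrow> real \<Rightarrow> real" where
  "poisson_op lam f t x = (LBINT y:{0<..}. poisson_kernel lam t x y * f y)"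

subsection \<open>The Segovia--Wheeden fractional derivative\<close>

text \<open>The natural number \<open>m\<close> with \<open>m - 1 \<le> \<beta> < m\<close>.\<close>

definition frac_order :: "real \<Rightarrow> nat" where
  "frac_order \<beta> = nat \<lfloor>\<beta>\<rfloor> + 1"

lemma frac_order_iff:
  assumes "0 < \<beta>"
  shows "frac_order \<beta> = m \<longleftrightarrow> real m - 1 \<le> \<beta> \<and> \<beta> < real m"
  unfolding frac_order_def using assms by linarith

definition frac_deriv :: "real \<Rightarrow> (real \<Rightarrow> real) \<Rightarrow> real \<Rightarrow> complex" where
  "frac_deriv \<beta> g t =
     (let m = frac_order \<beta>
      in exp (- \<i> * of_real (pi * (real m - \<beta>))) / of_real (Gamma (real m - \<beta>))
           * of_real (LBINT s:{0<..}. (deriv ^^ m) g (t + s) * s powr (real m - \<beta> - 1)))"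

text \<open>\<open>\<partial>\<^sub>t\<^sup>\<beta> P\<^sub>t\<^sup>\<lambda> f(x)\<close>, the derivative being taken in \<open>t\<close> for fixed \<open>x\<close>.\<close>

definition poisson_frac_deriv ::
    "real \<Rightarrow> real \<Rightarrow> (real \<Rightarrow> real) \<Rightarrow> real \<Rightarrow> real \<Rightarrow> complex" where
  "poisson_frac_deriv lam \<beta> f t x = frac_deriv \<beta> (\<lambda>\<tau>. poisson_op lam f \<tau> x) t"

subsection \<open>Oscillation conditions\<close>

text \<open>Bounded intervals of positive length, open, closed or half-open; the nondegeneracy is
  implicit in every expression that divides by the length.\<close>

definition bounded_intervals :: "real set set" where
  "bounded_intervals =
     {I. is_interval I \<and> bounded I \<and> I \<subseteq> {0<..} \<and> 0 < measure lborel I}"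

definition average :: "(real \<Rightarrow> real) \<Rightarrow> real set \<Rightarrow> real" where
  "average f I = (LBINT y:I. f y) / measure lborel I"

definition M1 :: "real \<Rightarrow> real \<Rightarrow> (real \<Rightarrow> real) \<Rightarrow> real \<Rightarrow> bool" where
  "M1 \<alpha> p f C \<longleftrightarrow>
     (\<forall>I\<in>bounded_intervals.
        (\<integral>\<^sup>+y\<in>I. ennreal (\<bar>f y - average f I\<bar> powr p) \<partial>lborel)
          / ennreal (measure lborel I powr (1 + p * \<alpha>)) \<le> ennreal C)"

definition M2 :: "real \<Rightarrow> real \<Rightarrow> (real \<Rightarrow> real) \<Rightarrow> real \<Rightarrow> bool" where
  "M2 \<alpha> p f C \<longleftrightarrow>
     (\<forall>b>0.
        (\<integral>\<^sup>+y\<in>{0<..<b}. ennreal (\<bar>f y\<bar> powr p) \<partial>lborel)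
          / ennreal (measure lborel {0<..<b} powr (1 + p * \<alpha>)) \<le> ennreal C)"

text \<open>The infimum of an empty set of constants is \<open>\<infinity>\<close>.\<close>

definition campanato_const :: "real \<Rightarrow> real \<Rightarrow> (real \<Rightarrow> real) \<Rightarrow> ennreal" where
  "campanato_const \<alpha> p f =
     (INF C\<in>{C. 0 < C \<and> M1 \<alpha> p f C \<and> M2 \<alpha> p f C}. ennreal (C powr (1 / p)))"

subsection \<open>Conditions on the Poisson extension\<close>

text \<open>\<open>\<parallel>g\<parallel>\<close> in \<open>L\<^sup>\<infinity>(A)\<close> for Lebesgue measure on \<open>A\<close>.\<close>

definition Linf_norm_on :: "'a::euclidean_space set \<Rightarrow> ('a \<Rightarrow> complex) \<Rightarrow> ennreal" where
  "Linf_norm_on A g = esssup (restrict_space lborel A) (\<lambda>x. ennreal (cmod (g x)))"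

definition poisson_Linf :: "real \<Rightarrow> real \<Rightarrow> real \<Rightarrow> (real \<Rightarrow> real) \<Rightarrow> ennreal" where
  "poisson_Linf lam \<beta> \<alpha> f =
     Linf_norm_on ({0<..} \<times> {0<..})
       (\<lambda>(x, t). of_real (t powr (\<beta> - \<alpha>)) * poisson_frac_deriv lam \<beta> f t x)"

definition carleson :: "real \<Rightarrow> real \<Rightarrow> real \<Rightarrow> (real \<Rightarrow> real) \<Rightarrow> ennreal" where
  "carleson lam \<beta> \<alpha> f =
     (SUP I\<in>bounded_intervals.
        (\<integral>\<^sup>+t\<in>{0<..<measure lborel I}.
           (\<integral>\<^sup>+x\<in>I.
              ennreal ((cmod (of_real (t powr \<beta>) * poisson_frac_deriv lam \<beta> f t x))\<^sup>2 / t)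
            \<partial>lborel) \<partial>lborel)
        / ennreal (measure lborel I powr (1 + 2 * \<alpha>)))"

definition ennreal_sqrt :: "ennreal \<Rightarrow> ennreal" where
  "ennreal_sqrt a = (if a = \<infinity> then \<infinity> else ennreal (sqrt (enn2real a)))"

end

theory Submission
  imports Defs
begin

text \<open>
  By subordination and the power series of the Bessel function, the Poisson kernel is an average
  over \<open>u \<in> (-1, 1)\<close> of \<open>t (A + t\<^sup>2) powr (- lam - 1)\<close> with \<open>A = x\<^sup>2 + y\<^sup>2 - 2 x y u\<close>. Scaling bounds its
  fractional derivatives by powers of \<open>A + t\<^sup>2\<close>, and these are again dominated by integrals of
  the Poisson kernel in \<open>t\<close>; the kernels satisfy a Harnack inequality and the semigroup property.

  Hoelder bounds control \<open>\<partial>\<^sub>t\<^sup>\<beta> P\<^sub>t f(x)\<close> because \<open>P\<^sub>t\<close> fixes \<open>y powr lam\<close>, so that a multiple of this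
  function may be subtracted to make \<open>f\<close> vanish at \<open>x\<close>. Conversely \<open>P\<^sub>t f\<close> is recovered by integrating
  \<open>\<partial>\<^sub>t\<^sup>\<beta> P\<^bsub>t+s\<^esub> f\<close> against \<open>s powr (\<beta> - 1)\<close>, and the semigroup property transfers a bound on
  \<open>\<partial>\<^sub>t\<^sup>\<beta> P\<^sub>t f\<close> to its differences. The Carleson condition gives the pointwise bound by writing
  \<open>\<partial>\<^sub>t\<^sup>\<beta> P\<^sub>T f\<close> as \<open>P\<^bsub>T-t\<^esub>\<close> applied to \<open>\<partial>\<^sub>t\<^sup>\<beta> P\<^sub>t f\<close>, \<open>T/4 < t < T/2\<close>, and averaging. The Campanato
  conditions are handled by comparing averages over dyadic intervals shrinking to an endpoint.
\<close>

subsection \<open>Derivatives of the elementary kernel\<close>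

text \<open>The obstacle is that \<open>P_t\<close> does not preserve constants. Its fixed function
  \<open>y powr lam\<close> grows too fast for the class of \<open>f\<close>: against the weight of
  \<open>adm lam 0\<close> it fails by a logarithm. The parameter \<open>e\<close> of
  \<open>adm\<close> and \<open>kernel_weight\<close> records the additional decay of the kernel in
  use: recovering \<open>P_t f\<close> from its fractional derivative leaves only
  \<open>e = 0\<close>, while any \<open>e > 0\<close> admits \<open>y powr lam\<close>. Derivatives
  in \<open>t\<close>, Weyl integrals and their inversion are proved for the scalar profile
  \<open>kap\<close> at fixed \<open>A\<close> and lifted by Fubini through
  \<open>kernel_weight\<close>, which serves both \<open>P_t f\<close> and \<open>P_s P_t f\<close>.
  No derivative in \<open>x\<close> is ever taken; regularity in \<open>x\<close> comes from the
  Harnack inequality alone. In the way back to Hoelder bounds, \<open>\<alpha> < lam\<close> is set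
  against the decay \<open>(x / t) powr lam\<close> of the mass of the kernel near the origin, and
  \<open>\<alpha> < min 1 lam\<close> against the exponent of its L1 modulus of continuity;
  \<open>\<alpha> < \<beta>\<close> leaves a positive power \<open>\<beta> - \<alpha>\<close> of
  decay in the forward estimate. The four quantities are never compared directly, only with the
  constants \<open>N\<close> of \<open>holder_bd\<close>.\<close>

abbreviation nn_integral_lborel :: "('a::euclidean_space \<Rightarrow> ennreal) \<Rightarrow> ennreal" (binder "\<integral>\<^sub>+" 10) where
  "nn_integral_lborel F \<equiv> integral\<^sup>N lborel F"

abbreviation nn_integral_pos :: "(real \<Rightarrow> ennreal) \<Rightarrow> ennreal" (binder "\<integral>\<^sub>0" 10) where
  "nn_integral_pos F \<equiv> \<integral>\<^sup>+x\<in>{0<..}. F x \<partial>lborel"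

abbreviation integral_lborel :: "(real \<Rightarrow> real) \<Rightarrow> real" (binder "\<integral>\<^sub>L" 10) where
  "integral_lborel F \<equiv> integral\<^sup>L lborel F"

abbreviation pos :: "real \<Rightarrow> 'a::zero_neq_one" where "pos \<equiv> indicator {0<..}"

lemma powr_exp_cong: "a = b \<Longrightarrow> x powr a = x powr (b::real)" by simp

lemma square_powr: "x > 0 \<Longrightarrow> (x\<^sup>2) powr c = x powr (2 * c :: real)"
  by (simp add: powr_realpow[symmetric] powr_powr del: powr_numeral)

text \<open>The \<open>m\<close>-th derivative of \<open>t ^ a * (A + t\<^sup>2) powr (- b)\<close> in \<open>t\<close>; at \<open>a = 0\<close> the truncated \<open>a - 1\<close> is multiplied by \<open>0\<close>.\<close>

fun dker :: "nat \<Rightarrow> nat \<Rightarrow> real \<Rightarrow> real \<Rightarrow> real \<Rightarrow> real" where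
  "dker 0 a b A t = t ^ a * (A + t\<^sup>2) powr (- b)"
| "dker (Suc m) a b A t = real a * dker m (a - 1) b A t - 2 * b * dker m (a + 1) (b + 1) A t"

lemma dker_has_derivative:
  assumes "A + t\<^sup>2 > 0"
  shows "(dker m a b A has_real_derivative dker (Suc m) a b A t) (at t)"
proof (induction m arbitrary: a b)
  case 0
  have e: "(A + t\<^sup>2) powr (- 1 - b) = (A + t\<^sup>2) powr (- b - 1)" by (rule arg_cong[where f="\<lambda>z. (A + t\<^sup>2) powr z"]) simp
  have "((\<lambda>t. t ^ a * (A + t\<^sup>2) powr (- b)) has_real_derivative
      real a * (t ^ (a - 1) * (A + t\<^sup>2) powr (- b)) - 2 * b * (t ^ (a + 1) * (A + t\<^sup>2) powr (- (b + 1)))) (at t)"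
    using assms by (auto intro!: derivative_eq_intros simp: e algebra_simps)
  then show ?case by (simp add: fun_eq_iff[symmetric] eta_contract_eq)
next
  case (Suc m)
  have "((\<lambda>t. real a * dker m (a - 1) b A t - 2 * b * dker m (a + 1) (b + 1) A t) has_real_derivative
      real a * dker (Suc m) (a - 1) b A t - 2 * b * dker (Suc m) (a + 1) (b + 1) A t) (at t)"
    by (intro derivative_intros Suc.IH DERIV_cmult)
  then show ?case by simp
qed

text \<open>Homogeneity: if \<open>A\<close> scales like the square of \<open>t\<close>, both terms
  of the recursion have degree \<open>a - 2 * b - m - 1\<close>, so the induction only has to carry
  the degree. The base case is \<open>t \<le> sqrt (A + t\<^sup>2)\<close>.\<close>

lemma dker_bound:
  "\<exists>C\<ge>0. \<forall>A t. A \<ge> 0 \<longrightarrow> t > 0 \<longrightarrow> \<bar>dker m a b A t\<bar> \<le> C * (A + t\<^sup>2) powr ((real a - 2 * b - real m) / 2)"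
proof (induction m arbitrary: a b)
  case 0
  have "\<bar>dker 0 a b A t\<bar> \<le> 1 * (A + t\<^sup>2) powr ((real a - 2 * b - real 0) / 2)" if "A \<ge> 0" "t > 0" for A t
  proof -
    have p: "A + t\<^sup>2 > 0" using that by (simp add: add_nonneg_pos)
    have "t \<le> sqrt (A + t\<^sup>2)" using that by (simp add: real_le_rsqrt)
    then have "t ^ a \<le> sqrt (A + t\<^sup>2) ^ a" using that by (intro power_mono) auto
    also have "\<dots> = (A + t\<^sup>2) powr (real a / 2)"
      using p by (simp add: powr_half_sqrt[symmetric] powr_realpow[symmetric] powr_powr)
    finally have "t ^ a * (A + t\<^sup>2) powr (- b) \<le> (A + t\<^sup>2) powr (real a / 2) * (A + t\<^sup>2) powr (- b)"
      by (intro mult_right_mono) auto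
    also have "\<dots> = (A + t\<^sup>2) powr ((real a - 2 * b - real 0) / 2)"
      by (simp add: powr_add[symmetric] field_simps)
    finally show ?thesis using that by (simp add: abs_mult)
  qed
  then show ?case by (intro exI[of _ 1]) auto
next
  case (Suc m)
  obtain C1 where C1: "C1 \<ge> 0" "\<And>A t. A \<ge> 0 \<Longrightarrow> t > 0 \<Longrightarrow> \<bar>dker m (a-1) b A t\<bar> \<le> C1 * (A + t\<^sup>2) powr ((real (a-1) - 2 * b - real m) / 2)"
    using Suc.IH[of "a-1" b] by auto
  obtain C2 where C2: "C2 \<ge> 0" "\<And>A t. A \<ge> 0 \<Longrightarrow> t > 0 \<Longrightarrow> \<bar>dker m (a+1) (b+1) A t\<bar> \<le> C2 * (A + t\<^sup>2) powr ((real (a+1) - 2 * (b+1) - real m) / 2)"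
    using Suc.IH[of "a+1" "b+1"] by blast
  have "\<bar>dker (Suc m) a b A t\<bar> \<le> (real a * C1 + 2 * \<bar>b\<bar> * C2) * (A + t\<^sup>2) powr ((real a - 2 * b - real (Suc m)) / 2)"
    if "A \<ge> 0" "t > 0" for A t
  proof -
    let ?P = "(A + t\<^sup>2) powr ((real a - 2 * b - real (Suc m)) / 2)"
    have 1: "real a * \<bar>dker m (a-1) b A t\<bar> \<le> real a * (C1 * ?P)"
    \<comment> \<open>For \<open>a = 0\<close> the truncated \<open>a - 1\<close> would have the
      wrong degree, but its coefficient is zero.\<close>
    proof (cases "a = 0")
      case False
      then have "(real (a-1) - 2 * b - real m) / 2 = (real a - 2 * b - real (Suc m)) / 2" by (simp add: of_nat_diff)
      then have "\<bar>dker m (a-1) b A t\<bar> \<le> C1 * ?P" using C1(2)[OF that] by metis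
      then show ?thesis by (intro mult_left_mono) auto
    qed simp
    have "(real (a+1) - 2 * (b+1) - real m) / 2 = (real a - 2 * b - real (Suc m)) / 2" by simp
    then have "\<bar>dker m (a+1) (b+1) A t\<bar> \<le> C2 * ?P" using C2(2)[OF that] by metis
    then have 2: "2 * \<bar>b\<bar> * \<bar>dker m (a+1) (b+1) A t\<bar> \<le> 2 * \<bar>b\<bar> * (C2 * ?P)"
      by (intro mult_left_mono) auto
    have "\<bar>dker (Suc m) a b A t\<bar> \<le> \<bar>real a * dker m (a-1) b A t\<bar> + \<bar>2 * b * dker m (a+1) (b+1) A t\<bar>"
      by (simp add: abs_triangle_ineq4)
    also have "\<dots> = real a * \<bar>dker m (a-1) b A t\<bar> + 2 * \<bar>b\<bar> * \<bar>dker m (a+1) (b+1) A t\<bar>"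
      by (simp add: abs_mult)
    finally show ?thesis using 1 2 by (simp add: algebra_simps)
  qed
  then show ?case using C1(1) C2(1) by (intro exI[of _ "real a * C1 + 2 * \<bar>b\<bar> * C2"]) auto
qed

text \<open>The profile \<open>t * (A + t\<^sup>2) powr (- lam - 1)\<close> is the integrand of
  \<open>pker\<close>, with \<open>A\<close> a squared distance; \<open>m\<close> counts its
  \<open>t\<close>-derivatives.\<close>

definition kap :: "real \<Rightarrow> nat \<Rightarrow> real \<Rightarrow> real \<Rightarrow> real" where
  "kap lam m A t = dker m 1 (lam + 1) A t"

lemma kap_0: "kap lam 0 A t = t * (A + t\<^sup>2) powr (- lam - 1)"
  by (simp add: kap_def)

lemma kap_deriv: "A \<ge> 0 \<Longrightarrow> t > 0 \<Longrightarrow> (kap lam m A has_real_derivative kap lam (Suc m) A t) (at t)"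
  unfolding kap_def[abs_def] by (rule dker_has_derivative) (simp add: add_nonneg_pos)

lemma kap_bound:
  "\<exists>C\<ge>0. \<forall>A t. A \<ge> 0 \<longrightarrow> t > 0 \<longrightarrow> \<bar>kap lam m A t\<bar> \<le> C * (A + t\<^sup>2) powr (- lam - (1 + real m) / 2)"
proof -
  have "(real 1 - 2 * (lam + 1) - real m) / 2 = - lam - (1 + real m) / 2" by (simp add: field_simps)
  then show ?thesis unfolding kap_def using dker_bound[of m 1 "lam + 1"] by metis
qed

text \<open>Decay in \<open>A\<close> is traded for a power of \<open>t\<close>. Every derivative is
  then bounded by the same weight \<open>(A + t\<^sup>2) powr (- lam - 1)\<close>, and one
  integrability hypothesis justifies all differentiations under the integral. For
  \<open>m = 0\<close> the traded exponent would be positive, hence the separate case.\<close>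

lemma kap_bound':
  "\<exists>C\<ge>0. \<forall>A t. A \<ge> 0 \<longrightarrow> t > 0 \<longrightarrow> \<bar>kap lam m A t\<bar> \<le> C * t powr (1 - real m) * (A + t\<^sup>2) powr (- lam - 1)"
proof (cases m)
  case 0
  then show ?thesis by (intro exI[of _ 1]) (simp add: kap_0 abs_mult)
next
  case (Suc n)
  obtain C where C: "C \<ge> 0" "\<And>A t. A \<ge> 0 \<Longrightarrow> t > 0 \<Longrightarrow> \<bar>kap lam m A t\<bar> \<le> C * (A + t\<^sup>2) powr (- lam - (1 + real m) / 2)"
    using kap_bound by blast
  have "\<bar>kap lam m A t\<bar> \<le> C * t powr (1 - real m) * (A + t\<^sup>2) powr (- lam - 1)" if "A \<ge> 0" "t > 0" for A t
  proof -
    have "(A + t\<^sup>2) powr (- lam - (1 + real m) / 2) = (A + t\<^sup>2) powr ((1 - real m) / 2) * (A + t\<^sup>2) powr (- lam - 1)"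
      by (subst powr_add[symmetric], rule arg_cong[where f="\<lambda>z. (A + t\<^sup>2) powr z"]) (simp add: field_simps)
    also have "\<dots> \<le> (t\<^sup>2) powr ((1 - real m) / 2) * (A + t\<^sup>2) powr (- lam - 1)"
      using that Suc by (intro mult_right_mono powr_mono2') auto
    also have "(t\<^sup>2) powr ((1 - real m) / 2) = t powr (1 - real m)"
      using that by (subst square_powr) (auto intro: powr_exp_cong)
    finally have "C * (A + t\<^sup>2) powr (- lam - (1 + real m) / 2) \<le> C * (t powr (1 - real m) * (A + t\<^sup>2) powr (- lam - 1))"
      using C by (intro mult_left_mono) auto
    then show ?thesis using C(2)[OF that] by simp
  qed
  then show ?thesis using C(1) by blast
qed

lemma dker_measurable [measurable]: "(\<lambda>(A, t). dker m a b A t) \<in> borel_measurable (borel \<Otimes>\<^sub>M borel)"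
  by (induction m arbitrary: a b) (auto simp: split_def)

lemma kap_measurable [measurable (raw)]:
  assumes [measurable]: "f \<in> borel_measurable M" "g \<in> borel_measurable M"
  shows "(\<lambda>x. kap lam m (f x) (g x)) \<in> borel_measurable M"
proof -
  have "(\<lambda>x. (\<lambda>(A, t). dker m 1 (lam + 1) A t) (f x, g x)) \<in> borel_measurable M"
    by (rule measurable_compose[OF _ dker_measurable]) simp
  then show ?thesis by (simp add: kap_def)
qed

section \<open>Power integrals that link kernel bounds with Poisson profiles\<close>

lemma nn_integral_powr_0:
  assumes "a > (0::real)" "R > 0"
  shows "(\<integral>\<^sup>+r\<in>{0<..R}. ennreal (r powr (a - 1)) \<partial>lborel) = ennreal (R powr a / a)"
proof -
  have "(\<integral>\<^sup>+r\<in>{0<..R}. ennreal (r powr (a - 1)) \<partial>lborel) = (\<integral>\<^sup>+r\<in>{0..R}. ennreal (r powr (a - 1)) \<partial>lborel)"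
    by (intro nn_integral_cong) (auto split: split_indicator)
  also have "\<dots> = ennreal (R powr a / a)"
    using has_integral_powr_from_0[of "a - 1" R] assms
    by (intro nn_integral_has_integral_lebesgue') auto
  finally show ?thesis .
qed

lemma nn_integral_powr_inf:
  assumes "b > (0::real)" "R > 0"
  shows "(\<integral>\<^sup>+r\<in>{R<..}. ennreal (r powr (- b - 1)) \<partial>lborel) = ennreal (R powr (- b) / b)"
proof -
  have "(\<integral>\<^sup>+r\<in>{R<..}. ennreal (r powr (- b - 1)) \<partial>lborel) = (\<integral>\<^sup>+r\<in>{R..}. ennreal (r powr (- b - 1)) \<partial>lborel)"
    by (intro nn_integral_cong_AE) (use AE_lborel_singleton[of R] in \<open>auto elim!: eventually_mono split: split_indicator\<close>)
  also have "\<dots> = ennreal (R powr (- b) / b)"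
    using has_integral_powr_to_inf[of "- b - 1" R] assms
    by (intro nn_integral_has_integral_lebesgue') auto
  finally show ?thesis .
qed

text \<open>Split at \<open>R = sqrt (A + t\<^sup>2)\<close>: up to \<open>R\<close> the kernel is
  at most \<open>R powr (- (a + b))\<close>, beyond it at most \<open>r powr (- (a + b))\<close>.
  Integration against \<open>r powr (a - 1)\<close> thus spends \<open>a\<close> of the
  \<open>a + b\<close> orders of decay, and the two pieces produce \<open>1 / a\<close> and
  \<open>1 / b\<close>.\<close>

lemma nn_integral_kernel_power:
  assumes "a > (0::real)" "b > 0" "A \<ge> 0" "t > 0"
  shows "(\<integral>\<^sub>0r. ennreal (r powr (a - 1) * (A + (t + r)\<^sup>2) powr (- (a + b) / 2)))
     \<le> ennreal ((1 / a + 1 / b) * (A + t\<^sup>2) powr (- b / 2))"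
proof -
  define R where "R = sqrt (A + t\<^sup>2)"
  have R: "R > 0" "R\<^sup>2 = A + t\<^sup>2" using assms by (auto simp: R_def add_nonneg_pos)
  have 0: "A + (t + r)\<^sup>2 \<ge> R\<^sup>2" "A + (t + r)\<^sup>2 \<ge> r\<^sup>2" if "r > 0" for r
    using that assms R by (auto simp: power2_eq_square algebra_simps intro!: add_nonneg_nonneg)
  have p2: "(x\<^sup>2) powr (- c / 2) = x powr (- c)" if "x > 0" for x c :: real
    using that by (simp add: powr_realpow[symmetric] powr_powr del: powr_numeral)
  have "(\<integral>\<^sub>0r. ennreal (r powr (a - 1) * (A + (t + r)\<^sup>2) powr (- (a + b) / 2)))
    \<le> (\<integral>\<^sub>+r. (ennreal (R powr (- (a + b))) * (ennreal (r powr (a - 1)) * indicator {0<..R} r)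
            + ennreal (r powr (- b - 1)) * indicator {R<..} r))"
  proof (intro nn_integral_mono)
    fix r :: real
    consider "r \<le> 0" | "0 < r" "r \<le> R" | "r > R" by linarith
    then show "ennreal (r powr (a - 1) * (A + (t + r)\<^sup>2) powr (- (a + b) / 2)) * pos r
      \<le> ennreal (R powr (- (a + b))) * (ennreal (r powr (a - 1)) * indicator {0<..R} r)
            + ennreal (r powr (- b - 1)) * indicator {R<..} r"
    proof cases
      case 2
      have "(A + (t + r)\<^sup>2) powr (- (a + b) / 2) \<le> (R\<^sup>2) powr (- (a + b) / 2)"
        using 0[OF 2(1)] R(1) assms by (intro powr_mono2') auto
      also have "\<dots> = R powr (- (a + b))" using R p2[of R "a+b"] by simp
      finally have "r powr (a - 1) * (A + (t + r)\<^sup>2) powr (- (a + b) / 2) \<le> R powr (- (a + b)) * r powr (a - 1)"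
        by (subst mult.commute, intro mult_right_mono) auto
      then show ?thesis using 2 by (auto simp: ennreal_mult'[symmetric] intro!: ennreal_leI)
    next
      case 3
      then have rp: "r > 0" using R by linarith
      have "(A + (t + r)\<^sup>2) powr (- (a + b) / 2) \<le> (r\<^sup>2) powr (- (a + b) / 2)"
        using 0[OF rp] rp assms by (intro powr_mono2') auto
      also have "\<dots> = r powr (- (a + b))" using p2[OF rp, of "a+b"] by simp
      finally have "r powr (a - 1) * (A + (t + r)\<^sup>2) powr (- (a + b) / 2) \<le> r powr (a - 1) * r powr (- (a + b))"
        by (intro mult_left_mono) auto
      also have "\<dots> = r powr (- b - 1)" by (subst powr_add[symmetric]) (rule powr_exp_cong, simp)
      finally show ?thesis using 3 rp by (auto intro!: ennreal_leI)
    qed simp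
  qed
  also have "\<dots> = ennreal (R powr (- (a + b))) * ennreal (R powr a / a) + ennreal (R powr (- b) / b)"
    using assms R by (subst nn_integral_add, simp, simp, subst nn_integral_cmult) (auto simp: nn_integral_powr_0 nn_integral_powr_inf)
  also have "\<dots> = ennreal (R powr (- (a + b)) * (R powr a / a) + R powr (- b) / b)"
    using assms by (simp add: ennreal_mult'[symmetric] ennreal_plus)
  also have "R powr (- (a + b)) * (R powr a / a) + R powr (- b) / b = (1 / a + 1 / b) * (A + t\<^sup>2) powr (- b / 2)"
  proof -
    have "R powr (- (a + b)) * R powr a = R powr (- b)" by (simp add: powr_add[symmetric])
    moreover have "(A + t\<^sup>2) powr (- b / 2) = R powr (- b)" using p2[OF R(1), of b] R(2) by simp
    ultimately show ?thesis by (simp add: field_simps)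
  qed
  finally show ?thesis .
qed

text \<open>A converse to the size bounds: a power with extra decay \<open>e > 0\<close> is
  dominated by genuine Poisson profiles at later times, so that kernels of fractional derivatives
  can use the mass, the invariance and the semigroup law of the Poisson kernel. The range
  \<open>R < r \<le> 2 * R\<close> with \<open>R = sqrt (A + t\<^sup>2)\<close> already
  suffices.\<close>

lemma powr_le_kap_integral:
  assumes "e > (0::real)" "lam > 0" "A \<ge> 0" "t > 0"
  shows "ennreal ((A + t\<^sup>2) powr (- lam - (1 + e) / 2))
    \<le> ennreal (4 powr (e + 2 * lam + 2)) * (\<integral>\<^sup>+r\<in>{t<..}. ennreal (r powr (- e - 1) * kap lam 0 A r) \<partial>lborel)"
proof -
  define R where "R = sqrt (A + t\<^sup>2)"
  have R: "R > 0" "R\<^sup>2 = A + t\<^sup>2" "t \<le> R" using assms by (auto simp: R_def add_nonneg_pos real_le_rsqrt)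
  have p2: "(x\<^sup>2) powr c = x powr (2 * c)" if "x > 0" for x c :: real
    using that by (simp add: powr_realpow[symmetric] powr_powr del: powr_numeral)
  define c where "c = e + 2 * lam + 2"
  have "c > 0" using assms by (simp add: c_def)
  \<comment> \<open>On this range \<open>A + r\<^sup>2 \<le> 5 * R\<^sup>2\<close>, rounded up to
    \<open>(4 * R)\<^sup>2\<close>, and \<open>r \<le> 4 * R\<close>; hence \<open>K\<close> bounds
    the integrand from below on an interval of length \<open>R\<close>.\<close>
  define K where "K = (4 * R) powr (- c)"
  have "ennreal (K * R) = (\<integral>\<^sup>+r\<in>{R<..2*R}. ennreal K \<partial>lborel)"
    using R by (subst nn_integral_cmult_indicator) (auto simp: ennreal_mult'' K_def)
  also have "\<dots> \<le> (\<integral>\<^sup>+r\<in>{t<..}. ennreal (r powr (- e - 1) * kap lam 0 A r) \<partial>lborel)"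
  proof (intro nn_integral_mono)
    fix r
    have "K \<le> r powr (- e - 1) * kap lam 0 A r" if r: "R < r" "r \<le> 2 * R"
    proof -
      have rp: "r > 0" using r R by linarith
      have "r\<^sup>2 \<le> (2 * R)\<^sup>2" using r R by (intro power_mono) auto
      moreover have "A \<le> R\<^sup>2" using R by simp
      ultimately have a: "A + r\<^sup>2 \<le> (4 * R)\<^sup>2"
        unfolding power_mult_distrib using zero_le_power2[of R] by (simp, linarith)
      have "K = (4 * R) powr (- e) * ((4 * R)\<^sup>2) powr (- lam - 1)"
        using R by (subst p2) (auto simp: K_def c_def powr_add[symmetric] intro!: powr_exp_cong)
      also have "\<dots> \<le> r powr (- e) * (A + r\<^sup>2) powr (- lam - 1)"
        using assms R r rp a by (intro mult_mono powr_mono2') (auto simp: add_nonneg_pos)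
      also have "r powr (- e) = r powr (- e - 1) * r"
        using rp by (simp add: powr_diff)
      finally show ?thesis by (simp add: kap_0 mult_ac)
    qed
    then show "ennreal K * indicator {R<..2 * R} r \<le> ennreal (r powr (- e - 1) * kap lam 0 A r) * indicator {t<..} r"
      using R by (auto simp: indicator_def intro!: ennreal_leI)
  qed
  finally have *: "ennreal (K * R) \<le> (\<integral>\<^sup>+r\<in>{t<..}. ennreal (r powr (- e - 1) * kap lam 0 A r) \<partial>lborel)" .
  have "(A + t\<^sup>2) powr (- lam - (1 + e) / 2) = R powr (- c + 1)"
    unfolding R(2)[symmetric] p2[OF R(1)] by (rule powr_exp_cong) (simp add: c_def field_simps)
  also have "\<dots> = 4 powr c * (K * R)"
    using R by (simp add: K_def powr_mult powr_diff powr_minus_divide)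
  finally show ?thesis using * by (simp add: c_def ennreal_mult' mult_left_mono)
qed

subsection \<open>Substitution and Gaussian integrals\<close>

text \<open>On each compact interval the usual substitution rule applies; monotone convergence on
  both sides then reaches \<open>S\<close> and \<open>T\<close>. Values in \<open>ennreal\<close>
  avoid every question of integrability.\<close>

lemma nn_integral_substitution_exhaust:
  fixes f :: "real \<Rightarrow> ennreal" and g g' :: "real \<Rightarrow> real" and l u :: "nat \<Rightarrow> real"
  assumes f[measurable]: "f \<in> borel_measurable borel"
    and lu: "\<And>n. l n < u n" "decseq l" "incseq u" "(\<Union>n. {l n..u n}) = S"
    and der: "\<And>x. x \<in> S \<Longrightarrow> (g has_real_derivative g' x) (at x)"
    and cont: "continuous_on S g'" and nonneg: "\<And>x. x \<in> S \<Longrightarrow> 0 \<le> g' x"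
    and T: "g ` S = T"
  shows "(\<integral>\<^sup>+x\<in>T. f x \<partial>lborel) = (\<integral>\<^sup>+x\<in>S. f (g x) * ennreal (g' x) \<partial>lborel)"
proof -
  have sub: "{l n..u n} \<subseteq> S" for n using lu(4) by auto
  have inc: "incseq (\<lambda>n. {l n..u n})"
  proof (unfold incseq_def, intro allI impI)
    fix m n :: nat assume mn: "m \<le> n"
    show "{l m..u m} \<subseteq> {l n..u n}"
      using decseqD[OF lu(2) mn] incseqD[OF lu(3) mn] by (intro subsetI) simp
  qed
  have img: "g ` {l n..u n} = {g (l n)..g (u n)}" for n
  proof -
    have cg: "continuous_on {l n..u n} g"
      by (rule DERIV_continuous_on[where D=g'], rule has_field_derivative_at_within, rule der) (use sub in blast)
    have mono: "g x \<le> g y" if "x \<in> {l n..u n}" "y \<in> {l n..u n}" "x \<le> y" for x y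
    proof (rule DERIV_nonneg_imp_nondecreasing[OF that(3)])
      fix z assume "x \<le> z" "z \<le> y"
      then have "z \<in> S" using that sub[of n] by auto
      then show "\<exists>d. DERIV g z :> d \<and> 0 \<le> d" using der nonneg by blast
    qed
    show ?thesis
    proof
      show "g ` {l n..u n} \<subseteq> {g (l n)..g (u n)}" using mono lu(1)[of n] by auto
      show "{g (l n)..g (u n)} \<subseteq> g ` {l n..u n}"
      proof
        fix y assume "y \<in> {g (l n)..g (u n)}"
        then obtain x where "l n \<le> x" "x \<le> u n" "g x = y"
          using IVT'[of g "l n" y "u n"] cg lu(1)[of n] by auto
        then show "y \<in> g ` {l n..u n}" by auto
      qed
    qed
  qed
  have incT: "incseq (\<lambda>n. {g (l n)..g (u n)})"
    unfolding img[symmetric] using inc by (simp add: incseq_def image_mono)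
  have TU: "T = (\<Union>n. {g (l n)..g (u n)})"
    unfolding T[symmetric] lu(4)[symmetric] img[symmetric] by (simp add: image_UN)
  have step: "(\<integral>\<^sub>+x. f x * indicator {g (l n)..g (u n)} x) =
      (\<integral>\<^sub>+x. f (g x) * ennreal (g' x) * indicator {l n..u n} x)" for n
    using sub[of n] by (intro nn_integral_substitution_aux f lu(1) der nonneg continuous_on_subset[OF cont]) auto
  have mg: "(\<lambda>x. f (g x) * ennreal (g' x) * indicator {l n..u n} x) \<in> borel_measurable lborel" for n
  proof -
    have cg: "continuous_on {l n..u n} g"
      by (rule DERIV_continuous_on[where D=g'], rule has_field_derivative_at_within, rule der) (use sub in blast)
    have 1: "g \<in> borel_measurable (restrict_space borel {l n..u n})"
      by (rule borel_measurable_continuous_on_restrict[OF cg])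
    have 2: "g' \<in> borel_measurable (restrict_space borel {l n..u n})"
      by (rule borel_measurable_continuous_on_restrict[OF continuous_on_subset[OF cont sub]])
    have "(\<lambda>x. f (g x) * ennreal (g' x)) \<in> borel_measurable (restrict_space borel {l n..u n})"
      using measurable_compose[OF 1 f] 2 by measurable
    then show ?thesis
      by (subst (asm) borel_measurable_restrict_space_iff_ennreal) auto
  qed
  have SUPind: "(SUP n. c * indicator (F n) x) = c * indicator (\<Union>n. F n) x"
    for c :: ennreal and F :: "nat \<Rightarrow> real set" and x
  proof (rule antisym)
    show "(SUP n. c * indicator (F n) x) \<le> c * indicator (\<Union>n. F n) x"
      by (rule SUP_least) (auto split: split_indicator)
    show "c * indicator (\<Union>n. F n) x \<le> (SUP n. c * indicator (F n) x)"
    proof (cases "x \<in> (\<Union>n. F n)")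
      case True
      then obtain n where "x \<in> F n" by blast
      then have "c * indicator (\<Union>n. F n) x = c * indicator (F n) x" by (auto split: split_indicator)
      then show ?thesis using SUP_upper[of n UNIV "\<lambda>n. c * indicator (F n) x"] by simp
    qed simp
  qed
  have incind: "incseq (\<lambda>n x. c x * indicator (F n) x)"
    if "incseq F" for c :: "real \<Rightarrow> ennreal" and F :: "nat \<Rightarrow> real set"
  proof (intro incseq_SucI le_funI)
    fix n x
    have "F n \<subseteq> F (Suc n)" using that by (rule incseq_SucD)
    then show "c x * indicator (F n) x \<le> c x * indicator (F (Suc n)) x"
      by (auto split: split_indicator)
  qed
  have "(\<integral>\<^sup>+x\<in>T. f x \<partial>lborel) = (\<integral>\<^sub>+x. (SUP n. f x * indicator {g (l n)..g (u n)} x))"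
    by (simp add: SUPind TU)
  also have "\<dots> = (SUP n. \<integral>\<^sup>+x. f x * indicator {g (l n)..g (u n)} x \<partial>lborel)"
    by (intro nn_integral_monotone_convergence_SUP incind incT) auto
  also have "\<dots> = (SUP n. \<integral>\<^sup>+x. f (g x) * ennreal (g' x) * indicator {l n..u n} x \<partial>lborel)"
    by (simp add: step)
  also have "\<dots> = (\<integral>\<^sub>+x. (SUP n. f (g x) * ennreal (g' x) * indicator {l n..u n} x))"
    by (intro nn_integral_monotone_convergence_SUP[symmetric] incind inc mg)
  also have "\<dots> = (\<integral>\<^sup>+x\<in>S. f (g x) * ennreal (g' x) \<partial>lborel)"
    by (simp add: SUPind lu(4))
  finally show ?thesis .
qed

lemma nn_integral_substitution_Ioi:
  fixes f :: "real \<Rightarrow> ennreal" and g g' :: "real \<Rightarrow> real"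
  assumes "f \<in> borel_measurable borel"
    and "\<And>x. x > 0 \<Longrightarrow> (g has_real_derivative g' x) (at x)"
    and "continuous_on {0<..} g'" and "\<And>x. x > 0 \<Longrightarrow> 0 \<le> g' x"
    and "g ` {0<..} = T"
  shows "(\<integral>\<^sup>+x\<in>T. f x \<partial>lborel) = (\<integral>\<^sub>0x. f (g x) * ennreal (g' x))"
proof (rule nn_integral_substitution_exhaust[where l="\<lambda>n. 1 / (real n + 2)" and u="\<lambda>n. real n + 1"])
  show "1 / (real n + 2) < real n + 1" for n by (simp add: field_simps add_pos_nonneg)
  show "decseq (\<lambda>n. 1 / (real n + 2))" by (auto simp: decseq_def field_simps)
  show "incseq (\<lambda>n. real n + 1)" by (auto simp: incseq_def)
  show "(\<Union>n. {1 / (real n + 2)..real n + 1}) = {0<..}"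
  proof (intro equalityI subsetI)
    fix x :: real assume "x \<in> {0<..}"
    then have x: "x > 0" by simp
    obtain n where n: "real n \<ge> max x (1 / x)" using real_arch_simple by blast
    then have "1 / (real n + 2) \<le> x" using x by (auto simp: field_simps)
    then show "x \<in> (\<Union>n. {1 / (real n + 2)..real n + 1})" using n by (intro UN_I[of n]) auto
  next
    fix x :: real assume "x \<in> (\<Union>n. {1 / (real n + 2)..real n + 1})"
    then obtain n where "1 / (real n + 2) \<le> x" by auto
    moreover have "0 < 1 / (real n + 2)" by simp
    ultimately have "0 < x" by linarith
    then show "x \<in> {0<..}" by simp
  qed
  show "(g has_real_derivative g' x) (at x)" "0 \<le> g' x" if "x \<in> {0<..}" for x
    using that assms(2,4) by simp_all
qed (fact assms)+

lemma nn_integral_reflect: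
  fixes f :: "real \<Rightarrow> ennreal"
  assumes [measurable]: "f \<in> borel_measurable borel"
  shows "(\<integral>\<^sub>+x. f (- x)) = (\<integral>\<^sub>+x. f x)"
  using nn_integral_real_affine[OF assms, of "-1" 0] by simp

text \<open>Since \<open>1 / x\<close> is decreasing, it is obtained from the increasing map
  \<open>- 1 / x\<close> followed by a reflection.\<close>

lemma nn_integral_inverse_Ioi:
  fixes f :: "real \<Rightarrow> ennreal"
  assumes [measurable]: "f \<in> borel_measurable borel"
  shows "(\<integral>\<^sub>0x. f x) = (\<integral>\<^sub>0x. f (1 / x) * ennreal (1 / x\<^sup>2))"
proof -
  have "(\<integral>\<^sub>0x. f x) = (\<integral>\<^sub>+x. f (- x) * pos (- x))"
    by (subst nn_integral_reflect) auto
  also have "\<dots> = (\<integral>\<^sup>+x\<in>{..<0}. f (- x) \<partial>lborel)"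
    by (intro nn_integral_cong) (auto split: split_indicator)
  also have "\<dots> = (\<integral>\<^sub>0x. f (- (- 1 / x)) * ennreal (1 / x\<^sup>2))"
  proof (rule nn_integral_substitution_Ioi)
    show "((\<lambda>x. - 1 / x) has_real_derivative 1 / x\<^sup>2) (at x)" if "x > 0" for x :: real
      using that by (auto intro!: derivative_eq_intros simp: power2_eq_square)
    show "continuous_on {0<..} (\<lambda>x::real. 1 / x\<^sup>2)" by (intro continuous_intros) auto
    show "(\<lambda>x::real. - 1 / x) ` {0<..} = {..<0}"
    proof (intro equalityI subsetI)
      fix x :: real assume "x \<in> {..<0}"
      then show "x \<in> (\<lambda>x. - 1 / x) ` {0<..}" by (intro image_eqI[of _ _ "- 1 / x"]) auto
    qed auto
  qed auto
  finally show ?thesis by simp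
qed

lemma Gamma_conv_nn_integral_Ioi:
  assumes "s > (0::real)"
  shows "(\<integral>\<^sub>0r. ennreal (r powr (s - 1) * exp (- r))) = ennreal (Gamma s)"
proof -
  have "(\<integral>\<^sub>0r. ennreal (r powr (s - 1) * exp (- r)))
     = (\<integral>\<^sub>+r. ennreal (indicator {0..} r * r powr (s - 1) / exp r))"
    by (intro nn_integral_cong) (auto simp: exp_minus field_simps split: split_indicator)
  then show ?thesis using Gamma_conv_nn_integral_real[OF assms] by simp
qed

lemma nn_integral_power_exp:
  assumes "s > (0::real)" "c > 0"
  shows "(\<integral>\<^sub>0r. ennreal (r powr (s - 1) * exp (- c * r))) = ennreal (Gamma s * c powr (- s))"
proof -
  have "ennreal (Gamma s) = (\<integral>\<^sub>0r. ennreal ((c * r) powr (s - 1) * exp (- (c * r))) * ennreal c)"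
    unfolding Gamma_conv_nn_integral_Ioi[OF assms(1), symmetric]
  proof (rule nn_integral_substitution_Ioi)
    show "((\<lambda>r. c * r) has_real_derivative c) (at x)" for x by (auto intro!: derivative_eq_intros)
    show "(*) c ` {0<..} = {0<..}"
    proof (intro equalityI subsetI)
      fix x :: real assume "x \<in> {0<..}"
      then show "x \<in> (*) c ` {0<..}" using assms by (intro image_eqI[of _ _ "x / c"]) auto
    qed (use assms in auto)
  qed (use assms in auto)
  also have "\<dots> = (\<integral>\<^sub>+r. ennreal (c powr s) * (ennreal (r powr (s - 1) * exp (- c * r)) * pos r))"
  proof (intro nn_integral_cong)
    fix r :: real
    have "(c * r) powr (s - 1) * c = c powr s * r powr (s - 1)" if "r > 0"
      using that assms by (simp add: powr_mult powr_diff field_simps)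
    then show "ennreal ((c * r) powr (s - 1) * exp (- (c * r))) * ennreal c * pos r =
       ennreal (c powr s) * (ennreal (r powr (s - 1) * exp (- c * r)) * pos r)"
      using assms by (auto simp: ennreal_mult'[symmetric] ennreal_mult''[symmetric] mult_ac split: split_indicator)
  qed
  also have "\<dots> = ennreal (c powr s) * (\<integral>\<^sub>0r. ennreal (r powr (s - 1) * exp (- c * r)))"
    by (rule nn_integral_cmult) auto
  finally have *: "ennreal (Gamma s) = ennreal (c powr s) * (\<integral>\<^sub>0r. ennreal (r powr (s - 1) * exp (- c * r)))" .
  have "ennreal (Gamma s * c powr (- s)) = ennreal (c powr (- s)) * ennreal (Gamma s)"
    using assms by (simp add: ennreal_mult' mult.commute)
  also have "\<dots> = ennreal (c powr (- s) * c powr s) * (\<integral>\<^sub>0r. ennreal (r powr (s - 1) * exp (- c * r)))"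
    by (subst *) (simp add: ennreal_mult' mult.assoc)
  also have "c powr (- s) * c powr s = 1" using assms by (simp add: powr_add[symmetric])
  finally show ?thesis by simp
qed

lemma nn_integral_power_gauss:
  assumes "s > (0::real)" "c > 0"
  shows "(\<integral>\<^sub>0y. ennreal (y powr (2 * s - 1) * exp (- c * y\<^sup>2))) = ennreal (Gamma s * c powr (- s) / 2)"
proof -
  have "ennreal (Gamma s * c powr (- s)) =
     (\<integral>\<^sub>0y. ennreal ((y\<^sup>2) powr (s - 1) * exp (- c * y\<^sup>2)) * ennreal (2 * y))"
    unfolding nn_integral_power_exp[OF assms, symmetric]
  proof (rule nn_integral_substitution_Ioi)
    show "((\<lambda>r. r\<^sup>2) has_real_derivative 2 * x) (at x)" for x :: real by (auto intro!: derivative_eq_intros)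
    show "power2 ` {0<..} = {0::real<..}"
    proof (intro equalityI subsetI)
      fix x :: real assume "x \<in> {0<..}"
      then show "x \<in> power2 ` {0<..}" by (intro image_eqI[of _ _ "sqrt x"]) auto
    qed auto
  qed (auto intro!: continuous_intros)
  also have "\<dots> = (\<integral>\<^sub>+y. ennreal 2 * (ennreal (y powr (2 * s - 1) * exp (- c * y\<^sup>2)) * pos y))"
  proof (intro nn_integral_cong)
    fix y :: real
    have "(y\<^sup>2) powr (s - 1) * y = y powr (2 * s - 1)" if y: "y > 0"
    proof -
      have "(y\<^sup>2) powr (s - 1) * y = y powr (2 * (s - 1)) * y powr 1"
        using y by (simp add: powr_realpow[symmetric] powr_powr del: powr_numeral)
      also have "\<dots> = y powr (2 * s - 1)" by (subst powr_add[symmetric]) (rule powr_exp_cong, simp)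
      finally show ?thesis .
    qed
    then show "ennreal ((y\<^sup>2) powr (s - 1) * exp (- c * y\<^sup>2)) * ennreal (2 * y) * pos y =
       ennreal 2 * (ennreal (y powr (2 * s - 1) * exp (- c * y\<^sup>2)) * pos y)"
      by (auto simp: ennreal_mult'[symmetric] ennreal_mult''[symmetric] mult_ac simp del: ennreal_numeral split: split_indicator)
  qed
  also have "\<dots> = ennreal 2 * (\<integral>\<^sub>0y. ennreal (y powr (2 * s - 1) * exp (- c * y\<^sup>2)))"
    by (rule nn_integral_cmult) auto
  finally have *: "ennreal (Gamma s * c powr (- s)) = ennreal 2 * (\<integral>\<^sub>0y. ennreal (y powr (2 * s - 1) * exp (- c * y\<^sup>2)))" .
  have "ennreal (Gamma s * c powr (- s) / 2) = ennreal (1 / 2) * ennreal (Gamma s * c powr (- s))"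
    by (subst ennreal_mult'[symmetric]) auto
  also have "\<dots> = ennreal (1 / 2 * 2) * (\<integral>\<^sub>0y. ennreal (y powr (2 * s - 1) * exp (- c * y\<^sup>2)))"
    by (subst *) (subst ennreal_mult', auto simp: mult.assoc)
  finally show ?thesis by simp
qed

text \<open>The substitution \<open>t = u\<^sup>2\<close> in the Beta integral. Even moments are all
  that the exponential series leaves once its odd powers cancel on \<open>(-1, 1)\<close>.\<close>

lemma nn_integral_beta_even:
  assumes "lam > (0::real)"
  shows "(\<integral>\<^sup>+u\<in>{0<..<1}. ennreal (u ^ (2 * k) * (1 - u\<^sup>2) powr (lam - 1)) \<partial>lborel)
     = ennreal (Beta (real k + 1 / 2) lam / 2)"
proof -
  let ?a = "real k + 1 / 2"
  have B: "(\<integral>\<^sup>+t\<in>{0..1}. ennreal (t powr (?a - 1) * (1 - t) powr (lam - 1)) \<partial>lborel) = ennreal (Beta ?a lam)"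
    using has_integral_Beta_real[of ?a lam] assms
    by (intro nn_integral_has_integral_lebesgue') auto
  have "(\<integral>\<^sup>+t\<in>{0..1}. ennreal (t powr (?a - 1) * (1 - t) powr (lam - 1)) \<partial>lborel)
    = (\<integral>\<^sub>0t. ennreal (t powr (?a - 1) * (1 - t) powr (lam - 1)) * indicator {0<..<1} t)"
    by (intro nn_integral_cong_AE)
      (use AE_lborel_singleton[of 0] AE_lborel_singleton[of 1] in \<open>eventually_elim, auto split: split_indicator\<close>)
  also have "\<dots> = (\<integral>\<^sub>0y. ennreal ((y\<^sup>2) powr (?a - 1) * (1 - y\<^sup>2) powr (lam - 1)) * indicator {0<..<1} (y\<^sup>2) * ennreal (2 * y))"
  proof (rule nn_integral_substitution_Ioi)
    show "((\<lambda>r. r\<^sup>2) has_real_derivative 2 * x) (at x)" for x :: real by (auto intro!: derivative_eq_intros)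
    show "power2 ` {0<..} = {0::real<..}"
    proof (intro equalityI subsetI)
      fix x :: real assume "x \<in> {0<..}"
      then show "x \<in> power2 ` {0<..}" by (intro image_eqI[of _ _ "sqrt x"]) auto
    qed auto
  qed (auto intro!: continuous_intros)
  also have "\<dots> = (\<integral>\<^sub>+u. ennreal 2 * (ennreal (u ^ (2 * k) * (1 - u\<^sup>2) powr (lam - 1)) * indicator {0<..<1} u))"
  proof (intro nn_integral_cong)
    fix y :: real
    have "(y\<^sup>2) powr (?a - 1) * y = y ^ (2 * k)" if y: "y > 0"
    proof -
      have "(y\<^sup>2) powr (?a - 1) * y = y powr (2 * (?a - 1)) * y powr 1"
        using y by (simp add: powr_realpow[symmetric] powr_powr del: powr_numeral)
      also have "\<dots> = y powr (real (2 * k))" by (subst powr_add[symmetric]) (rule powr_exp_cong, simp)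
      finally show ?thesis using y by (simp add: powr_realpow del: of_nat_mult)
    qed
    then have *: "(y\<^sup>2) powr (?a - 1) * (1 - y\<^sup>2) powr (lam - 1) * (2 * y) = 2 * (y ^ (2 * k) * (1 - y\<^sup>2) powr (lam - 1))" if "y > 0"
      using that by (simp add: mult_ac)
    have "y\<^sup>2 < 1 \<longleftrightarrow> y < 1" if "y > 0" using that by (simp add: power_less_one_iff)
    then show "ennreal ((y\<^sup>2) powr (?a - 1) * (1 - y\<^sup>2) powr (lam - 1)) * indicator {0<..<1} (y\<^sup>2) * ennreal (2 * y) * pos y =
       ennreal 2 * (ennreal (y ^ (2 * k) * (1 - y\<^sup>2) powr (lam - 1)) * indicator {0<..<1} y)"
      using * by (auto simp: ennreal_mult'[symmetric] ennreal_mult''[symmetric] simp del: ennreal_numeral split: split_indicator)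
  qed
  also have "\<dots> = ennreal 2 * (\<integral>\<^sup>+u\<in>{0<..<1}. ennreal (u ^ (2 * k) * (1 - u\<^sup>2) powr (lam - 1)) \<partial>lborel)"
    by (rule nn_integral_cmult) auto
  finally have *: "ennreal (Beta ?a lam) = ennreal 2 * (\<integral>\<^sup>+u\<in>{0<..<1}. ennreal (u ^ (2 * k) * (1 - u\<^sup>2) powr (lam - 1)) \<partial>lborel)"
    using B by simp
  have "Beta ?a lam \<ge> 0" using assms by (simp add: Beta_def)
  then have "ennreal (Beta ?a lam / 2) = ennreal (1 / 2) * ennreal (Beta ?a lam)"
    by (subst ennreal_mult'[symmetric]) auto
  also have "\<dots> = ennreal (1 / 2 * 2) * (\<integral>\<^sup>+u\<in>{0<..<1}. ennreal (u ^ (2 * k) * (1 - u\<^sup>2) powr (lam - 1)) \<partial>lborel)"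
    by (subst *) (subst ennreal_mult', auto simp: mult.assoc)
  finally show ?thesis by simp
qed

subsection \<open>The Poisson kernel as an average\<close>

text \<open>The unnormalised weight of Poisson's integral for the Bessel function of order
  \<open>lam - 1 / 2\<close>. With \<open>u\<close> read as the cosine of an angle,
  \<open>qf x y u\<close> is the squared distance of two points at radii \<open>x\<close> and
  \<open>y\<close> enclosing that angle.\<close>

definition bmeas :: "real \<Rightarrow> real measure" where
  "bmeas lam = density lborel (\<lambda>u. ennreal ((1 - u\<^sup>2) powr (lam - 1)) * indicator {-1<..<1} u)"

definition qf :: "real \<Rightarrow> real \<Rightarrow> real \<Rightarrow> real" where
  "qf x y u = x\<^sup>2 + y\<^sup>2 - 2 * x * y * u"

text \<open>Coefficients of \<open>z powr (- \<nu>) * bessel_I \<nu> (2 * z)\<close> in powers of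
  \<open>z\<^sup>2\<close>, for \<open>\<nu> = lam - 1 / 2\<close>.\<close>

definition hcoef :: "real \<Rightarrow> nat \<Rightarrow> real" where
  "hcoef lam k = 1 / (fact k * Gamma (lam + 1 / 2 + real k))"

lemma sets_bmeas [measurable_cong, simp]: "sets (bmeas lam) = sets borel"
  and space_bmeas [simp]: "space (bmeas lam) = UNIV"
  by (simp_all add: bmeas_def)

lemma nn_integral_bmeas:
  assumes [measurable]: "f \<in> borel_measurable borel"
  shows "(\<integral>\<^sup>+u. f u \<partial>bmeas lam) = (\<integral>\<^sup>+u\<in>{-1<..<1}. ennreal ((1 - u\<^sup>2) powr (lam - 1)) * f u \<partial>lborel)"
  unfolding bmeas_def by (subst nn_integral_density) (auto intro!: nn_integral_cong simp: mult_ac)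

lemma AE_bmeas: "AE u in bmeas lam. -1 < u \<and> u < 1"
  unfolding bmeas_def by (subst AE_density) (auto split: split_indicator)

lemma qf_measurable [measurable (raw)]:
  assumes [measurable]: "f \<in> borel_measurable M" "g \<in> borel_measurable M" "h \<in> borel_measurable M"
  shows "(\<lambda>x. qf (f x) (g x) (h x)) \<in> borel_measurable M"
  unfolding qf_def by measurable

lemma qf_ge:
  assumes "x \<ge> 0" "y \<ge> 0" "u \<le> 1" shows "(x - y)\<^sup>2 \<le> qf x y u"
proof -
  have "qf x y u - (x - y)\<^sup>2 = 2 * (x * y) * (1 - u)" by (simp add: qf_def power2_eq_square algebra_simps)
  moreover have "0 \<le> 2 * (x * y) * (1 - u)" using assms by (intro mult_nonneg_nonneg) auto
  ultimately show ?thesis by linarith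
qed

lemma qf_nonneg: "x \<ge> 0 \<Longrightarrow> y \<ge> 0 \<Longrightarrow> u \<le> 1 \<Longrightarrow> 0 \<le> qf x y u"
  using qf_ge[of x y u] zero_le_power2[of "x - y"] by linarith

lemma qf_commute: "qf x y u = qf y x u" by (simp add: qf_def)

lemma Gamma_half_plus: "Gamma (real k + 1 / 2) = sqrt pi * fact (2 * k) / (4 ^ k * fact k)"
proof (induction k)
  case 0 then show ?case by (simp add: Gamma_one_half_real)
next
  case (Suc k)
  have "Gamma (real (Suc k) + 1 / 2) = Gamma ((real k + 1 / 2) + 1)" by (simp add: algebra_simps)
  also have "\<dots> = (real k + 1 / 2) * Gamma (real k + 1 / 2)"
    by (rule Gamma_plus1) (auto simp: nonpos_Ints_def dest!: arg_cong[where f="\<lambda>x. x > 0"])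
  also have "\<dots> = (real k + 1 / 2) * (sqrt pi * fact (2 * k) / (4 ^ k * fact k))" by (simp add: Suc)
  also have "\<dots> = sqrt pi * fact (2 * Suc k) / (4 ^ Suc k * fact (Suc k))"
  proof -
    have f: "fact (2 * Suc k) = (2 * (real k + 1)) * (2 * real k + 1) * fact (2 * k)"
      by (simp add: algebra_simps)
    have g: "fact (Suc k) = (real k + 1) * fact k" by (simp add: algebra_simps)
    have "real k + 1 \<noteq> 0" by linarith
    then show ?thesis unfolding f g by (simp add: divide_simps) (simp add: algebra_simps)
  qed
  finally show ?case .
qed

text \<open>Only the first factor can be below 1. This crude bound is enough to compare the Bessel
  series with the exponential series.\<close>

lemma pochhammer_ge_half:
  assumes "(mu::real) \<ge> 1 / 2" shows "pochhammer mu k \<ge> 1 / 2"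
proof (cases k)
  case (Suc n)
  have "pochhammer mu (Suc n) \<ge> 1 / 2"
  proof (induction n)
    case (Suc n)
    have "1 / 2 * 1 \<le> pochhammer mu (Suc n) * (mu + real (Suc n))"
      using Suc assms by (intro mult_mono) auto
    then show ?case by (simp add: pochhammer_Suc[of mu "Suc n"])
  qed (use assms in simp)
  then show ?thesis using Suc by simp
qed simp

lemma Gamma_plus_nat_ge:
  assumes "(mu::real) \<ge> 1 / 2" shows "Gamma (mu + real k) \<ge> Gamma mu / 2"
proof -
  have "mu \<notin> \<int>\<^sub>\<le>\<^sub>0" using assms by (auto elim!: nonpos_Ints_cases)
  then have "Gamma (mu + real k) = pochhammer mu k * Gamma mu"
    using pochhammer_Gamma[of mu k] assms by (simp add: Gamma_eq_zero_iff)
  then show ?thesis using pochhammer_ge_half[OF assms, of k] Gamma_real_pos[of mu] assms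
    by (simp add: mult_right_mono)
qed

lemma hcoef_pos: "lam > 0 \<Longrightarrow> hcoef lam k > 0"
  by (simp add: hcoef_def Gamma_real_pos)

lemma hcoef_le:
  assumes "lam > 0" shows "hcoef lam k \<le> 2 / Gamma (lam + 1 / 2) / fact k"
proof -
  have "Gamma (lam + 1 / 2) > 0" using assms by (simp add: Gamma_real_pos)
  moreover have "Gamma (lam + 1 / 2 + real k) > 0" using assms by (simp add: Gamma_real_pos)
  moreover have "Gamma (lam + 1 / 2) / 2 \<le> Gamma (lam + 1 / 2 + real k)"
    using assms by (intro Gamma_plus_nat_ge) auto
  ultimately have "1 / Gamma (lam + 1 / 2 + real k) \<le> 2 / Gamma (lam + 1 / 2)"
    by (simp add: field_simps)
  from divide_right_mono[OF this, of "fact k"] show ?thesis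
    unfolding hcoef_def by (simp add: mult.commute)
qed

lemma summable_hcoef:
  assumes "lam > 0" shows "summable (\<lambda>k. z ^ k * hcoef lam k)"
proof (rule summable_comparison_test')
  show "summable (\<lambda>k. 2 / Gamma (lam + 1 / 2) * (\<bar>z\<bar> ^ k / fact k))"
    using summable_exp[of "\<bar>z\<bar>"] by (intro summable_mult) (simp add: field_simps)
  show "norm (z ^ k * hcoef lam k) \<le> 2 / Gamma (lam + 1 / 2) * (\<bar>z\<bar> ^ k / fact k)" if "k \<ge> 0" for k
    using mult_left_mono[OF hcoef_le[OF assms, of k], of "\<bar>z\<bar> ^ k"] hcoef_pos[OF assms, of k]
    by (simp add: abs_mult power_abs mult_ac)
qed

lemma cosh_sums_even: "(\<lambda>k. x ^ (2 * k) / fact (2 * k)) sums cosh (x::real)"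
proof -
  have "(\<lambda>k. (\<lambda>n. if even n then x ^ n /\<^sub>R fact n else 0) (2 * k)) sums cosh x"
    by (subst sums_mono_reindex[of "(*) 2"]) (auto simp: strict_mono_def cosh_converges)
  then show ?thesis by (simp add: field_simps)
qed

text \<open>Poisson's integral representation of the modified Bessel function: folding
  \<open>(-1, 0)\<close> onto \<open>(0, 1)\<close> turns the exponential into
  \<open>2 * cosh\<close>, whose even powers are integrated termwise as Beta integrals. All terms
  are nonnegative, so sum and integral may be exchanged freely.\<close>

lemma nn_integral_bmeas_exp:
  assumes lam: "lam > 0"
  shows "(\<integral>\<^sup>+u. ennreal (exp (2 * z * u)) \<partial>bmeas lam) = ennreal (sqrt pi * Gamma lam * (\<Sum>k. (z\<^sup>2) ^ k * hcoef lam k))"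
proof -
  let ?b = "\<lambda>u::real. (1 - u\<^sup>2) powr (lam - 1)"
  have "(\<integral>\<^sup>+u. ennreal (exp (2 * z * u)) \<partial>bmeas lam)
     = (\<integral>\<^sub>+u. ennreal (?b u * exp (2 * z * u)) * indicator {-1<..<1} u)"
    by (subst nn_integral_bmeas) (auto simp: ennreal_mult')
  also have "\<dots> = (\<integral>\<^sub>+u. ennreal (?b u * exp (2 * z * u)) * indicator {0<..<1} u
       + ennreal (?b u * exp (2 * z * u)) * indicator {-1<..<0} u)"
    by (intro nn_integral_cong_AE) (use AE_lborel_singleton[of 0] in \<open>eventually_elim, auto split: split_indicator\<close>)
  also have "\<dots> = (\<integral>\<^sub>+u. ennreal (?b u * exp (2 * z * u)) * indicator {0<..<1} u)
       + (\<integral>\<^sub>+u. ennreal (?b u * exp (2 * z * u)) * indicator {-1<..<0} u)"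
    by (rule nn_integral_add) auto
  also have "(\<integral>\<^sub>+u. ennreal (?b u * exp (2 * z * u)) * indicator {-1<..<0} u)
     = (\<integral>\<^sub>+u. ennreal (?b u * exp (- 2 * z * u)) * indicator {0<..<1} u)"
    by (subst nn_integral_reflect[symmetric]) (auto intro!: nn_integral_cong split: split_indicator)
  also have "(\<integral>\<^sub>+u. ennreal (?b u * exp (2 * z * u)) * indicator {0<..<1} u) + \<dots>
     = (\<integral>\<^sub>+u. (ennreal (?b u * exp (2 * z * u)) * indicator {0<..<1} u + ennreal (?b u * exp (- 2 * z * u)) * indicator {0<..<1} u))"
    by (rule nn_integral_add[symmetric]) auto
  also have "\<dots> = (\<integral>\<^sub>+u. (\<Sum>k. ennreal (2 * (2 * z) ^ (2 * k) / fact (2 * k)) * (ennreal (u ^ (2 * k) * ?b u) * indicator {0<..<1} u)))"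
  proof (intro nn_integral_cong)
    fix u :: real
    have *: "(\<lambda>k. 2 * (2 * z) ^ (2 * k) / fact (2 * k) * (u ^ (2 * k) * ?b u)) sums (?b u * exp (2 * z * u) + ?b u * exp (- 2 * z * u))"
    proof -
      have "(\<lambda>k. 2 * ?b u * ((2 * z * u) ^ (2 * k) / fact (2 * k))) sums (2 * ?b u * cosh (2 * z * u))"
        by (intro sums_mult cosh_sums_even)
      also have "2 * ?b u * cosh (2 * z * u) = ?b u * exp (2 * z * u) + ?b u * exp (- 2 * z * u)"
        by (simp add: cosh_def algebra_simps)
      finally show ?thesis by (simp add: power_mult_distrib mult_ac)
    qed
    have "(\<Sum>k. ennreal (2 * (2 * z) ^ (2 * k) / fact (2 * k) * (u ^ (2 * k) * ?b u))) = ennreal (?b u * exp (2 * z * u) + ?b u * exp (- 2 * z * u))"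
      using * by (subst suminf_ennreal2) (auto simp: sums_iff intro!: mult_nonneg_nonneg)
    then show "ennreal (?b u * exp (2 * z * u)) * indicator {0<..<1} u + ennreal (?b u * exp (- 2 * z * u)) * indicator {0<..<1} u
      = (\<Sum>k. ennreal (2 * (2 * z) ^ (2 * k) / fact (2 * k)) * (ennreal (u ^ (2 * k) * ?b u) * indicator {0<..<1} u))"
      by (auto simp: ennreal_mult'[symmetric] ennreal_plus[symmetric] simp del: ennreal_plus split: split_indicator)
  qed
  also have "\<dots> = (\<Sum>k. \<integral>\<^sup>+u. ennreal (2 * (2 * z) ^ (2 * k) / fact (2 * k)) * (ennreal (u ^ (2 * k) * ?b u) * indicator {0<..<1} u) \<partial>lborel)"
    by (rule nn_integral_suminf) auto
  also have "\<dots> = (\<Sum>k. ennreal (sqrt pi * Gamma lam * ((z\<^sup>2) ^ k * hcoef lam k)))"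
  proof (intro suminf_cong)
    fix k
    have "(\<integral>\<^sub>+u. ennreal (2 * (2 * z) ^ (2 * k) / fact (2 * k)) * (ennreal (u ^ (2 * k) * ?b u) * indicator {0<..<1} u))
      = ennreal (2 * (2 * z) ^ (2 * k) / fact (2 * k)) * ennreal (Beta (real k + 1 / 2) lam / 2)"
      by (subst nn_integral_cmult) (auto simp: nn_integral_beta_even[OF lam])
    also have "\<dots> = ennreal (2 * (2 * z) ^ (2 * k) / fact (2 * k) * (Beta (real k + 1 / 2) lam / 2))"
      by (subst ennreal_mult') auto
    also have "2 * (2 * z) ^ (2 * k) / fact (2 * k) * (Beta (real k + 1 / 2) lam / 2) = sqrt pi * Gamma lam * ((z\<^sup>2) ^ k * hcoef lam k)"
    proof -
      \<comment> \<open>The formula for \<open>Gamma (k + 1 / 2)\<close> supplies the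
        \<open>fact (2 * k)\<close> and the power of 4 that cancel here.\<close>
      have "(2 * z) ^ (2 * k) = 4 ^ k * (z\<^sup>2) ^ k" by (simp add: power_mult_distrib power_mult)
      moreover have "Gamma (real k + 1 / 2 + lam) = Gamma (lam + 1 / 2 + real k)" by (simp add: algebra_simps)
      ultimately show ?thesis by (simp add: Beta_def Gamma_half_plus hcoef_def)
    qed
    finally show "(\<integral>\<^sub>+u. ennreal (2 * (2 * z) ^ (2 * k) / fact (2 * k)) * (ennreal (u ^ (2 * k) * ?b u) * indicator {0<..<1} u))
       = ennreal (sqrt pi * Gamma lam * ((z\<^sup>2) ^ k * hcoef lam k))" .
  qed
  also have "\<dots> = ennreal (\<Sum>k. sqrt pi * Gamma lam * ((z\<^sup>2) ^ k * hcoef lam k))"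
    using lam hcoef_pos[OF lam] by (intro suminf_ennreal2 summable_mult summable_hcoef mult_nonneg_nonneg)
      (auto simp: Gamma_real_pos less_imp_le)
  also have "\<dots> = ennreal (sqrt pi * Gamma lam * (\<Sum>k. (z\<^sup>2) ^ k * hcoef lam k))"
    by (subst suminf_mult[OF summable_hcoef[OF lam]]) simp
  finally show ?thesis .
qed

text \<open>In the variable \<open>p = 1 / (4 * s)\<close> the Gaussian has exponent
  \<open>- p * (x\<^sup>2 + y\<^sup>2)\<close> and the Bessel argument is
  \<open>2 * p * x * y\<close>; this form allows products of heat kernels to be integrated
  termwise.\<close>

lemma heat_kernel_series:
  assumes "lam > 0" "s > 0" "x > 0" "y > 0" and p: "p = 1 / (4 * s)"
  shows "heat_kernel lam s x y = 2 * p powr (lam + 1 / 2) * (x * y) powr lam * exp (- p * (x\<^sup>2 + y\<^sup>2))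
     * (\<Sum>k. ((p * x * y)\<^sup>2) ^ k * hcoef lam k)"
proof -
  have pp: "p > 0" using assms by simp
  have z: "p * x * y > 0" using pp assms by simp
  have "bessel_I (lam - 1 / 2) (x * y / (2 * s)) = (\<Sum>k. (p * x * y) powr (lam - 1 / 2) * (((p * x * y)\<^sup>2) ^ k * hcoef lam k))"
    unfolding bessel_I_def
  proof (intro suminf_cong)
    fix k
    have a: "x * y / (2 * s) / 2 = p * x * y" by (simp add: p)
    have b: "(p * x * y) powr (2 * real k + (lam - 1 / 2)) = (p * x * y) powr (lam - 1 / 2) * ((p * x * y)\<^sup>2) ^ k"
    proof -
      have "(p * x * y) powr (2 * real k) = (p * x * y) ^ (2 * k)"
        using powr_realpow[OF z, of "2 * k"] by simp
      then show ?thesis unfolding powr_add power_mult[symmetric] by (simp add: mult.commute)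
    qed
    have c: "rGamma (lam - 1 / 2 + real k + 1) = 1 / Gamma (lam + 1 / 2 + real k)"
      by (simp add: rGamma_inverse_Gamma inverse_eq_divide algebra_simps)
    show "(x * y / (2 * s) / 2) powr (2 * real k + (lam - 1 / 2)) * rGamma (lam - 1 / 2 + real k + 1) / fact k =
      (p * x * y) powr (lam - 1 / 2) * (((p * x * y)\<^sup>2) ^ k * hcoef lam k)"
      unfolding a b c hcoef_def by simp
  qed
  also have "\<dots> = (p * x * y) powr (lam - 1 / 2) * (\<Sum>k. ((p * x * y)\<^sup>2) ^ k * hcoef lam k)"
    by (rule suminf_mult[OF summable_hcoef[OF assms(1)]])
  finally have 1: "bessel_I (lam - 1 / 2) (x * y / (2 * s)) = (p * x * y) powr (lam - 1 / 2) * (\<Sum>k. ((p * x * y)\<^sup>2) ^ k * hcoef lam k)" .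
  have 2: "sqrt (x * y) / (2 * s) * (p * x * y) powr (lam - 1 / 2) = 2 * p powr (lam + 1 / 2) * (x * y) powr lam"
  proof -
    have a: "sqrt (x * y) / (2 * s) = 2 * p powr 1 * (x * y) powr (1 / 2)"
      using assms by (simp add: powr_half_sqrt)
    have b: "(p * x * y) powr (lam - 1 / 2) = p powr (lam - 1 / 2) * (x * y) powr (lam - 1 / 2)"
      unfolding mult.assoc by (rule powr_mult)
    have c: "p powr 1 * p powr (lam - 1 / 2) = p powr (lam + 1 / 2)"
      by (subst powr_add[symmetric]) (rule powr_exp_cong, simp)
    have d: "(x * y) powr (1 / 2) * (x * y) powr (lam - 1 / 2) = (x * y) powr lam"
      by (subst powr_add[symmetric]) (rule powr_exp_cong, simp)
    show ?thesis unfolding a b c[symmetric] d[symmetric] by (simp only: mult_ac)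
  qed
  have 3: "exp (- (x\<^sup>2 + y\<^sup>2) / (4 * s)) = exp (- p * (x\<^sup>2 + y\<^sup>2))"
    by (rule arg_cong[where f=exp]) (simp add: p diff_divide_distrib add_divide_distrib)
  show ?thesis unfolding heat_kernel_def 1 3 2[symmetric] by (simp only: mult_ac)
qed

text \<open>Poisson's integral merges with the Gaussian, because
  \<open>x\<^sup>2 + y\<^sup>2 - 2 * x * y * u\<close> is \<open>qf x y u\<close>: the heat kernel
  becomes an average of Gaussians of this squared distance.\<close>

lemma heat_kernel_nn_integral:
  assumes "lam > 0" "s > 0" "x > 0" "y > 0" and p: "p = 1 / (4 * s)"
  shows "ennreal (heat_kernel lam s x y) = ennreal (2 / (sqrt pi * Gamma lam) * p powr (lam + 1 / 2) * (x * y) powr lam)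
     * (\<integral>\<^sup>+u. ennreal (exp (- p * qf x y u)) \<partial>bmeas lam)"
proof -
  have G: "Gamma lam > 0" using assms by (simp add: Gamma_real_pos)
  have "(\<integral>\<^sup>+u. ennreal (exp (- p * qf x y u)) \<partial>bmeas lam)
      = (\<integral>\<^sup>+u. ennreal (exp (- p * (x\<^sup>2 + y\<^sup>2))) * ennreal (exp (2 * (p * x * y) * u)) \<partial>bmeas lam)"
    by (intro nn_integral_cong) (simp add: ennreal_mult'[symmetric] exp_add[symmetric] qf_def algebra_simps)
  also have "\<dots> = ennreal (exp (- p * (x\<^sup>2 + y\<^sup>2)))
      * ennreal (sqrt pi * Gamma lam * (\<Sum>k. ((p * x * y)\<^sup>2) ^ k * hcoef lam k))"
    by (subst nn_integral_cmult) (auto simp: nn_integral_bmeas_exp[OF assms(1)])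
  also have "ennreal (2 / (sqrt pi * Gamma lam) * p powr (lam + 1 / 2) * (x * y) powr lam) * \<dots>
     = ennreal (2 / (sqrt pi * Gamma lam) * p powr (lam + 1 / 2) * (x * y) powr lam *
         (exp (- p * (x\<^sup>2 + y\<^sup>2)) * (sqrt pi * Gamma lam * (\<Sum>k. ((p * x * y)\<^sup>2) ^ k * hcoef lam k))))"
    using G by (simp add: ennreal_mult'[symmetric])
  also have "\<dots> = ennreal (heat_kernel lam s x y)"
    using G by (subst heat_kernel_series[OF assms]) (simp add: field_simps)
  finally show ?thesis ..
qed

lemma bessel_I_measurable [measurable]: "bessel_I nu \<in> borel_measurable borel"
  unfolding bessel_I_def[abs_def] by measurable

lemma heat_kernel_measurable [measurable (raw)]:
  assumes [measurable]: "f \<in> borel_measurable M" "g \<in> borel_measurable M" "h \<in> borel_measurable M"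
  shows "(\<lambda>x. heat_kernel lam (f x) (g x) (h x)) \<in> borel_measurable M"
proof -
  have [measurable]: "(\<lambda>x. bessel_I nu (k x)) \<in> borel_measurable M" if "k \<in> borel_measurable M" for k nu
    using measurable_compose[OF that bessel_I_measurable] .
  show ?thesis unfolding heat_kernel_def by measurable
qed

lemma heat_kernel_nonneg:
  assumes "lam > 0" "s > 0" "x > 0" "y > 0" shows "heat_kernel lam s x y \<ge> 0"
proof -
  have "(\<Sum>k. (((1 / (4 * s)) * x * y)\<^sup>2) ^ k * hcoef lam k) \<ge> 0"
    using hcoef_pos[OF assms(1)] by (intro suminf_nonneg summable_hcoef assms) (auto simp: less_imp_le)
  then show ?thesis by (subst heat_kernel_series[OF assms refl]) auto
qed

text \<open>The closed form that \<open>poisson_kernel\<close> takes at positive arguments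
  (\<open>poisson_kernel_eq\<close>); all later estimates start from it.\<close>

definition pker :: "real \<Rightarrow> real \<Rightarrow> real \<Rightarrow> real \<Rightarrow> real" where
  "pker lam t x y = 2 * lam / pi * (x * y) powr lam * (\<integral>u. kap lam 0 (qf x y u) t \<partial>bmeas lam)"

text \<open>The inversion \<open>r = 1 / s\<close> reduces this to a Gamma integral. The range
  \<open>lam > -1\<close> includes \<open>-1 / 2\<close>, the case that gives the subordinator mass
  one.\<close>

lemma nn_integral_inverse_power_exp:
  assumes "lam > -1" "D > 0"
  shows "(\<integral>\<^sub>0s. ennreal (s powr (- lam - 2) * exp (- D / (4 * s))))
     = ennreal (Gamma (lam + 1) * (D / 4) powr (- lam - 1))"
proof -
  have "(\<integral>\<^sub>0s. ennreal (s powr (- lam - 2) * exp (- D / (4 * s))))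
    = (\<integral>\<^sub>0s. ennreal ((1 / s) powr (- lam - 2) * exp (- D / (4 * (1 / s)))) * ennreal (1 / s\<^sup>2))"
    by (rule nn_integral_inverse_Ioi) auto
  also have "\<dots> = (\<integral>\<^sub>0r. ennreal (r powr (lam + 1 - 1) * exp (- (D / 4) * r)))"
  proof (intro nn_integral_cong)
    fix r :: real
    have *: "(1 / r) powr (- lam - 2) * (1 / r\<^sup>2) = r powr (lam + 1 - 1)" if "r > 0"
    proof -
      have "(1 / r) powr (- lam - 2) = r powr (lam + 2)"
        using that by (simp add: powr_divide powr_minus_divide powr_diff powr_add)
      moreover have "1 / r\<^sup>2 = r powr (- 2)" using that by (simp add: powr_minus_divide)
      moreover have "r powr (lam + 2) * r powr (- 2) = r powr (lam + 1 - 1)"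
        by (subst powr_add[symmetric]) (rule powr_exp_cong, simp)
      ultimately show ?thesis by simp
    qed
    have "(1 / r) powr (- lam - 2) * exp (- D / (4 * (1 / r))) * (1 / r\<^sup>2) = r powr (lam + 1 - 1) * exp (- (D / 4) * r)" if "r > 0"
    proof -
      have e: "exp (- D / (4 * (1 / r))) = exp (- (D / 4) * r)" by simp
      show ?thesis unfolding e *[OF that, symmetric] by (simp only: mult_ac)
    qed
    then show "ennreal ((1 / r) powr (- lam - 2) * exp (- D / (4 * (1 / r)))) * ennreal (1 / r\<^sup>2) * pos r
       = ennreal (r powr (lam + 1 - 1) * exp (- (D / 4) * r)) * pos r"
      by (auto simp: ennreal_mult'[symmetric] ennreal_mult''[symmetric] split: split_indicator)
  qed
  also have "\<dots> = ennreal (Gamma (lam + 1) * (D / 4) powr (- (lam + 1)))"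
    using assms by (intro nn_integral_power_exp) auto
  finally show ?thesis by simp
qed

lemma finite_measure_bmeas:
  assumes "lam > 0" shows "finite_measure (bmeas lam)"
proof
  show "emeasure (bmeas lam) (space (bmeas lam)) \<noteq> \<infinity>"
    using nn_integral_bmeas_exp[OF assms, of 0] by simp
qed

lemma kap_0_nonneg: "t \<ge> 0 \<Longrightarrow> kap lam 0 A t \<ge> 0"
  by (simp add: kap_0)

lemma kap_0_le:
  assumes "lam > 0" "A \<ge> B" "B \<ge> 0" "t > 0" shows "kap lam 0 A t \<le> t * (B + t\<^sup>2) powr (- lam - 1)"
  using assms unfolding kap_0 by (intro mult_left_mono powr_mono2') (auto simp: add_nonneg_pos)

lemma integrable_kap_bmeas:
  assumes "lam > 0" "t > 0" "x > 0" "y > 0"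
  shows "integrable (bmeas lam) (\<lambda>u. kap lam 0 (qf x y u) t)"
proof -
  interpret finite_measure "bmeas lam" by (rule finite_measure_bmeas[OF assms(1)])
  show ?thesis
  proof (rule integrable_const_bound[where B="t * (0 + t\<^sup>2) powr (- lam - 1)"])
    show "AE u in bmeas lam. norm (kap lam 0 (qf x y u) t) \<le> t * (0 + t\<^sup>2) powr (- lam - 1)"
      using AE_bmeas
    proof eventually_elim
      case (elim u)
      show ?case
        using kap_0_nonneg[of t lam "qf x y u"] kap_0_le[OF assms(1) qf_nonneg order_refl assms(2), of x y u] assms elim by auto
    qed
  qed measurable
qed

lemma pker_nn_integral:
  assumes "lam > 0" "t > 0" "x > 0" "y > 0"
  shows "ennreal (pker lam t x y) = ennreal (2 * lam / pi * (x * y) powr lam) * (\<integral>\<^sup>+u. ennreal (kap lam 0 (qf x y u) t) \<partial>bmeas lam)"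
  using assms integrable_kap_bmeas[OF assms] unfolding pker_def
  by (subst nn_integral_eq_integral) (auto simp: kap_0_nonneg ennreal_mult'[symmetric])

lemma pker_nonneg: "lam > 0 \<Longrightarrow> t > 0 \<Longrightarrow> pker lam t x y \<ge> 0"
  unfolding pker_def by (intro mult_nonneg_nonneg integral_nonneg_AE) (auto simp: kap_0_nonneg)

text \<open>With the heat kernel written as an average over \<open>u\<close> and the integrals
  exchanged, each \<open>u\<close> leaves a Gamma integral in \<open>s\<close> with
  \<open>D = qf x y u + t\<^sup>2\<close>. The constants combine to \<open>2 * lam / pi\<close>
  through \<open>Gamma (lam + 1) = lam * Gamma lam\<close> and
  \<open>4 powr (1 / 2) = 2\<close>.\<close>

lemma poisson_integrand_nn_integral:
  assumes "lam > 0" "t > 0" "x > 0" "y > 0"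
  shows "(\<integral>\<^sub>0s. ennreal (t / (2 * sqrt pi) * (exp (- t\<^sup>2 / (4 * s)) / s powr (3 / 2) * heat_kernel lam s x y)))
     = ennreal (pker lam t x y)"
proof -
  interpret B: finite_measure "bmeas lam" by (rule finite_measure_bmeas[OF assms(1)])
  interpret P: pair_sigma_finite lborel "bmeas lam" ..
  have G: "Gamma lam > 0" using assms by (simp add: Gamma_real_pos)
  define c where "c = t / (pi * Gamma lam) * 4 powr (- lam - 1 / 2) * (x * y) powr lam"
  have c: "c \<ge> 0" using assms G by (simp add: c_def)
  let ?E = "\<lambda>s u. ennreal (s powr (- lam - 2) * exp (- (qf x y u + t\<^sup>2) / (4 * s)))"
  have "(\<integral>\<^sub>0s. ennreal (t / (2 * sqrt pi) * (exp (- t\<^sup>2 / (4 * s)) / s powr (3 / 2) * heat_kernel lam s x y)))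
    = (\<integral>\<^sub>+s. (\<integral>\<^sup>+u. ennreal c * (?E s u * pos s) \<partial>bmeas lam))"
  proof (intro nn_integral_cong)
    fix s :: real
    show "ennreal (t / (2 * sqrt pi) * (exp (- t\<^sup>2 / (4 * s)) / s powr (3 / 2) * heat_kernel lam s x y)) * pos s
      = (\<integral>\<^sup>+u. ennreal c * (?E s u * pos s) \<partial>bmeas lam)"
    proof (cases "s > 0")
      case True
      let ?k = "t / (2 * sqrt pi) * (exp (- t\<^sup>2 / (4 * s)) / s powr (3 / 2))"
      let ?h = "2 / (sqrt pi * Gamma lam) * (1 / (4 * s)) powr (lam + 1 / 2) * (x * y) powr lam"
      have kh: "?k * ?h = c * (s powr (- lam - 2) * exp (- t\<^sup>2 / (4 * s)))"
      proof -
        have "(1 / (4 * s)) powr (lam + 1 / 2) = 4 powr (- lam - 1 / 2) * s powr (- (lam + 1 / 2))"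
        proof -
          have "(1 / (4 * s)) powr (lam + 1 / 2) = (4 * s) powr (- (lam + 1 / 2))"
            using True by (simp add: powr_divide powr_minus_divide[symmetric])
          also have "\<dots> = 4 powr (- (lam + 1 / 2)) * s powr (- (lam + 1 / 2))"
            using True by (simp add: powr_mult)
          finally show ?thesis by simp
        qed
        moreover have "s powr (- (lam + 1 / 2)) / s powr (3 / 2) = s powr (- lam - 2)"
          by (subst powr_diff[symmetric]) (rule powr_exp_cong, simp)
        moreover have "sqrt pi * sqrt pi = pi" by simp
        ultimately show ?thesis
        proof -
          assume 1: "(1 / (4 * s)) powr (lam + 1 / 2) = 4 powr (- lam - 1 / 2) * s powr (- (lam + 1 / 2))"
            and 2: "s powr (- (lam + 1 / 2)) / s powr (3 / 2) = s powr (- lam - 2)"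
            and 3: "sqrt pi * sqrt pi = pi"
          have "?k * ?h = t / ((sqrt pi * sqrt pi) * Gamma lam) * 4 powr (- lam - 1 / 2) * (x * y) powr lam *
            ((s powr (- (lam + 1 / 2)) / s powr (3 / 2)) * exp (- t\<^sup>2 / (4 * s)))"
          proof -
            have "sqrt pi * (sqrt pi * z) = pi * z" for z by (simp flip: mult.assoc)
            then show ?thesis unfolding 1 by (simp add: field_simps)
          qed
          then show ?thesis unfolding 2 3 c_def .
        qed
      qed
      have "ennreal (?k * heat_kernel lam s x y) = ennreal ?k * ennreal (heat_kernel lam s x y)"
        using assms True by (intro ennreal_mult') auto
      also have "\<dots> = ennreal (?k * ?h) * (\<integral>\<^sup>+u. ennreal (exp (- (1 / (4 * s)) * qf x y u)) \<partial>bmeas lam)"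
        using assms True G by (subst heat_kernel_nn_integral[OF assms(1) True assms(3,4) refl], subst ennreal_mult') (auto simp: mult.assoc)
      also have "\<dots> = (\<integral>\<^sup>+u. ennreal (?k * ?h) * ennreal (exp (- (1 / (4 * s)) * qf x y u)) \<partial>bmeas lam)"
        by (rule nn_integral_cmult[symmetric]) measurable
      also have "\<dots> = (\<integral>\<^sup>+u. ennreal c * (?E s u * pos s) \<partial>bmeas lam)"
      proof (intro nn_integral_cong)
        fix u
        have e: "exp (- t\<^sup>2 / (4 * s)) * exp (- (1 / (4 * s)) * qf x y u) = exp (- (qf x y u + t\<^sup>2) / (4 * s))"
          by (simp add: exp_add[symmetric] add_divide_distrib diff_divide_distrib)
        have "ennreal (?k * ?h) * ennreal (exp (- (1 / (4 * s)) * qf x y u))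
          = ennreal (c * (s powr (- lam - 2) * (exp (- t\<^sup>2 / (4 * s)) * exp (- (1 / (4 * s)) * qf x y u))))"
          unfolding kh using c by (subst ennreal_mult'[symmetric]) (auto simp: mult.assoc)
        also have "\<dots> = ennreal c * ?E s u"
          unfolding e using c by (simp add: ennreal_mult')
        finally show "ennreal (?k * ?h) * ennreal (exp (- (1 / (4 * s)) * qf x y u))
          = ennreal c * (?E s u * pos s)"
          using True by simp
      qed
      finally show ?thesis using True by (simp add: mult.assoc)
    qed simp
  qed
  also have "\<dots> = (\<integral>\<^sup>+u. (\<integral>\<^sub>+s. ennreal c * (?E s u * pos s)) \<partial>bmeas lam)"
    by (rule P.Fubini'[symmetric]) measurable
  also have "\<dots> = (\<integral>\<^sup>+u. ennreal (2 * lam / pi * (x * y) powr lam) * ennreal (kap lam 0 (qf x y u) t) \<partial>bmeas lam)"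
  proof (intro nn_integral_cong_AE, use AE_bmeas in eventually_elim)
    fix u :: real assume "-1 < u \<and> u < 1"
    then have D: "qf x y u + t\<^sup>2 > 0" using assms qf_nonneg[of x y u] by (intro add_nonneg_pos) auto
    have "(\<integral>\<^sub>+s. ennreal c * (?E s u * pos s))
      = ennreal c * ennreal (Gamma (lam + 1) * ((qf x y u + t\<^sup>2) / 4) powr (- lam - 1))"
      using nn_integral_inverse_power_exp[of lam, OF _ D] assms by (subst nn_integral_cmult) auto
    also have "\<dots> = ennreal (2 * lam / pi * (x * y) powr lam * kap lam 0 (qf x y u) t)"
    proof -
      have "Gamma (lam + 1) = lam * Gamma lam" using assms by (intro Gamma_plus1) (auto elim!: nonpos_Ints_cases)
      moreover have "((qf x y u + t\<^sup>2) / 4) powr (- lam - 1) = 4 powr (lam + 1) * (qf x y u + t\<^sup>2) powr (- lam - 1)"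
      proof -
        have "((qf x y u + t\<^sup>2) / 4) powr (- lam - 1) = (qf x y u + t\<^sup>2) powr (- lam - 1) / 4 powr (- (lam + 1))"
          using D by (simp add: powr_divide)
        then show ?thesis using powr_minus_divide[of 4 "lam + 1"] by simp
      qed
      moreover have "4 powr (- lam - 1 / 2) * 4 powr (lam + 1) = (2::real)"
      proof -
        have "4 powr (- lam - 1 / 2) * 4 powr (lam + 1) = (4::real) powr (1 / 2)"
          by (subst powr_add[symmetric]) (rule powr_exp_cong, simp)
        then show ?thesis by (simp add: powr_half_sqrt)
      qed
      ultimately have "c * (Gamma (lam + 1) * ((qf x y u + t\<^sup>2) / 4) powr (- lam - 1))
        = 2 * lam / pi * (x * y) powr lam * kap lam 0 (qf x y u) t"
        using G unfolding c_def kap_0 by (simp add: field_simps)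
      then show ?thesis using c by (subst ennreal_mult'[symmetric]) auto
    qed
    also have "\<dots> = ennreal (2 * lam / pi * (x * y) powr lam) * ennreal (kap lam 0 (qf x y u) t)"
      using assms by (intro ennreal_mult') auto
    finally show "(\<integral>\<^sub>+s. ennreal c * (?E s u * pos s))
      = ennreal (2 * lam / pi * (x * y) powr lam) * ennreal (kap lam 0 (qf x y u) t)" .
  qed
  also have "\<dots> = ennreal (pker lam t x y)"
    by (subst nn_integral_cmult) (auto simp: pker_nn_integral[OF assms])
  finally show ?thesis .
qed

lemma poisson_kernel_eq:
  assumes "lam > 0" "t > 0" "x > 0" "y > 0"
  shows "poisson_kernel lam t x y = pker lam t x y"
proof -
  have "poisson_kernel lam t x y = (LBINT s. pos s * (t / (2 * sqrt pi) * (exp (- t\<^sup>2 / (4 * s)) / s powr (3 / 2) * heat_kernel lam s x y)))"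
    unfolding poisson_kernel_def set_lebesgue_integral_def
    by (subst integral_mult_right_zero[symmetric]) (auto intro!: Bochner_Integration.integral_cong)
  also have "\<dots> = enn2real (\<integral>\<^sub>+s. ennreal (pos s * (t / (2 * sqrt pi) * (exp (- t\<^sup>2 / (4 * s)) / s powr (3 / 2) * heat_kernel lam s x y))))"
    using assms by (intro integral_eq_nn_integral AE_I2) (auto simp: heat_kernel_nonneg split: split_indicator)
  also have "(\<integral>\<^sub>+s. ennreal (pos s * (t / (2 * sqrt pi) * (exp (- t\<^sup>2 / (4 * s)) / s powr (3 / 2) * heat_kernel lam s x y))))
    = ennreal (pker lam t x y)"
    unfolding poisson_integrand_nn_integral[OF assms, symmetric]
    by (intro nn_integral_cong) (auto split: split_indicator)
  finally show ?thesis using pker_nonneg[OF assms(1,2)] by simp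
qed

subsection \<open>The heat semigroup\<close>

lemma ennreal_mult_eqD:
  assumes "c > 0" "ennreal c * A = ennreal d" shows "A = ennreal (d / c)"
proof -
  have "A = ennreal (1 / c * c) * A" using assms by simp
  also have "\<dots> = ennreal (1 / c) * (ennreal c * A)" using assms(1) by (subst ennreal_mult') (auto simp: mult.assoc)
  also have "\<dots> = ennreal (1 / c * d)" unfolding assms(2) using assms(1) by (subst ennreal_mult') auto
  finally show ?thesis by simp
qed

lemma powr_minus_add_nat:
  assumes "(c::real) > 0" "b = a + real k" shows "c powr (- b) = c powr (- a) / c ^ k"
proof -
  have "c powr (- b) = c powr (- a - real k)" unfolding assms(2) by (rule powr_exp_cong) simp
  then show ?thesis using assms(1) by (simp only: powr_diff powr_realpow)
qed

text \<open>The Chu-Vandermonde identity, arranged so that \<open>k\<close> enters only through the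
  falling factorials \<open>fact j * (k choose j)\<close>; summed against
  \<open>X ^ k / fact k\<close> these give \<open>X ^ j * exp X\<close>.\<close>

lemma pochhammer_Vandermonde:
  "pochhammer (real k + mu) l = (\<Sum>j\<le>l. real (l choose j) * pochhammer (real j + mu) (l - j) * (fact j * real (k choose j)))"
proof -
  have "pochhammer (real k + mu) l = fact l * ((real k + (real l + mu - 1)) gchoose l)"
    by (simp add: gbinomial_pochhammer' algebra_simps)
  also have "\<dots> = fact l * (\<Sum>j\<le>l. (real k gchoose j) * ((real l + mu - 1) gchoose (l - j)))"
    by (simp add: gbinomial_Vandermonde[symmetric] atLeast0AtMost)
  also have "\<dots> = (\<Sum>j\<le>l. real (l choose j) * pochhammer (real j + mu) (l - j) * (fact j * real (k choose j)))"
    unfolding sum_distrib_left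
  proof (intro sum.cong refl)
    fix j assume "j \<in> {..l}"
    then have j: "j \<le> l" by simp
    have 1: "(real l + mu - 1) gchoose (l - j) = pochhammer (real j + mu) (l - j) / fact (l - j)"
      using j by (simp add: gbinomial_pochhammer' of_nat_diff algebra_simps)
    have 2: "real (l choose j) = fact l / (fact j * fact (l - j))" by (rule binomial_fact[OF j])
    show "fact l * ((real k gchoose j) * ((real l + mu - 1) gchoose (l - j))) = real (l choose j) * pochhammer (real j + mu) (l - j) * (fact j * real (k choose j))"
      unfolding 1 2 by (simp add: binomial_gbinomial)
  qed
  finally show ?thesis .
qed

lemma exp_sums_shift: "(\<lambda>k. X ^ k / fact k * (fact j * real (k choose j))) sums (X ^ j * exp (X::real))"
proof -
  have "(\<lambda>k. X ^ (k + j) / fact (k + j) * (fact j * real ((k + j) choose j))) sums (X ^ j * exp X)"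
  proof -
    have "(\<lambda>k. X ^ j * (X ^ k /\<^sub>R fact k)) sums (X ^ j * exp X)" by (intro sums_mult exp_converges)
    moreover have "X ^ j * (X ^ k /\<^sub>R fact k) = X ^ (k + j) / fact (k + j) * (fact j * real ((k + j) choose j))" for k
      by (simp add: binomial_fact power_add field_simps)
    ultimately show ?thesis by simp
  qed
  then show ?thesis
    by (subst sums_iff_shift'[of _ j, symmetric]) (simp add: binomial_eq_0)
qed

lemma Gamma_ratio_pochhammer:
  assumes "mu > 0" shows "Gamma (mu + real n + real l) / Gamma (mu + real n) = pochhammer (real n + mu) l"
proof -
  have "mu + real n \<notin> \<int>\<^sub>\<le>\<^sub>0" using assms by (auto elim!: nonpos_Ints_cases)
  then show ?thesis using pochhammer_Gamma[of "mu + real n" l] by (simp add: add.commute)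
qed

text \<open>The terminating case of Kummer's transformation: up to the factor
  \<open>Gamma (mu + l) / Gamma mu\<close> the series is the confluent hypergeometric function with
  parameters \<open>mu + l\<close> and \<open>mu\<close>, and it equals \<open>exp X\<close> times a
  polynomial of Laguerre type.\<close>

lemma kummer_sums:
  assumes "mu > 0"
  shows "(\<lambda>k. X ^ k / fact k * (Gamma (mu + real k + real l) / Gamma (mu + real k))) sums
     (exp X * (\<Sum>j\<le>l. real (l choose j) * (Gamma (mu + real l) / Gamma (mu + real j)) * X ^ j))"
proof -
  have "(\<lambda>k. \<Sum>j\<le>l. real (l choose j) * pochhammer (real j + mu) (l - j) * (X ^ k / fact k * (fact j * real (k choose j))))
     sums (\<Sum>j\<le>l. real (l choose j) * pochhammer (real j + mu) (l - j) * (X ^ j * exp X))"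
    by (rule sums_sum, rule sums_mult, rule exp_sums_shift)
  moreover have "(\<Sum>j\<le>l. real (l choose j) * pochhammer (real j + mu) (l - j) * (X ^ k / fact k * (fact j * real (k choose j))))
     = X ^ k / fact k * (Gamma (mu + real k + real l) / Gamma (mu + real k))" for k
    unfolding Gamma_ratio_pochhammer[OF assms] pochhammer_Vandermonde[of k mu l] sum_distrib_left
    by (intro sum.cong refl) (simp only: mult_ac)
  moreover have "(\<Sum>j\<le>l. real (l choose j) * pochhammer (real j + mu) (l - j) * (X ^ j * exp X))
     = exp X * (\<Sum>j\<le>l. real (l choose j) * (Gamma (mu + real l) / Gamma (mu + real j)) * X ^ j)"
    unfolding sum_distrib_left
  proof (intro sum.cong refl)
    fix j assume "j \<in> {..l}"
    then have "pochhammer (real j + mu) (l - j) = Gamma (mu + real l) / Gamma (mu + real j)"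
      using Gamma_ratio_pochhammer[OF assms, of j "l - j"] by (simp add: of_nat_diff)
    then show "real (l choose j) * pochhammer (real j + mu) (l - j) * (X ^ j * exp X)
      = exp X * (real (l choose j) * (Gamma (mu + real l) / Gamma (mu + real j)) * X ^ j)" by simp
  qed
  ultimately show ?thesis by simp
qed

text \<open>Termwise Gaussian integrals followed by \<open>kummer_sums\<close>. The factor
  \<open>y powr (2 * l + lam) * exp (- q * y\<^sup>2)\<close> is, up to constants, the
  \<open>l\<close>-th term of a second heat kernel in \<open>y\<close> with parameter
  \<open>q\<close>; for \<open>l = 0\<close> and \<open>q = 0\<close> the invariance of
  \<open>y powr lam\<close> results.\<close>

lemma heat_kernel_moment:
  assumes lam: "lam > 0" and "s > 0" "x > 0" and q: "q \<ge> 0" and p: "p = 1 / (4 * s)"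
  shows "(\<integral>\<^sub>0y. ennreal (heat_kernel lam s x y * (y powr (2 * real l + lam) * exp (- q * y\<^sup>2))))
     = ennreal (p powr (lam + 1 / 2) * x powr lam * exp (- p * x\<^sup>2) * (p + q) powr (- (lam + 1 / 2 + real l)) *
        (exp (p\<^sup>2 * x\<^sup>2 / (p + q)) * (\<Sum>j\<le>l. real (l choose j) * (Gamma (lam + 1 / 2 + real l) / Gamma (lam + 1 / 2 + real j)) * (p\<^sup>2 * x\<^sup>2 / (p + q)) ^ j)))"
proof -
  let ?mu = "lam + 1 / 2"
  define X where "X = p\<^sup>2 * x\<^sup>2 / (p + q)"
  have pp: "p > 0" using assms by simp
  have c: "p + q > 0" using pp q by simp
  have X: "X \<ge> 0" using c by (simp add: X_def)
  define K where "K = p powr ?mu * x powr lam * exp (- p * x\<^sup>2)"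
  have K: "K \<ge> 0" by (simp add: K_def)
  define G where "G k = Gamma (?mu + real k + real l) / Gamma (?mu + real k)" for k
  have G: "G k > 0" for k using lam by (auto simp: G_def intro!: divide_pos_pos Gamma_real_pos)
  have "(\<integral>\<^sub>0y. ennreal (heat_kernel lam s x y * (y powr (2 * real l + lam) * exp (- q * y\<^sup>2))))
     = (\<integral>\<^sub>+y. (\<Sum>k. ennreal (2 * K * ((p * x)\<^sup>2) ^ k * hcoef lam k) * (ennreal (y powr (2 * (?mu + real k + real l) - 1) * exp (- (p + q) * y\<^sup>2)) * pos y)))"
  proof (intro nn_integral_cong)
    fix y :: real
    show "ennreal (heat_kernel lam s x y * (y powr (2 * real l + lam) * exp (- q * y\<^sup>2))) * pos y
      = (\<Sum>k. ennreal (2 * K * ((p * x)\<^sup>2) ^ k * hcoef lam k) * (ennreal (y powr (2 * (?mu + real k + real l) - 1) * exp (- (p + q) * y\<^sup>2)) * pos y))"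
    proof (cases "y > 0")
      case y: True
      let ?c = "2 * p powr ?mu * (x * y) powr lam * exp (- p * (x\<^sup>2 + y\<^sup>2)) * (y powr (2 * real l + lam) * exp (- q * y\<^sup>2))"
      have t: "?c * (((p * x * y)\<^sup>2) ^ k * hcoef lam k)
         = 2 * K * ((p * x)\<^sup>2) ^ k * hcoef lam k * (y powr (2 * (?mu + real k + real l) - 1) * exp (- (p + q) * y\<^sup>2))" for k
      proof -
        have a: "exp (- p * (x\<^sup>2 + y\<^sup>2)) * exp (- q * y\<^sup>2) = exp (- p * x\<^sup>2) * exp (- (p + q) * y\<^sup>2)"
          by (simp add: exp_add[symmetric] algebra_simps)
        have b: "((p * x * y)\<^sup>2) ^ k = ((p * x)\<^sup>2) ^ k * y powr (real (2 * k))"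
          using y by (simp add: power_mult_distrib power_mult[symmetric] powr_realpow del: of_nat_mult)
        have d: "y powr lam * y powr (2 * real l + lam) * y powr (real (2 * k)) = y powr (2 * (?mu + real k + real l) - 1)"
          by (subst powr_add[symmetric])+ (rule powr_exp_cong, simp)
        have e: "(x * y) powr lam = x powr lam * y powr lam" by (rule powr_mult)
        have "?c * (((p * x * y)\<^sup>2) ^ k * hcoef lam k)
          = 2 * p powr ?mu * x powr lam * ((p * x)\<^sup>2) ^ k * hcoef lam k * (exp (- p * (x\<^sup>2 + y\<^sup>2)) * exp (- q * y\<^sup>2)) *
            (y powr lam * y powr (2 * real l + lam) * y powr (real (2 * k)))"
          unfolding b e by (simp only: mult_ac)
        then show ?thesis unfolding a d K_def by (simp only: mult_ac)
      qed
      have s1: "summable (\<lambda>k. ((p * x * y)\<^sup>2) ^ k * hcoef lam k)" by (rule summable_hcoef[OF lam])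
      have "heat_kernel lam s x y * (y powr (2 * real l + lam) * exp (- q * y\<^sup>2)) = ?c * (\<Sum>k. ((p * x * y)\<^sup>2) ^ k * hcoef lam k)"
        by (subst heat_kernel_series[OF lam \<open>s > 0\<close> \<open>x > 0\<close> y p]) (simp only: mult_ac)
      also have "\<dots> = (\<Sum>k. ?c * (((p * x * y)\<^sup>2) ^ k * hcoef lam k))" by (rule suminf_mult[OF s1, symmetric])
      finally have 1: "heat_kernel lam s x y * (y powr (2 * real l + lam) * exp (- q * y\<^sup>2)) = (\<Sum>k. ?c * (((p * x * y)\<^sup>2) ^ k * hcoef lam k))" .
      have "ennreal (\<Sum>k. ?c * (((p * x * y)\<^sup>2) ^ k * hcoef lam k)) = (\<Sum>k. ennreal (?c * (((p * x * y)\<^sup>2) ^ k * hcoef lam k)))"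
        using hcoef_pos[OF lam] by (intro suminf_ennreal2[symmetric] summable_mult s1) (auto intro!: mult_nonneg_nonneg simp: less_imp_le)
      then show ?thesis using y hcoef_pos[OF lam] K unfolding 1 t
        by (simp add: ennreal_mult' less_imp_le)
    qed simp
  qed
  also have "\<dots> = (\<Sum>k. \<integral>\<^sup>+y. ennreal (2 * K * ((p * x)\<^sup>2) ^ k * hcoef lam k) * (ennreal (y powr (2 * (?mu + real k + real l) - 1) * exp (- (p + q) * y\<^sup>2)) * pos y) \<partial>lborel)"
    by (rule nn_integral_suminf) auto
  also have "\<dots> = (\<Sum>k. ennreal (K * (p + q) powr (- (?mu + real l)) * (X ^ k / fact k * G k)))"
  proof (intro suminf_cong)
    fix k
    have "(\<integral>\<^sub>+y. ennreal (2 * K * ((p * x)\<^sup>2) ^ k * hcoef lam k) * (ennreal (y powr (2 * (?mu + real k + real l) - 1) * exp (- (p + q) * y\<^sup>2)) * pos y))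
      = ennreal (2 * K * ((p * x)\<^sup>2) ^ k * hcoef lam k) * ennreal (Gamma (?mu + real k + real l) * (p + q) powr (- (?mu + real k + real l)) / 2)"
      by (subst nn_integral_cmult, measurable, subst nn_integral_power_gauss) (use lam c in auto)
    also have "\<dots> = ennreal (2 * K * ((p * x)\<^sup>2) ^ k * hcoef lam k * (Gamma (?mu + real k + real l) * (p + q) powr (- (?mu + real k + real l)) / 2))"
      using K hcoef_pos[OF lam, of k] by (subst ennreal_mult') (auto simp: less_imp_le)
    also have "2 * K * ((p * x)\<^sup>2) ^ k * hcoef lam k * (Gamma (?mu + real k + real l) * (p + q) powr (- (?mu + real k + real l)) / 2)
       = K * (p + q) powr (- (?mu + real l)) * (X ^ k / fact k * G k)"
    proof -
      have "(p + q) powr (- (?mu + real k + real l)) = (p + q) powr (- (?mu + real l)) / (p + q) ^ k"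
        using c by (rule powr_minus_add_nat) simp
      moreover have "X ^ k = ((p * x)\<^sup>2) ^ k / (p + q) ^ k" by (simp add: X_def power_divide power_mult_distrib)
      ultimately show ?thesis by (simp add: hcoef_def G_def mult_ac)
    qed
    finally show "(\<integral>\<^sub>+y. ennreal (2 * K * ((p * x)\<^sup>2) ^ k * hcoef lam k) * (ennreal (y powr (2 * (?mu + real k + real l) - 1) * exp (- (p + q) * y\<^sup>2)) * pos y))
      = ennreal (K * (p + q) powr (- (?mu + real l)) * (X ^ k / fact k * G k))" .
  qed
  also have "\<dots> = ennreal (\<Sum>k. K * (p + q) powr (- (?mu + real l)) * (X ^ k / fact k * G k))"
    using K X G lam by (intro suminf_ennreal2 summable_mult sums_summable[OF kummer_sums[of ?mu X l, folded G_def]])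
      (auto intro!: mult_nonneg_nonneg divide_nonneg_pos simp: less_imp_le)
  also have "(\<Sum>k. K * (p + q) powr (- (?mu + real l)) * (X ^ k / fact k * G k)) = K * (p + q) powr (- (?mu + real l)) *
     (exp X * (\<Sum>j\<le>l. real (l choose j) * (Gamma (?mu + real l) / Gamma (?mu + real j)) * X ^ j))"
    using lam by (intro sums_unique[symmetric] sums_mult kummer_sums[of ?mu X l, folded G_def]) auto
  finally show ?thesis by (simp add: K_def X_def)
qed

lemma heat_kernel_powr_invariant:
  assumes lam: "lam > 0" and "s > 0" "x > 0"
  shows "(\<integral>\<^sub>0y. ennreal (heat_kernel lam s x y * y powr lam)) = ennreal (x powr lam)"
proof -
  define p where "p = 1 / (4 * s)"
  have pp: "p > 0" using assms by (simp add: p_def)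
  have "Gamma (lam + 1 / 2) > 0" using lam by (simp add: Gamma_real_pos)
  moreover have "p powr (lam + 1 / 2) * p powr (- (lam + 1 / 2)) = 1" using pp by (simp add: powr_add[symmetric])
  moreover have "exp (- p * x\<^sup>2) * exp (p\<^sup>2 * x\<^sup>2 / p) = 1" using pp by (simp add: exp_add[symmetric] power2_eq_square)
  ultimately have "p powr (lam + 1 / 2) * x powr lam * exp (- p * x\<^sup>2) * (p + 0) powr (- (lam + 1 / 2 + real 0)) *
        (exp (p\<^sup>2 * x\<^sup>2 / (p + 0)) * (\<Sum>j\<le>0. real (0 choose j) * (Gamma (lam + 1 / 2 + real 0) / Gamma (lam + 1 / 2 + real j)) * (p\<^sup>2 * x\<^sup>2 / (p + 0)) ^ j))
       = x powr lam * (p powr (lam + 1 / 2) * p powr (- (lam + 1 / 2))) * (exp (- p * x\<^sup>2) * exp (p\<^sup>2 * x\<^sup>2 / p))"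
    by (simp add: mult_ac)
  also have "\<dots> = x powr lam" using \<open>p powr (lam + 1 / 2) * p powr (- (lam + 1 / 2)) = 1\<close> \<open>exp (- p * x\<^sup>2) * exp (p\<^sup>2 * x\<^sup>2 / p) = 1\<close> by simp
  finally show ?thesis using heat_kernel_moment[OF assms order_refl p_def, of 0] by simp
qed

text \<open>The second kernel is expanded in its power series and each term integrated by
  \<open>heat_kernel_moment\<close>. The resulting double sum is the Cauchy product of the Bessel
  series at \<open>X * Y\<close> with the series of \<open>exp Y\<close>, and
  \<open>X * Y = (r * x * z)\<^sup>2\<close> is the argument that belongs to time
  \<open>a + b\<close>.\<close>

lemma heat_kernel_semigroup:
  assumes lam: "lam > 0" and "a > 0" "b > 0" "x > 0" "z > 0"
  shows "(\<integral>\<^sub>0y. ennreal (heat_kernel lam a x y * heat_kernel lam b y z)) = ennreal (heat_kernel lam (a + b) x z)"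
proof -
  let ?mu = "lam + 1 / 2"
  define p q where "p = 1 / (4 * a)" and "q = 1 / (4 * b)"
  have pq: "p > 0" "q > 0" using assms by (auto simp: p_def q_def)
  \<comment> \<open>Times add and \<open>p\<close>, \<open>q\<close> are inverse times, hence the
    parallel combination. It also satisfies \<open>p\<^sup>2 / (p + q) = p - r\<close> and its
    mirror image, which turn \<open>exp X\<close> and \<open>exp Y\<close> into the Gaussian with
    parameter \<open>r\<close>.\<close>
  define r where "r = p * q / (p + q)"
  have r: "r = 1 / (4 * (a + b))" using assms by (simp add: r_def p_def q_def field_simps)
  define X Y where "X = p\<^sup>2 * x\<^sup>2 / (p + q)" and "Y = q\<^sup>2 * z\<^sup>2 / (p + q)"
  have XY: "X \<ge> 0" "Y \<ge> 0" using pq by (auto simp: X_def Y_def)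
  define H where "H l = 2 * q powr ?mu * z powr lam * exp (- q * z\<^sup>2) * (((q * z)\<^sup>2) ^ l * hcoef lam l)" for l
  have H: "H l \<ge> 0" for l using hcoef_pos[OF lam, of l] by (simp add: H_def)
  define J where "J l = p powr ?mu * x powr lam * exp (- p * x\<^sup>2) * (p + q) powr (- (?mu + real l)) *
        (exp X * (\<Sum>j\<le>l. real (l choose j) * (Gamma (?mu + real l) / Gamma (?mu + real j)) * X ^ j))" for l
  define K where "K = 2 * (p powr ?mu * q powr ?mu * (p + q) powr (- ?mu)) * (x * z) powr lam * (exp (- p * x\<^sup>2) * exp (- q * z\<^sup>2) * exp X)"
  have K: "K \<ge> 0" by (simp add: K_def)
  let ?M = "\<lambda>l y. ennreal (heat_kernel lam a x y * (y powr (2 * real l + lam) * exp (- q * y\<^sup>2))) * pos y"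
  let ?S = "\<lambda>l. \<Sum>j\<le>l. (X * Y) ^ j * hcoef lam j * (Y ^ (l - j) / fact (l - j))"
  have "(\<integral>\<^sub>0y. ennreal (heat_kernel lam a x y * heat_kernel lam b y z))
     = (\<integral>\<^sub>+y. (\<Sum>l. ennreal (H l) * (?M l y)))"
  proof (intro nn_integral_cong)
    fix y :: real
    show "ennreal (heat_kernel lam a x y * heat_kernel lam b y z) * pos y
      = (\<Sum>l. ennreal (H l) * (?M l y))"
    proof (cases "y > 0")
      case y: True
      let ?c = "heat_kernel lam a x y * (2 * q powr ?mu * (y * z) powr lam * exp (- q * (y\<^sup>2 + z\<^sup>2)))"
      have hk: "heat_kernel lam a x y \<ge> 0" by (rule heat_kernel_nonneg) (use assms y in auto)
      have t: "?c * (((q * y * z)\<^sup>2) ^ l * hcoef lam l) = H l * (heat_kernel lam a x y * (y powr (2 * real l + lam) * exp (- q * y\<^sup>2)))" for l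
      proof -
        have 1: "exp (- q * (y\<^sup>2 + z\<^sup>2)) = exp (- q * y\<^sup>2) * exp (- q * z\<^sup>2)" by (simp add: exp_add[symmetric] algebra_simps)
        have 2: "((q * y * z)\<^sup>2) ^ l = ((q * z)\<^sup>2) ^ l * y powr (2 * real l)"
          using y powr_realpow[OF y, of "2 * l"] by (simp add: power_mult_distrib power_mult[symmetric])
        have 3: "y powr (2 * real l + lam) = y powr (2 * real l) * y powr lam" by (rule powr_add)
        have 4: "(y * z) powr lam = y powr lam * z powr lam" by (rule powr_mult)
        show ?thesis unfolding 1 2 3 4 H_def by (simp only: mult_ac)
      qed
      have s1: "summable (\<lambda>k. ((q * y * z)\<^sup>2) ^ k * hcoef lam k)" by (rule summable_hcoef[OF lam])
      have "heat_kernel lam a x y * heat_kernel lam b y z = ?c * (\<Sum>k. ((q * y * z)\<^sup>2) ^ k * hcoef lam k)"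
        by (subst heat_kernel_series[OF lam \<open>b > 0\<close> y \<open>z > 0\<close> q_def]) (simp only: mult_ac)
      also have "\<dots> = (\<Sum>k. ?c * (((q * y * z)\<^sup>2) ^ k * hcoef lam k))" by (rule suminf_mult[OF s1, symmetric])
      finally have 1: "heat_kernel lam a x y * heat_kernel lam b y z = (\<Sum>k. ?c * (((q * y * z)\<^sup>2) ^ k * hcoef lam k))" .
      have "ennreal (\<Sum>k. ?c * (((q * y * z)\<^sup>2) ^ k * hcoef lam k)) = (\<Sum>k. ennreal (?c * (((q * y * z)\<^sup>2) ^ k * hcoef lam k)))"
        using hcoef_pos[OF lam] hk by (intro suminf_ennreal2[symmetric] summable_mult s1) (auto intro!: mult_nonneg_nonneg simp: less_imp_le)
      then show ?thesis using y H unfolding 1 t by (simp add: ennreal_mult')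
    qed simp
  qed
  also have "\<dots> = (\<Sum>l. \<integral>\<^sup>+y. ennreal (H l) * (?M l y) \<partial>lborel)"
    by (rule nn_integral_suminf) measurable
  also have "\<dots> = (\<Sum>l. ennreal (K * (?S l)))"
  proof (intro suminf_cong)
    fix l
    have "(\<integral>\<^sub>+y. ennreal (H l) * (?M l y))
      = ennreal (H l) * ennreal (J l)"
      using heat_kernel_moment[OF lam \<open>a > 0\<close> \<open>x > 0\<close>, of q p l] pq
      by (subst nn_integral_cmult) (auto simp: p_def J_def X_def)
    also have "\<dots> = ennreal (H l * J l)" by (rule ennreal_mult'[symmetric]) (rule H)
    also have "H l * J l = K * (?S l)"
    proof -
      have 1: "(p + q) powr (- (?mu + real l)) = (p + q) powr (- ?mu) / (p + q) ^ l"
        by (rule powr_minus_add_nat) (use pq in simp_all)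
      have 2: "Y ^ l = ((q * z)\<^sup>2) ^ l / (p + q) ^ l" by (simp add: Y_def power_divide power_mult_distrib)
      have 3: "(x * z) powr lam = x powr lam * z powr lam" by (rule powr_mult)
      have "H l * J l = K * (Y ^ l * (hcoef lam l * (\<Sum>j\<le>l. real (l choose j) * (Gamma (?mu + real l) / Gamma (?mu + real j)) * X ^ j)))"
        unfolding H_def J_def K_def 1 2 3 by simp
      also have "Y ^ l * (hcoef lam l * (\<Sum>j\<le>l. real (l choose j) * (Gamma (?mu + real l) / Gamma (?mu + real j)) * X ^ j))
         = (?S l)"
        unfolding sum_distrib_left
      proof (intro sum.cong refl)
        fix j assume "j \<in> {..l}"
        then have j: "j \<le> l" by simp
        have G: "Gamma (?mu + real l) > 0" using lam by (simp add: Gamma_real_pos)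
        have "Y ^ l = Y ^ j * Y ^ (l - j)" using j by (simp add: power_add[symmetric])
        moreover have "real (l choose j) = fact l / (fact j * fact (l - j))" by (rule binomial_fact[OF j])
        ultimately show "Y ^ l * (hcoef lam l * (real (l choose j) * (Gamma (?mu + real l) / Gamma (?mu + real j)) * X ^ j))
          = (X * Y) ^ j * hcoef lam j * (Y ^ (l - j) / fact (l - j))"
          using G by (simp add: hcoef_def power_mult_distrib mult_ac)
      qed
      finally show ?thesis .
    qed
    finally show "(\<integral>\<^sub>+y. ennreal (H l) * (?M l y))
      = ennreal (K * (?S l))" .
  qed
  also have "\<dots> = ennreal (\<Sum>l. K * (?S l))"
  proof -
    have "summable (\<lambda>k. norm ((X * Y) ^ k * hcoef lam k))"
      using summable_hcoef[OF lam, of "X * Y"] XY hcoef_pos[OF lam] by (simp add: abs_mult less_imp_le)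
    moreover have "summable (\<lambda>k. norm (Y ^ k / fact k))" using summable_norm_exp[of Y] XY by (simp add: field_simps)
    ultimately have "summable (\<lambda>l. \<Sum>j\<le>l. (X * Y) ^ j * hcoef lam j * (Y ^ (l - j) / fact (l - j)))"
      by (rule summable_Cauchy_product)
    then show ?thesis using K XY hcoef_pos[OF lam]
      by (intro suminf_ennreal2 summable_mult mult_nonneg_nonneg sum_nonneg) (auto simp: less_imp_le)
  qed
  also have "(\<Sum>l. K * (?S l)) = K * (exp Y * (\<Sum>j. (X * Y) ^ j * hcoef lam j))"
  proof -
    have 1: "summable (\<lambda>k. norm ((X * Y) ^ k * hcoef lam k))"
      using summable_hcoef[OF lam, of "X * Y"] XY hcoef_pos[OF lam] by (simp add: abs_mult less_imp_le)
    have 2: "summable (\<lambda>k. norm (Y ^ k / fact k))" using summable_norm_exp[of Y] XY by (simp add: field_simps)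
    have "(\<lambda>l. \<Sum>j\<le>l. (X * Y) ^ j * hcoef lam j * (Y ^ (l - j) / fact (l - j))) sums ((\<Sum>j. (X * Y) ^ j * hcoef lam j) * (\<Sum>k. Y ^ k / fact k))"
      by (rule Cauchy_product_sums[OF 1 2])
    moreover have "(\<Sum>k. Y ^ k / fact k) = exp Y" by (simp add: exp_def divide_inverse mult.commute)
    ultimately have "(\<lambda>l. K * (?S l)) sums (K * ((\<Sum>j. (X * Y) ^ j * hcoef lam j) * exp Y))"
      by (intro sums_mult) simp
    then show ?thesis by (simp add: sums_iff mult.commute)
  qed
  also have "K * (exp Y * (\<Sum>j. (X * Y) ^ j * hcoef lam j)) = heat_kernel lam (a + b) x z"
  proof -
    have "p powr ?mu * q powr ?mu * (p + q) powr (- ?mu) = r powr ?mu"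
      unfolding r_def powr_mult powr_divide powr_minus_divide by simp
    moreover have "exp (- p * x\<^sup>2) * exp (- q * z\<^sup>2) * exp X * exp Y = exp (- r * (x\<^sup>2 + z\<^sup>2))"
    proof -
      have "p\<^sup>2 / (p + q) = p - r" "q\<^sup>2 / (p + q) = q - r"
        using pq by (simp_all add: r_def field_simps power2_eq_square)
      then have "X = (p - r) * x\<^sup>2" "Y = (q - r) * z\<^sup>2"
        unfolding X_def Y_def by (metis times_divide_eq_left)+
      then have "- p * x\<^sup>2 + - q * z\<^sup>2 + X + Y = - r * (x\<^sup>2 + z\<^sup>2)"
        by (simp add: algebra_simps)
      then show ?thesis by (simp flip: exp_add)
    qed
    moreover have "X * Y = (r * x * z)\<^sup>2" by (simp add: X_def Y_def r_def power2_eq_square)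
    ultimately have "K * (exp Y * (\<Sum>j. (X * Y) ^ j * hcoef lam j)) = 2 * r powr ?mu * (x * z) powr lam * exp (- r * (x\<^sup>2 + z\<^sup>2)) * (\<Sum>j. ((r * x * z)\<^sup>2) ^ j * hcoef lam j)"
    proof -
      assume 1: "p powr ?mu * q powr ?mu * (p + q) powr (- ?mu) = r powr ?mu"
        and 2: "exp (- p * x\<^sup>2) * exp (- q * z\<^sup>2) * exp X * exp Y = exp (- r * (x\<^sup>2 + z\<^sup>2))"
        and 3: "X * Y = (r * x * z)\<^sup>2"
      show ?thesis unfolding 2[symmetric] 3 K_def 1 by (simp only: mult_ac)
    qed
    then show ?thesis
      using heat_kernel_series[OF lam _ \<open>x > 0\<close> \<open>z > 0\<close> r] assms by simp
  qed
  finally show ?thesis .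
qed

subsection \<open>Subordination and the Poisson semigroup\<close>

text \<open>The density in \<open>s\<close> of the one-sided stable law of index 1/2 at time
  \<open>t\<close>; the Poisson kernel is the heat kernel integrated against it.\<close>

definition subord :: "real \<Rightarrow> real \<Rightarrow> real" where
  "subord t s = t / (2 * sqrt pi) * (exp (- t\<^sup>2 / (4 * s)) / s powr (3 / 2))"

lemma subord_nonneg: "t \<ge> 0 \<Longrightarrow> subord t s \<ge> 0" by (simp add: subord_def)

lemma subord_measurable [measurable (raw)]:
  assumes [measurable]: "f \<in> borel_measurable M" "g \<in> borel_measurable M"
  shows "(\<lambda>x. subord (f x) (g x)) \<in> borel_measurable M"
  unfolding subord_def by measurable

lemma pker_subordination:
  assumes "lam > 0" "t > 0" "x > 0" "y > 0"
  shows "ennreal (pker lam t x y) = (\<integral>\<^sub>0s. ennreal (subord t s * heat_kernel lam s x y))"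
  unfolding poisson_integrand_nn_integral[OF assms, symmetric] subord_def by (simp only: mult.assoc)

lemma nn_integral_subord:
  assumes "t > 0" shows "(\<integral>\<^sub>0s. ennreal (subord t s)) = 1"
proof -
  have "(\<integral>\<^sub>0s. ennreal (subord t s))
    = (\<integral>\<^sub>+s. ennreal (t / (2 * sqrt pi)) * (ennreal (s powr (- (- 1 / 2) - 2) * exp (- t\<^sup>2 / (4 * s))) * pos s))"
  proof (intro nn_integral_cong)
    fix s :: real
    have "s powr (- (- 1 / 2) - 2) = 1 / s powr (3 / 2)" by (simp add: powr_minus_divide)
    then show "ennreal (subord t s) * pos s =
      ennreal (t / (2 * sqrt pi)) * (ennreal (s powr (- (- 1 / 2) - 2) * exp (- t\<^sup>2 / (4 * s))) * pos s)"
      using assms by (auto simp: subord_def ennreal_mult'[symmetric] split: split_indicator)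
  qed
  also have "\<dots> = ennreal (t / (2 * sqrt pi)) * ennreal (Gamma (- 1 / 2 + 1) * (t\<^sup>2 / 4) powr (- (- 1 / 2) - 1))"
    using assms by (subst nn_integral_cmult, measurable, subst nn_integral_inverse_power_exp) auto
  also have "\<dots> = ennreal (t / (2 * sqrt pi) * (Gamma (- 1 / 2 + 1) * (t\<^sup>2 / 4) powr (- (- 1 / 2) - 1)))"
    using assms by (intro ennreal_mult'[symmetric]) auto
  also have "t / (2 * sqrt pi) * (Gamma (- 1 / 2 + 1) * (t\<^sup>2 / 4) powr (- (- 1 / 2) - 1)) = 1"
  proof -
    have "(t\<^sup>2 / 4) powr (- (- 1 / 2) - 1) = ((t / 2)\<^sup>2) powr (- (1 / 2))" by (simp add: power_divide)
    also have "\<dots> = 2 / t" using assms by (subst square_powr) (auto simp: powr_minus_divide)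
    finally show ?thesis using assms Gamma_one_half_real by simp
  qed
  finally show ?thesis by simp
qed

text \<open>Inherited from the heat kernel by Tonelli, since the subordinator has mass one. From
  here on \<open>y powr lam\<close> takes the place that constants have for the classical Poisson
  semigroup.\<close>

lemma pker_powr_invariant:
  assumes "lam > 0" "t > 0" "x > 0"
  shows "(\<integral>\<^sub>0y. ennreal (pker lam t x y * y powr lam)) = ennreal (x powr lam)"
proof -
  let ?h = "\<lambda>s y. ennreal (heat_kernel lam s x y * y powr lam) * pos y"
  have "(\<integral>\<^sub>0y. ennreal (pker lam t x y * y powr lam))
     = (\<integral>\<^sub>+y. (\<integral>\<^sub>+s. ennreal (subord t s) * (pos s * (?h s y))))"
  proof (intro nn_integral_cong)
    fix y :: real
    show "ennreal (pker lam t x y * y powr lam) * pos y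
      = (\<integral>\<^sub>+s. ennreal (subord t s) * (pos s * (?h s y)))"
    proof (cases "y > 0")
      case True
      have "ennreal (pker lam t x y * y powr lam) = (\<integral>\<^sub>0s. ennreal (subord t s * heat_kernel lam s x y)) * ennreal (y powr lam)"
        using pker_nonneg[of lam t x y] assms by (subst ennreal_mult) (auto simp: pker_subordination[OF assms True])
      also have "\<dots> = (\<integral>\<^sub>+s. ennreal (subord t s * heat_kernel lam s x y) * pos s * ennreal (y powr lam))"
        by (rule nn_integral_multc[symmetric]) measurable
      also have "\<dots> = (\<integral>\<^sub>+s. ennreal (subord t s) * (pos s * (?h s y)))"
        using True assms subord_nonneg[of t]
        by (intro nn_integral_cong) (auto simp: ennreal_mult' heat_kernel_nonneg mult_ac ennreal_mult'' split: split_indicator)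
      finally show ?thesis using True by simp
    qed simp
  qed
  also have "\<dots> = (\<integral>\<^sub>+s. (\<integral>\<^sub>+y. ennreal (subord t s) * (pos s * (?h s y))))"
    by (rule lborel_pair.Fubini'[symmetric]) measurable
  also have "\<dots> = (\<integral>\<^sub>+s. ennreal (subord t s) * pos s * ennreal (x powr lam))"
  proof (intro nn_integral_cong)
    fix s :: real
    have "(\<integral>\<^sub>+y. ennreal (subord t s) * (pos s * (?h s y)))
      = ennreal (subord t s) * (pos s * (\<integral>\<^sub>+y. ennreal (heat_kernel lam s x y * y powr lam) * pos y))"
      by (subst nn_integral_cmult, measurable, subst nn_integral_cmult) auto
    then show "(\<integral>\<^sub>+y. ennreal (subord t s) * (pos s * (?h s y)))
      = ennreal (subord t s) * pos s * ennreal (x powr lam)"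
      using heat_kernel_powr_invariant[OF assms(1) _ assms(3), of s] by (auto split: split_indicator)
  qed
  also have "\<dots> = ennreal (x powr lam)"
    by (subst nn_integral_multc) (auto simp: nn_integral_subord[OF assms(2)])
  finally show ?thesis .
qed

section \<open>Gaussian integrals behind the convolution of subordinators\<close>

lemma nn_integral_gauss_full:
  assumes "c > 0" shows "(\<integral>\<^sub>+g. ennreal (exp (- c * g\<^sup>2))) = ennreal (sqrt (pi / c))"
proof -
  have h: "(\<integral>\<^sub>0y. ennreal (exp (- c * y\<^sup>2))) = ennreal (sqrt (pi / c) / 2)"
  proof -
    have "(\<integral>\<^sub>0y. ennreal (exp (- c * y\<^sup>2)))
      = (\<integral>\<^sub>0y. ennreal (y powr (2 * (1 / 2) - 1) * exp (- c * y\<^sup>2)))"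
      by (intro nn_integral_cong) (auto split: split_indicator)
    also have "\<dots> = ennreal (Gamma (1 / 2) * c powr (- (1 / 2)) / 2)"
      using assms by (intro nn_integral_power_gauss) auto
    also have "Gamma (1 / 2) * c powr (- (1 / 2)) / 2 = sqrt (pi / c) / 2"
      using assms Gamma_one_half_real by (simp add: powr_minus_divide powr_half_sqrt real_sqrt_divide)
    finally show ?thesis .
  qed
  have "(\<integral>\<^sub>+g. ennreal (exp (- c * g\<^sup>2)))
     = (\<integral>\<^sub>+g. ennreal (exp (- c * g\<^sup>2)) * pos g + ennreal (exp (- c * g\<^sup>2)) * indicator {..<0} g)"
    by (intro nn_integral_cong_AE) (use AE_lborel_singleton[of 0] in \<open>eventually_elim, auto split: split_indicator\<close>)
  also have "\<dots> = (\<integral>\<^sub>+g. ennreal (exp (- c * g\<^sup>2)) * pos g) + (\<integral>\<^sub>+g. ennreal (exp (- c * g\<^sup>2)) * indicator {..<0} g)"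
    by (rule nn_integral_add) auto
  also have "(\<integral>\<^sub>+g. ennreal (exp (- c * g\<^sup>2)) * indicator {..<0} g) = (\<integral>\<^sub>+g. ennreal (exp (- c * g\<^sup>2)) * pos g)"
    by (subst nn_integral_reflect[symmetric]) (auto intro!: nn_integral_cong split: split_indicator)
  finally show ?thesis unfolding h using assms by (simp add: ennreal_plus[symmetric] del: ennreal_plus)
qed

text \<open>The increasing bijection \<open>s * q - t / q\<close> from the half line onto the real
  line has derivative \<open>s + t / q\<^sup>2\<close>, so the full Gaussian integral is
  \<open>s\<close> times the first integral plus \<open>t\<close> times the second. Replacing
  \<open>q\<close> by \<open>t / (s * q)\<close> only changes the sign of
  \<open>s * q - t / q\<close>, which shows that both shares are equal.\<close>

lemma nn_integral_two_sided_gauss: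
  assumes "c > 0" "t > 0" "s > 0"
  defines "F \<equiv> \<lambda>q::real. exp (- c * (s * q - t / q)\<^sup>2)"
  shows "(\<integral>\<^sub>0q. ennreal (F q)) = ennreal (sqrt (pi / c) / (2 * s))"
    and "(\<integral>\<^sub>0q. ennreal (F q / q\<^sup>2)) = ennreal (sqrt (pi / c) / (2 * t))"
proof -
  let ?A = "\<integral>\<^sup>+q\<in>{0<..}. ennreal (F q) \<partial>lborel"
  let ?B = "\<integral>\<^sup>+q\<in>{0<..}. ennreal (F q / q\<^sup>2) \<partial>lborel"
  have [measurable]: "F \<in> borel_measurable borel" unfolding F_def by measurable
  have Fpos: "F q > 0" for q by (simp add: F_def)
  have BA: "?B = ennreal (s / t) * ?A"
  proof -
    have "?B = (\<integral>\<^sub>0q. ennreal (F (1 / (1 / q))) * ennreal (1 / q\<^sup>2))"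
      by (intro nn_integral_cong) (auto simp: ennreal_mult''[symmetric] split: split_indicator)
    also have "\<dots> = (\<integral>\<^sub>0q. ennreal (F (1 / q)))"
      by (rule nn_integral_inverse_Ioi[symmetric]) measurable
    also have "\<dots> = (\<integral>\<^sub>0q. ennreal (F (1 / (s / t * q))) * ennreal (s / t))"
    proof (rule nn_integral_substitution_Ioi)
      show "((\<lambda>q. s / t * q) has_real_derivative s / t) (at x)" for x by (rule DERIV_cmult_Id)
      show "(*) (s / t) ` {0<..} = {0<..}"
      proof (intro equalityI subsetI)
        fix x :: real assume "x \<in> {0<..}"
        then show "x \<in> (*) (s / t) ` {0<..}" by (intro image_eqI[of _ _ "x * t / s"]) (use assms(2,3) in auto)
      qed (use assms in auto)
    qed (use assms in auto)
    also have "\<dots> = (\<integral>\<^sub>+q. ennreal (s / t) * (ennreal (F q) * pos q))"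
    proof (intro nn_integral_cong)
      fix q :: real
      have "F (1 / (s / t * q)) = F q" if "q > 0"
      proof -
        have "s * (1 / (s / t * q)) - t / (1 / (s / t * q)) = - (s * q - t / q)" using assms that by (simp add: field_simps)
        then show ?thesis unfolding F_def by (simp only: power2_minus)
      qed
      then show "ennreal (F (1 / (s / t * q))) * ennreal (s / t) * pos q = ennreal (s / t) * (ennreal (F q) * pos q)"
        by (auto simp: mult_ac split: split_indicator)
    qed
    finally show ?thesis by (simp add: nn_integral_cmult)
  qed
  have "ennreal (sqrt (pi / c)) = (\<integral>\<^sup>+g\<in>UNIV. ennreal (exp (- c * g\<^sup>2)) \<partial>lborel)"
    using nn_integral_gauss_full[OF assms(1)] by simp
  also have "\<dots> = (\<integral>\<^sub>0q. ennreal (exp (- c * (s * q - t / q)\<^sup>2)) * ennreal (s + t / q\<^sup>2))"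
  proof (rule nn_integral_substitution_Ioi)
    show "((\<lambda>q. s * q - t / q) has_real_derivative s + t / x\<^sup>2) (at x)" if "x > 0" for x
      using that by (auto intro!: derivative_eq_intros simp: power2_eq_square)
    show "continuous_on {0<..} (\<lambda>x. s + t / x\<^sup>2)" by (intro continuous_intros) auto
    show "(\<lambda>q. s * q - t / q) ` {0<..} = UNIV"
    proof (intro equalityI subsetI)
      fix g :: real
      \<comment> \<open>The preimage of \<open>g\<close> is \<open>(g + d) / (2 * s)\<close>, the
        positive root of \<open>s * q\<^sup>2 - g * q - t = 0\<close>.\<close>
      define d where "d = sqrt (g\<^sup>2 + 4 * s * t)"
      have d2: "d\<^sup>2 = g\<^sup>2 + 4 * s * t" using assms by (simp add: d_def)
      have "\<bar>g\<bar> < d" unfolding d_def using assms by (intro real_less_rsqrt) auto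
      then have gd: "g + d > 0" by linarith
      have "s * ((g + d) / (2 * s)) - t / ((g + d) / (2 * s)) = g"
      proof -
        have "2 * s * t * 2 = (d - g) * (d + g)" using d2 by (simp add: power2_eq_square algebra_simps)
        then have 1: "t / ((g + d) / (2 * s)) = (d - g) / 2" using gd assms(2,3) by (simp add: field_simps)
        have 2: "s * ((g + d) / (2 * s)) = (g + d) / 2" using assms(3) by simp
        show ?thesis unfolding 1 2 by (simp add: field_simps)
      qed
      then show "g \<in> (\<lambda>q. s * q - t / q) ` {0<..}" using gd assms by (intro image_eqI[of _ _ "(g + d) / (2 * s)"]) auto
    qed auto
  qed (use assms in \<open>auto intro: add_nonneg_nonneg\<close>)
  also have "\<dots> = (\<integral>\<^sub>+q. ennreal s * (ennreal (F q) * pos q) + ennreal t * (ennreal (F q / q\<^sup>2) * pos q))"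
    using assms Fpos by (intro nn_integral_cong)
      (auto simp: F_def[symmetric] ennreal_mult'[symmetric] ennreal_mult''[symmetric] ennreal_plus[symmetric] less_imp_le distrib_left distrib_right mult_ac
        simp del: ennreal_plus split: split_indicator)
  also have "\<dots> = ennreal s * ?A + ennreal t * ?B"
    by (subst nn_integral_add) (auto simp: nn_integral_cmult)
  also have "ennreal t * ?B = ennreal s * ?A"
    unfolding BA using assms by (simp add: mult.assoc[symmetric] ennreal_mult'[symmetric])
  also have "ennreal s * ?A + ennreal s * ?A = ennreal (2 * s) * ?A"
    using assms by (simp add: distrib_right[symmetric] ennreal_plus[symmetric] del: ennreal_plus)
  finally have "ennreal (2 * s) * ?A = ennreal (sqrt (pi / c))" by simp
  from ennreal_mult_eqD[OF _ this] show A: "?A = ennreal (sqrt (pi / c) / (2 * s))" using assms by simp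
  show "?B = ennreal (sqrt (pi / c) / (2 * t))"
    unfolding BA A using assms by (simp add: ennreal_mult'[symmetric])
qed

lemma nn_integral_substitution_Ioo:
  fixes f :: "real \<Rightarrow> ennreal"
  assumes [measurable]: "f \<in> borel_measurable borel" and S: "S > 0"
  shows "(\<integral>\<^sup>+a\<in>{0<..<S}. f a \<partial>lborel) = (\<integral>\<^sub>0q. f (S * q\<^sup>2 / (1 + q\<^sup>2)) * ennreal (2 * S * q / (1 + q\<^sup>2)\<^sup>2))"
proof (rule nn_integral_substitution_Ioi)
  have p: "1 + q\<^sup>2 > 0" for q :: real by (simp add: add_pos_nonneg)
  show "((\<lambda>q. S * q\<^sup>2 / (1 + q\<^sup>2)) has_real_derivative 2 * S * x / (1 + x\<^sup>2)\<^sup>2) (at x)" for x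
    using p[of x] by (auto intro!: derivative_eq_intros simp: power2_eq_square field_simps)
  show "continuous_on {0<..} (\<lambda>x. 2 * S * x / (1 + x\<^sup>2)\<^sup>2)"
    using p by (intro continuous_intros) (auto simp: less_imp_neq[symmetric])
  show "(\<lambda>q. S * q\<^sup>2 / (1 + q\<^sup>2)) ` {0<..} = {0<..<S}"
  proof (intro equalityI subsetI)
    fix a assume "a \<in> {0<..<S}"
    then have a: "0 < a" "a < S" by auto
    have "S * (sqrt (a / (S - a)))\<^sup>2 / (1 + (sqrt (a / (S - a)))\<^sup>2) = a" using a S by (simp add: field_simps)
    then show "a \<in> (\<lambda>q. S * q\<^sup>2 / (1 + q\<^sup>2)) ` {0<..}" using a by (intro image_eqI[of _ _ "sqrt (a / (S - a))"]) auto
  next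
    fix a assume "a \<in> (\<lambda>q. S * q\<^sup>2 / (1 + q\<^sup>2)) ` {0<..}"
    then obtain q where q: "q > 0" "a = S * q\<^sup>2 / (1 + q\<^sup>2)" by auto
    have "a > 0" unfolding q(2) using q(1) S p[of q] by simp
    moreover have "a < S" unfolding q(2) using S p[of q] by (simp add: pos_divide_less_eq algebra_simps)
    ultimately show "a \<in> {0<..<S}" by simp
  qed
qed (use assms in auto)

text \<open>With \<open>a = S * q\<^sup>2 / (1 + q\<^sup>2)\<close> the exponents split as
  \<open>t\<^sup>2 / a + s\<^sup>2 / (S - a) = ((t + s)\<^sup>2 + (s * q - t / q)\<^sup>2) /
  S\<close>. The factor for \<open>t + s\<close> separates, and the two-sided Gaussian integrals
  remain.\<close>

lemma subord_convolution:
  assumes "t > 0" "s > 0" "S > 0"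
  shows "(\<integral>\<^sup>+a\<in>{0<..<S}. ennreal (subord t a * subord s (S - a)) \<partial>lborel) = ennreal (subord (t + s) S)"
proof -
  define c where "c = 1 / (4 * S)"
  have c: "c > 0" using assms by (simp add: c_def)
  define F where "F q = exp (- c * (s * q - t / q)\<^sup>2)" for q
  have F: "F q > 0" for q by (simp add: F_def)
  have [measurable]: "F \<in> borel_measurable borel" unfolding F_def by measurable
  define K where "K = t * s / (2 * pi * S\<^sup>2) * exp (- (t + s)\<^sup>2 / (4 * S))"
  have K: "K \<ge> 0" using assms by (simp add: K_def)
  have "(\<integral>\<^sup>+a\<in>{0<..<S}. ennreal (subord t a * subord s (S - a)) \<partial>lborel)
    = (\<integral>\<^sub>0q. ennreal (subord t (S * q\<^sup>2 / (1 + q\<^sup>2)) * subord s (S - S * q\<^sup>2 / (1 + q\<^sup>2))) * ennreal (2 * S * q / (1 + q\<^sup>2)\<^sup>2))"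
    by (rule nn_integral_substitution_Ioo) (use assms in auto)
  also have "\<dots> = (\<integral>\<^sub>+q. ennreal K * (ennreal (F q) * pos q + ennreal (F q / q\<^sup>2) * pos q))"
  proof (intro nn_integral_cong)
    fix q :: real
    have "subord t (S * q\<^sup>2 / (1 + q\<^sup>2)) * subord s (S - S * q\<^sup>2 / (1 + q\<^sup>2)) * (2 * S * q / (1 + q\<^sup>2)\<^sup>2) = K * (F q + F q / q\<^sup>2)" if q: "q > 0"
    proof -
      define d where "d = 1 + q\<^sup>2"
      have d: "d > 0" by (simp add: d_def add_pos_nonneg)
      have Sa: "S - S * q\<^sup>2 / d = S / d" using d by (simp add: d_def field_simps)
      have e: "exp (- t\<^sup>2 / (4 * (S * q\<^sup>2 / d))) * exp (- s\<^sup>2 / (4 * (S / d))) = exp (- (t + s)\<^sup>2 / (4 * S)) * F q"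
      proof -
        have "- t\<^sup>2 / (4 * (S * q\<^sup>2 / d)) + - s\<^sup>2 / (4 * (S / d)) = - (t + s)\<^sup>2 / (4 * S) + - c * (s * q - t / q)\<^sup>2"
          using assms q d unfolding c_def by (simp add: field_simps) (simp add: d_def algebra_simps power2_eq_square)
        then show ?thesis unfolding F_def by (simp only: exp_add[symmetric])
      qed
      have p: "(S * q\<^sup>2 / d) powr (3 / 2) * (S / d) powr (3 / 2) = (S * q / d) ^ 3"
      proof -
        have "(S * q\<^sup>2 / d) powr (3 / 2) * (S / d) powr (3 / 2) = ((S * q / d)\<^sup>2) powr (3 / 2)"
          by (subst powr_mult[symmetric]) (simp add: power2_eq_square field_simps)
        also have "\<dots> = (S * q / d) powr 3" using assms q d by (subst square_powr) auto
        also have "\<dots> = (S * q / d) ^ 3" using assms q d by (simp add: powr_numeral)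
        finally show ?thesis .
      qed
      have "subord t (S * q\<^sup>2 / d) * subord s (S / d) * (2 * S * q / d\<^sup>2)
        = t * s / (4 * (sqrt pi * sqrt pi)) * (exp (- t\<^sup>2 / (4 * (S * q\<^sup>2 / d))) * exp (- s\<^sup>2 / (4 * (S / d))))
          / ((S * q\<^sup>2 / d) powr (3 / 2) * (S / d) powr (3 / 2)) * (2 * S * q / d\<^sup>2)"
        unfolding subord_def by simp
      also have "\<dots> = t * s / (4 * pi) * (exp (- (t + s)\<^sup>2 / (4 * S)) * F q) / (S * q / d) ^ 3 * (2 * S * q / d\<^sup>2)"
        unfolding e p by simp
      also have "\<dots> = K * (F q * (d / q\<^sup>2))"
        using assms q d unfolding K_def by (simp add: power2_eq_square power3_eq_cube field_simps)
      also have "F q * (d / q\<^sup>2) = F q + F q / q\<^sup>2" using q by (simp add: d_def field_simps)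
      finally show ?thesis unfolding d_def[symmetric] Sa .
    qed
    then show "ennreal (subord t (S * q\<^sup>2 / (1 + q\<^sup>2)) * subord s (S - S * q\<^sup>2 / (1 + q\<^sup>2))) * ennreal (2 * S * q / (1 + q\<^sup>2)\<^sup>2) * pos q
      = ennreal K * (ennreal (F q) * pos q + ennreal (F q / q\<^sup>2) * pos q)"
      using K F[of q] assms by (auto simp: ennreal_mult'[symmetric] ennreal_mult''[symmetric] ennreal_plus[symmetric] less_imp_le
        simp del: ennreal_plus split: split_indicator)
  qed
  also have "\<dots> = ennreal K * (ennreal (sqrt (pi / c) / (2 * s)) + ennreal (sqrt (pi / c) / (2 * t)))"
    using nn_integral_two_sided_gauss[OF c assms(1,2)]
    by (subst nn_integral_cmult, measurable, subst nn_integral_add) (auto simp: F_def)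
  also have "\<dots> = ennreal (K * (sqrt (pi / c) / (2 * s) + sqrt (pi / c) / (2 * t)))"
    using K c assms by (simp add: ennreal_mult' ennreal_plus)
  also have "K * (sqrt (pi / c) / (2 * s) + sqrt (pi / c) / (2 * t)) = subord (t + s) S"
  proof -
    have "sqrt (pi / c) = 2 * sqrt pi * sqrt S" using assms by (simp add: c_def real_sqrt_mult)
    moreover have "S powr (3 / 2) = S * sqrt S"
    proof -
      have "S powr (3 / 2) = S powr (1 + 1 / 2)" by (rule powr_exp_cong) simp
      also have "\<dots> = S * sqrt S" using assms by (subst powr_add) (simp add: powr_half_sqrt)
      finally show ?thesis .
    qed
    moreover have "t * s / (2 * (b * b) * (a * a)\<^sup>2) * E * (2 * b * a / (2 * s) + 2 * b * a / (2 * t)) = (t + s) / (2 * b) * (E / (a * a * a))"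
      if "a > 0" "b > 0" for a b E :: real
      using that assms by (simp add: field_simps power2_eq_square)
    from this[of "sqrt S" "sqrt pi" "exp (- (t + s)\<^sup>2 / (4 * S))"]
    have "t * s / (2 * pi * S\<^sup>2) * exp (- (t + s)\<^sup>2 / (4 * S)) * (2 * sqrt pi * sqrt S / (2 * s) + 2 * sqrt pi * sqrt S / (2 * t))
      = (t + s) / (2 * sqrt pi) * (exp (- (t + s)\<^sup>2 / (4 * S)) / (S * sqrt S))"
      using assms by simp
    ultimately show ?thesis unfolding K_def subord_def by simp
  qed
  finally show ?thesis .
qed

lemma pker_commute: "pker lam t x y = pker lam t y x"
  by (simp add: pker_def qf_commute mult.commute)

lemma pker_measurable [measurable (raw)]:
  assumes "lam > 0" and [measurable]: "f \<in> borel_measurable M" "g \<in> borel_measurable M" "h \<in> borel_measurable M"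
  shows "(\<lambda>x. pker lam (f x) (g x) (h x)) \<in> borel_measurable M"
proof -
  interpret finite_measure "bmeas lam" by (rule finite_measure_bmeas[OF assms(1)])
  show ?thesis unfolding pker_def by measurable
qed

text \<open>Both factors are written by subordination. Tonelli brings the heat semigroup inside, and
  the shift \<open>S = a + b\<close> leaves the convolution of the two subordinators.\<close>

lemma pker_semigroup:
  assumes lam: "lam > 0" and ts: "t > 0" "s > 0" and xz: "x > 0" "z > 0"
  shows "(\<integral>\<^sub>0y. ennreal (pker lam t x y * pker lam s y z)) = ennreal (pker lam (t + s) x z)"
proof -
  let ?W = "heat_kernel lam"
  let ?K = "\<lambda>y a b. ennreal (subord t a * subord s b) * (ennreal (?W a x y * ?W b y z) * pos y) * (pos a * pos b)"
  let ?L = "\<lambda>S a. ennreal (subord t a * subord s (S - a) * ?W S x z) * (pos a * pos (S - a))"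
  have W0: "?W a u v \<ge> 0" if "a > 0" "u > 0" "v > 0" for a u v using heat_kernel_nonneg[OF lam that] .
  have "(\<integral>\<^sub>0y. ennreal (pker lam t x y * pker lam s y z))
    = (\<integral>\<^sub>+y. (\<integral>\<^sub>+a. (\<integral>\<^sub>+b. ?K y a b)))"
  proof (intro nn_integral_cong)
    fix y :: real
    show "ennreal (pker lam t x y * pker lam s y z) * pos y
      = (\<integral>\<^sub>+a. (\<integral>\<^sub>+b. ?K y a b))"
    proof (cases "y > 0")
      case y: True
      have "ennreal (pker lam t x y * pker lam s y z) = ennreal (pker lam t x y) * ennreal (pker lam s y z)"
        using pker_nonneg[OF lam ts(1)] by (rule ennreal_mult')
      also have "\<dots> = (\<integral>\<^sub>+a. ennreal (subord t a * ?W a x y) * pos a * (\<integral>\<^sub>+b. ennreal (subord s b * ?W b y z) * pos b))"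
        unfolding pker_subordination[OF lam ts(1) xz(1) y] pker_subordination[OF lam ts(2) y xz(2)]
        by (rule nn_integral_multc[symmetric]) measurable
      also have "\<dots> = (\<integral>\<^sub>+a. (\<integral>\<^sub>+b. ennreal (subord t a * ?W a x y) * pos a * (ennreal (subord s b * ?W b y z) * pos b)))"
        by (intro nn_integral_cong nn_integral_cmult[symmetric]) measurable
      also have "\<dots> = (\<integral>\<^sub>+a. (\<integral>\<^sub>+b. ?K y a b))"
        using y W0 subord_nonneg[of t] subord_nonneg[of s] ts xz
        by (intro nn_integral_cong) (auto simp: ennreal_mult'[symmetric] mult_ac split: split_indicator)
      finally show ?thesis using y by simp
    qed simp
  qed
  also have "\<dots> = (\<integral>\<^sub>+a. (\<integral>\<^sub>+y. (\<integral>\<^sub>+b. ?K y a b)))"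
    by (rule lborel_pair.Fubini'[symmetric]) measurable
  also have "\<dots> = (\<integral>\<^sub>+a. (\<integral>\<^sub>+b. (\<integral>\<^sub>+y. ?K y a b)))"
    by (intro nn_integral_cong lborel_pair.Fubini'[symmetric]) measurable
  also have "\<dots> = (\<integral>\<^sub>+a. (\<integral>\<^sub>+b. ennreal (subord t a * subord s b * ?W (a + b) x z) * (pos a * pos b)))"
  proof (intro nn_integral_cong)
    fix a b :: real
    have "(\<integral>\<^sub>+y. ?K y a b)
      = ennreal (subord t a * subord s b) * (\<integral>\<^sub>+y. (ennreal (?W a x y * ?W b y z) * pos y)) * (pos a * pos b)"
      by (subst nn_integral_multc, measurable, subst nn_integral_cmult) auto
    then show "(\<integral>\<^sub>+y. ?K y a b)
       = ennreal (subord t a * subord s b * ?W (a + b) x z) * (pos a * pos b)"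
      using heat_kernel_semigroup[OF lam _ _ xz, of a b] subord_nonneg[of t a] subord_nonneg[of s b] ts
      by (auto simp: ennreal_mult' split: split_indicator)
  qed
  also have "\<dots> = (\<integral>\<^sub>+a. (\<integral>\<^sup>+S. ?L S a \<partial>lborel))"
  proof (rule nn_integral_cong)
    fix a :: real
    show "(\<integral>\<^sub>+b. ennreal (subord t a * subord s b * ?W (a + b) x z) * (pos a * pos b))
      = (\<integral>\<^sup>+S. ?L S a \<partial>lborel)"
      using nn_integral_real_affine[of "\<lambda>S. ?L S a" 1 a]
      by simp
  qed
  also have "\<dots> = (\<integral>\<^sup>+S. (\<integral>\<^sub>+a. ?L S a) \<partial>lborel)"
    by (rule lborel_pair.Fubini'[symmetric]) measurable
  also have "\<dots> = (\<integral>\<^sup>+S\<in>{0<..}. ennreal (subord (t + s) S * ?W S x z) \<partial>lborel)"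
  proof (intro nn_integral_cong)
    fix S :: real
    show "(\<integral>\<^sub>+a. ?L S a)
      = ennreal (subord (t + s) S * ?W S x z) * pos S"
    proof (cases "S > 0")
      case True
      have "(\<integral>\<^sub>+a. ?L S a)
        = (\<integral>\<^sub>+a. ennreal (subord t a * subord s (S - a)) * indicator {0<..<S} a * ennreal (?W S x z))"
        using W0[OF True xz] by (intro nn_integral_cong) (auto simp: ennreal_mult'' split: split_indicator)
      also have "\<dots> = ennreal (subord (t + s) S) * ennreal (?W S x z)"
        by (subst nn_integral_multc, measurable) (simp add: subord_convolution[OF ts True])
      finally show ?thesis using W0[OF True xz] True by (simp add: ennreal_mult'')
    next
      case False
      then have "?L S a = 0" for a :: real
        by (auto split: split_indicator)
      then have "(\<integral>\<^sub>+a. ?L S a) = 0"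
        by (simp only: nn_integral_const) simp
      then show ?thesis using False by simp
    qed
  qed
  also have "\<dots> = ennreal (pker lam (t + s) x z)"
    using pker_subordination[OF lam _ xz, of "t + s"] ts by simp
  finally show ?thesis .
qed

subsection \<open>Harnack and size estimates\<close>

text \<open>\<open>qf x y u + t\<^sup>2\<close> is the squared length \<open>R\<^sup>2\<close> of
  the vector \<open>(x - y * u, y * sqrt (1 - u\<^sup>2), t)\<close>. Moving \<open>x\<close> by
  \<open>d\<close> lengthens it by at most \<open>d\<close>, and \<open>d \<le> d / t * R\<close>
  because \<open>t \<le> R\<close>.\<close>

lemma qf_compare:
  assumes "u \<le> 1" "-1 \<le> u" "t > 0"
  shows "qf x' y u + t\<^sup>2 \<le> (1 + \<bar>x' - x\<bar> / t)\<^sup>2 * (qf x y u + t\<^sup>2)"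
proof -
  define d where "d = \<bar>x' - x\<bar>"
  have u2: "u\<^sup>2 \<le> 1" using assms by (simp add: abs_square_le_1 abs_le_iff)
  have q: "qf x y u = (x - y * u)\<^sup>2 + y\<^sup>2 * (1 - u\<^sup>2)" by (simp add: qf_def power2_eq_square algebra_simps)
  have q1: "(x - y * u)\<^sup>2 \<le> qf x y u" unfolding q using u2 by simp
  define R where "R = sqrt (qf x y u + t\<^sup>2)"
  have pos: "qf x y u + t\<^sup>2 > 0" using q1 assms(3) zero_le_power2[of "x - y * u"] by (intro add_nonneg_pos) (linarith, simp)
  have R2: "R\<^sup>2 = qf x y u + t\<^sup>2" and R0: "R > 0" using pos by (auto simp: R_def)
  have Rt: "t \<le> R" unfolding R_def using q1 zero_le_power2[of "x - y * u"] by (intro real_le_rsqrt) linarith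
  have "\<bar>x - y * u\<bar> \<le> R" unfolding R_def using q1 zero_le_power2[of t] by (intro real_le_rsqrt) (subst power2_abs, linarith)
  then have "d * \<bar>x - y * u\<bar> \<le> d * R" by (intro mult_left_mono) (auto simp: d_def)
  moreover have "(x' - x) * (x - y * u) \<le> d * \<bar>x - y * u\<bar>" unfolding d_def abs_mult[symmetric] by (rule abs_ge_self)
  moreover have "qf x' y u + t\<^sup>2 = R\<^sup>2 + 2 * ((x' - x) * (x - y * u)) + d\<^sup>2"
    unfolding R2 d_def by (simp add: qf_def power2_eq_square algebra_simps)
  ultimately have "qf x' y u + t\<^sup>2 \<le> R\<^sup>2 + 2 * (d * R) + d\<^sup>2" by linarith
  also have "\<dots> = (R + d)\<^sup>2" by (simp add: power2_eq_square algebra_simps)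
  also have "\<dots> \<le> (R + d / t * R)\<^sup>2"
  proof (intro power_mono add_left_mono)
    have "d / t * t \<le> d / t * R" using Rt assms by (intro mult_left_mono) (auto simp: d_def)
    then show "d \<le> d / t * R" using assms by simp
  qed (use R0 in \<open>auto simp: d_def\<close>)
  also have "\<dots> = (1 + d / t)\<^sup>2 * R\<^sup>2" by (simp add: power2_eq_square algebra_simps)
  finally show ?thesis unfolding R2 d_def .
qed

text \<open>The factor \<open>(x * y) powr lam\<close> contributes the ratio of the radii, and
  \<open>qf_compare\<close> under the exponent \<open>- lam - 1\<close> contributes the power
  \<open>2 * lam + 2\<close>.\<close>

lemma pker_harnack:
  assumes lam: "lam > 0" and "t > 0" "x > 0" "x' > 0" "y > 0"
  shows "pker lam t x y \<le> (x / x') powr lam * (1 + \<bar>x' - x\<bar> / t) powr (2 * lam + 2) * pker lam t x' y"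
proof -
  let ?H = "(1 + \<bar>x' - x\<bar> / t) powr (2 * lam + 2)"
  have b: "1 + \<bar>x' - x\<bar> / t > 0" using assms by (simp add: add_pos_nonneg)
  have "(\<integral>u. kap lam 0 (qf x y u) t \<partial>bmeas lam) \<le> (\<integral>u. ?H * kap lam 0 (qf x' y u) t \<partial>bmeas lam)"
  proof (intro integral_mono_AE integrable_mult_right integrable_kap_bmeas assms)
    show "AE u in bmeas lam. kap lam 0 (qf x y u) t \<le> ?H * kap lam 0 (qf x' y u) t"
      using AE_bmeas
    proof eventually_elim
      case (elim u)
      have p: "qf x y u + t\<^sup>2 > 0" "qf x' y u + t\<^sup>2 > 0"
        using qf_nonneg[of x y u] qf_nonneg[of x' y u] assms elim by (auto intro: add_nonneg_pos)
      have "((1 + \<bar>x' - x\<bar> / t)\<^sup>2 * (qf x y u + t\<^sup>2)) powr (- lam - 1) \<le> (qf x' y u + t\<^sup>2) powr (- lam - 1)"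
        using qf_compare[of u t x' y x] elim assms p by (intro powr_mono2') auto
      moreover have "((1 + \<bar>x' - x\<bar> / t)\<^sup>2) powr (- lam - 1) = 1 / ?H"
        using b by (simp only: square_powr powr_minus_divide[symmetric]) (rule powr_exp_cong, simp)
      ultimately have "(qf x y u + t\<^sup>2) powr (- lam - 1) / ?H \<le> (qf x' y u + t\<^sup>2) powr (- lam - 1)"
        unfolding powr_mult by simp
      moreover have "?H > 0" using b by simp
      ultimately have "(qf x y u + t\<^sup>2) powr (- lam - 1) \<le> ?H * (qf x' y u + t\<^sup>2) powr (- lam - 1)"
        by (simp add: divide_le_eq mult.commute)
      then have "t * (qf x y u + t\<^sup>2) powr (- lam - 1) \<le> t * (?H * (qf x' y u + t\<^sup>2) powr (- lam - 1))"
        using assms by (intro mult_left_mono) auto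
      then show ?case unfolding kap_0 by (simp only: mult_ac)
    qed
  qed
  then have "2 * lam / pi * (x * y) powr lam * (\<integral>u. kap lam 0 (qf x y u) t \<partial>bmeas lam) \<le> 2 * lam / pi * (x * y) powr lam * (\<integral>u. ?H * kap lam 0 (qf x' y u) t \<partial>bmeas lam)"
    using lam by (intro mult_left_mono) auto
  also have "(\<integral>u. ?H * kap lam 0 (qf x' y u) t \<partial>bmeas lam) = ?H * (\<integral>u. kap lam 0 (qf x' y u) t \<partial>bmeas lam)" by simp
  also have "(x * y) powr lam = (x / x') powr lam * (x' * y) powr lam"
    using assms by (subst powr_mult[symmetric]) simp
  also have "2 * lam / pi * ((x / x') powr lam * (x' * y) powr lam) * (?H * (\<integral>u. kap lam 0 (qf x' y u) t \<partial>bmeas lam))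
     = (x / x') powr lam * ?H * pker lam t x' y"
    unfolding pker_def by (simp only: mult_ac)
  finally show ?thesis unfolding pker_def using \<open>(x * y) powr lam = (x / x') powr lam * (x' * y) powr lam\<close> by simp
qed

text \<open>Lets a time that varies in \<open>[t / 2, t]\<close> be frozen at \<open>t\<close>, as
  the average over times in the Carleson argument requires.\<close>

lemma pker_time_compare:
  assumes lam: "lam > 0" and "t / 2 \<le> s" "s \<le> t" "t > 0" "x > 0" "y > 0"
  shows "pker lam s x y \<le> 4 powr (lam + 1) * pker lam t x y"
proof -
  have s: "s > 0" using assms by linarith
  have "(\<integral>u. kap lam 0 (qf x y u) s \<partial>bmeas lam) \<le> (\<integral>u. 4 powr (lam + 1) * kap lam 0 (qf x y u) t \<partial>bmeas lam)"
  proof (intro integral_mono_AE integrable_mult_right integrable_kap_bmeas assms s)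
    show "AE u in bmeas lam. kap lam 0 (qf x y u) s \<le> 4 powr (lam + 1) * kap lam 0 (qf x y u) t"
      using AE_bmeas
    proof eventually_elim
      case (elim u)
      have q: "qf x y u \<ge> 0" using qf_nonneg[of x y u] assms elim by auto
      have "t\<^sup>2 \<le> (2 * s)\<^sup>2" using assms by (intro power_mono) auto
      then have "(qf x y u + t\<^sup>2) / 4 \<le> qf x y u + s\<^sup>2" using q by (simp add: power_mult_distrib)
      then have "(qf x y u + s\<^sup>2) powr (- lam - 1) \<le> ((qf x y u + t\<^sup>2) / 4) powr (- lam - 1)"
        using assms q s by (intro powr_mono2') (auto intro: add_nonneg_pos)
      also have "\<dots> = 4 powr (lam + 1) * (qf x y u + t\<^sup>2) powr (- lam - 1)"
      proof -
        have "((qf x y u + t\<^sup>2) / 4) powr (- lam - 1) = (qf x y u + t\<^sup>2) powr (- lam - 1) / 4 powr (- (lam + 1))"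
          by (simp add: powr_divide)
        then show ?thesis using powr_minus_divide[of 4 "lam + 1"] by simp
      qed
      finally have "s * (qf x y u + s\<^sup>2) powr (- lam - 1) \<le> t * (4 powr (lam + 1) * (qf x y u + t\<^sup>2) powr (- lam - 1))"
        using assms s by (intro mult_mono) auto
      then show ?case unfolding kap_0 by (simp only: mult_ac)
    qed
  qed
  then have "2 * lam / pi * (x * y) powr lam * (\<integral>u. kap lam 0 (qf x y u) s \<partial>bmeas lam) \<le> 2 * lam / pi * (x * y) powr lam * (\<integral>u. 4 powr (lam + 1) * kap lam 0 (qf x y u) t \<partial>bmeas lam)"
    using lam by (intro mult_left_mono) auto
  then show ?thesis unfolding pker_def by (simp add: mult_ac)
qed

definition bmass :: "real \<Rightarrow> real" where "bmass lam = 2 * lam / pi * measure (bmeas lam) UNIV"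

lemma bmass_nonneg: "lam > 0 \<Longrightarrow> bmass lam \<ge> 0" by (simp add: bmass_def)

lemma pker_le:
  assumes lam: "lam > 0" and "t > 0" "x > 0" "y > 0"
  shows "pker lam t x y \<le> bmass lam * t * (x * y) powr lam * ((x - y)\<^sup>2 + t\<^sup>2) powr (- lam - 1)"
proof -
  interpret finite_measure "bmeas lam" by (rule finite_measure_bmeas[OF lam])
  have "(\<integral>u. kap lam 0 (qf x y u) t \<partial>bmeas lam) \<le> (\<integral>u. t * ((x - y)\<^sup>2 + t\<^sup>2) powr (- lam - 1) \<partial>bmeas lam)"
  proof (intro integral_mono_AE integrable_kap_bmeas assms)
    show "AE u in bmeas lam. kap lam 0 (qf x y u) t \<le> t * ((x - y)\<^sup>2 + t\<^sup>2) powr (- lam - 1)"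
      using AE_bmeas by eventually_elim (use assms in \<open>auto intro!: kap_0_le qf_ge\<close>)
  qed simp
  then have "2 * lam / pi * (x * y) powr lam * (\<integral>u. kap lam 0 (qf x y u) t \<partial>bmeas lam) \<le> 2 * lam / pi * (x * y) powr lam * (measure (bmeas lam) UNIV * (t * ((x - y)\<^sup>2 + t\<^sup>2) powr (- lam - 1)))"
    using lam by (intro mult_left_mono) auto
  then show ?thesis unfolding pker_def bmass_def by (simp add: mult_ac)
qed

text \<open>For \<open>y \<ge> t\<close> the factor \<open>(y / t) powr lam \<ge> 1\<close> may be
  inserted, and the invariance of \<open>y powr lam\<close> evaluates the integral; the interval
  \<open>(0, t)\<close> is short enough for the pointwise bound. The decay
  \<open>(x / t) powr lam\<close> is later set against \<open>\<alpha> < lam\<close>.\<close>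

lemma nn_integral_pker_small:
  assumes lam: "lam > 0" and "t > 0" "x > 0"
  shows "(\<integral>\<^sub>0y. ennreal (pker lam t x y)) \<le> ennreal ((1 + bmass lam) * (x / t) powr lam)"
proof -
  have "(\<integral>\<^sub>0y. ennreal (pker lam t x y))
    \<le> (\<integral>\<^sub>+y. ennreal (t powr (- lam)) * (ennreal (pker lam t x y * y powr lam) * pos y)
         + ennreal (bmass lam * x powr lam * t powr (- lam - 1)) * indicator {0<..<t} y)"
  proof (intro nn_integral_mono)
    fix y :: real
    consider "y \<le> 0" | "0 < y" "y < t" | "y > 0" "y \<ge> t" by linarith
    then show "ennreal (pker lam t x y) * pos y \<le>
      ennreal (t powr (- lam)) * (ennreal (pker lam t x y * y powr lam) * pos y)
         + ennreal (bmass lam * x powr lam * t powr (- lam - 1)) * indicator {0<..<t} y"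
    proof cases
      case 2
      have "pker lam t x y \<le> bmass lam * t * (x * y) powr lam * ((x - y)\<^sup>2 + t\<^sup>2) powr (- lam - 1)"
        using assms 2 by (intro pker_le) auto
      also have "\<dots> \<le> bmass lam * t * (x * t) powr lam * (t\<^sup>2) powr (- lam - 1)"
        using assms 2 bmass_nonneg[OF lam] by (intro mult_mono mult_nonneg_nonneg powr_mono2 powr_mono2') auto
      also have "\<dots> = bmass lam * x powr lam * (t powr 1 * t powr lam * t powr (2 * (- lam - 1)))"
        using assms by (subst square_powr) (auto simp: powr_mult)
      also have "t powr 1 * t powr lam * t powr (2 * (- lam - 1)) = t powr (- lam - 1)"
        by (subst powr_add[symmetric])+ (rule powr_exp_cong, simp)
      finally have "ennreal (pker lam t x y) \<le> ennreal (bmass lam * x powr lam * t powr (- lam - 1))" by (rule ennreal_leI)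
      also have "\<dots> \<le> ennreal (t powr (- lam)) * ennreal (pker lam t x y * y powr lam) + \<dots>"
        by simp
      finally show ?thesis using 2 by simp
    next
      case 3
      have "1 \<le> t powr (- lam) * y powr lam"
      proof -
        have "t powr lam \<le> y powr lam" using 3 assms by (intro powr_mono2) auto
        then have "t powr (- lam) * t powr lam \<le> t powr (- lam) * y powr lam" by (intro mult_left_mono) auto
        then show ?thesis using assms by (simp add: powr_add[symmetric])
      qed
      then have "pker lam t x y * 1 \<le> pker lam t x y * (t powr (- lam) * y powr lam)"
        using pker_nonneg[OF lam \<open>t > 0\<close>] by (intro mult_left_mono) auto
      then have "ennreal (pker lam t x y) \<le> ennreal (t powr (- lam) * (pker lam t x y * y powr lam))"
        by (intro ennreal_leI) (simp add: mult_ac)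
      then show ?thesis using 3 by (simp add: ennreal_mult')
    qed simp
  qed
  also have "\<dots> = (\<integral>\<^sub>+y. ennreal (t powr (- lam)) * (ennreal (pker lam t x y * y powr lam) * pos y))
         + (\<integral>\<^sub>+y. ennreal (bmass lam * x powr lam * t powr (- lam - 1)) * indicator {0<..<t} y)"
    using lam by (intro nn_integral_add) measurable
  also have "(\<integral>\<^sub>+y. ennreal (t powr (- lam)) * (ennreal (pker lam t x y * y powr lam) * pos y)) = ennreal (t powr (- lam)) * ennreal (x powr lam)"
  proof -
    have [measurable]: "(\<lambda>y. pker lam t x y) \<in> borel_measurable borel" by (rule pker_measurable[OF lam]) auto
    show ?thesis by (subst nn_integral_cmult) (auto simp: pker_powr_invariant[OF assms])
  qed
  also have "(\<integral>\<^sub>+y. ennreal (bmass lam * x powr lam * t powr (- lam - 1)) * indicator {0<..<t} y)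
     = ennreal (bmass lam * x powr lam * t powr (- lam - 1)) * ennreal t"
    using assms by (subst nn_integral_cmult_indicator) auto
  also have "ennreal (t powr (- lam)) * ennreal (x powr lam) + ennreal (bmass lam * x powr lam * t powr (- lam - 1)) * ennreal t
     = ennreal (t powr (- lam) * x powr lam + bmass lam * x powr lam * t powr (- lam - 1) * t)"
    using assms bmass_nonneg[OF lam] by (simp add: ennreal_mult'' ennreal_plus)
  also have "t powr (- lam) * x powr lam + bmass lam * x powr lam * t powr (- lam - 1) * t = (1 + bmass lam) * (x / t) powr lam"
  proof -
    have "t powr (- lam - 1) * t = t powr (- lam)" using assms by (simp add: powr_diff)
    moreover have "(x / t) powr lam = x powr lam * t powr (- lam)" by (simp add: powr_divide powr_minus_divide)
    ultimately show ?thesis by (simp add: algebra_simps)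
  qed
  finally show ?thesis .
qed

text \<open>For \<open>x \<le> t\<close> this is contained in \<open>nn_integral_pker_small\<close>.
  For \<open>t < x\<close> the same argument is cut at \<open>x / 2\<close> instead of
  \<open>t\<close>, because below \<open>x / 2\<close> the distance to \<open>x\<close> is
  comparable with \<open>x\<close>.\<close>

lemma nn_integral_pker_le:
  assumes lam: "lam > 0"
  shows "\<exists>C\<ge>0. \<forall>t>0. \<forall>x>0. (\<integral>\<^sub>0y. ennreal (pker lam t x y)) \<le> ennreal C"
proof -
  define C where "C = 2 powr lam + bmass lam * 4 powr (lam + 1) + 1"
  have C0: "C \<ge> 0" using bmass_nonneg[OF lam] by (simp add: C_def)
  have "(\<integral>\<^sub>0y. ennreal (pker lam t x y)) \<le> ennreal C" if t: "t > 0" and x: "x > 0" for t x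
  proof (cases "x \<le> t")
    case True
    have "(x / t) powr lam \<le> 1 powr lam" using True t x lam by (intro powr_mono2) auto
    then have "(1 + bmass lam) * (x / t) powr lam \<le> (1 + bmass lam) * 1" using bmass_nonneg[OF lam] by (intro mult_left_mono) auto
    also have "\<dots> \<le> C"
    proof -
      have "1 \<le> 4 powr (lam + 1)" using lam by (intro ge_one_powr_ge_zero) auto
      then have "bmass lam * 1 \<le> bmass lam * 4 powr (lam + 1)" using bmass_nonneg[OF lam] by (intro mult_left_mono) auto
      then have "bmass lam + 0 \<le> bmass lam * 4 powr (lam + 1) + 2 powr lam" by (intro add_mono) auto
      then show ?thesis by (simp add: C_def add.commute)
    qed
    finally show ?thesis using nn_integral_pker_small[OF lam t x] by (meson ennreal_leI order_trans)
  next
    case False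
    then have tx: "t < x" by simp
    have "(\<integral>\<^sub>0y. ennreal (pker lam t x y))
      \<le> (\<integral>\<^sub>+y. ennreal ((2 / x) powr lam) * (ennreal (pker lam t x y * y powr lam) * pos y)
         + ennreal (bmass lam * 4 powr (lam + 1) / x) * indicator {0<..<x} y)"
    proof (intro nn_integral_mono)
      fix y :: real
      consider "y \<le> 0" | "0 < y" "y < x / 2" | "y > 0" "y \<ge> x / 2" by linarith
      then show "ennreal (pker lam t x y) * pos y \<le>
        ennreal ((2 / x) powr lam) * (ennreal (pker lam t x y * y powr lam) * pos y)
           + ennreal (bmass lam * 4 powr (lam + 1) / x) * indicator {0<..<x} y"
      proof cases
        case 2
        have xy: "(x / 2)\<^sup>2 \<le> (x - y)\<^sup>2 + t\<^sup>2"
        proof -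
          have "(x / 2)\<^sup>2 \<le> (x - y)\<^sup>2" using 2 x by (intro power_mono) auto
          then show ?thesis using zero_le_power2[of t] by linarith
        qed
        have "pker lam t x y \<le> bmass lam * t * (x * y) powr lam * ((x - y)\<^sup>2 + t\<^sup>2) powr (- lam - 1)"
          using lam t x 2 by (intro pker_le) auto
        also have "\<dots> \<le> bmass lam * x * (x * x) powr lam * ((x / 2)\<^sup>2) powr (- lam - 1)"
          using lam t x tx xy 2 bmass_nonneg[OF lam] by (intro mult_mono mult_nonneg_nonneg powr_mono2 powr_mono2') auto
        also have "\<dots> = bmass lam * 4 powr (lam + 1) / x"
        proof -
          have a: "((x / 2)\<^sup>2) powr (- lam - 1) = (x * x) powr (- lam - 1) * 4 powr (lam + 1)"
            using powr_minus_divide[of 4 "lam + 1"] by (simp add: power2_eq_square powr_divide)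
          have b: "x * ((x * x) powr lam * (x * x) powr (- lam - 1)) = 1 / x"
            using x by (simp add: powr_add[symmetric] powr_minus_divide)
          have "bmass lam * x * (x * x) powr lam * ((x * x) powr (- lam - 1) * 4 powr (lam + 1))
            = bmass lam * 4 powr (lam + 1) * (x * ((x * x) powr lam * (x * x) powr (- lam - 1)))"
            by (simp only: mult_ac)
          then show ?thesis unfolding a b by simp
        qed
        finally have "ennreal (pker lam t x y) \<le> ennreal (bmass lam * 4 powr (lam + 1) / x)" by (rule ennreal_leI)
        also have "\<dots> \<le> ennreal ((2 / x) powr lam) * ennreal (pker lam t x y * y powr lam) + \<dots>" by simp
        finally show ?thesis using 2 by simp
      next
        case 3
        have "1 \<le> (2 / x) powr lam * y powr lam"
          unfolding powr_mult[symmetric] using 3 x lam by (intro ge_one_powr_ge_zero) (auto simp: field_simps)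
        then have "pker lam t x y * 1 \<le> pker lam t x y * ((2 / x) powr lam * y powr lam)"
          using pker_nonneg[OF lam t] by (intro mult_left_mono) auto
        then have "ennreal (pker lam t x y) \<le> ennreal ((2 / x) powr lam * (pker lam t x y * y powr lam))"
          by (intro ennreal_leI) (simp add: mult_ac)
        also have "\<dots> = ennreal ((2 / x) powr lam) * ennreal (pker lam t x y * y powr lam)" by (rule ennreal_mult') simp
        also have "\<dots> \<le> \<dots> + ennreal (bmass lam * 4 powr (lam + 1) / x) * indicator {0<..<x} y" by simp
        finally show ?thesis using 3 by simp
      qed simp
    qed
    also have "\<dots> = (\<integral>\<^sub>+y. ennreal ((2 / x) powr lam) * (ennreal (pker lam t x y * y powr lam) * pos y))
         + (\<integral>\<^sub>+y. ennreal (bmass lam * 4 powr (lam + 1) / x) * indicator {0<..<x} y)"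
      using lam by (intro nn_integral_add) measurable
    also have "(\<integral>\<^sub>+y. ennreal ((2 / x) powr lam) * (ennreal (pker lam t x y * y powr lam) * pos y)) = ennreal ((2 / x) powr lam) * ennreal (x powr lam)"
    proof -
      have [measurable]: "(\<lambda>y. pker lam t x y) \<in> borel_measurable borel" by (rule pker_measurable[OF lam]) auto
      show ?thesis by (subst nn_integral_cmult) (auto simp: pker_powr_invariant[OF lam t x])
    qed
    also have "(\<integral>\<^sub>+y. ennreal (bmass lam * 4 powr (lam + 1) / x) * indicator {0<..<x} y)
       = ennreal (bmass lam * 4 powr (lam + 1) / x) * ennreal x"
      using x by (subst nn_integral_cmult_indicator) auto
    also have "ennreal ((2 / x) powr lam) * ennreal (x powr lam) + ennreal (bmass lam * 4 powr (lam + 1) / x) * ennreal x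
       = ennreal ((2 / x) powr lam * x powr lam + bmass lam * 4 powr (lam + 1) / x * x)"
    proof -
      have e1: "ennreal ((2 / x) powr lam) * ennreal (x powr lam) = ennreal ((2 / x) powr lam * x powr lam)"
        by (rule ennreal_mult'[symmetric]) simp
      have e2: "ennreal (bmass lam * 4 powr (lam + 1) / x) * ennreal x = ennreal (bmass lam * 4 powr (lam + 1) / x * x)"
        by (rule ennreal_mult''[symmetric]) (use x in simp)
      show ?thesis unfolding e1 e2 by (rule ennreal_plus[symmetric]) (use x bmass_nonneg[OF lam] in auto)
    qed
    also have "\<dots> \<le> ennreal C"
      using x unfolding powr_mult[symmetric] by (intro ennreal_leI) (simp add: C_def)
    finally show ?thesis .
  qed
  then show ?thesis using C0 by blast
qed

text \<open>This is \<open>powr_le_kap_integral\<close> averaged over \<open>u\<close>; the factor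
  \<open>pi / (2 * lam)\<close> undoes the normalisation of \<open>pker\<close>.\<close>

lemma kernel_power_le_pker:
  assumes "e > 0" "lam > 0" "t > 0" "x > 0" "y > 0"
  shows "ennreal ((x * y) powr lam) * (\<integral>\<^sup>+u. ennreal ((qf x y u + t\<^sup>2) powr (- lam - (1 + e) / 2)) \<partial>bmeas lam)
     \<le> ennreal (4 powr (e + 2 * lam + 2) * pi / (2 * lam)) * (\<integral>\<^sup>+r\<in>{t<..}. ennreal (r powr (- e - 1) * pker lam r x y) \<partial>lborel)"
proof -
  interpret B: finite_measure "bmeas lam" by (rule finite_measure_bmeas[OF assms(2)])
  interpret P: pair_sigma_finite lborel "bmeas lam" ..
  let ?c = "4 powr (e + 2 * lam + 2)"
  let ?K = "\<lambda>r. \<integral>\<^sup>+u. ennreal (r powr (- e - 1) * kap lam 0 (qf x y u) r) * indicator {t<..} r \<partial>bmeas lam"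
  let ?w = "ennreal ((x * y) powr lam)"
  let ?k = "\<lambda>r. \<integral>\<^sup>+u. ennreal (kap lam 0 (qf x y u) r) \<partial>bmeas lam"
  have "(\<integral>\<^sup>+u. ennreal ((qf x y u + t\<^sup>2) powr (- lam - (1 + e) / 2)) \<partial>bmeas lam)
     \<le> (\<integral>\<^sup>+u. ennreal ?c * (\<integral>\<^sup>+r\<in>{t<..}. ennreal (r powr (- e - 1) * kap lam 0 (qf x y u) r) \<partial>lborel) \<partial>bmeas lam)"
    by (intro nn_integral_mono_AE, use AE_bmeas in eventually_elim) (use assms in \<open>auto intro!: powr_le_kap_integral qf_nonneg\<close>)
  also have "\<dots> = ennreal ?c * (\<integral>\<^sup>+u. (\<integral>\<^sup>+r\<in>{t<..}. ennreal (r powr (- e - 1) * kap lam 0 (qf x y u) r) \<partial>lborel) \<partial>bmeas lam)"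
    by (rule nn_integral_cmult) measurable
  also have "(\<integral>\<^sup>+u. (\<integral>\<^sup>+r\<in>{t<..}. ennreal (r powr (- e - 1) * kap lam 0 (qf x y u) r) \<partial>lborel) \<partial>bmeas lam)
     = (\<integral>\<^sub>+r. (?K r))"
    by (rule P.Fubini') measurable
  finally have 1: "(\<integral>\<^sup>+u. ennreal ((qf x y u + t\<^sup>2) powr (- lam - (1 + e) / 2)) \<partial>bmeas lam)
     \<le> ennreal ?c * (\<integral>\<^sub>+r. (?K r))" .
  have 2: "?w * (?K r)
     = ennreal (pi / (2 * lam)) * (ennreal (r powr (- e - 1) * pker lam r x y) * indicator {t<..} r)" for r
  proof (cases "r > t")
    case True
    then have r: "r > 0" using assms by linarith
    have "ennreal (2 * lam / pi * (x * y) powr lam) = ennreal (2 * lam / pi) * ?w"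
      using assms by (intro ennreal_mult') auto
    then have "ennreal (pker lam r x y) = ennreal (2 * lam / pi) * (?w * (?k r))"
      unfolding pker_nn_integral[OF assms(2) r assms(4,5)] by (simp add: mult.assoc)
    then have "ennreal (pi / (2 * lam)) * ennreal (pker lam r x y) = ennreal (pi / (2 * lam) * (2 * lam / pi)) * (?w * (?k r))"
      using assms by (subst ennreal_mult') (auto simp: mult.assoc)
    also have "pi / (2 * lam) * (2 * lam / pi) = 1" using assms by simp
    finally have 3: "?w * (?k r) = ennreal (pi / (2 * lam)) * ennreal (pker lam r x y)" by simp
    have "(?K r)
      = ennreal (r powr (- e - 1)) * (?k r)"
      using True by (subst nn_integral_cmult[symmetric]) (auto simp: ennreal_mult')
    then have "?w * (?K r)
       = ennreal (r powr (- e - 1)) * (?w * (?k r))"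
      by (simp only: mult_ac)
    also have "\<dots> = ennreal (pi / (2 * lam)) * (ennreal (r powr (- e - 1)) * ennreal (pker lam r x y))"
      unfolding 3 by (simp only: mult_ac)
    finally show ?thesis using True by (simp add: ennreal_mult')
  qed simp
  have "?w * (\<integral>\<^sup>+u. ennreal ((qf x y u + t\<^sup>2) powr (- lam - (1 + e) / 2)) \<partial>bmeas lam)
    \<le> ?w * (ennreal ?c * (\<integral>\<^sub>+r. (?K r)))"
    by (intro mult_left_mono 1) simp
  also have "\<dots> = ennreal ?c * (?w * (\<integral>\<^sub>+r. (?K r)))"
    by (simp only: mult_ac)
  also have "\<dots> = ennreal ?c * (\<integral>\<^sub>+r. ?w * (?K r))"
    by (subst nn_integral_cmult) measurable
  also have "\<dots> = ennreal ?c * (\<integral>\<^sub>+r. ennreal (pi / (2 * lam)) * (ennreal (r powr (- e - 1) * pker lam r x y) * indicator {t<..} r))"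
    by (simp only: 2)
  also have "\<dots> = ennreal ?c * (ennreal (pi / (2 * lam)) * (\<integral>\<^sub>+r. (ennreal (r powr (- e - 1) * pker lam r x y) * indicator {t<..} r)))"
  proof -
    have [measurable]: "(\<lambda>r. pker lam r x y) \<in> borel_measurable borel" by (rule pker_measurable[OF assms(2)]) auto
    show ?thesis by (subst nn_integral_cmult) auto
  qed
  also have "\<dots> = ennreal (?c * pi / (2 * lam)) * (\<integral>\<^sub>+r. (ennreal (r powr (- e - 1) * pker lam r x y) * indicator {t<..} r))"
    using assms by (simp add: mult.assoc[symmetric] ennreal_mult'[symmetric])
  finally show ?thesis .
qed

subsection \<open>Weyl fractional integrals\<close>

text \<open>The mean value theorem bounds the difference quotients by \<open>h\<close>, and
  dominated convergence along an arbitrary null sequence gives the limit.\<close>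

lemma has_real_derivative_lebesgue_integral:
  fixes F F' :: "real \<Rightarrow> 'a \<Rightarrow> real"
  assumes d: "d > 0"
    and int: "\<And>t. \<bar>t - t0\<bar> < d \<Longrightarrow> integrable M (F t)"
    and der: "\<And>t a. \<bar>t - t0\<bar> < d \<Longrightarrow> a \<in> space M \<Longrightarrow> ((\<lambda>t. F t a) has_real_derivative F' t a) (at t)"
    and bound: "\<And>t a. \<bar>t - t0\<bar> < d \<Longrightarrow> a \<in> space M \<Longrightarrow> \<bar>F' t a\<bar> \<le> h a"
    and h: "integrable M h" and meas: "F' t0 \<in> borel_measurable M"
  shows "((\<lambda>t. \<integral>a. F t a \<partial>M) has_real_derivative (\<integral>a. F' t0 a \<partial>M)) (at t0)"
proof -
  let ?S = "{-d<..<d}"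
  have "((\<lambda>k. ((\<integral>a. F (t0 + k) a \<partial>M) - (\<integral>a. F t0 a \<partial>M)) / k) \<longlongrightarrow> (\<integral>a. F' t0 a \<partial>M)) (at 0 within ?S)"
    unfolding tendsto_at_iff_sequentially
  proof (intro allI impI)
    fix X :: "nat \<Rightarrow> real" assume X: "\<forall>i. X i \<in> ?S - {0}" and X0: "X \<longlonglongrightarrow> 0"
    have Xd: "\<bar>X i\<bar> < d" and Xn: "X i \<noteq> 0" for i using X by (auto simp: abs_less_iff minus_less_iff)
    have eq: "((\<integral>a. F (t0 + X i) a \<partial>M) - (\<integral>a. F t0 a \<partial>M)) / X i = (\<integral>a. (F (t0 + X i) a - F t0 a) / X i \<partial>M)" for i
      using int[of "t0 + X i"] int[of t0] Xd[of i] d by (simp add: Bochner_Integration.integral_diff)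
    have "(\<lambda>i. \<integral>a. (F (t0 + X i) a - F t0 a) / X i \<partial>M) \<longlonglongrightarrow> (\<integral>a. F' t0 a \<partial>M)"
    proof (rule integral_dominated_convergence[OF meas _ h])
      show "(\<lambda>a. (F (t0 + X i) a - F t0 a) / X i) \<in> borel_measurable M" for i
      proof -
        have "F (t0 + X i) \<in> borel_measurable M" "F t0 \<in> borel_measurable M"
          using int[of "t0 + X i"] int[of t0] Xd[of i] d by (auto dest: borel_measurable_integrable)
        then show ?thesis by measurable
      qed
      show "AE a in M. (\<lambda>i. (F (t0 + X i) a - F t0 a) / X i) \<longlonglongrightarrow> F' t0 a"
      proof (rule AE_I2)
        fix a assume a: "a \<in> space M"
        have "((\<lambda>k. (F (t0 + k) a - F t0 a) / k) \<longlongrightarrow> F' t0 a) (at 0)"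
          using der[of t0 a] a d by (simp add: DERIV_def)
        then show "(\<lambda>i. (F (t0 + X i) a - F t0 a) / X i) \<longlonglongrightarrow> F' t0 a"
          using X0 Xn unfolding tendsto_at_iff_sequentially by (auto simp: o_def)
      qed
      show "AE a in M. norm ((F (t0 + X i) a - F t0 a) / X i) \<le> h a" for i
      proof (rule AE_I2)
        fix a assume a: "a \<in> space M"
        have "norm (F (t0 + X i) a - F t0 a) \<le> h a * norm (t0 + X i - t0)"
        proof (rule field_differentiable_bound[where f'="\<lambda>t. F' t a" and S="{t0 - d<..<t0 + d}"])
          fix z assume z: "z \<in> {t0 - d<..<t0 + d}"
          then have "\<bar>z - t0\<bar> < d" by (auto simp: abs_less_iff)
          then show "((\<lambda>t. F t a) has_real_derivative F' z a) (at z within {t0 - d<..<t0 + d})" "norm (F' z a) \<le> h a"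
            using der[of z a] bound[of z a] a by (auto intro: has_field_derivative_at_within)
        qed (use d Xd[of i] in \<open>auto simp: abs_less_iff\<close>)
        then show "norm ((F (t0 + X i) a - F t0 a) / X i) \<le> h a"
          using Xn[of i] by (simp add: divide_le_eq)
      qed
    qed
    then show "((\<lambda>k. ((\<integral>a. F (t0 + k) a \<partial>M) - (\<integral>a. F t0 a \<partial>M)) / k) \<circ> X) \<longlonglongrightarrow> (\<integral>a. F' t0 a \<partial>M)"
      by (simp add: o_def eq)
  qed
  moreover have "at 0 within ?S = at (0::real)" using d by (intro at_within_open) auto
  ultimately show ?thesis by (simp add: DERIV_def)
qed

lemma integral_swap_nonneg_bound:
  fixes f :: "'a \<Rightarrow> 'b \<Rightarrow> real"
  assumes M: "sigma_finite_measure M" and N: "sigma_finite_measure N"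
    and [measurable]: "case_prod f \<in> borel_measurable (M \<Otimes>\<^sub>M N)"
    and fin: "(\<integral>\<^sup>+x. (\<integral>\<^sup>+y. ennreal \<bar>f x y\<bar> \<partial>N) \<partial>M) < \<infinity>"
  shows "integrable (M \<Otimes>\<^sub>M N) (case_prod f)"
    and "(\<integral>x. (\<integral>y. f x y \<partial>N) \<partial>M) = (\<integral>y. (\<integral>x. f x y \<partial>M) \<partial>N)"
    and "integrable M (\<lambda>x. \<integral>y. f x y \<partial>N)" "integrable N (\<lambda>y. \<integral>x. f x y \<partial>M)"
    and "(\<integral>z. case_prod f z \<partial>(M \<Otimes>\<^sub>M N)) = (\<integral>x. (\<integral>y. f x y \<partial>N) \<partial>M)"
proof -
  interpret M: sigma_finite_measure M by fact
  interpret N: sigma_finite_measure N by fact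
  interpret P: pair_sigma_finite M N ..
  show I: "integrable (M \<Otimes>\<^sub>M N) (case_prod f)"
  proof (rule integrableI_bounded)
    have "(\<integral>\<^sup>+z. ennreal (norm (case_prod f z)) \<partial>(M \<Otimes>\<^sub>M N)) = (\<integral>\<^sup>+x. (\<integral>\<^sup>+y. ennreal (norm (case_prod f (x, y))) \<partial>N) \<partial>M)"
      by (rule N.nn_integral_fst[symmetric]) measurable
    then show "(\<integral>\<^sup>+z. ennreal (norm (case_prod f z)) \<partial>(M \<Otimes>\<^sub>M N)) < \<infinity>" using fin by simp
  qed measurable
  show "(\<integral>x. (\<integral>y. f x y \<partial>N) \<partial>M) = (\<integral>y. (\<integral>x. f x y \<partial>M) \<partial>N)" by (rule P.Fubini_integral[OF I, symmetric])
  show "integrable M (\<lambda>x. \<integral>y. f x y \<partial>N)" by (rule P.integrable_fst[OF I])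
  show "integrable N (\<lambda>y. \<integral>x. f x y \<partial>M)" by (rule P.integrable_snd[OF I])
  show "(\<integral>z. case_prod f z \<partial>(M \<Otimes>\<^sub>M N)) = (\<integral>x. (\<integral>y. f x y \<partial>N) \<partial>M)"
    by (rule P.integral_fst[OF I, symmetric])
qed

text \<open>The derivative of order \<open>m = g + b\<close> has \<open>m\<close> orders of decay
  beyond the degree \<open>- 2 * lam - 1\<close>; the integral against \<open>s powr (g - 1)\<close>
  spends \<open>g\<close> of them and leaves \<open>b\<close>. The bound is on the absolute
  integral, so that Fubini can be based on it.\<close>

lemma kap_tail_bound:
  assumes "g > 0" "b > 0" "lam > 0" "real m = g + b"
  shows "\<exists>C\<ge>0. \<forall>A t. A \<ge> 0 \<longrightarrow> t > 0 \<longrightarrow>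
    (\<integral>\<^sub>+s. ennreal \<bar>pos s * (kap lam m A (t + s) * s powr (g - 1))\<bar>)
      \<le> ennreal (C * (A + t\<^sup>2) powr (- lam - (1 + b) / 2))"
proof -
  obtain C where C: "C \<ge> 0" "\<And>A t. A \<ge> 0 \<Longrightarrow> t > 0 \<Longrightarrow> \<bar>kap lam m A t\<bar> \<le> C * (A + t\<^sup>2) powr (- lam - (1 + real m) / 2)"
    using kap_bound by blast
  let ?b = "2 * lam + 1 + b"
  have ex: "- lam - (1 + real m) / 2 = - (g + ?b) / 2" using assms(4) by (simp add: field_simps)
  have ex2: "- ?b / 2 = - lam - (1 + b) / 2" by (simp add: field_simps)
  have "(\<integral>\<^sub>+s. ennreal \<bar>pos s * (kap lam m A (t + s) * s powr (g - 1))\<bar>)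
      \<le> ennreal (C * (1 / g + 1 / ?b) * (A + t\<^sup>2) powr (- lam - (1 + b) / 2))" if A: "A \<ge> 0" and t: "t > 0" for A t
  proof -
    have "(\<integral>\<^sub>+s. ennreal \<bar>pos s * (kap lam m A (t + s) * s powr (g - 1))\<bar>)
      \<le> (\<integral>\<^sub>+s. ennreal C * (ennreal (s powr (g - 1) * (A + (t + s)\<^sup>2) powr (- (g + ?b) / 2)) * pos s))"
    proof (intro nn_integral_mono)
      fix s :: real
      have "\<bar>kap lam m A (t + s) * s powr (g - 1)\<bar> \<le> C * (s powr (g - 1) * (A + (t + s)\<^sup>2) powr (- (g + ?b) / 2))" if "s > 0"
        using mult_right_mono[OF C(2)[OF A, of "t + s"], of "s powr (g - 1)"] t that unfolding ex by (simp add: abs_mult mult_ac)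
      then show "ennreal \<bar>pos s * (kap lam m A (t + s) * s powr (g - 1))\<bar>
         \<le> ennreal C * (ennreal (s powr (g - 1) * (A + (t + s)\<^sup>2) powr (- (g + ?b) / 2)) * pos s)"
        using C(1) by (auto simp: ennreal_mult'[symmetric] intro!: ennreal_leI split: split_indicator)
    qed
    also have "\<dots> = ennreal C * (\<integral>\<^sub>0s. ennreal (s powr (g - 1) * (A + (t + s)\<^sup>2) powr (- (g + ?b) / 2)))"
      by (rule nn_integral_cmult) measurable
    also have "\<dots> \<le> ennreal C * ennreal ((1 / g + 1 / ?b) * (A + t\<^sup>2) powr (- ?b / 2))"
      using assms A t by (intro mult_left_mono nn_integral_kernel_power) auto
    also have "\<dots> = ennreal (C * (1 / g + 1 / ?b) * (A + t\<^sup>2) powr (- lam - (1 + b) / 2))"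
      unfolding ex2 using C(1) by (simp add: ennreal_mult'[symmetric] mult.assoc)
    finally show ?thesis .
  qed
  moreover have "C * (1 / g + 1 / ?b) \<ge> 0" using C(1) assms by (intro mult_nonneg_nonneg) auto
  ultimately show ?thesis by blast
qed

text \<open>The Weyl integral of the \<open>m\<close>-th derivative, without the factor \<open>1 / Gamma g\<close>; in the application \<open>g = m - \<beta>\<close>.\<close>

definition kphi :: "real \<Rightarrow> nat \<Rightarrow> real \<Rightarrow> real \<Rightarrow> real \<Rightarrow> real" where
  "kphi lam m g A t = (\<integral>\<^sub>Ls. pos s * (kap lam m A (t + s) * s powr (g - 1)))"

lemma kphi_measurable [measurable (raw)]:
  assumes [measurable]: "f \<in> borel_measurable M" "h \<in> borel_measurable M"
  shows "(\<lambda>x. kphi lam m g (f x) (h x)) \<in> borel_measurable M"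
  unfolding kphi_def by measurable

lemma kap_tail_integrable:
  assumes "g > 0" "b > 0" "lam > 0" "real m = g + b" "A \<ge> 0" "t > 0"
  shows "integrable lborel (\<lambda>s. pos s * (kap lam m A (t + s) * s powr (g - 1)))"
proof (rule integrableI_bounded)
  obtain C where C: "C \<ge> 0" "\<And>A t. A \<ge> 0 \<Longrightarrow> t > 0 \<Longrightarrow> (\<integral>\<^sub>+s. ennreal \<bar>pos s * (kap lam m A (t + s) * s powr (g - 1))\<bar>)
      \<le> ennreal (C * (A + t\<^sup>2) powr (- lam - (1 + b) / 2))"
    using kap_tail_bound[OF assms(1-4)] by blast
  show "(\<integral>\<^sub>+s. ennreal (norm (pos s * (kap lam m A (t + s) * s powr (g - 1))))) < \<infinity>"
    using C(2)[OF assms(5,6)] by (simp add: order_le_less_trans)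
qed measurable

lemma kphi_bound:
  assumes "g > 0" "b > 0" "lam > 0" "real m = g + b"
  shows "\<exists>C\<ge>0. \<forall>A t. A \<ge> 0 \<longrightarrow> t > 0 \<longrightarrow> \<bar>kphi lam m g A t\<bar> \<le> C * (A + t\<^sup>2) powr (- lam - (1 + b) / 2)"
proof -
  obtain C where C: "C \<ge> 0" "\<And>A t. A \<ge> 0 \<Longrightarrow> t > 0 \<Longrightarrow> (\<integral>\<^sub>+s. ennreal \<bar>pos s * (kap lam m A (t + s) * s powr (g - 1))\<bar>)
      \<le> ennreal (C * (A + t\<^sup>2) powr (- lam - (1 + b) / 2))"
    using kap_tail_bound[OF assms] by blast
  have "\<bar>kphi lam m g A t\<bar> \<le> C * (A + t\<^sup>2) powr (- lam - (1 + b) / 2)" if "A \<ge> 0" "t > 0" for A t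
  proof -
    have "ennreal \<bar>kphi lam m g A t\<bar> \<le> (\<integral>\<^sub>+s. ennreal \<bar>pos s * (kap lam m A (t + s) * s powr (g - 1))\<bar>)"
      unfolding kphi_def using integral_norm_bound_ennreal[OF kap_tail_integrable[OF assms that]] by simp
    also have "\<dots> \<le> ennreal (C * (A + t\<^sup>2) powr (- lam - (1 + b) / 2))" by (rule C(2)[OF that])
    finally show ?thesis using C(1) by (simp add: ennreal_le_iff)
  qed
  then show ?thesis using C(1) by blast
qed

lemma integral_beta_scaled:
  assumes "a > 0" "b > (0::real)" "r > 0"
  shows "(\<integral>\<^sub>Lx. indicator {0<..<r} x * (x powr (a - 1) * (r - x) powr (b - 1))) = r powr (a + b - 1) * Beta a b"
proof -
  have B: "(\<integral>\<^sub>Lx. indicator {0<..<1} x * (x powr (a - 1) * (1 - x) powr (b - 1))) = Beta a b"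
  proof -
    have "(\<integral>\<^sub>Lx. indicator {0<..<1} x * (x powr (a - 1) * (1 - x) powr (b - 1))) = (LBINT x:{0..1}. x powr (a - 1) * (1 - x) powr (b - 1))"
      unfolding set_lebesgue_integral_def
      by (intro integral_cong_AE) (use AE_lborel_singleton[of 0] AE_lborel_singleton[of 1] in \<open>auto elim!: eventually_elim2 split: split_indicator\<close>)
    also have "\<dots> = integral {0..1} (\<lambda>x. x powr (a - 1) * (1 - x) powr (b - 1))"
      using assms by (intro set_borel_integral_eq_integral integrable_Beta)
    also have "\<dots> = Beta a b" using has_integral_Beta_real[OF assms(1,2)] by (rule integral_unique)
    finally show ?thesis .
  qed
  have "(\<integral>\<^sub>Lx. indicator {0<..<r} x * (x powr (a - 1) * (r - x) powr (b - 1)))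
     = r * (\<integral>\<^sub>Lx. indicator {0<..<r} (0 + r * x) * ((0 + r * x) powr (a - 1) * (r - (0 + r * x)) powr (b - 1)))"
    using lborel_integral_real_affine[of r "\<lambda>x. indicator {0<..<r} x * (x powr (a - 1) * (r - x) powr (b - 1))" 0] assms(3) by simp
  also have "(\<integral>\<^sub>Lx. indicator {0<..<r} (0 + r * x) * ((0 + r * x) powr (a - 1) * (r - (0 + r * x)) powr (b - 1)))
    = (\<integral>\<^sub>Lx. r powr (a - 1) * r powr (b - 1) * (indicator {0<..<1} x * (x powr (a - 1) * (1 - x) powr (b - 1))))"
  proof (rule Bochner_Integration.integral_cong[OF refl])
    fix x :: real
    have i: "indicator {0<..<r} (0 + r * x) = (indicator {0<..<1} x :: real)"
      using assms(3) by (auto simp: indicator_def zero_less_mult_iff)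
    have j: "r - (0 + r * x) = r * (1 - x)" by (simp add: algebra_simps)
    show "indicator {0<..<r} (0 + r * x) * ((0 + r * x) powr (a - 1) * (r - (0 + r * x)) powr (b - 1))
      = r powr (a - 1) * r powr (b - 1) * (indicator {0<..<1} x * (x powr (a - 1) * (1 - x) powr (b - 1)))"
      unfolding i j powr_mult by (simp add: powr_mult mult_ac)
  qed
  also have "\<dots> = r powr (a - 1) * r powr (b - 1) * Beta a b" by (simp add: B)
  also have "r * (r powr (a - 1) * r powr (b - 1) * Beta a b) = (r powr 1 * r powr (a - 1) * r powr (b - 1)) * Beta a b"
    using assms(3) by simp
  also have "r powr 1 * r powr (a - 1) * r powr (b - 1) = r powr (a + b - 1)"
    by (subst powr_add[symmetric])+ (rule powr_exp_cong, simp)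
  finally show ?thesis .
qed

lemma kap_isCont: "A \<ge> 0 \<Longrightarrow> t > 0 \<Longrightarrow> isCont (kap lam m A) t"
  using kap_deriv by (rule DERIV_isCont)

section \<open>Inversion of the fractional derivative on the profile\<close>

lemma kap_moment_integrable:
  assumes "lam > 0" "A \<ge> 0" "t > 0"
  shows "integrable lborel (\<lambda>r. pos r * (r ^ j * kap lam (Suc j) A (t + r)))"
proof -
  obtain C where C: "C \<ge> 0" "\<And>A t. A \<ge> 0 \<Longrightarrow> t > 0 \<Longrightarrow> \<bar>kap lam (Suc j) A t\<bar> \<le> C * (A + t\<^sup>2) powr (- lam - (1 + real (Suc j)) / 2)"
    using kap_bound by blast
  let ?a = "real j + 1" and ?b = "2 * lam + 1"
  have ex: "- lam - (1 + real (Suc j)) / 2 = - (?a + ?b) / 2" by (simp add: field_simps)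
  show ?thesis
  proof (rule integrableI_bounded)
    have "(\<integral>\<^sub>+r. ennreal (norm (pos r * (r ^ j * kap lam (Suc j) A (t + r)))))
      \<le> (\<integral>\<^sub>+r. ennreal C * (ennreal (r powr (?a - 1) * (A + (t + r)\<^sup>2) powr (- (?a + ?b) / 2)) * pos r))"
    proof (intro nn_integral_mono)
      fix r :: real
      have "\<bar>r ^ j * kap lam (Suc j) A (t + r)\<bar> \<le> C * (r powr (?a - 1) * (A + (t + r)\<^sup>2) powr (- (?a + ?b) / 2))" if "r > 0"
        using mult_left_mono[OF C(2)[OF assms(2), of "t + r"], of "r ^ j"] assms that unfolding ex by (simp add: abs_mult mult_ac powr_realpow)
      then show "ennreal (norm (pos r * (r ^ j * kap lam (Suc j) A (t + r))))
        \<le> ennreal C * (ennreal (r powr (?a - 1) * (A + (t + r)\<^sup>2) powr (- (?a + ?b) / 2)) * pos r)"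
        using C(1) by (auto simp: ennreal_mult'[symmetric] intro!: ennreal_leI split: split_indicator)
    qed
    also have "\<dots> = ennreal C * (\<integral>\<^sub>0r. ennreal (r powr (?a - 1) * (A + (t + r)\<^sup>2) powr (- (?a + ?b) / 2)))"
      by (rule nn_integral_cmult) measurable
    also have "\<dots> \<le> ennreal C * ennreal ((1 / ?a + 1 / ?b) * (A + t\<^sup>2) powr (- ?b / 2))"
      using assms by (intro mult_left_mono nn_integral_kernel_power) auto
    also have "\<dots> < \<infinity>" by (simp add: ennreal_mult_less_top)
    finally show "(\<integral>\<^sub>+r. ennreal (norm (pos r * (r ^ j * kap lam (Suc j) A (t + r))))) < \<infinity>" .
  qed measurable
qed

lemma kap_moment_tendsto_0:
  assumes "lam > 0" "A \<ge> 0" "t > 0"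
  shows "((\<lambda>r. r ^ j * kap lam j A (t + r)) \<longlongrightarrow> 0) at_top"
proof -
  obtain C where C: "C \<ge> 0" "\<And>A t. A \<ge> 0 \<Longrightarrow> t > 0 \<Longrightarrow> \<bar>kap lam j A t\<bar> \<le> C * (A + t\<^sup>2) powr (- lam - (1 + real j) / 2)"
    using kap_bound by blast
  have lim: "((\<lambda>r. C * r powr (- (2 * lam + 1))) \<longlongrightarrow> 0) at_top"
    using assms by (intro tendsto_mult_right_zero tendsto_neg_powr filterlim_ident) auto
  show ?thesis
  proof (rule Lim_null_comparison[OF _ lim], use eventually_gt_at_top[of 0] in eventually_elim)
    fix r :: real assume r: "0 < r"
    have "\<bar>kap lam j A (t + r)\<bar> \<le> C * (A + (t + r)\<^sup>2) powr (- lam - (1 + real j) / 2)"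
      using assms r by (intro C(2)) auto
    also have "\<dots> \<le> C * (r\<^sup>2) powr (- lam - (1 + real j) / 2)"
    proof -
      have "r\<^sup>2 \<le> (t + r)\<^sup>2" using r assms by (intro power_mono) auto
      then have "r\<^sup>2 \<le> A + (t + r)\<^sup>2" using assms by linarith
      then show ?thesis using C(1) assms r by (intro mult_left_mono powr_mono2') auto
    qed
    also have "(r\<^sup>2) powr (- lam - (1 + real j) / 2) = r powr (- (2 * lam + 1) - real j)"
      using r by (subst square_powr) (auto intro!: powr_exp_cong simp: field_simps)
    finally have "r ^ j * \<bar>kap lam j A (t + r)\<bar> \<le> r ^ j * (C * r powr (- (2 * lam + 1) - real j))"
      using r by (intro mult_left_mono) auto
    also have "\<dots> = C * (r powr (real j) * r powr (- (2 * lam + 1) - real j))" using r by (simp add: powr_realpow mult_ac)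
    also have "r powr (real j) * r powr (- (2 * lam + 1) - real j) = r powr (- (2 * lam + 1))"
      by (subst powr_add[symmetric]) (rule powr_exp_cong, simp)
    finally show "norm (r ^ j * kap lam j A (t + r)) \<le> C * r powr (- (2 * lam + 1))"
      using r by (simp add: abs_mult)
  qed
qed

text \<open>Repeated integration by parts: a positive power of \<open>r\<close> removes the boundary
  term at 0, and the decay of \<open>kap\<close> removes it at infinity. Each step lowers the power
  and the order of the derivative together, down to the fundamental theorem of calculus for
  \<open>j = 0\<close>.\<close>

lemma kap_moment:
  assumes "lam > 0" "A \<ge> 0" "t > 0"
  shows "(\<integral>\<^sub>Lr. pos r * (r ^ j * kap lam (Suc j) A (t + r))) = (-1) ^ Suc j * fact j * kap lam 0 A t"
proof (induction j)
  case 0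
  have "(LBINT r=ereal 0..\<infinity>. kap lam (Suc 0) A (t + r)) = 0 - kap lam 0 A t"
  proof (rule interval_integral_FTC_integrable[where F="\<lambda>r. kap lam 0 A (t + r)"])
    fix r assume "ereal 0 < ereal r"
    then have "t + r > 0" using assms by simp
    then have "((\<lambda>r. kap lam 0 A (t + r)) has_real_derivative kap lam (Suc 0) A (t + r) * 1) (at r)"
      using assms by (intro DERIV_chain2[of "kap lam 0 A", OF kap_deriv]) (auto intro!: derivative_eq_intros)
    then show "((\<lambda>r. kap lam 0 A (t + r)) has_vector_derivative kap lam (Suc 0) A (t + r)) (at r)"
      by (simp add: has_real_derivative_iff_has_vector_derivative)
    show "isCont (\<lambda>r. kap lam (Suc 0) A (t + r)) r"
      by (rule isCont_o2[OF _ kap_isCont]) (use assms \<open>t + r > 0\<close> in auto)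
  next
    show "set_integrable lborel (einterval (ereal 0) \<infinity>) (\<lambda>r. kap lam (Suc 0) A (t + r))"
      using kap_moment_integrable[OF assms, of 0] by (simp add: set_integrable_def)
    show "(((\<lambda>r. kap lam 0 A (t + r)) \<circ> real_of_ereal) \<longlongrightarrow> kap lam 0 A t) (at_right (ereal 0))"
    proof -
      have "isCont (\<lambda>r. kap lam 0 A (t + r)) 0" by (rule isCont_o2[OF _ kap_isCont]) (use assms in auto)
      then have "((\<lambda>r. kap lam 0 A (t + r)) \<longlongrightarrow> kap lam 0 A t) (at_right 0)"
        by (auto simp: isCont_def intro: filterlim_mono at_within_le_at)
      then show ?thesis by (simp only: ereal_tendsto_simps1)
    qed
    show "(((\<lambda>r. kap lam 0 A (t + r)) \<circ> real_of_ereal) \<longlongrightarrow> 0) (at_left \<infinity>)"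
      using kap_moment_tendsto_0[OF assms, of 0] by (simp add: ereal_tendsto_simps1)
  qed simp
  then show ?case by (simp add: interval_integral_to_infinity_eq set_lebesgue_integral_def)
next
  case (Suc j)
  let ?F = "\<lambda>r. r ^ Suc j * kap lam (Suc j) A (t + r)"
  let ?f = "\<lambda>r. real (Suc j) * (r ^ j * kap lam (Suc j) A (t + r)) + r ^ Suc j * kap lam (Suc (Suc j)) A (t + r)"
  have i1: "integrable lborel (\<lambda>r. pos r * (r ^ j * kap lam (Suc j) A (t + r)))"
    and i2: "integrable lborel (\<lambda>r. pos r * (r ^ Suc j * kap lam (Suc (Suc j)) A (t + r)))"
    by (rule kap_moment_integrable[OF assms])+
  have feq: "pos r * ?f r = real (Suc j) * (pos r * (r ^ j * kap lam (Suc j) A (t + r))) + pos r * (r ^ Suc j * kap lam (Suc (Suc j)) A (t + r))" for r :: real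
    by (simp add: algebra_simps)
  have ct: "isCont (\<lambda>r. kap lam k A (t + r)) r" if "r \<ge> 0" for r k
    by (rule isCont_o2[OF _ kap_isCont]) (use assms that in auto)
  have "(LBINT r=ereal 0..\<infinity>. ?f r) = 0 - 0"
  proof (rule interval_integral_FTC_integrable[where F="?F"])
    fix r assume "ereal 0 < ereal r"
    then have r: "r > 0" "t + r > 0" using assms by auto
    have "((\<lambda>r. kap lam (Suc j) A (t + r)) has_real_derivative kap lam (Suc (Suc j)) A (t + r) * 1) (at r)"
      using assms r by (intro DERIV_chain2[of "kap lam (Suc j) A", OF kap_deriv]) (auto intro!: derivative_eq_intros)
    then have "(?F has_real_derivative (real (Suc j) * r ^ j) * kap lam (Suc j) A (t + r) + (kap lam (Suc (Suc j)) A (t + r) * 1) * r ^ Suc j) (at r)"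
      by (intro DERIV_mult) (auto intro!: derivative_eq_intros simp del: power_Suc)
    then show "(?F has_vector_derivative ?f r) (at r)"
      by (simp add: has_real_derivative_iff_has_vector_derivative mult_ac)
    show "isCont ?f r" using r by (intro continuous_intros ct) auto
  next
    show "set_integrable lborel (einterval (ereal 0) \<infinity>) ?f"
    proof -
      have "integrable lborel (\<lambda>r. pos r * ?f r)"
        unfolding feq by (rule Bochner_Integration.integrable_add[OF integrable_mult_right[OF i1, of "real (Suc j)"] i2])
      then show ?thesis unfolding set_integrable_def by simp
    qed
    show "((?F \<circ> real_of_ereal) \<longlongrightarrow> 0) (at_right (ereal 0))"
    proof -
      have "isCont ?F 0" by (intro continuous_intros ct) auto
      then have "(?F \<longlongrightarrow> 0) (at_right 0)"
        by (auto simp: isCont_def intro: filterlim_mono at_within_le_at)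
      then show ?thesis by (simp only: ereal_tendsto_simps1)
    qed
    show "((?F \<circ> real_of_ereal) \<longlongrightarrow> 0) (at_left \<infinity>)"
      using kap_moment_tendsto_0[OF assms, of "Suc j"] by (simp only: ereal_tendsto_simps1)
  qed simp
  then have "0 = (\<integral>\<^sub>Lr. pos r * ?f r)"
    by (simp add: interval_integral_to_infinity_eq set_lebesgue_integral_def)
  also have "\<dots> = real (Suc j) * (\<integral>\<^sub>Lr. pos r * (r ^ j * kap lam (Suc j) A (t + r))) + (\<integral>\<^sub>Lr. pos r * (r ^ Suc j * kap lam (Suc (Suc j)) A (t + r)))"
    unfolding feq by (subst Bochner_Integration.integral_add[OF integrable_mult_right[OF i1] i2]) simp
  finally show ?case unfolding Suc by (simp add: algebra_simps)
qed

text \<open>Weyl integrals of orders \<open>b\<close> and \<open>g\<close> compose to one of the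
  integer order \<open>m\<close>: after the exchange the inner integral is a Beta integral, which
  leaves \<open>r ^ (m - 1)\<close> against the \<open>m\<close>-th derivative, the case
  \<open>j = m - 1\<close> of \<open>kap_moment\<close>. The surviving decay
  \<open>- lam - 1 / 2\<close> has no extra \<open>e\<close>, hence the demand \<open>e = 0\<close>
  in \<open>kint_inversion\<close>.\<close>

lemma kphi_inversion:
  assumes "b > 0" "g > 0" "lam > 0" "real m = g + b"
  shows "\<exists>C\<ge>0. \<forall>A t. A \<ge> 0 \<longrightarrow> t > 0 \<longrightarrow>
    (\<integral>\<^sub>+s. ennreal \<bar>pos s * (kphi lam m g A (t + s) * s powr (b - 1))\<bar>)
        \<le> ennreal (C * (A + t\<^sup>2) powr (- lam - 1 / 2))
    \<and> (\<integral>\<^sub>Ls. pos s * (kphi lam m g A (t + s) * s powr (b - 1))) = (-1) ^ m * Gamma b * Gamma g * kap lam 0 A t"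
proof -
  obtain C where C: "C \<ge> 0" "\<And>A t. A \<ge> 0 \<Longrightarrow> t > 0 \<Longrightarrow>
    (\<integral>\<^sub>+s. ennreal \<bar>pos s * (kap lam m A (t + s) * s powr (g - 1))\<bar>)
      \<le> ennreal (C * (A + t\<^sup>2) powr (- lam - (1 + b) / 2))"
    using kap_tail_bound[OF assms(2,1,3,4)] by blast
  obtain j where j: "m = Suc j" using assms by (cases m) auto
  let ?c = "2 * lam + 1"
  define D where "D = C * (1 / b + 1 / ?c)"
  have D: "D \<ge> 0" using C(1) assms by (auto simp: D_def intro!: mult_nonneg_nonneg)
  have main: "(\<integral>\<^sub>+s. ennreal \<bar>pos s * (kphi lam m g A (t + s) * s powr (b - 1))\<bar>)
        \<le> ennreal (D * (A + t\<^sup>2) powr (- lam - 1 / 2))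
    \<and> (\<integral>\<^sub>Ls. pos s * (kphi lam m g A (t + s) * s powr (b - 1))) = (-1) ^ m * Gamma b * Gamma g * kap lam 0 A t"
    if A: "A \<ge> 0" and t: "t > 0" for A t
  proof -
    \<comment> \<open>The variable \<open>r = \<tau> + s\<close> joins the two integrations, and
      \<open>pos (r - \<tau>)\<close> stands for \<open>s > 0\<close>.\<close>
    define f where "f \<tau> r = pos \<tau> * pos (r - \<tau>) * (kap lam m A (t + r) * (r - \<tau>) powr (g - 1) * \<tau> powr (b - 1))" for \<tau> r
    have fm: "case_prod f \<in> borel_measurable (lborel \<Otimes>\<^sub>M lborel)" unfolding f_def[abs_def] by measurable
    have inner: "(\<integral>\<^sub>+r. ennreal \<bar>f \<tau> r\<bar>) = (\<integral>\<^sub>+s. ennreal (pos \<tau> * \<tau> powr (b - 1)) * ennreal \<bar>pos s * (kap lam m A (t + \<tau> + s) * s powr (g - 1))\<bar>)" for \<tau>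
    proof -
      have "(\<integral>\<^sub>+r. ennreal \<bar>f \<tau> r\<bar>) = (\<integral>\<^sub>+s. ennreal \<bar>f \<tau> (\<tau> + 1 * s)\<bar>)"
        using nn_integral_real_affine[of "\<lambda>r. ennreal \<bar>f \<tau> r\<bar>" 1 \<tau>] unfolding f_def by simp
      also have "\<dots> = (\<integral>\<^sub>+s. ennreal (pos \<tau> * \<tau> powr (b - 1)) * ennreal \<bar>pos s * (kap lam m A (t + \<tau> + s) * s powr (g - 1))\<bar>)"
        by (intro nn_integral_cong) (auto simp: f_def ennreal_mult'[symmetric] abs_mult mult_ac add_ac split: split_indicator)
      finally show ?thesis .
    qed
    have innerI: "(\<integral>\<^sub>Lr. f \<tau> r) = pos \<tau> * (kphi lam m g A (t + \<tau>) * \<tau> powr (b - 1))" for \<tau>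
    proof -
      have "(\<integral>\<^sub>Lr. f \<tau> r) = (\<integral>\<^sub>Ls. f \<tau> (\<tau> + 1 * s))"
        using lborel_integral_real_affine[of 1 "f \<tau>" \<tau>] by simp
      also have "\<dots> = (\<integral>\<^sub>Ls. (pos \<tau> * \<tau> powr (b - 1)) * (pos s * (kap lam m A (t + \<tau> + s) * s powr (g - 1))))"
        by (intro Bochner_Integration.integral_cong refl) (auto simp: f_def mult_ac add_ac split: split_indicator)
      also have "\<dots> = (pos \<tau> * \<tau> powr (b - 1)) * kphi lam m g A (t + \<tau>)"
        unfolding kphi_def by (rule integral_mult_right_zero)
      finally show ?thesis by (simp only: mult_ac)
    qed
    have ex: "- lam - (1 + b) / 2 = - (b + ?c) / 2" "- lam - 1 / 2 = - ?c / 2" by (auto simp: field_simps)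
    have fin: "(\<integral>\<^sub>+\<tau>. (\<integral>\<^sub>+r. ennreal \<bar>f \<tau> r\<bar>)) \<le> ennreal (D * (A + t\<^sup>2) powr (- lam - 1 / 2))"
    proof -
      have "(\<integral>\<^sub>+\<tau>. (\<integral>\<^sub>+r. ennreal \<bar>f \<tau> r\<bar>)) \<le> (\<integral>\<^sub>+\<tau>. ennreal C * (ennreal (\<tau> powr (b - 1) * (A + (t + \<tau>)\<^sup>2) powr (- (b + ?c) / 2)) * pos \<tau>))"
      proof (rule nn_integral_mono)
        fix \<tau> :: real
        show "(\<integral>\<^sub>+r. ennreal \<bar>f \<tau> r\<bar>) \<le> ennreal C * (ennreal (\<tau> powr (b - 1) * (A + (t + \<tau>)\<^sup>2) powr (- (b + ?c) / 2)) * pos \<tau>)"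
        proof (cases "\<tau> > 0")
          case True
          have "(\<integral>\<^sub>+r. ennreal \<bar>f \<tau> r\<bar>) = ennreal (\<tau> powr (b - 1)) * (\<integral>\<^sub>+s. ennreal \<bar>pos s * (kap lam m A (t + \<tau> + s) * s powr (g - 1))\<bar>)"
            unfolding inner using True by (subst nn_integral_cmult) auto
          also have "\<dots> \<le> ennreal (\<tau> powr (b - 1)) * ennreal (C * (A + (t + \<tau>)\<^sup>2) powr (- lam - (1 + b) / 2))"
            using A t True by (intro mult_left_mono C(2)) auto
          also have "\<dots> = ennreal C * ennreal (\<tau> powr (b - 1) * (A + (t + \<tau>)\<^sup>2) powr (- (b + ?c) / 2))"
            unfolding ex(1) using C(1) by (simp add: ennreal_mult'[symmetric] mult_ac)
          finally show ?thesis using True by simp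
        qed (simp add: inner)
      qed
      also have "\<dots> = ennreal C * (\<integral>\<^sup>+\<tau>\<in>{0<..}. ennreal (\<tau> powr (b - 1) * (A + (t + \<tau>)\<^sup>2) powr (- (b + ?c) / 2)) \<partial>lborel)"
        by (rule nn_integral_cmult) measurable
      also have "\<dots> \<le> ennreal C * ennreal ((1 / b + 1 / ?c) * (A + t\<^sup>2) powr (- ?c / 2))"
        using assms A t by (intro mult_left_mono nn_integral_kernel_power) auto
      also have "\<dots> = ennreal (D * (A + t\<^sup>2) powr (- lam - 1 / 2))"
        unfolding ex(2) D_def using C(1) by (simp add: ennreal_mult'[symmetric] mult.assoc)
      finally show ?thesis .
    qed
    then have fin': "(\<integral>\<^sub>+\<tau>. (\<integral>\<^sub>+r. ennreal \<bar>f \<tau> r\<bar>)) < \<infinity>" by (simp add: order_le_less_trans)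
    note swap = integral_swap_nonneg_bound[OF lborel.sigma_finite_measure_axioms lborel.sigma_finite_measure_axioms fm fin']
    have "(\<integral>\<^sub>Ls. pos s * (kphi lam m g A (t + s) * s powr (b - 1))) = (\<integral>\<^sub>L\<tau>. (\<integral>\<^sub>Lr. f \<tau> r))"
      by (simp only: innerI)
    also have "\<dots> = (\<integral>\<^sub>Lr. (\<integral>\<^sub>L\<tau>. f \<tau> r))" by (rule swap(2))
    also have "\<dots> = (\<integral>\<^sub>Lr. Beta b g * (pos r * (r ^ j * kap lam (Suc j) A (t + r))))"
    proof (rule Bochner_Integration.integral_cong[OF refl])
      fix r :: real
      show "(\<integral>\<^sub>L\<tau>. f \<tau> r) = Beta b g * (pos r * (r ^ j * kap lam (Suc j) A (t + r)))"
      proof (cases "r > 0")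
        case True
        have "(\<integral>\<^sub>L\<tau>. f \<tau> r) = (\<integral>\<^sub>L\<tau>. kap lam m A (t + r) * (indicator {0<..<r} \<tau> * (\<tau> powr (b - 1) * (r - \<tau>) powr (g - 1))))"
          by (intro Bochner_Integration.integral_cong refl) (auto simp: f_def mult_ac split: split_indicator)
        also have "\<dots> = kap lam m A (t + r) * (r powr (b + g - 1) * Beta b g)"
          using integral_beta_scaled[OF assms(1,2) True] by simp
        also have "b + g - 1 = real j" using assms(4) j by simp
        finally show ?thesis using True j by (simp add: powr_realpow mult_ac)
      next
        case False
        then have "f \<tau> r = 0" for \<tau> by (auto simp: f_def split: split_indicator)
        then show ?thesis using False by simp
      qed
    qed
    also have "\<dots> = Beta b g * ((-1) ^ Suc j * fact j * kap lam 0 A t)"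
      using kap_moment[OF assms(3) A t] by simp
    also have "Beta b g = Gamma b * Gamma g / fact j"
      using assms(4) j Gamma_fact[of j, where 'a=real] by (simp add: Beta_def add.commute)
    finally have 2: "(\<integral>\<^sub>Ls. pos s * (kphi lam m g A (t + s) * s powr (b - 1))) = (-1) ^ m * Gamma b * Gamma g * kap lam 0 A t"
      using j by simp
    have 1: "(\<integral>\<^sub>+s. ennreal \<bar>pos s * (kphi lam m g A (t + s) * s powr (b - 1))\<bar>) \<le> (\<integral>\<^sub>+\<tau>. (\<integral>\<^sub>+r. ennreal \<bar>f \<tau> r\<bar>))"
    proof (rule nn_integral_mono)
      fix \<tau> :: real
      show "ennreal \<bar>pos \<tau> * (kphi lam m g A (t + \<tau>) * \<tau> powr (b - 1))\<bar> \<le> (\<integral>\<^sub>+r. ennreal \<bar>f \<tau> r\<bar>)"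
      proof (cases "integrable lborel (f \<tau>)")
        case True
        then show ?thesis unfolding innerI[symmetric] using integral_norm_bound_ennreal[OF True] by simp
      next
        \<comment> \<open>A function that is not integrable has integral 0 by default, so the bound
          is trivial here.\<close>
        case False
        then show ?thesis unfolding innerI[symmetric] by (simp add: not_integrable_integral_eq)
      qed
    qed
    show ?thesis using order_trans[OF 1 fin] 2 by blast
  qed
  then show ?thesis using D by blast
qed

section \<open>Superpositions of the profile\<close>

definition kint :: "'a measure \<Rightarrow> ('a \<Rightarrow> real) \<Rightarrow> ('a \<Rightarrow> real) \<Rightarrow> real \<Rightarrow> nat \<Rightarrow> real \<Rightarrow> real" where
  "kint M w A lam m t = (\<integral>a. w a * kap lam m (A a) t \<partial>M)"

text \<open>Abstracts from \<open>f\<close> and from the base point: a signed weight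
  \<open>w\<close> over parameters \<open>a\<close> with squared distances \<open>A a\<close>. The
  two instances are the extension \<open>P_t f (x)\<close> and the composition
  \<open>P_s P_t f (x)\<close>. Nonnegativity of \<open>A\<close> is asked for only where
  \<open>w\<close> is nonzero, because \<open>qfp\<close> is nonnegative on the support of its
  weight. In \<open>integ\<close> a larger \<open>e\<close> is a weaker demand.\<close>

locale kernel_weight =
  fixes M :: "'a measure" and w A :: "'a \<Rightarrow> real" and lam e :: real
  assumes sf: "sigma_finite_measure M"
    and wm [measurable]: "w \<in> borel_measurable M" and Am [measurable]: "A \<in> borel_measurable M"
    and A0: "\<And>a. w a \<noteq> 0 \<Longrightarrow> 0 \<le> A a"
    and lam: "0 < lam" and e: "0 \<le> e" "e \<le> 1"
    and integ: "integrable M (\<lambda>a. w a * (A a + 1) powr (- lam - (1 + e) / 2))"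
begin

text \<open>Since \<open>A + t\<^sup>2\<close> dominates \<open>min 1 (t\<^sup>2) * (A + 1)\<close>,
  integrability at time 1 carries over to every time, and additional decay is harmless.\<close>

lemma integ_power:
  assumes "t > 0" "e' \<ge> e"
  shows "integrable M (\<lambda>a. w a * (A a + t\<^sup>2) powr (- lam - (1 + e') / 2))"
proof -
  define c where "c = min 1 (t\<^sup>2)"
  have c: "c > 0" using assms by (simp add: c_def)
  define K where "K = (t\<^sup>2) powr (- (e' - e) / 2) * c powr (- lam - (1 + e) / 2)"
  show ?thesis
  proof (rule Bochner_Integration.integrable_bound[OF integrable_mult_right[OF integ, of K] _ AE_I2])
    fix a
    show "norm (w a * (A a + t\<^sup>2) powr (- lam - (1 + e') / 2)) \<le> norm (K * (w a * (A a + 1) powr (- lam - (1 + e) / 2)))"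
    proof (cases "w a = 0")
      case False
      then have A: "A a \<ge> 0" by (rule A0)
      have "c * (A a + 1) \<le> A a + t\<^sup>2"
      proof -
        have "c * A a \<le> 1 * A a" using A by (intro mult_right_mono) (auto simp: c_def)
        moreover have "c \<le> t\<^sup>2" by (simp add: c_def)
        ultimately show ?thesis by (simp add: distrib_left)
      qed
      then have 1: "(A a + t\<^sup>2) powr (- lam - (1 + e) / 2) \<le> (c * (A a + 1)) powr (- lam - (1 + e) / 2)"
        using c A lam e by (intro powr_mono2') auto
      have "(A a + t\<^sup>2) powr (- lam - (1 + e') / 2) = (A a + t\<^sup>2) powr (- (e' - e) / 2) * (A a + t\<^sup>2) powr (- lam - (1 + e) / 2)"
        by (subst powr_add[symmetric]) (rule powr_exp_cong, simp add: field_simps)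
      also have "\<dots> \<le> (t\<^sup>2) powr (- (e' - e) / 2) * (c * (A a + 1)) powr (- lam - (1 + e) / 2)"
        using assms A by (intro mult_mono 1 powr_mono2') auto
      also have "\<dots> = K * (A a + 1) powr (- lam - (1 + e) / 2)" by (simp add: K_def powr_mult)
      finally have "\<bar>w a\<bar> * (A a + t\<^sup>2) powr (- lam - (1 + e') / 2) \<le> \<bar>w a\<bar> * (K * (A a + 1) powr (- lam - (1 + e) / 2))"
        by (intro mult_left_mono) auto
      moreover have "K \<ge> 0" by (simp add: K_def)
      ultimately show ?thesis by (simp add: abs_mult mult_ac)
    qed simp
  qed measurable
qed

lemma integ_power1: "t > 0 \<Longrightarrow> integrable M (\<lambda>a. w a * (A a + t\<^sup>2) powr (- lam - 1))"
  using integ_power[of t 1] e by simp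

lemma kap_integrable:
  assumes "t > 0" shows "integrable M (\<lambda>a. w a * kap lam m (A a) t)"
proof -
  obtain C where C: "C \<ge> 0" "\<And>A t. A \<ge> 0 \<Longrightarrow> t > 0 \<Longrightarrow> \<bar>kap lam m A t\<bar> \<le> C * t powr (1 - real m) * (A + t\<^sup>2) powr (- lam - 1)"
    using kap_bound' by blast
  show ?thesis
  proof (rule Bochner_Integration.integrable_bound[OF integrable_mult_right[OF integ_power1[OF assms], of "C * t powr (1 - real m)"] _ AE_I2])
    fix a
    show "norm (w a * kap lam m (A a) t) \<le> norm (C * t powr (1 - real m) * (w a * (A a + t\<^sup>2) powr (- lam - 1)))"
    proof (cases "w a = 0")
      case False
      from mult_left_mono[OF C(2)[OF A0[OF this] assms], of "\<bar>w a\<bar>"] C(1) show ?thesis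
        by (simp add: abs_mult mult_ac)
    qed simp
  qed measurable
qed

lemma kint_deriv:
  assumes t: "t > 0"
  shows "(kint M w A lam m has_real_derivative kint M w A lam (Suc m) t) (at t)"
proof -
  obtain C where C: "C \<ge> 0" "\<And>A t. A \<ge> 0 \<Longrightarrow> t > 0 \<Longrightarrow> \<bar>kap lam (Suc m) A t\<bar> \<le> C * t powr (1 - real (Suc m)) * (A + t\<^sup>2) powr (- lam - 1)"
    using kap_bound' by blast
  \<comment> \<open>All times considered exceed \<open>t / 2\<close>, where the bounds, which
    decrease in time, are largest; this is why the majorant is taken at
    \<open>t / 2\<close>.\<close>
  have pos: "t' > t / 2" "t' > 0" if "\<bar>t' - t\<bar> < t / 2" for t' using that t unfolding abs_less_iff by linarith+
  have "((\<lambda>t. \<integral>a. w a * kap lam m (A a) t \<partial>M) has_real_derivative (\<integral>a. w a * kap lam (Suc m) (A a) t \<partial>M)) (at t)"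
  proof (rule has_real_derivative_lebesgue_integral[where F="\<lambda>t a. w a * kap lam m (A a) t" and F'="\<lambda>t a. w a * kap lam (Suc m) (A a) t" and d="t / 2"
      and h="\<lambda>a. C * (t / 2) powr (1 - real (Suc m)) * norm (w a * (A a + (t / 2)\<^sup>2) powr (- lam - 1))"])
    show "t / 2 > 0" using t by simp
    show "integrable M (\<lambda>a. w a * kap lam m (A a) t')" if "\<bar>t' - t\<bar> < t / 2" for t'
      using pos(2)[OF that] by (rule kap_integrable)
    show "((\<lambda>t. w a * kap lam m (A a) t) has_real_derivative w a * kap lam (Suc m) (A a) t') (at t')" if "\<bar>t' - t\<bar> < t / 2" for t' a
    proof (cases "w a = 0")
      case False
      show ?thesis by (rule DERIV_cmult[OF kap_deriv[OF A0[OF False] pos(2)[OF that]]])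
    qed simp
    show "\<bar>w a * kap lam (Suc m) (A a) t'\<bar> \<le> C * (t / 2) powr (1 - real (Suc m)) * norm (w a * (A a + (t / 2)\<^sup>2) powr (- lam - 1))"
      if t': "\<bar>t' - t\<bar> < t / 2" for t' a
    proof (cases "w a = 0")
      case False
      note A = A0[OF False]
      have sq: "(t / 2)\<^sup>2 \<le> t'\<^sup>2" using pos[OF t'] t by (intro power_mono) auto
      have "\<bar>kap lam (Suc m) (A a) t'\<bar> \<le> C * t' powr (1 - real (Suc m)) * (A a + t'\<^sup>2) powr (- lam - 1)"
        by (rule C(2)[OF A pos(2)[OF t']])
      also have "\<dots> \<le> C * (t / 2) powr (1 - real (Suc m)) * (A a + (t / 2)\<^sup>2) powr (- lam - 1)"
        using C(1) A pos[OF t'] t sq lam by (intro mult_mono powr_mono2' mult_nonneg_nonneg) (auto intro: add_nonneg_pos)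
      finally have "\<bar>w a\<bar> * \<bar>kap lam (Suc m) (A a) t'\<bar> \<le> \<bar>w a\<bar> * (C * (t / 2) powr (1 - real (Suc m)) * (A a + (t / 2)\<^sup>2) powr (- lam - 1))"
        by (intro mult_left_mono) auto
      then show ?thesis by (simp add: abs_mult mult_ac)
    qed simp
    show "integrable M (\<lambda>a. C * (t / 2) powr (1 - real (Suc m)) * norm (w a * (A a + (t / 2)\<^sup>2) powr (- lam - 1)))"
      using t by (intro integrable_mult_right integrable_norm integ_power1) simp
    show "(\<lambda>a. w a * kap lam (Suc m) (A a) t) \<in> borel_measurable M" by measurable
  qed
  then show ?thesis unfolding kint_def[abs_def] .
qed

lemma kphi_integrable:
  assumes "g > 0" "b > 0" "b \<ge> e" "real m = g + b" "t > 0"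
  shows "integrable M (\<lambda>a. w a * kphi lam m g (A a) t)"
proof -
  obtain C where C: "C \<ge> 0" "\<And>A t. A \<ge> 0 \<Longrightarrow> t > 0 \<Longrightarrow> \<bar>kphi lam m g A t\<bar> \<le> C * (A + t\<^sup>2) powr (- lam - (1 + b) / 2)"
    using kphi_bound[OF assms(1,2) lam assms(4)] by blast
  show ?thesis
  proof (rule Bochner_Integration.integrable_bound[OF integrable_mult_right[OF integ_power[OF assms(5,3)], of C] _ AE_I2])
    fix a
    show "norm (w a * kphi lam m g (A a) t) \<le> norm (C * (w a * (A a + t\<^sup>2) powr (- lam - (1 + b) / 2)))"
    proof (cases "w a = 0")
      case False
      from mult_left_mono[OF C(2)[OF A0[OF this] assms(5)], of "\<bar>w a\<bar>"] C(1) show ?thesis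
        by (simp add: abs_mult mult_ac)
    qed simp
  qed measurable
qed

text \<open>Fubini, with \<open>kap_tail_bound\<close> as absolute bound; \<open>b \<ge> e\<close>
  says that the decay left over is covered by \<open>integ\<close>.\<close>

lemma kint_tail:
  assumes "g > 0" "b > 0" "b \<ge> e" "real m = g + b" "t > 0"
  shows "(\<integral>\<^sub>Ls. pos s * (kint M w A lam m (t + s) * s powr (g - 1))) = (\<integral>a. w a * kphi lam m g (A a) t \<partial>M)"
proof -
  obtain C where C: "C \<ge> 0" "\<And>A t. A \<ge> 0 \<Longrightarrow> t > 0 \<Longrightarrow>
    (\<integral>\<^sub>+s. ennreal \<bar>pos s * (kap lam m A (t + s) * s powr (g - 1))\<bar>)
      \<le> ennreal (C * (A + t\<^sup>2) powr (- lam - (1 + b) / 2))"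
    using kap_tail_bound[OF assms(1,2) lam assms(4)] by blast
  define f where "f a s = w a * (pos s * (kap lam m (A a) (t + s) * s powr (g - 1)))" for a s
  have fm: "case_prod f \<in> borel_measurable (M \<Otimes>\<^sub>M lborel)" unfolding f_def[abs_def] by measurable
  have "(\<integral>\<^sup>+a. (\<integral>\<^sub>+s. ennreal \<bar>f a s\<bar>) \<partial>M) \<le> (\<integral>\<^sup>+a. ennreal (norm (C * (w a * (A a + t\<^sup>2) powr (- lam - (1 + b) / 2)))) \<partial>M)"
  proof (rule nn_integral_mono)
    fix a
    show "(\<integral>\<^sub>+s. ennreal \<bar>f a s\<bar>) \<le> ennreal (norm (C * (w a * (A a + t\<^sup>2) powr (- lam - (1 + b) / 2))))"
    proof (cases "w a = 0")
      case False
      have "(\<integral>\<^sub>+s. ennreal \<bar>f a s\<bar>) = (\<integral>\<^sub>+s. ennreal \<bar>w a\<bar> * ennreal \<bar>pos s * (kap lam m (A a) (t + s) * s powr (g - 1))\<bar>)"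
        unfolding f_def by (intro nn_integral_cong) (simp add: abs_mult ennreal_mult')
      also have "\<dots> = ennreal \<bar>w a\<bar> * (\<integral>\<^sub>+s. ennreal \<bar>pos s * (kap lam m (A a) (t + s) * s powr (g - 1))\<bar>)"
        by (rule nn_integral_cmult) measurable
      also have "\<dots> \<le> ennreal \<bar>w a\<bar> * ennreal (C * (A a + t\<^sup>2) powr (- lam - (1 + b) / 2))"
        by (intro mult_left_mono C(2) A0[OF False] assms) simp
      also have "\<dots> = ennreal (norm (C * (w a * (A a + t\<^sup>2) powr (- lam - (1 + b) / 2))))"
        using C(1) by (simp add: ennreal_mult'[symmetric] abs_mult mult_ac)
      finally show ?thesis .
    qed (simp add: f_def)
  qed
  also have "\<dots> < \<infinity>"
    using integrable_mult_right[OF integ_power[OF assms(5,3)], of C] by (simp only: integrable_iff_bounded)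
  finally have fin: "(\<integral>\<^sup>+a. (\<integral>\<^sub>+s. ennreal \<bar>f a s\<bar>) \<partial>M) < \<infinity>" .
  note swap = integral_swap_nonneg_bound[OF sf lborel.sigma_finite_measure_axioms fm fin]
  have "(\<integral>a. w a * kphi lam m g (A a) t \<partial>M) = (\<integral>a. (\<integral>\<^sub>Ls. f a s) \<partial>M)"
    unfolding kphi_def f_def by simp
  also have "\<dots> = (\<integral>\<^sub>Ls. (\<integral>a. f a s \<partial>M))" by (rule swap(2))
  also have "\<dots> = (\<integral>\<^sub>Ls. pos s * (kint M w A lam m (t + s) * s powr (g - 1)))"
  proof (rule Bochner_Integration.integral_cong[OF refl])
    fix s :: real
    have "(\<integral>a. f a s \<partial>M) = (\<integral>a. (pos s * s powr (g - 1)) * (w a * kap lam m (A a) (t + s)) \<partial>M)"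
      unfolding f_def by (intro Bochner_Integration.integral_cong refl) (simp only: mult_ac)
    then show "(\<integral>a. f a s \<partial>M) = pos s * (kint M w A lam m (t + s) * s powr (g - 1))"
      by (simp add: kint_def)
  qed
  finally show ?thesis ..
qed

lemma kint_inversion:
  assumes "g > 0" "b > 0" "e = 0" "real m = g + b" "t > 0"
  shows "(\<integral>\<^sub>Ls. pos s * ((\<integral>a. w a * kphi lam m g (A a) (t + s) \<partial>M) * s powr (b - 1)))
     = (-1) ^ m * Gamma b * Gamma g * kint M w A lam 0 t"
    and "integrable lborel (\<lambda>s. pos s * ((\<integral>a. w a * kphi lam m g (A a) (t + s) \<partial>M) * s powr (b - 1)))"
proof -
  obtain C where C: "C \<ge> 0" "\<And>A t. A \<ge> 0 \<Longrightarrow> t > 0 \<Longrightarrow>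
    (\<integral>\<^sub>+s. ennreal \<bar>pos s * (kphi lam m g A (t + s) * s powr (b - 1))\<bar>)
        \<le> ennreal (C * (A + t\<^sup>2) powr (- lam - 1 / 2))"
     "\<And>A t. A \<ge> 0 \<Longrightarrow> t > 0 \<Longrightarrow> (\<integral>\<^sub>Ls. pos s * (kphi lam m g A (t + s) * s powr (b - 1))) = (-1) ^ m * Gamma b * Gamma g * kap lam 0 A t"
    using kphi_inversion[OF assms(2,1) lam assms(4)] by blast
  define f where "f a s = w a * (pos s * (kphi lam m g (A a) (t + s) * s powr (b - 1)))" for a s
  have fm: "case_prod f \<in> borel_measurable (M \<Otimes>\<^sub>M lborel)" unfolding f_def[abs_def] by measurable
  have ip: "integrable M (\<lambda>a. w a * (A a + t\<^sup>2) powr (- lam - 1 / 2))" using integ_power[OF assms(5), of 0] assms(3) by simp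
  have "(\<integral>\<^sup>+a. (\<integral>\<^sub>+s. ennreal \<bar>f a s\<bar>) \<partial>M) \<le> (\<integral>\<^sup>+a. ennreal (norm (C * (w a * (A a + t\<^sup>2) powr (- lam - 1 / 2)))) \<partial>M)"
  proof (rule nn_integral_mono)
    fix a
    show "(\<integral>\<^sub>+s. ennreal \<bar>f a s\<bar>) \<le> ennreal (norm (C * (w a * (A a + t\<^sup>2) powr (- lam - 1 / 2))))"
    proof (cases "w a = 0")
      case False
      have "(\<integral>\<^sub>+s. ennreal \<bar>f a s\<bar>) = (\<integral>\<^sub>+s. ennreal \<bar>w a\<bar> * ennreal \<bar>pos s * (kphi lam m g (A a) (t + s) * s powr (b - 1))\<bar>)"
        unfolding f_def by (intro nn_integral_cong) (simp add: abs_mult ennreal_mult')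
      also have "\<dots> = ennreal \<bar>w a\<bar> * (\<integral>\<^sub>+s. ennreal \<bar>pos s * (kphi lam m g (A a) (t + s) * s powr (b - 1))\<bar>)"
        by (rule nn_integral_cmult) measurable
      also have "\<dots> \<le> ennreal \<bar>w a\<bar> * ennreal (C * (A a + t\<^sup>2) powr (- lam - 1 / 2))"
        by (intro mult_left_mono C(2) A0[OF False] assms) simp
      also have "\<dots> = ennreal (norm (C * (w a * (A a + t\<^sup>2) powr (- lam - 1 / 2))))"
        using C(1) by (simp add: ennreal_mult'[symmetric] abs_mult mult_ac)
      finally show ?thesis .
    qed (simp add: f_def)
  qed
  also have "\<dots> < \<infinity>"
    using integrable_mult_right[OF ip, of C] by (simp only: integrable_iff_bounded)
  finally have fin: "(\<integral>\<^sup>+a. (\<integral>\<^sub>+s. ennreal \<bar>f a s\<bar>) \<partial>M) < \<infinity>" .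
  note swap = integral_swap_nonneg_bound[OF sf lborel.sigma_finite_measure_axioms fm fin]
  have eq: "(\<integral>a. f a s \<partial>M) = pos s * ((\<integral>a. w a * kphi lam m g (A a) (t + s) \<partial>M) * s powr (b - 1))" for s
  proof -
    have "(\<integral>a. f a s \<partial>M) = (\<integral>a. (pos s * s powr (b - 1)) * (w a * kphi lam m g (A a) (t + s)) \<partial>M)"
      unfolding f_def by (intro Bochner_Integration.integral_cong refl) (simp only: mult_ac)
    then show ?thesis by simp
  qed
  show "integrable lborel (\<lambda>s. pos s * ((\<integral>a. w a * kphi lam m g (A a) (t + s) \<partial>M) * s powr (b - 1)))"
    using swap(4) by (simp only: eq)
  have "(\<integral>\<^sub>Ls. pos s * ((\<integral>a. w a * kphi lam m g (A a) (t + s) \<partial>M) * s powr (b - 1))) = (\<integral>\<^sub>Ls. (\<integral>a. f a s \<partial>M))"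
    by (simp only: eq)
  also have "\<dots> = (\<integral>a. (\<integral>\<^sub>Ls. f a s) \<partial>M)" by (rule swap(2)[symmetric])
  also have "\<dots> = (\<integral>a. ((-1) ^ m * Gamma b * Gamma g) * (w a * kap lam 0 (A a) t) \<partial>M)"
  proof (rule Bochner_Integration.integral_cong[OF refl])
    fix a
    show "(\<integral>\<^sub>Ls. f a s) = ((-1) ^ m * Gamma b * Gamma g) * (w a * kap lam 0 (A a) t)"
    proof (cases "w a = 0")
      case False
      then show ?thesis unfolding f_def using C(3)[OF A0[OF False] assms(5)] by simp
    qed (simp add: f_def)
  qed
  finally show "(\<integral>\<^sub>Ls. pos s * ((\<integral>a. w a * kphi lam m g (A a) (t + s) \<partial>M) * s powr (b - 1)))
     = (-1) ^ m * Gamma b * Gamma g * kint M w A lam 0 t" by (simp add: kint_def)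
qed

end

subsection \<open>Fractional derivatives of Poisson extensions\<close>

text \<open>\<open>f\<close> is integrable against the size of the Poisson kernel; an \<open>e > 0\<close> admits the function \<open>y powr lam\<close>, fixed by the semigroup.\<close>

definition adm :: "real \<Rightarrow> real \<Rightarrow> (real \<Rightarrow> real) \<Rightarrow> bool" where
  "adm lam e f \<longleftrightarrow> integrable lborel (\<lambda>y. pos y * (f y * (y powr lam * (1 + y) powr (- 2 * lam - 1 - e))))"

text \<open>Density of \<open>P_t f (x)\<close> with respect to \<open>PM lam\<close>. The
  indicators confine it to \<open>(0, \<infinity>) \<times> (-1, 1)\<close>, so that only the values
  of \<open>f\<close> on the half line count and \<open>qfp\<close> is nonnegative on the
  support.\<close>

definition wt :: "real \<Rightarrow> real \<Rightarrow> (real \<Rightarrow> real) \<Rightarrow> real \<times> real \<Rightarrow> real" where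
  "wt lam x f z = 2 * lam / pi * (x * fst z) powr lam * (pos (fst z) * f (fst z)) * indicator {-1<..<1} (snd z)"

definition qfp :: "real \<Rightarrow> real \<times> real \<Rightarrow> real" where "qfp x z = qf x (fst z) (snd z)"

abbreviation PM :: "real \<Rightarrow> (real \<times> real) measure" where "PM lam \<equiv> lborel \<Otimes>\<^sub>M bmeas lam"

lemma adm_mono:
  assumes "adm lam e f" "e \<le> e'" shows "adm lam e' f"
  unfolding adm_def
proof (rule Bochner_Integration.integrable_bound[OF assms(1)[unfolded adm_def] _ AE_I2])
  have [measurable]: "(\<lambda>y. pos y * (f y * (y powr lam * (1 + y) powr (- 2 * lam - 1 - e)))) \<in> borel_measurable lborel"
    using assms(1) unfolding adm_def by (rule borel_measurable_integrable)
  have eq: "(\<lambda>y. pos y * (f y * (y powr lam * (1 + y) powr (- 2 * lam - 1 - e'))))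
    = (\<lambda>y. (pos y * (f y * (y powr lam * (1 + y) powr (- 2 * lam - 1 - e)))) * (1 + y) powr (e - e'))"
  proof
    fix y :: real
    have "(1 + y) powr (- 2 * lam - 1 - e') = (1 + y) powr (- 2 * lam - 1 - e) * (1 + y) powr (e - e')"
      by (subst powr_add[symmetric]) (rule powr_exp_cong, simp)
    then show "pos y * (f y * (y powr lam * (1 + y) powr (- 2 * lam - 1 - e')))
      = (pos y * (f y * (y powr lam * (1 + y) powr (- 2 * lam - 1 - e)))) * (1 + y) powr (e - e')" by simp
  qed
  show "(\<lambda>y. pos y * (f y * (y powr lam * (1 + y) powr (- 2 * lam - 1 - e')))) \<in> borel_measurable lborel"
    unfolding eq by measurable
  fix y :: real
  show "norm (pos y * (f y * (y powr lam * (1 + y) powr (- 2 * lam - 1 - e'))))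
    \<le> norm (pos y * (f y * (y powr lam * (1 + y) powr (- 2 * lam - 1 - e))))"
    using assms(2) by (auto simp: abs_mult intro!: mult_left_mono powr_mono split: split_indicator)
qed

lemma adm_measurable:
  assumes "adm lam e f" shows "(\<lambda>y. pos y * f y) \<in> borel_measurable borel"
proof -
  have [measurable]: "(\<lambda>y. pos y * (f y * (y powr lam * (1 + y) powr (- 2 * lam - 1 - e)))) \<in> borel_measurable lborel"
    using assms unfolding adm_def by (rule borel_measurable_integrable)
  have "(\<lambda>y. pos y * f y) = (\<lambda>y. (pos y * (f y * (y powr lam * (1 + y) powr (- 2 * lam - 1 - e)))) / (y powr lam * (1 + y) powr (- 2 * lam - 1 - e)))"
    by (rule ext) (auto split: split_indicator)
  also have "\<dots> \<in> borel_measurable borel" by measurable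
  finally show ?thesis .
qed

lemma adm_add:
  assumes "adm lam e f" "adm lam e h" shows "adm lam e (\<lambda>y. f y + h y)"
  using Bochner_Integration.integrable_add[OF assms[unfolded adm_def]] unfolding adm_def by (simp add: algebra_simps)

lemma adm_cmult:
  assumes "adm lam e f" shows "adm lam e (\<lambda>y. c * f y)"
  using integrable_mult_right[OF assms[unfolded adm_def], of c] unfolding adm_def by (simp add: mult_ac)

lemma integrable_one_plus_powr:
  assumes "e > 0" shows "integrable lborel (\<lambda>y. pos y * (1 + y) powr (- e - 1) :: real)"
proof (rule integrableI_bounded)
  have "(\<integral>\<^sub>+y. ennreal (norm (pos y * (1 + y) powr (- e - 1) :: real)))
     = (\<integral>\<^sub>+y. ennreal ((1 + 1 * y) powr (- e - 1)) * indicator {1<..} (1 + 1 * y))"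
    by (intro nn_integral_cong) (auto split: split_indicator)
  also have "\<dots> = (\<integral>\<^sup>+y\<in>{1<..}. ennreal (y powr (- e - 1)) \<partial>lborel)"
    using nn_integral_real_affine[of "\<lambda>y. ennreal (y powr (- e - 1)) * indicator {1<..} y" 1 1] by simp
  also have "\<dots> < \<infinity>" using nn_integral_powr_inf[OF assms, of 1] by simp
  finally show "(\<integral>\<^sub>+y. ennreal (norm (pos y * (1 + y) powr (- e - 1) :: real))) < \<infinity>" .
qed measurable

lemma adm_powr:
  assumes "e > 0" "lam > 0" shows "adm lam e (\<lambda>y. y powr lam)"
  unfolding adm_def
proof (rule Bochner_Integration.integrable_bound[OF integrable_one_plus_powr[OF assms(1)] _ AE_I2])
  fix y :: real
  have "y powr lam * (y powr lam * (1 + y) powr (- 2 * lam - 1 - e)) \<le> (1 + y) powr (- e - 1)" if "y > 0"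
  proof -
    have "y powr lam * (y powr lam * (1 + y) powr (- 2 * lam - 1 - e)) \<le> (1 + y) powr lam * ((1 + y) powr lam * (1 + y) powr (- 2 * lam - 1 - e))"
      using that assms by (intro mult_mono mult_right_mono powr_mono2 mult_nonneg_nonneg) auto
    also have "\<dots> = (1 + y) powr (- e - 1)"
      by (subst powr_add[symmetric])+ (rule powr_exp_cong, simp)
    finally show ?thesis .
  qed
  then show "norm (pos y * (y powr lam * (y powr lam * (1 + y) powr (- 2 * lam - 1 - e)))) \<le> norm (pos y * (1 + y) powr (- e - 1))"
    by (auto simp: abs_mult split: split_indicator)
qed measurable

text \<open>Since \<open>y \<le> 1 + y\<close> and \<open>min lam \<beta> \<le> lam\<close>, the
  weight \<open>y powr lam * (1 + y) powr (- 2 * lam - 1)\<close> is at most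
  \<open>(1 + y) powr (- 1 - min lam \<beta>)\<close>.\<close>

lemma L_space_adm:
  assumes "f \<in> L_space (min lam \<beta> / 2)" "lam > 0" "\<beta> > 0" shows "adm lam 0 f"
  unfolding adm_def
proof (rule Bochner_Integration.integrable_bound[OF _ _ AE_I2])
  let ?g = "\<lambda>x. pos x * (f x * (1 + x) powr (- 1 - min lam \<beta>))"
  show i: "integrable lborel ?g" using assms(1) by (simp add: L_space_def set_integrable_def)
  have [measurable]: "?g \<in> borel_measurable lborel" using i by (rule borel_measurable_integrable)
  have eq: "(\<lambda>y. pos y * (f y * (y powr lam * (1 + y) powr (- 2 * lam - 1 - 0))))
    = (\<lambda>y. ?g y * (y powr lam * (1 + y) powr (min lam \<beta> - 2 * lam)))"
  proof
    fix y :: real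
    have "(1 + y) powr (- 2 * lam - 1 - 0) = (1 + y) powr (- 1 - min lam \<beta>) * (1 + y) powr (min lam \<beta> - 2 * lam)"
      by (subst powr_add[symmetric]) (rule powr_exp_cong, simp)
    then show "pos y * (f y * (y powr lam * (1 + y) powr (- 2 * lam - 1 - 0))) = ?g y * (y powr lam * (1 + y) powr (min lam \<beta> - 2 * lam))"
      by simp
  qed
  show "(\<lambda>y. pos y * (f y * (y powr lam * (1 + y) powr (- 2 * lam - 1 - 0)))) \<in> borel_measurable lborel"
    unfolding eq by measurable
  fix y :: real
  have "y powr lam * (1 + y) powr (- 2 * lam - 1 - 0) \<le> (1 + y) powr (- 1 - min lam \<beta>)" if "y > 0"
  proof -
    have "y powr lam * (1 + y) powr (- 2 * lam - 1 - 0) \<le> (1 + y) powr lam * (1 + y) powr (- 2 * lam - 1 - 0)"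
      using that assms by (intro mult_right_mono powr_mono2) auto
    also have "\<dots> = (1 + y) powr (- lam - 1)" by (subst powr_add[symmetric]) (rule powr_exp_cong, simp)
    also have "\<dots> \<le> (1 + y) powr (- 1 - min lam \<beta>)" using that by (intro powr_mono) auto
    finally show ?thesis .
  qed
  then show "norm (pos y * (f y * (y powr lam * (1 + y) powr (- 2 * lam - 1 - 0)))) \<le> norm (?g y)"
    by (auto simp: abs_mult intro!: mult_left_mono split: split_indicator)
qed

lemma sigma_finite_PM:
  assumes "lam > 0" shows "sigma_finite_measure (PM lam)"
proof -
  interpret B: finite_measure "bmeas lam" by (rule finite_measure_bmeas[OF assms])
  interpret P: pair_sigma_finite lborel "bmeas lam" ..
  show ?thesis by (rule P.P.sigma_finite_measure_axioms)
qed

lemma qfp_nonneg: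
  assumes "wt lam x f z \<noteq> 0" shows "0 \<le> qfp x z"
proof -
  have u: "-1 < snd z" "snd z < 1" using assms by (auto simp: wt_def indicator_def split: if_splits)
  have "(snd z)\<^sup>2 \<le> 1" using u by (simp add: abs_square_le_1 abs_le_iff)
  then have "0 \<le> (x - fst z * snd z)\<^sup>2 + (fst z)\<^sup>2 * (1 - (snd z)\<^sup>2)" by (intro add_nonneg_nonneg mult_nonneg_nonneg) auto
  also have "\<dots> = qfp x z" by (simp add: qfp_def qf_def power2_eq_square algebra_simps)
  finally show ?thesis .
qed

text \<open>From \<open>1 + y \<le> (1 + x) * (1 + \<bar>x - y\<bar>)\<close>. Weights centred at
  \<open>x\<close> are thereby replaced by weights centred at the origin, at a cost that depends on
  \<open>x\<close> only.\<close>

lemma one_plus_le: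
  assumes "x > 0" "y > (0::real)" shows "(1 + y)\<^sup>2 / (2 * (1 + x)\<^sup>2) \<le> (x - y)\<^sup>2 + 1"
proof -
  define d where "d = \<bar>x - y\<bar>"
  have "1 + y \<le> 1 + x + d" by (simp add: d_def)
  also have "\<dots> \<le> (1 + x) * (1 + d)" using assms by (simp add: algebra_simps d_def)
  finally have "(1 + y)\<^sup>2 \<le> ((1 + x) * (1 + d))\<^sup>2" using assms by (intro power_mono) auto
  also have "\<dots> = (1 + x)\<^sup>2 * (1 + d)\<^sup>2" by (rule power_mult_distrib)
  also have "(1 + d)\<^sup>2 \<le> 2 * (d\<^sup>2 + 1)"
    using zero_le_power2[of "d - 1"] by (simp add: power2_eq_square algebra_simps)
  also have "d\<^sup>2 = (x - y)\<^sup>2" by (simp add: d_def)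
  finally have "(1 + y)\<^sup>2 \<le> (1 + x)\<^sup>2 * (2 * ((x - y)\<^sup>2 + 1))" using assms by simp
  then have "(1 + y)\<^sup>2 \<le> ((x - y)\<^sup>2 + 1) * (2 * (1 + x)\<^sup>2)" by (simp only: mult_ac)
  then show ?thesis by (subst pos_divide_le_eq) (use assms in simp, assumption)
qed

lemma wt_measurable [measurable (raw)]:
  assumes f: "(\<lambda>y. pos y * f y :: real) \<in> borel_measurable borel"
    and [measurable]: "h \<in> borel_measurable N" "k \<in> N \<rightarrow>\<^sub>M (borel \<Otimes>\<^sub>M borel)"
  shows "(\<lambda>a. wt lam (h a) f (k a)) \<in> borel_measurable N"
proof -
  have [measurable]: "(\<lambda>a. pos (fst (k a)) * f (fst (k a))) \<in> borel_measurable N"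
    by (rule measurable_compose[OF _ f]) measurable
  show ?thesis unfolding wt_def by measurable
qed

lemma qfp_measurable [measurable (raw)]:
  assumes [measurable]: "h \<in> borel_measurable N" "k \<in> N \<rightarrow>\<^sub>M (borel \<Otimes>\<^sub>M borel)"
  shows "(\<lambda>a. qfp (h a) (k a)) \<in> borel_measurable N"
  unfolding qfp_def by measurable

lemma id_PM_measurable [measurable]: "(\<lambda>z. z) \<in> PM lam \<rightarrow>\<^sub>M (borel \<Otimes>\<^sub>M borel)"
proof -
  have "sets (PM lam) = sets (borel \<Otimes>\<^sub>M borel)" by (intro sets_pair_measure_cong) auto
  then show ?thesis by (simp cong: measurable_cong_sets)
qed

lemma kernel_weight_wt:
  assumes f: "adm lam e f" and lam: "lam > 0" and e: "0 \<le> e" "e \<le> 1" and x: "x > 0"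
  shows "kernel_weight (PM lam) (wt lam x f) (qfp x) lam e"
proof -
  interpret B: finite_measure "bmeas lam" by (rule finite_measure_bmeas[OF lam])
  have fm: "(\<lambda>y. pos y * f y :: real) \<in> borel_measurable borel" by (rule adm_measurable[OF f])
  note [measurable] = wt_measurable[OF fm]
  let ?p = "- lam - (1 + e) / 2"
  define G where "G = (\<lambda>y. pos y * (f y * (y powr lam * (1 + y) powr (- 2 * lam - 1 - e))))"
  have gi: "integrable lborel G" using f by (simp add: adm_def G_def)
  then have [measurable]: "G \<in> borel_measurable borel" using borel_measurable_integrable by force
  define K where "K = 2 * lam / pi * x powr lam * (2 * (1 + x)\<^sup>2) powr (- ?p)"
  have K: "K \<ge> 0" using lam by (simp add: K_def)
  have hi: "integrable (PM lam) (\<lambda>z. K * G (fst z))"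
  proof -
    have "integrable (PM lam) (case_prod (\<lambda>y (u::real). K * G y))"
    proof (rule integral_swap_nonneg_bound(1)[OF lborel.sigma_finite_measure_axioms B.sigma_finite_measure_axioms])
      show "case_prod (\<lambda>y (u::real). K * G y) \<in> borel_measurable (PM lam)" by measurable
      have "(\<integral>\<^sub>+y. (\<integral>\<^sup>+u. ennreal \<bar>K * G y\<bar> \<partial>bmeas lam)) = (\<integral>\<^sub>+y. ennreal (norm (K * G y))) * emeasure (bmeas lam) UNIV"
        by (subst nn_integral_multc[symmetric]) simp_all
      also have "\<dots> < \<infinity>"
        using integrable_mult_right[OF gi, of K] unfolding integrable_iff_bounded
        by (simp add: ennreal_mult_less_top B.emeasure_eq_measure)
      finally show "(\<integral>\<^sub>+y. (\<integral>\<^sup>+u. ennreal \<bar>K * G y\<bar> \<partial>bmeas lam)) < \<infinity>" .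
    qed
    then show ?thesis by (simp add: split_beta')
  qed
  show ?thesis
  proof (rule kernel_weight.intro)
    show "sigma_finite_measure (PM lam)" by (rule sigma_finite_PM[OF lam])
    show "wt lam x f \<in> borel_measurable (PM lam)" by measurable
    show "qfp x \<in> borel_measurable (PM lam)" by measurable
    show "integrable (PM lam) (\<lambda>a. wt lam x f a * (qfp x a + 1) powr ?p)"
    proof (rule Bochner_Integration.integrable_bound[OF hi _ AE_I2])
      show "(\<lambda>a. wt lam x f a * (qfp x a + 1) powr ?p) \<in> borel_measurable (PM lam)" by measurable
      fix z :: "real \<times> real"
      obtain y u where z: "z = (y, u)" by (cases z)
      show "norm (wt lam x f z * (qfp x z + 1) powr ?p) \<le> norm (K * G (fst z))"
      proof (cases "y > 0 \<and> -1 < u \<and> u < 1")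
        case True
        then have y: "y > 0" by simp
        have "(1 + y)\<^sup>2 / (2 * (1 + x)\<^sup>2) \<le> qf x y u + 1"
          using one_plus_le[OF x y] qf_ge[of x y u] x True by linarith
        then have "(qf x y u + 1) powr ?p \<le> ((1 + y)\<^sup>2 / (2 * (1 + x)\<^sup>2)) powr ?p"
          using lam e x y by (intro powr_mono2') auto
        also have "\<dots> = (2 * (1 + x)\<^sup>2) powr (- ?p) * (1 + y) powr (- 2 * lam - 1 - e)"
        proof -
          have "((1 + y)\<^sup>2 / (2 * (1 + x)\<^sup>2)) powr ?p = ((1 + y)\<^sup>2) powr ?p / (2 * (1 + x)\<^sup>2) powr ?p" by (rule powr_divide)
          also have "((1 + y)\<^sup>2) powr ?p = (1 + y) powr (- 2 * lam - 1 - e)"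
            using y by (subst square_powr) (auto intro!: powr_exp_cong simp: field_simps)
          also have "(1 + y) powr (- 2 * lam - 1 - e) / (2 * (1 + x)\<^sup>2) powr ?p = (2 * (1 + x)\<^sup>2) powr (- ?p) * (1 + y) powr (- 2 * lam - 1 - e)"
            by (subst powr_minus[of "2 * (1 + x)\<^sup>2" ?p]) (rule trans[OF divide_inverse mult.commute])
          finally show ?thesis .
        qed
        finally have "2 * lam / pi * (x powr lam * y powr lam) * \<bar>f y\<bar> * (qf x y u + 1) powr ?p
          \<le> 2 * lam / pi * (x powr lam * y powr lam) * \<bar>f y\<bar> * ((2 * (1 + x)\<^sup>2) powr (- ?p) * (1 + y) powr (- 2 * lam - 1 - e))"
          using lam by (intro mult_left_mono) auto
        then show ?thesis using True K lam by (simp add: z wt_def qfp_def K_def G_def abs_mult powr_mult mult_ac)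
      qed (auto simp: z wt_def)
    qed
  qed (use lam e qfp_nonneg in auto)
qed

text \<open>Up to a phase, \<open>Vker\<close> is \<open>Gamma g\<close> times the fractional derivative of the Poisson extension of \<open>f\<close>, and \<open>Uker\<close> is the
  \<open>m\<close>-th \<open>t\<close>-derivative of the extension itself.\<close>

definition Vker :: "real \<Rightarrow> nat \<Rightarrow> real \<Rightarrow> (real \<Rightarrow> real) \<Rightarrow> real \<Rightarrow> real \<Rightarrow> real" where
  "Vker lam m g f t x = (\<integral>z. wt lam x f z * kphi lam m g (qfp x z) t \<partial>PM lam)"

definition Uker :: "real \<Rightarrow> nat \<Rightarrow> (real \<Rightarrow> real) \<Rightarrow> real \<Rightarrow> real \<Rightarrow> real" where
  "Uker lam m f t x = kint (PM lam) (wt lam x f) (qfp x) lam m t"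

lemma wt_integral_snd:
  assumes "lam > 0" "x > 0" "y > 0" and [measurable]: "F \<in> borel_measurable borel"
  shows "(\<integral>u. wt lam x f (y, u) * F (qfp x (y, u)) \<partial>bmeas lam) = 2 * lam / pi * (x * y) powr lam * f y * (\<integral>u. F (qf x y u) \<partial>bmeas lam)"
proof -
  have "(\<integral>u. wt lam x f (y, u) * F (qfp x (y, u)) \<partial>bmeas lam) = (\<integral>u. 2 * lam / pi * (x * y) powr lam * f y * (indicator {-1<..<1} u * F (qf x y u)) \<partial>bmeas lam)"
    using assms(1-3) by (intro Bochner_Integration.integral_cong refl) (simp add: wt_def qfp_def mult_ac)
  also have "\<dots> = 2 * lam / pi * (x * y) powr lam * f y * (\<integral>u. indicator {-1<..<1} u * F (qf x y u) \<partial>bmeas lam)"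
    by (rule integral_mult_right_zero)
  also have "(\<integral>u. indicator {-1<..<1} u * F (qf x y u) \<partial>bmeas lam) = (\<integral>u. F (qf x y u) \<partial>bmeas lam)"
  proof (rule integral_cong_AE)
    show "AE u in bmeas lam. indicator {-1<..<1} u * F (qf x y u) = F (qf x y u)"
      using AE_bmeas by eventually_elim auto
  qed measurable
  finally show ?thesis .
qed

lemma Uker_0:
  assumes f: "adm lam e f" and lam: "lam > 0" and e: "0 \<le> e" "e \<le> 1" and "x > 0" "t > 0"
  shows "integrable lborel (\<lambda>y. pos y * (pker lam t x y * f y))"
    and "Uker lam 0 f t x = (\<integral>\<^sub>Ly. pos y * (pker lam t x y * f y))"
proof -
  interpret B: finite_measure "bmeas lam" by (rule finite_measure_bmeas[OF lam])
  interpret P: pair_sigma_finite lborel "bmeas lam" ..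
  interpret K: kernel_weight "PM lam" "wt lam x f" "qfp x" lam e by (rule kernel_weight_wt[OF f lam e \<open>x > 0\<close>])
  have I: "integrable (PM lam) (\<lambda>z. wt lam x f z * kap lam 0 (qfp x z) t)" by (rule K.kap_integrable[OF \<open>t > 0\<close>])
  have eq: "(\<integral>u. wt lam x f (y, u) * kap lam 0 (qfp x (y, u)) t \<partial>bmeas lam) = pos y * (pker lam t x y * f y)" for y
  proof (cases "y > 0")
    case True
    then show ?thesis using wt_integral_snd[OF lam \<open>x > 0\<close> True, where f=f and F="\<lambda>A. kap lam 0 A t"] by (simp add: pker_def mult_ac)
  qed (simp add: wt_def)
  show "integrable lborel (\<lambda>y. pos y * (pker lam t x y * f y))"
    using P.integrable_fst'[OF I] by (simp only: eq)
  show "Uker lam 0 f t x = (\<integral>\<^sub>Ly. pos y * (pker lam t x y * f y))"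
    unfolding Uker_def kint_def using P.integral_fst'[OF I] by (simp only: eq)
qed

lemma poisson_op_eq:
  assumes f: "adm lam e f" and lam: "lam > 0" and e: "0 \<le> e" "e \<le> 1" and "x > 0" "t > 0"
  shows "poisson_op lam f t x = Uker lam 0 f t x"
  unfolding poisson_op_def Uker_0(2)[OF assms] set_lebesgue_integral_def
  using poisson_kernel_eq[OF lam \<open>t > 0\<close> \<open>x > 0\<close>] by (intro Bochner_Integration.integral_cong refl) (auto split: split_indicator)

lemma Uker_deriv:
  assumes f: "adm lam e f" and lam: "lam > 0" and e: "0 \<le> e" "e \<le> 1" and "x > 0" "t > 0"
  shows "((\<lambda>t. Uker lam m f t x) has_real_derivative Uker lam (Suc m) f t x) (at t)"
proof -
  interpret K: kernel_weight "PM lam" "wt lam x f" "qfp x" lam e by (rule kernel_weight_wt[OF f lam e \<open>x > 0\<close>])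
  show ?thesis unfolding Uker_def using K.kint_deriv[OF \<open>t > 0\<close>] by simp
qed

text \<open>Derivatives are local, so agreement of \<open>F\<close> with \<open>G 0\<close> on the
  open half line is enough. This turns the iterated \<open>deriv\<close> in the fractional
  derivative into \<open>Uker\<close>.\<close>

lemma higher_deriv_chain:
  fixes F :: "real \<Rightarrow> real" and G :: "nat \<Rightarrow> real \<Rightarrow> real"
  assumes "\<And>t. t > 0 \<Longrightarrow> F t = G 0 t" and "\<And>k t. t > 0 \<Longrightarrow> (G k has_real_derivative G (Suc k) t) (at t)"
  shows "t > 0 \<Longrightarrow> (deriv ^^ k) F t = G k t"
proof (induction k arbitrary: t)
  case (Suc k)
  have "((deriv ^^ k) F has_real_derivative G (Suc k) t) (at t)"
    by (rule has_field_derivative_transform_within_open[OF assms(2)[OF Suc.prems], of "{0<..}"]) (use Suc in auto)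
  then show ?case by (simp add: DERIV_imp_deriv)
qed (use assms in simp)

text \<open>Both chains compute the iterated derivatives of the same function. Two integral
  representations are thus identified at every order from their agreement at order 0.\<close>

lemma chain_unique:
  fixes G H :: "nat \<Rightarrow> real \<Rightarrow> real"
  assumes "\<And>t. t > 0 \<Longrightarrow> H 0 t = G 0 t"
    and "\<And>k t. t > 0 \<Longrightarrow> (G k has_real_derivative G (Suc k) t) (at t)"
    and "\<And>k t. t > 0 \<Longrightarrow> (H k has_real_derivative H (Suc k) t) (at t)"
    and "t > 0"
  shows "H k t = G k t"
  using higher_deriv_chain[of "H 0" G t k] higher_deriv_chain[of "H 0" H t k] assms by simp

text \<open>The phase has modulus one, so only the factor \<open>1 / Gamma g\<close> survives in
  \<open>cmod\<close>; \<open>e \<le> \<beta>\<close> is what \<open>kint_tail\<close> asks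
  for.\<close>

lemma poisson_frac_deriv_eq:
  assumes f: "adm lam e f" and lam: "lam > 0" and e: "0 \<le> e" "e \<le> 1" "e \<le> \<beta>" and xt: "x > 0" "t > 0" and b: "\<beta> > 0"
    and m: "m = frac_order \<beta>" and g: "g = real m - \<beta>"
  shows "cmod (poisson_frac_deriv lam \<beta> f t x) = \<bar>Vker lam m g f t x\<bar> / Gamma g"
proof -
  interpret K: kernel_weight "PM lam" "wt lam x f" "qfp x" lam e by (rule kernel_weight_wt[OF f lam e(1,2) \<open>x > 0\<close>])
  have gp: "g > 0" using frac_order_iff[OF b, of m] m g by simp
  have d: "(deriv ^^ m) (\<lambda>\<tau>. poisson_op lam f \<tau> x) (t + s) = Uker lam m f (t + s) x" if "s > 0" for s
    by (rule higher_deriv_chain[where G="\<lambda>m t. Uker lam m f t x"])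
      (use poisson_op_eq[OF f lam e(1,2) xt(1)] Uker_deriv[OF f lam e(1,2) xt(1)] that xt in auto)
  have "(LBINT s:{0<..}. (deriv ^^ m) (\<lambda>\<tau>. poisson_op lam f \<tau> x) (t + s) * s powr (g - 1))
    = (\<integral>\<^sub>Ls. pos s * (Uker lam m f (t + s) x * s powr (g - 1)))"
    unfolding set_lebesgue_integral_def by (intro Bochner_Integration.integral_cong refl) (auto simp: d split: split_indicator)
  also have "\<dots> = Vker lam m g f t x"
    unfolding Vker_def Uker_def using gp g e b xt by (intro K.kint_tail) auto
  finally have I: "(LBINT s:{0<..}. (deriv ^^ m) (\<lambda>\<tau>. poisson_op lam f \<tau> x) (t + s) * s powr (g - 1)) = Vker lam m g f t x" .
  have "Gamma g > 0" using gp by (simp add: Gamma_real_pos)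
  moreover have "cmod (exp (- \<i> * complex_of_real (pi * g))) = 1" by (simp add: norm_exp_eq_Re)
  ultimately show ?thesis unfolding poisson_frac_deriv_def frac_deriv_def Let_def m[symmetric] g[symmetric] I
    by (simp add: norm_mult norm_divide)
qed

lemma Vker_measurable [measurable (raw)]:
  assumes lam: "lam > 0" and f: "(\<lambda>y. pos y * f y :: real) \<in> borel_measurable borel"
    and [measurable]: "h \<in> borel_measurable N" "k \<in> borel_measurable N"
  shows "(\<lambda>a. Vker lam m g f (h a) (k a)) \<in> borel_measurable N"
proof -
  interpret S: sigma_finite_measure "PM lam" by (rule sigma_finite_PM[OF lam])
  note [measurable] = wt_measurable[OF f]
  have [measurable]: "(\<lambda>z. snd z) \<in> N \<Otimes>\<^sub>M PM lam \<rightarrow>\<^sub>M (borel \<Otimes>\<^sub>M borel)"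
    by (rule measurable_compose[OF measurable_snd id_PM_measurable])
  show ?thesis unfolding Vker_def by (rule S.borel_measurable_lebesgue_integral) measurable
qed

section \<open>Compatibility of the fractional derivative with the semigroup\<close>

lemma divide_powr_minus: "a / b powr (- c) = b powr c * (a::real)"
  by (simp add: powr_minus divide_inverse mult.commute)

text \<open>For \<open>r \<ge> 1\<close> the factor \<open>r\<close> of the kernel is absorbed by
  half a power of \<open>(x - z)\<^sup>2 + r\<^sup>2\<close>, at the price of one order of decay.
  What remains is the weight of \<open>adm\<close> with \<open>e = 0\<close>, uniformly in
  \<open>r\<close>.\<close>

lemma pker_far_bound:
  assumes lam: "lam > 0" and x: "x > 0"
  shows "\<exists>D\<ge>0. \<forall>r\<ge>1. \<forall>z>0. pker lam r x z \<le> D * (z powr lam * (1 + z) powr (- 2 * lam - 1))"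
proof -
  define D where "D = bmass lam * x powr lam * (2 * (1 + x)\<^sup>2) powr (lam + 1 / 2)"
  have D: "D \<ge> 0" using bmass_nonneg[OF lam] by (simp add: D_def)
  have "pker lam r x z \<le> D * (z powr lam * (1 + z) powr (- 2 * lam - 1))" if r: "r \<ge> 1" and z: "z > 0" for r z
  proof -
    let ?R = "(x - z)\<^sup>2 + r\<^sup>2"
    have Rp: "?R > 0" using r by (intro add_nonneg_pos) auto
    have "r = (r\<^sup>2) powr (1 / 2)" using r by (simp add: powr_half_sqrt)
    also have "\<dots> \<le> ?R powr (1 / 2)" by (intro powr_mono2) auto
    finally have r1: "r \<le> ?R powr (1 / 2)" .
    have "1\<^sup>2 \<le> r\<^sup>2" using r by (intro power_mono) auto
    then have ge: "(1 + z)\<^sup>2 / (2 * (1 + x)\<^sup>2) \<le> ?R" using one_plus_le[OF x z] by simp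
    have "pker lam r x z \<le> bmass lam * r * (x * z) powr lam * ?R powr (- lam - 1)"
      using lam r x z by (intro pker_le) auto
    also have "\<dots> \<le> bmass lam * ?R powr (1 / 2) * (x * z) powr lam * ?R powr (- lam - 1)"
      using r1 r bmass_nonneg[OF lam] by (intro mult_right_mono mult_left_mono) auto
    also have "\<dots> = bmass lam * (x * z) powr lam * (?R powr (1 / 2) * ?R powr (- lam - 1))" by (simp only: mult_ac)
    also have "?R powr (1 / 2) * ?R powr (- lam - 1) = ?R powr (- (lam + 1 / 2))"
      by (subst powr_add[symmetric]) (rule powr_exp_cong, simp)
    also have "bmass lam * (x * z) powr lam * ?R powr (- (lam + 1 / 2)) \<le> bmass lam * (x * z) powr lam * ((1 + z)\<^sup>2 / (2 * (1 + x)\<^sup>2)) powr (- (lam + 1 / 2))"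
      using ge bmass_nonneg[OF lam] lam x z by (intro mult_left_mono powr_mono2') auto
    also have "((1 + z)\<^sup>2 / (2 * (1 + x)\<^sup>2)) powr (- (lam + 1 / 2)) = (2 * (1 + x)\<^sup>2) powr (lam + 1 / 2) * (1 + z) powr (- 2 * lam - 1)"
    proof -
      have "((1 + z)\<^sup>2 / (2 * (1 + x)\<^sup>2)) powr (- (lam + 1 / 2)) = ((1 + z)\<^sup>2) powr (- (lam + 1 / 2)) / (2 * (1 + x)\<^sup>2) powr (- (lam + 1 / 2))"
        by (rule powr_divide)
      also have "((1 + z)\<^sup>2) powr (- (lam + 1 / 2)) = (1 + z) powr (- 2 * lam - 1)"
        using z by (subst square_powr) (auto intro!: powr_exp_cong)
      finally show ?thesis unfolding divide_powr_minus .
    qed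
    also have "bmass lam * (x * z) powr lam * ((2 * (1 + x)\<^sup>2) powr (lam + 1 / 2) * (1 + z) powr (- 2 * lam - 1)) = D * (z powr lam * (1 + z) powr (- 2 * lam - 1))"
      unfolding D_def powr_mult[of x z] by (simp only: mult_ac)
    finally show ?thesis .
  qed
  then show ?thesis using D by blast
qed

text \<open>The density that expresses \<open>P_s P_t f (x)\<close> as a superposition of profiles
  in \<open>t\<close>; the first component is the intermediate point between the two
  kernels.\<close>

definition Vmeas_w :: "real \<Rightarrow> real \<Rightarrow> real \<Rightarrow> (real \<Rightarrow> real) \<Rightarrow> real \<times> real \<times> real \<Rightarrow> real" where
  "Vmeas_w lam s x f a = pos (fst a) * pker lam s x (fst a) * wt lam (fst a) f (snd a)"

lemma snd_PM_measurable [measurable]: "(\<lambda>z. snd z) \<in> N \<Otimes>\<^sub>M PM lam \<rightarrow>\<^sub>M (borel \<Otimes>\<^sub>M borel)"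
  by (rule measurable_compose[OF measurable_snd id_PM_measurable])

text \<open>\<open>kernel_power_le_pker\<close> integrated against the absolute value of
  \<open>f\<close>: estimates of the fractional kernel return to Poisson kernels, for which mass and
  semigroup law are available.\<close>

lemma nn_integral_wt_power_le:
  assumes f: "(\<lambda>y. pos y * f y :: real) \<in> borel_measurable borel"
    and e: "e > 0" and lam: "lam > 0" and y: "y > 0" and t: "t > 0"
  shows "(\<integral>\<^sup>+z. ennreal (\<bar>wt lam y f z\<bar> * (qfp y z + t\<^sup>2) powr (- lam - (1 + e) / 2)) \<partial>PM lam)
    \<le> ennreal (4 powr (e + 2 * lam + 2)) * (\<integral>\<^sub>+z. ennreal \<bar>pos z * f z\<bar> * (\<integral>\<^sup>+r\<in>{t<..}. ennreal (r powr (- e - 1) * pker lam r y z) \<partial>lborel))"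
proof -
  interpret B: finite_measure "bmeas lam" by (rule finite_measure_bmeas[OF lam])
  note [measurable] = wt_measurable[OF f] f pker_measurable[OF lam]
  let ?p = "- lam - (1 + e) / 2"
  have "(\<integral>\<^sup>+z. ennreal (\<bar>wt lam y f z\<bar> * (qfp y z + t\<^sup>2) powr ?p) \<partial>PM lam)
    = (\<integral>\<^sub>+z. (\<integral>\<^sup>+u. ennreal (\<bar>wt lam y f (z, u)\<bar> * (qfp y (z, u) + t\<^sup>2) powr ?p) \<partial>bmeas lam))"
    by (rule B.nn_integral_fst[symmetric]) measurable
  also have "\<dots> \<le> (\<integral>\<^sub>+z. ennreal (4 powr (e + 2 * lam + 2)) * (ennreal \<bar>pos z * f z\<bar> * (\<integral>\<^sup>+r\<in>{t<..}. ennreal (r powr (- e - 1) * pker lam r y z) \<partial>lborel)))"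
  proof (rule nn_integral_mono)
    fix z :: real
    show "(\<integral>\<^sup>+u. ennreal (\<bar>wt lam y f (z, u)\<bar> * (qfp y (z, u) + t\<^sup>2) powr ?p) \<partial>bmeas lam)
      \<le> ennreal (4 powr (e + 2 * lam + 2)) * (ennreal \<bar>pos z * f z\<bar> * (\<integral>\<^sup>+r\<in>{t<..}. ennreal (r powr (- e - 1) * pker lam r y z) \<partial>lborel))"
    proof (cases "z > 0")
      case z: True
      have "(\<integral>\<^sup>+u. ennreal (\<bar>wt lam y f (z, u)\<bar> * (qfp y (z, u) + t\<^sup>2) powr ?p) \<partial>bmeas lam)
        \<le> (\<integral>\<^sup>+u. ennreal (2 * lam / pi * \<bar>f z\<bar> * (y * z) powr lam) * ennreal ((qf y z u + t\<^sup>2) powr ?p) \<partial>bmeas lam)"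
        using lam z by (intro nn_integral_mono) (auto simp: wt_def qfp_def abs_mult ennreal_mult'[symmetric] mult_ac split: split_indicator)
      also have "\<dots> = ennreal (2 * lam / pi * \<bar>f z\<bar> * (y * z) powr lam) * (\<integral>\<^sup>+u. ennreal ((qf y z u + t\<^sup>2) powr ?p) \<partial>bmeas lam)"
        by (rule nn_integral_cmult) measurable
      also have "\<dots> = ennreal (2 * lam / pi * \<bar>f z\<bar>) * (ennreal ((y * z) powr lam) * (\<integral>\<^sup>+u. ennreal ((qf y z u + t\<^sup>2) powr ?p) \<partial>bmeas lam))"
        using lam by (subst ennreal_mult') (auto simp: mult.assoc)
      also have "\<dots> \<le> ennreal (2 * lam / pi * \<bar>f z\<bar>) * (ennreal (4 powr (e + 2 * lam + 2) * pi / (2 * lam)) * (\<integral>\<^sup>+r\<in>{t<..}. ennreal (r powr (- e - 1) * pker lam r y z) \<partial>lborel))"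
        by (intro mult_left_mono kernel_power_le_pker e lam t y z) simp
      also have "\<dots> = ennreal (2 * lam / pi * \<bar>f z\<bar> * (4 powr (e + 2 * lam + 2) * pi / (2 * lam))) * (\<integral>\<^sup>+r\<in>{t<..}. ennreal (r powr (- e - 1) * pker lam r y z) \<partial>lborel)"
        using lam by (subst ennreal_mult'[of "2 * lam / pi * \<bar>f z\<bar>"]) (auto simp: mult.assoc)
      also have "2 * lam / pi * \<bar>f z\<bar> * (4 powr (e + 2 * lam + 2) * pi / (2 * lam)) = 4 powr (e + 2 * lam + 2) * \<bar>f z\<bar>"
        using lam by simp
      finally show ?thesis using z by (simp add: ennreal_mult' mult.assoc)
    qed (simp add: wt_def)
  qed
  also have "\<dots> = ennreal (4 powr (e + 2 * lam + 2)) * (\<integral>\<^sub>+z. ennreal \<bar>pos z * f z\<bar> * (\<integral>\<^sup>+r\<in>{t<..}. ennreal (r powr (- e - 1) * pker lam r y z) \<partial>lborel))"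
    by (rule nn_integral_cmult) measurable
  finally show ?thesis .
qed

lemma nn_integral_pker_semigroup_ind:
  assumes lam: "lam > 0" and "s > 0" "r > 0" "x > 0" "z > 0"
  shows "(\<integral>\<^sub>+y. ennreal (pos y * pker lam s x y) * ennreal (pker lam r y z)) = ennreal (pker lam (s + r) x z)"
proof -
  have "(\<integral>\<^sub>+y. ennreal (pos y * pker lam s x y) * ennreal (pker lam r y z)) = (\<integral>\<^sub>0y. ennreal (pker lam s x y * pker lam r y z))"
    using pker_nonneg[OF lam \<open>s > 0\<close>] by (intro nn_integral_cong) (auto simp: ennreal_mult' split: split_indicator)
  then show ?thesis using pker_semigroup[OF assms] by simp
qed

text \<open>Absolute integrability of the composed kernel is reduced by
  \<open>nn_integral_wt_power_le\<close> to Poisson kernels at times \<open>r > 1\<close>. The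
  integral over the intermediate point collapses to \<open>pker lam (s + r) x z\<close> by the
  semigroup law, and \<open>pker_far_bound\<close> controls this uniformly in \<open>r\<close>. The
  remaining factor \<open>r powr (- e - 1)\<close> is integrable over
  \<open>(1, \<infinity>)\<close> because \<open>e > 0\<close>.\<close>

lemma kernel_weight_Vmeas:
  assumes f: "adm lam 0 f" and lam: "lam > 0" and e: "0 < e" "e \<le> 1" and sx: "s > 0" "x > 0"
  shows "kernel_weight (lborel \<Otimes>\<^sub>M PM lam) (Vmeas_w lam s x f) (\<lambda>a. qfp (fst a) (snd a)) lam e"
proof -
  interpret B: finite_measure "bmeas lam" by (rule finite_measure_bmeas[OF lam])
  interpret S: sigma_finite_measure "PM lam" by (rule sigma_finite_PM[OF lam])
  interpret P: pair_sigma_finite lborel "PM lam" ..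
  have fm: "(\<lambda>y. pos y * f y :: real) \<in> borel_measurable borel" by (rule adm_measurable[OF f])
  define f0 where "f0 z = \<bar>pos z * f z\<bar>" for z
  have [measurable]: "f0 \<in> borel_measurable borel" unfolding f0_def using fm by measurable
  note [measurable] = wt_measurable[OF fm] pker_measurable[OF lam]
  let ?p = "- lam - (1 + e) / 2"
  obtain D where D: "D \<ge> 0" "\<And>r z. r \<ge> 1 \<Longrightarrow> z > 0 \<Longrightarrow> pker lam r x z \<le> D * (z powr lam * (1 + z) powr (- 2 * lam - 1))"
    using pker_far_bound[OF lam sx(2)] by blast
  let ?g = "\<lambda>z. \<bar>pos z * (f z * (z powr lam * (1 + z) powr (- 2 * lam - 1 - 0)))\<bar>"
  have gfin: "(\<integral>\<^sub>+z. ennreal (?g z)) < \<infinity>"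
    using f unfolding adm_def integrable_iff_bounded by simp
  have gm: "(\<lambda>z. ennreal (?g z)) \<in> borel_measurable lborel"
    using f unfolding adm_def integrable_iff_bounded by (auto intro!: measurable_compose[OF _ measurable_ennreal] borel_measurable_abs)
  let ?C = "4 powr (e + 2 * lam + 2)"
  let ?q = "\<lambda>y. ennreal (pos y * pker lam s x y)"
  let ?R = "\<lambda>y z. \<integral>\<^sup>+r\<in>{1<..}. ennreal (r powr (- e - 1) * pker lam r y z) \<partial>lborel"
  let ?K = "\<lambda>y z r. ennreal (f0 z) * (ennreal (r powr (- e - 1)) * indicator {1<..} r) * (?q y * ennreal (pker lam r y z))"
  have wm: "Vmeas_w lam s x f \<in> borel_measurable (lborel \<Otimes>\<^sub>M PM lam)" unfolding Vmeas_w_def[abs_def] by measurable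
  have qm: "(\<lambda>a. qfp (fst a) (snd a)) \<in> borel_measurable (lborel \<Otimes>\<^sub>M PM lam)" by measurable
  show ?thesis
  proof (rule kernel_weight.intro)
    show "sigma_finite_measure (lborel \<Otimes>\<^sub>M PM lam)" by (rule P.P.sigma_finite_measure_axioms)
    show "0 \<le> qfp (fst a) (snd a)" if "Vmeas_w lam s x f a \<noteq> 0" for a
      using that by (intro qfp_nonneg[of lam _ f]) (auto simp: Vmeas_w_def)
    show "integrable (lborel \<Otimes>\<^sub>M PM lam) (\<lambda>a. Vmeas_w lam s x f a * (qfp (fst a) (snd a) + 1) powr ?p)"
    proof (rule integrableI_bounded)
      show "(\<lambda>a. Vmeas_w lam s x f a * (qfp (fst a) (snd a) + 1) powr ?p) \<in> borel_measurable (lborel \<Otimes>\<^sub>M PM lam)"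
        unfolding Vmeas_w_def by measurable
      have "(\<integral>\<^sup>+a. ennreal (norm (Vmeas_w lam s x f a * (qfp (fst a) (snd a) + 1) powr ?p)) \<partial>(lborel \<Otimes>\<^sub>M PM lam))
        = (\<integral>\<^sub>+y. (\<integral>\<^sup>+z. ennreal (norm (Vmeas_w lam s x f (y, z) * (qfp (fst (y, z)) (snd (y, z)) + 1) powr ?p)) \<partial>PM lam))"
        unfolding Vmeas_w_def by (rule S.nn_integral_fst[symmetric]) measurable
      also have "\<dots> = (\<integral>\<^sub>+y. ?q y * (\<integral>\<^sup>+z. ennreal (\<bar>wt lam y f z\<bar> * (qfp y z + 1\<^sup>2) powr ?p) \<partial>PM lam))"
      proof (rule nn_integral_cong)
        fix y :: real
        show "(\<integral>\<^sup>+z. ennreal (norm (Vmeas_w lam s x f (y, z) * (qfp (fst (y, z)) (snd (y, z)) + 1) powr ?p)) \<partial>PM lam)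
          = ?q y * (\<integral>\<^sup>+z. ennreal (\<bar>wt lam y f z\<bar> * (qfp y z + 1\<^sup>2) powr ?p) \<partial>PM lam)"
          using pker_nonneg[OF lam sx(1), of x y]
          by (subst nn_integral_cmult[symmetric], measurable, intro nn_integral_cong) (auto simp: Vmeas_w_def abs_mult ennreal_mult'[symmetric] mult_ac split: split_indicator)
      qed
      also have "\<dots> \<le> (\<integral>\<^sub>+y. ?q y * (ennreal ?C * (\<integral>\<^sub>+z. ennreal (f0 z) * (?R y z))))"
      proof (rule nn_integral_mono)
        fix y :: real
        show "?q y * (\<integral>\<^sup>+z. ennreal (\<bar>wt lam y f z\<bar> * (qfp y z + 1\<^sup>2) powr ?p) \<partial>PM lam)
          \<le> ?q y * (ennreal ?C * (\<integral>\<^sub>+z. ennreal (f0 z) * (?R y z)))"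
        proof (cases "y > 0")
          case True
          show ?thesis by (intro mult_left_mono nn_integral_wt_power_le[where f=f, folded f0_def] fm e lam True) auto
        qed simp
      qed
      also have "\<dots> = ennreal ?C * (\<integral>\<^sub>+y. (\<integral>\<^sub>+z. (\<integral>\<^sub>+r. ?K y z r)))"
      proof -
        have "(\<integral>\<^sub>+y. ?q y * (ennreal ?C * (\<integral>\<^sub>+z. ennreal (f0 z) * (?R y z))))
          = (\<integral>\<^sub>+y. ennreal ?C * (\<integral>\<^sub>+z. (\<integral>\<^sub>+r. ?K y z r)))"
        proof (rule nn_integral_cong)
          fix y :: real
          have "?q y * (\<integral>\<^sub>+z. ennreal (f0 z) * (?R y z))
            = (\<integral>\<^sub>+z. ?q y * (ennreal (f0 z) * (?R y z)))"
            by (rule nn_integral_cmult[symmetric]) measurable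
          also have "\<dots> = (\<integral>\<^sub>+z. (\<integral>\<^sub>+r. ?K y z r))"
          proof (rule nn_integral_cong)
            fix z :: real
            have "?q y * (ennreal (f0 z) * (?R y z))
              = (\<integral>\<^sub>+r. (?q y * ennreal (f0 z)) * (ennreal (r powr (- e - 1) * pker lam r y z) * indicator {1<..} r))"
              by (subst nn_integral_cmult) (auto simp: mult.assoc)
            also have "\<dots> = (\<integral>\<^sub>+r. ?K y z r)"
            proof (rule nn_integral_cong)
              fix r :: real
              have sp: "ennreal (r powr (- e - 1) * pker lam r y z) = ennreal (r powr (- e - 1)) * ennreal (pker lam r y z)"
                by (rule ennreal_mult') simp
              show "?q y * ennreal (f0 z) * (ennreal (r powr (- e - 1) * pker lam r y z) * indicator {1<..} r)
                = ?K y z r"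
                unfolding sp by (simp only: mult_ac)
            qed
            finally show "?q y * (ennreal (f0 z) * (?R y z))
              = (\<integral>\<^sub>+r. ?K y z r)" .
          qed
          finally have Z: "?q y * (\<integral>\<^sub>+z. ennreal (f0 z) * (?R y z))
            = (\<integral>\<^sub>+z. (\<integral>\<^sub>+r. ?K y z r))" .
          show "?q y * (ennreal ?C * (\<integral>\<^sub>+z. ennreal (f0 z) * (?R y z)))
            = ennreal ?C * (\<integral>\<^sub>+z. (\<integral>\<^sub>+r. ?K y z r))"
            by (rule trans[OF mult.left_commute]) (rule arg_cong[where f="\<lambda>q. ennreal ?C * q", OF Z])
        qed
        also have "\<dots> = ennreal ?C * (\<integral>\<^sub>+y. (\<integral>\<^sub>+z. (\<integral>\<^sub>+r. ?K y z r)))"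
          by (rule nn_integral_cmult) measurable
        finally show ?thesis .
      qed
      also have "(\<integral>\<^sub>+y. (\<integral>\<^sub>+z. (\<integral>\<^sub>+r. ?K y z r)))
        = (\<integral>\<^sub>+z. (\<integral>\<^sub>+y. (\<integral>\<^sub>+r. ?K y z r)))"
        by (rule lborel_pair.Fubini') measurable
      also have "\<dots> = (\<integral>\<^sub>+z. (\<integral>\<^sub>+r. (\<integral>\<^sub>+y. ?K y z r)))"
        by (rule nn_integral_cong, rule lborel_pair.Fubini') measurable
      also have "\<dots> \<le> (\<integral>\<^sub>+z. (\<integral>\<^sub>+r. ennreal D * ennreal (?g z) * (ennreal (r powr (- e - 1)) * indicator {1<..} r)))"
      proof (intro nn_integral_mono)
        fix z r :: real
        show "(\<integral>\<^sub>+y. ?K y z r)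
          \<le> ennreal D * ennreal (?g z) * (ennreal (r powr (- e - 1)) * indicator {1<..} r)"
        proof (cases "z > 0 \<and> r > 1")
          case True
          have "(\<integral>\<^sub>+y. ?K y z r)
            = ennreal (f0 z) * (ennreal (r powr (- e - 1)) * indicator {1<..} r) * (\<integral>\<^sub>+y. ?q y * ennreal (pker lam r y z))"
            by (rule nn_integral_cmult) measurable
          also have "\<dots> = ennreal \<bar>f z\<bar> * ennreal (r powr (- e - 1)) * ennreal (pker lam (s + r) x z)"
            using True by (subst nn_integral_pker_semigroup_ind[OF lam sx(1) _ sx(2)]) (auto simp: f0_def)
          also have "\<dots> \<le> ennreal \<bar>f z\<bar> * ennreal (r powr (- e - 1)) * ennreal (D * (z powr lam * (1 + z) powr (- 2 * lam - 1)))"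
            using True sx by (intro mult_left_mono ennreal_leI D(2)) auto
          also have "\<dots> = ennreal D * ennreal (?g z) * (ennreal (r powr (- e - 1)) * indicator {1<..} r)"
            using True D(1) by (simp add: ennreal_mult'[symmetric] abs_mult mult_ac)
          finally show ?thesis .
        qed (auto simp: f0_def split: split_indicator)
      qed
      also have "\<dots> = (\<integral>\<^sub>+z. ennreal D * ennreal (?g z) * ennreal (1 powr (- e) / e))"
        using nn_integral_powr_inf[OF e(1), of 1] by (subst nn_integral_cmult) auto
      also have "\<dots> = ennreal D * (\<integral>\<^sub>+z. ennreal (?g z)) * ennreal (1 powr (- e) / e)"
        using gm by (subst nn_integral_multc, simp, subst nn_integral_cmult) auto
      also have "ennreal ?C * \<dots> < \<infinity>" using gfin by (simp add: ennreal_mult_less_top)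
      finally show "(\<integral>\<^sup>+a. ennreal (norm (Vmeas_w lam s x f a * (qfp (fst a) (snd a) + 1) powr ?p)) \<partial>(lborel \<Otimes>\<^sub>M PM lam)) < \<infinity>"
        by (simp add: mult_left_mono)
    qed
  qed (use lam e wm qm in auto)
qed

lemma Uker_semigroup:
  assumes f: "adm lam 0 f" and lam: "lam > 0" and ts: "t > 0" "s > 0" and x: "x > 0"
  shows "(\<integral>\<^sub>Ly. pos y * pker lam s x y * Uker lam 0 f t y) = Uker lam 0 f (t + s) x"
proof -
  have fm: "(\<lambda>y. pos y * f y :: real) \<in> borel_measurable borel" by (rule adm_measurable[OF f])
  define f0 where "f0 z = pos z * f z" for z
  have [measurable]: "f0 \<in> borel_measurable borel" unfolding f0_def using fm by measurable
  note [measurable] = pker_measurable[OF lam]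
  define F where "F z y = f0 z * ((pos y * pker lam s x y) * pker lam t y z)" for z y
  have Fm: "case_prod F \<in> borel_measurable (lborel \<Otimes>\<^sub>M lborel)" unfolding F_def[abs_def] by measurable
  have inn: "(\<integral>\<^sub>+y. ennreal \<bar>F z y\<bar>) = ennreal \<bar>pos z * (pker lam (s + t) x z * f z)\<bar>" for z
  proof (cases "z > 0")
    case True
    have "(\<integral>\<^sub>+y. ennreal \<bar>F z y\<bar>) = (\<integral>\<^sub>+y. ennreal \<bar>f z\<bar> * (ennreal (pos y * pker lam s x y) * ennreal (pker lam t y z)))"
      using True pker_nonneg[OF lam ts(1)] pker_nonneg[OF lam ts(2)]
      by (intro nn_integral_cong) (auto simp: F_def f0_def abs_mult ennreal_mult' split: split_indicator)
    also have "\<dots> = ennreal \<bar>f z\<bar> * ennreal (pker lam (s + t) x z)"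
      by (subst nn_integral_cmult) (auto simp: nn_integral_pker_semigroup_ind[OF lam ts(2,1) x True])
    finally show ?thesis using True pker_nonneg[OF lam, of "s + t" x z] ts by (simp add: ennreal_mult'[symmetric] abs_mult mult.commute)
  qed (simp add: F_def f0_def)
  have "(\<integral>\<^sub>+z. (\<integral>\<^sub>+y. ennreal \<bar>F z y\<bar>)) < \<infinity>"
    unfolding inn using Uker_0(1)[OF f lam order_refl zero_le_one x, of "s + t"] ts unfolding integrable_iff_bounded by simp
  note swap = integral_swap_nonneg_bound[OF lborel.sigma_finite_measure_axioms lborel.sigma_finite_measure_axioms Fm this]
  have Fz: "(\<integral>\<^sub>Ly. F z y) = pos z * (pker lam (s + t) x z * f z)" for z
  proof (cases "z > 0")
    case True
    have "(\<integral>\<^sub>Ly. (pos y * pker lam s x y) * pker lam t y z) = enn2real (\<integral>\<^sub>+y. ennreal ((pos y * pker lam s x y) * pker lam t y z))"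
      using pker_nonneg[OF lam ts(1)] pker_nonneg[OF lam ts(2)] by (intro integral_eq_nn_integral AE_I2) auto
    also have "(\<integral>\<^sub>+y. ennreal ((pos y * pker lam s x y) * pker lam t y z)) = ennreal (pker lam (s + t) x z)"
      unfolding nn_integral_pker_semigroup_ind[OF lam ts(2,1) x True, symmetric]
      using pker_nonneg[OF lam ts(1)] by (intro nn_integral_cong) (auto simp: ennreal_mult'')
    finally show ?thesis unfolding F_def f0_def using True pker_nonneg[OF lam, of "s + t" x z] ts by (simp add: mult.commute)
  qed (simp add: F_def f0_def)
  have "(\<integral>\<^sub>Ly. pos y * pker lam s x y * Uker lam 0 f t y) = (\<integral>\<^sub>Ly. (\<integral>\<^sub>Lz. F z y))"
  proof (rule Bochner_Integration.integral_cong[OF refl])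
    fix y :: real
    show "pos y * pker lam s x y * Uker lam 0 f t y = (\<integral>\<^sub>Lz. F z y)"
    proof (cases "y > 0")
      case True
      have "(\<integral>\<^sub>Lz. F z y) = (\<integral>\<^sub>Lz. (pos y * pker lam s x y) * (pos z * (pker lam t y z * f z)))"
        by (intro Bochner_Integration.integral_cong refl) (simp add: F_def f0_def mult_ac)
      also have "\<dots> = (pos y * pker lam s x y) * (\<integral>\<^sub>Lz. (pos z * (pker lam t y z * f z)))"
        by (rule integral_mult_right_zero)
      finally show ?thesis unfolding Uker_0(2)[OF f lam order_refl zero_le_one True ts(1)] ..
    qed (simp add: F_def f0_def)
  qed
  also have "\<dots> = (\<integral>\<^sub>Lz. (\<integral>\<^sub>Ly. F z y))" by (rule swap(2)[symmetric])
  also have "\<dots> = Uker lam 0 f (t + s) x"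
    unfolding Fz using Uker_0(2)[OF f lam order_refl zero_le_one x, of "t + s"] ts by (simp add: add.commute)
  finally show ?thesis .
qed

text \<open>No derivative is moved through \<open>P_s\<close> by hand: the extensions
  \<open>P_s P_t f (x)\<close> and \<open>P_(t+s) f (x)\<close> are both chains of derivatives
  supplied by \<open>kernel_weight\<close>. They agree at order 0 by \<open>Uker_semigroup\<close>,
  hence at every order, and the Weyl integral is applied to both.\<close>

lemma Vker_semigroup:
  assumes f: "adm lam 0 f" and lam: "lam > 0" and b: "b > 0" and g: "g > 0" "real m = g + b"
    and ts: "t > 0" "s > 0" and x: "x > 0"
  shows "integrable lborel (\<lambda>y. pos y * pker lam s x y * Vker lam m g f t y)"
    and "Vker lam m g f (t + s) x = (\<integral>\<^sub>Ly. pos y * pker lam s x y * Vker lam m g f t y)"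
proof -
  \<comment> \<open>The locale asks for \<open>e \<le> 1\<close>, the tail integral for
    \<open>e \<le> b\<close>, and the composed kernel for \<open>e > 0\<close>.\<close>
  define e where "e = min 1 b"
  have e: "0 < e" "e \<le> 1" "e \<le> b" using b by (auto simp: e_def)
  have fe: "adm lam e f" using adm_mono[OF f] e by simp
  interpret S: sigma_finite_measure "PM lam" by (rule sigma_finite_PM[OF lam])
  interpret P: pair_sigma_finite lborel "PM lam" ..
  interpret K: kernel_weight "PM lam" "wt lam x f" "qfp x" lam e by (rule kernel_weight_wt[OF fe lam _ e(2) x]) (use e in simp)
  interpret K': kernel_weight "lborel \<Otimes>\<^sub>M PM lam" "Vmeas_w lam s x f" "\<lambda>a. qfp (fst a) (snd a)" lam e
    by (rule kernel_weight_Vmeas[OF f lam e(1,2) ts(2) x])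
  let ?H = "\<lambda>k. kint (lborel \<Otimes>\<^sub>M PM lam) (Vmeas_w lam s x f) (\<lambda>a. qfp (fst a) (snd a)) lam k"
  let ?G = "\<lambda>k t. Uker lam k f (t + s) x"
  have H0: "?H 0 r = ?G 0 r" if r: "r > 0" for r
  proof -
    have "?H 0 r = (\<integral>\<^sub>Ly. (\<integral>z. Vmeas_w lam s x f (y, z) * kap lam 0 (qfp (fst (y, z)) (snd (y, z))) r \<partial>PM lam))"
      unfolding kint_def by (rule P.integral_fst'[OF K'.kap_integrable[OF r], symmetric])
    also have "\<dots> = (\<integral>\<^sub>Ly. pos y * pker lam s x y * Uker lam 0 f r y)"
      unfolding Uker_def kint_def Vmeas_w_def by (simp add: mult.assoc)
    also have "\<dots> = ?G 0 r" by (rule Uker_semigroup[OF f lam r ts(2) x])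
    finally show ?thesis .
  qed
  have GH: "?H m r = ?G m r" if "r > 0" for r
  proof (rule chain_unique[of ?H ?G])
    show "(?G k has_real_derivative ?G (Suc k) r) (at r)" if "r > 0" for k r
      using Uker_deriv[OF f lam order_refl zero_le_one x, of "r + s" k] that ts by (simp add: DERIV_shift)
    show "(?H k has_real_derivative ?H (Suc k) r) (at r)" if "r > 0" for k r by (rule K'.kint_deriv[OF that])
  qed (use H0 that in auto)
  have V: "(\<integral>z. Vmeas_w lam s x f (y, z) * kphi lam m g (qfp (fst (y, z)) (snd (y, z))) t \<partial>PM lam) = pos y * pker lam s x y * Vker lam m g f t y" for y
    unfolding Vmeas_w_def Vker_def by (simp add: mult.assoc)
  note I = K'.kphi_integrable[OF g(1) b e(3) g(2) ts(1)]
  show "integrable lborel (\<lambda>y. pos y * pker lam s x y * Vker lam m g f t y)"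
    using P.integrable_fst'[OF I] unfolding V .
  have "Vker lam m g f (t + s) x = (\<integral>\<^sub>Lr. pos r * (Uker lam m f (t + s + r) x * r powr (g - 1)))"
    unfolding Vker_def Uker_def by (rule K.kint_tail[symmetric, OF g(1) b e(3) g(2)]) (use ts in simp)
  also have "\<dots> = (\<integral>\<^sub>Lr. pos r * (?H m (t + r) * r powr (g - 1)))"
    using GH[of "t + _"] ts by (intro Bochner_Integration.integral_cong refl) (auto simp: add_ac split: split_indicator)
  also have "\<dots> = (\<integral>a. Vmeas_w lam s x f a * kphi lam m g (qfp (fst a) (snd a)) t \<partial>(lborel \<Otimes>\<^sub>M PM lam))"
    by (rule K'.kint_tail[OF g(1) b e(3) g(2) ts(1)])
  also have "\<dots> = (\<integral>\<^sub>Ly. pos y * pker lam s x y * Vker lam m g f t y)"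
    using P.integral_fst'[OF I] unfolding V ..
  finally show "Vker lam m g f (t + s) x = (\<integral>\<^sub>Ly. pos y * pker lam s x y * Vker lam m g f t y)" .
qed

subsection \<open>Hoelder bounds and the fractional derivative\<close>

lemma one_plus_powr_le:
  assumes "0 \<le> s" "s \<le> 1" "k \<ge> (0::real)"
  shows "(1 + s) powr k - 1 \<le> k * 2 powr k * s"
proof (cases "s = 0")
  case False
  then have s: "s > 0" using assms by simp
  have "\<exists>z>0. z < s \<and> (1 + s) powr k - (1 + 0) powr k = (s - 0) * (k * (1 + z) powr (k - 1))"
    by (rule MVT2[of 0 s "\<lambda>s. (1 + s) powr k" "\<lambda>z. k * (1 + z) powr (k - 1)"]) (use s in \<open>auto intro!: derivative_eq_intros\<close>)
  then obtain z where z: "z > 0" "z < s" "(1 + s) powr k - 1 = s * (k * (1 + z) powr (k - 1))" by auto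
  have "(1 + z) powr (k - 1) \<le> (1 + z) powr k" using z by (intro powr_mono) auto
  also have "\<dots> \<le> 2 powr k" using z assms by (intro powr_mono2) auto
  finally have "s * (k * (1 + z) powr (k - 1)) \<le> s * (k * 2 powr k)" using assms s by (intro mult_left_mono) auto
  then show ?thesis using z by (simp add: mult_ac)
qed simp

text \<open>For \<open>l \<le> 1\<close> by subadditivity of the power, for \<open>l > 1\<close> by
  the mean value theorem on a bounded range. This is the origin of the exponent
  \<open>min 1 lam\<close>.\<close>

lemma powr_diff_le:
  assumes "0 < s" "s \<le> 1" "0 \<le> d" "d \<le> 1" "l > (0::real)"
  shows "(s + d) powr l - s powr l \<le> (1 + l * 2 powr l) * d powr min 1 l"
proof (cases "d = 0")
  case False
  then have d: "d > 0" using assms by simp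
  show ?thesis
  proof (cases "l \<le> 1")
    case True
    have p: "x \<le> x powr l" if "0 < x" "x \<le> 1" for x :: real
      using powr_mono'[of l 1 x] that True by simp
    have "s / (s + d) + d / (s + d) \<le> (s / (s + d)) powr l + (d / (s + d)) powr l"
      using assms d by (intro add_mono p) auto
    then have "1 \<le> (s powr l + d powr l) / (s + d) powr l"
      using assms d by (simp add: powr_divide add_divide_distrib[symmetric])
    then have "(s + d) powr l \<le> s powr l + d powr l" using assms d by (simp add: le_divide_eq split: if_splits)
    then have "(s + d) powr l - s powr l \<le> 1 * d powr min 1 l" using True by simp
    also have "\<dots> \<le> (1 + l * 2 powr l) * d powr min 1 l" using assms by (intro mult_right_mono) auto
    finally show ?thesis .
  next
    case False
    have "\<exists>z>s. z < s + d \<and> (s + d) powr l - s powr l = (s + d - s) * (l * z powr (l - 1))"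
      by (rule MVT2) (use d assms in \<open>auto intro!: derivative_eq_intros\<close>)
    then obtain z where z: "z > s" "z < s + d" "(s + d) powr l - s powr l = d * (l * z powr (l - 1))" by auto
    have "z powr (l - 1) \<le> 2 powr (l - 1)" using z assms False by (intro powr_mono2) auto
    also have "\<dots> \<le> 2 powr l" by (intro powr_mono) auto
    finally have "d * (l * z powr (l - 1)) \<le> d * (l * 2 powr l)" using d assms by (intro mult_left_mono) auto
    also have "\<dots> \<le> (1 + l * 2 powr l) * d" using d by (simp add: algebra_simps)
    finally show ?thesis unfolding z(3) using False d by simp
  qed
qed simp

section \<open>The L1 modulus of continuity of the Poisson kernel\<close>

lemma pker_diff_pointwise:
  assumes lam: "lam > 0" and t: "t > 0" and x: "x > 0" "x < x'" and y: "y > 0"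
  shows "\<bar>pker lam t x y - pker lam t x' y\<bar> \<le> ((x' / x) powr lam * (1 + (x' - x) / t) powr (2 * lam + 2) - 1) * pker lam t x y"
proof -
  have x': "x' > 0" using x by linarith
  define B where "B = (1 + (x' - x) / t) powr (2 * lam + 2)"
  define R where "R = (x' / x) powr lam"
  have B1: "B \<ge> 1" unfolding B_def using t x lam by (intro ge_one_powr_ge_zero) auto
  have R1: "R \<ge> 1" unfolding R_def using x lam by (intro ge_one_powr_ge_zero) auto
  have h1: "pker lam t x' y \<le> R * B * pker lam t x y"
    using pker_harnack[OF lam t x' x(1) y] x unfolding R_def B_def by (simp add: abs_minus_commute)
  have h2: "pker lam t x y \<le> R * B * pker lam t x' y"
  proof -
    have "pker lam t x y \<le> (x / x') powr lam * B * pker lam t x' y"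
      using pker_harnack[OF lam t x(1) x' y] x unfolding B_def by simp
    also have "\<dots> \<le> R * B * pker lam t x' y"
    proof -
      have "(x / x') powr lam \<le> 1 powr lam" using x x' lam by (intro powr_mono2) auto
      then have "(x / x') powr lam \<le> R" using R1 by simp
      then show ?thesis using B1 pker_nonneg[OF lam t] by (intro mult_right_mono) auto
    qed
    finally show ?thesis .
  qed
  have RB: "R * B \<ge> 1" using mult_mono[OF R1 B1] R1 by simp
  show ?thesis
  proof (cases "pker lam t x y \<le> pker lam t x' y")
    case True
    then show ?thesis using h1 unfolding R_def[symmetric] B_def[symmetric] by (simp add: algebra_simps)
  next
    case False
    then have "pker lam t x y - pker lam t x' y \<le> (R * B - 1) * pker lam t x' y" using h2 by (simp add: algebra_simps)
    also have "\<dots> \<le> (R * B - 1) * pker lam t x y" using False RB by (intro mult_left_mono) auto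
    finally show ?thesis using False unfolding R_def[symmetric] B_def[symmetric] by simp
  qed
qed

text \<open>Harnack bounds the difference by \<open>H - 1\<close> times the kernel. For
  \<open>t \<le> x\<close> the factor \<open>H - 1\<close> is of order
  \<open>d = \<bar>x - x'\<bar> / t\<close>. For \<open>x < t\<close> the ratio
  \<open>(x' / x) powr lam\<close> in \<open>H\<close> may be arbitrarily large, but the mass of the
  kernel is only of order \<open>(x / t) powr lam\<close>; their product leaves
  \<open>(x' / t) powr lam - (x / t) powr lam\<close>, which is of order
  \<open>d powr min 1 lam\<close>.\<close>

lemma nn_integral_pker_diff:
  assumes lam: "lam > 0"
  shows "\<exists>C\<ge>0. \<forall>t>0. \<forall>x>0. \<forall>x'>0. (\<integral>\<^sub>0y. ennreal \<bar>pker lam t x y - pker lam t x' y\<bar>)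
    \<le> ennreal (C * min 1 ((\<bar>x - x'\<bar> / t) powr min 1 lam))"
proof -
  let ?D = "\<lambda>t x x'. \<integral>\<^sub>0y. ennreal \<bar>pker lam t x y - pker lam t x' y\<bar>"
  let ?P = "\<lambda>t x. \<integral>\<^sub>0y. ennreal (pker lam t x y)"
  note [measurable] = pker_measurable[OF lam]
  obtain C1 where C1: "C1 \<ge> 0" "\<And>t x. t > 0 \<Longrightarrow> x > 0 \<Longrightarrow> (?P t x) \<le> ennreal C1"
    using nn_integral_pker_le[OF lam] by blast
  define C2 where "C2 = 1 + bmass lam"
  have C2: "C2 \<ge> 0" using bmass_nonneg[OF lam] by (simp add: C2_def)
  define k where "k = 3 * lam + 2"
  define L where "L = k * 2 powr k"
  have kp: "k > 0" using lam by (simp add: k_def)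
  have L: "L \<ge> 0" using kp by (simp add: L_def)
  define E where "E = 1 + lam * 2 powr lam"
  have E: "E \<ge> 0" using lam by (simp add: E_def)
  define C where "C = 2 * C1 + C1 * L + C2 * (2 powr lam * L + E)"
  have C: "C \<ge> 2 * C1" "C \<ge> C1 * L" "C \<ge> C2 * (2 powr lam * L + E)" "C \<ge> 0"
    using C1(1) C2 L E by (auto simp: C_def)
  let ?a = "min 1 lam"
  have ap: "?a > 0" using lam by simp
  have main: "(?D t x x') \<le> ennreal (C * min 1 (((x' - x) / t) powr ?a))"
    if t: "t > 0" and x: "x > 0" "x < x'" for t x x'
  proof -
    define d where "d = (x' - x) / t"
    have d: "d > 0" using t x by (simp add: d_def)
    have x': "x' > 0" using x by linarith
    show ?thesis
    proof (cases "d \<ge> 1")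
      case True
      have "(?D t x x')
        \<le> (\<integral>\<^sub>+y. ennreal (pker lam t x y) * pos y + ennreal (pker lam t x' y) * pos y)"
        using pker_nonneg[OF lam t]
        by (intro nn_integral_mono) (auto simp: ennreal_plus[symmetric] abs_if intro!: ennreal_leI simp del: ennreal_plus split: split_indicator)
      also have "\<dots> = (?P t x) + (\<integral>\<^sub>0y. ennreal (pker lam t x' y))"
        by (rule nn_integral_add) measurable
      also have "\<dots> \<le> ennreal C1 + ennreal C1" by (intro add_mono C1(2) t x x')
      also have "\<dots> = ennreal (2 * C1)" using C1(1) by (simp add: ennreal_plus[symmetric] del: ennreal_plus)
      also have "\<dots> \<le> ennreal (C * min 1 (d powr ?a))"
      proof -
        have "1 \<le> d powr ?a" using True ap by (intro ge_one_powr_ge_zero) auto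
        then show ?thesis using C(1) by (intro ennreal_leI) simp
      qed
      finally show ?thesis by (simp add: d_def)
    next
      case False
      then have d1: "d < 1" by simp
      have dda: "d \<le> d powr ?a" using powr_mono'[of ?a 1 d] d d1 by simp
      have da1: "d powr ?a \<le> 1" using d d1 ap by (intro powr_le1) auto
      define H where "H = (x' / x) powr lam * (1 + d) powr (2 * lam + 2)"
      have B1: "(1 + d) powr (2 * lam + 2) \<ge> 1" using d lam by (intro ge_one_powr_ge_zero) auto
      have H1: "H \<ge> 1"
      proof -
        have "(x' / x) powr lam \<ge> 1" using x lam by (intro ge_one_powr_ge_zero) auto
        from mult_mono[OF this B1] show ?thesis by (simp add: H_def)
      qed
      have "(?D t x x')
        \<le> (\<integral>\<^sub>+y. ennreal (H - 1) * (ennreal (pker lam t x y) * pos y))"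
        using pker_diff_pointwise[OF lam t x] H1 unfolding d_def[symmetric] H_def[symmetric]
        by (intro nn_integral_mono) (auto simp: ennreal_mult'[symmetric] intro!: ennreal_leI split: split_indicator)
      also have "\<dots> = ennreal (H - 1) * (?P t x)"
        by (rule nn_integral_cmult) measurable
      finally have 1: "(?D t x x') \<le> ennreal (H - 1) * (?P t x)" .
      have L2: "(1 + d) powr (2 * lam + 2) - 1 \<le> L * d"
      proof -
        have "(1 + d) powr (2 * lam + 2) \<le> (1 + d) powr k" using d lam by (intro powr_mono) (auto simp: k_def)
        then show ?thesis using one_plus_powr_le[of d k] d d1 kp unfolding L_def by linarith
      qed
      show ?thesis
      proof (cases "t \<le> x")
        case True
        have "(x' - x) / x \<le> d" unfolding d_def using True t x by (intro divide_left_mono) auto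
        then have "x' / x \<le> 1 + d" using x by (simp add: field_simps)
        then have "(x' / x) powr lam \<le> (1 + d) powr lam" using x lam by (intro powr_mono2) auto
        then have "H \<le> (1 + d) powr lam * (1 + d) powr (2 * lam + 2)" unfolding H_def by (intro mult_right_mono) auto
        also have "\<dots> = (1 + d) powr k" by (subst powr_add[symmetric]) (rule powr_exp_cong, simp add: k_def)
        finally have "H - 1 \<le> L * d" using one_plus_powr_le[of d k] d d1 kp unfolding L_def by linarith
        then have "(H - 1) * C1 \<le> L * d * C1" using C1(1) by (intro mult_right_mono) auto
        also have "\<dots> \<le> L * d powr ?a * C1" using dda L C1(1) by (intro mult_right_mono mult_left_mono) auto
        also have "\<dots> \<le> C * d powr ?a" using mult_right_mono[OF C(2), of "d powr ?a"] by (simp add: mult_ac)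
        finally have "ennreal (H - 1) * ennreal C1 \<le> ennreal (C * min 1 (d powr ?a))"
          using H1 da1 by (subst ennreal_mult'[symmetric]) (auto intro!: ennreal_leI)
        moreover have "ennreal (H - 1) * (?P t x) \<le> ennreal (H - 1) * ennreal C1"
          by (intro mult_left_mono C1(2) t x) simp
        ultimately show ?thesis using 1 unfolding d_def by (meson order_trans)
      next
        case False
        then have xt: "x < t" by simp
        have "(H - 1) * (C2 * (x / t) powr lam) \<le> C * d powr ?a"
        proof -
          have s: "x' / t = x / t + d" using t by (simp add: d_def field_simps)
          have e1: "H * (x / t) powr lam = (x' / t) powr lam * (1 + d) powr (2 * lam + 2)"
            unfolding H_def using x x' t by (simp add: powr_divide)
          have "(x' / t) powr lam \<le> 2 powr lam" unfolding s
          proof (rule powr_mono2)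
            have "x / t < 1" using xt t by simp
            then show "x / t + d \<le> 2" using d1 by linarith
          qed (use x t d lam in auto)
          then have "(x' / t) powr lam * ((1 + d) powr (2 * lam + 2) - 1) \<le> 2 powr lam * (L * d)"
            using L2 B1 by (intro mult_mono) auto
          also have "\<dots> \<le> 2 powr lam * (L * d powr ?a)" using dda L by (intro mult_left_mono) auto
          finally have e2: "(x' / t) powr lam * ((1 + d) powr (2 * lam + 2) - 1) \<le> 2 powr lam * (L * d powr ?a)" .
          have e3: "(x' / t) powr lam - (x / t) powr lam \<le> E * d powr ?a"
            unfolding s E_def using x t xt d d1 lam by (intro powr_diff_le) auto
          have "(H - 1) * (x / t) powr lam = (x' / t) powr lam * ((1 + d) powr (2 * lam + 2) - 1) + ((x' / t) powr lam - (x / t) powr lam)"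
            using e1 by (simp add: algebra_simps)
          also have "\<dots> \<le> (2 powr lam * L + E) * d powr ?a" using e2 e3 by (simp add: algebra_simps)
          finally have "C2 * ((H - 1) * (x / t) powr lam) \<le> C2 * ((2 powr lam * L + E) * d powr ?a)" using C2 by (intro mult_left_mono) auto
          also have "\<dots> \<le> C * d powr ?a" using mult_right_mono[OF C(3), of "d powr ?a"] by (simp add: mult_ac)
          finally show ?thesis by (simp add: mult_ac)
        qed
        then have "ennreal (H - 1) * ennreal (C2 * (x / t) powr lam) \<le> ennreal (C * min 1 (d powr ?a))"
          using H1 da1 by (subst ennreal_mult'[symmetric]) (auto intro!: ennreal_leI)
        moreover have "ennreal (H - 1) * (?P t x) \<le> ennreal (H - 1) * ennreal (C2 * (x / t) powr lam)"
          unfolding C2_def by (intro mult_left_mono nn_integral_pker_small lam t x) simp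
        ultimately show ?thesis using 1 unfolding d_def by (meson order_trans)
      qed
    qed
  qed
  have "(?D t x x') \<le> ennreal (C * min 1 ((\<bar>x - x'\<bar> / t) powr ?a))"
    if "t > 0" "x > 0" "x' > 0" for t x x'
  proof -
    consider "x < x'" | "x' < x" | "x = x'" by linarith
    then show ?thesis
    proof cases
      case 1 then show ?thesis using main[OF that(1,2) 1] by simp
    next
      case 2 then show ?thesis using main[OF that(1,3) 2] by (simp add: abs_minus_commute)
    qed simp
  qed
  then show ?thesis using C(4) by blast
qed

section \<open>Convergence to the boundary values\<close>

lemma Uker_powr:
  assumes lam: "lam > 0" and "x > 0" "t > 0"
  shows "integrable lborel (\<lambda>y. pos y * (pker lam t x y * y powr lam))"
    and "(\<integral>\<^sub>Ly. pos y * (pker lam t x y * y powr lam)) = x powr lam"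
proof -
  note [measurable] = pker_measurable[OF lam]
  have nn: "(\<integral>\<^sub>+y. ennreal (pos y * (pker lam t x y * y powr lam))) = ennreal (x powr lam)"
    unfolding pker_powr_invariant[OF lam assms(3,2), symmetric]
    by (intro nn_integral_cong) (auto split: split_indicator)
  have pos: "0 \<le> pos y * (pker lam t x y * y powr lam)" for y
    using pker_nonneg[OF lam \<open>t > 0\<close>] by simp
  show "integrable lborel (\<lambda>y. pos y * (pker lam t x y * y powr lam))"
    using nn pos by (intro integrableI_bounded) auto
  show "(\<integral>\<^sub>Ly. pos y * (pker lam t x y * y powr lam)) = x powr lam"
    using nn pos by (subst integral_eq_nn_integral) auto
qed

text \<open>Because constants are not preserved, the value at \<open>x\<close> is removed by
  subtracting the multiple of \<open>y powr lam\<close> that agrees with \<open>f\<close> there. The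
  remainder \<open>h\<close> is small near \<open>x\<close>; away from \<open>x\<close> the kernel
  is of order \<open>t\<close> times the weight of \<open>adm lam 1\<close>, the class that contains
  \<open>h\<close>.\<close>

lemma Uker_tendsto:
  assumes f: "adm lam 0 f" and lam: "lam > 0" and x: "x > 0" and cont: "isCont f x"
  shows "((\<lambda>t. Uker lam 0 f t x) \<longlongrightarrow> f x) (at_right 0)"
proof -
  note [measurable] = pker_measurable[OF lam]
  define c where "c = f x / x powr lam"
  define h where "h = (\<lambda>y. f y + (- c) * y powr lam)"
  have ha: "adm lam 1 h" unfolding h_def using adm_mono[OF f] lam by (intro adm_add adm_cmult adm_powr) auto
  have hx: "h x = 0" using x by (simp add: h_def c_def)
  have hc: "isCont h x" unfolding h_def using cont x by (intro continuous_intros) auto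
  obtain C1 where C1: "C1 \<ge> 0" "\<And>t x. t > 0 \<Longrightarrow> x > 0 \<Longrightarrow> (\<integral>\<^sub>0y. ennreal (pker lam t x y)) \<le> ennreal C1"
    using nn_integral_pker_le[OF lam] by blast
  have diff: "Uker lam 0 f t x - f x = (\<integral>\<^sub>Ly. pos y * (pker lam t x y * h y))" if t: "t > 0" for t
  proof -
    have "(\<integral>\<^sub>Ly. pos y * (pker lam t x y * h y))
      = (\<integral>\<^sub>Ly. pos y * (pker lam t x y * f y) - c * (pos y * (pker lam t x y * y powr lam)))"
      by (intro Bochner_Integration.integral_cong refl) (simp add: h_def algebra_simps)
    also have "\<dots> = Uker lam 0 f t x - c * x powr lam"
      using Uker_0[OF f lam order_refl zero_le_one x t] Uker_powr[OF lam x t] by (subst Bochner_Integration.integral_diff) auto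
    also have "c * x powr lam = f x" using x by (simp add: c_def)
    finally show ?thesis ..
  qed
  let ?g = "\<lambda>z. \<bar>pos z * (h z * (z powr lam * (1 + z) powr (- 2 * lam - 1 - 1)))\<bar>"
  have gi: "integrable lborel ?g" using ha unfolding adm_def by (rule integrable_abs)
  define I where "I = (\<integral>\<^sub>Lz. ?g z)"
  have I: "I \<ge> 0" unfolding I_def by (rule integral_nonneg_AE) auto
  show ?thesis
  proof (rule tendstoI)
    fix eps :: real assume eps: "eps > 0"
    define e1 where "e1 = eps / (2 * (C1 + 1))"
    have e1: "e1 > 0" using eps C1 by (simp add: e1_def)
    obtain d where d: "d > 0" "\<And>y. \<bar>y - x\<bar> < d \<Longrightarrow> \<bar>h y\<bar> < e1"
      using hc e1 hx unfolding continuous_at_eps_delta by (auto simp: dist_real_def)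
    \<comment> \<open>Chosen so that \<open>q * (1 + y)\<^sup>2 \<le> (x - y)\<^sup>2\<close>
      whenever \<open>\<bar>y - x\<bar> \<ge> d\<close>, by \<open>one_plus_le\<close> and the
      monotonicity of \<open>v / (1 + v)\<close>.\<close>
    define q where "q = d\<^sup>2 / (1 + d\<^sup>2) / (2 * (1 + x)\<^sup>2)"
    have q: "q > 0"
    proof -
      have "0 < 1 + d\<^sup>2" by (simp add: add_pos_nonneg)
      moreover have "0 < 2 * (1 + x)\<^sup>2" "0 < d\<^sup>2" using d x by auto
      ultimately show ?thesis unfolding q_def by (intro divide_pos_pos)
    qed
    define K where "K = bmass lam * x powr lam * q powr (- lam - 1)"
    have K: "K \<ge> 0" using bmass_nonneg[OF lam] by (simp add: K_def)
    have far: "pker lam t x y \<le> t * K * (y powr lam * (1 + y) powr (- 2 * lam - 1 - 1))" if t: "t > 0" and y: "y > 0" "\<bar>y - x\<bar> \<ge> d" for t y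
    proof -
      have dd: "d\<^sup>2 \<le> (x - y)\<^sup>2" using y(2) d(1) by (intro abs_le_square_iff[THEN iffD1]) (simp add: abs_minus_commute)
      have "d\<^sup>2 * ((x - y)\<^sup>2 + 1) \<le> (x - y)\<^sup>2 * (1 + d\<^sup>2)" using dd by (simp add: algebra_simps)
      then have "d\<^sup>2 / (1 + d\<^sup>2) * ((x - y)\<^sup>2 + 1) \<le> (x - y)\<^sup>2" by (simp add: divide_le_eq add_pos_nonneg)
      moreover have "d\<^sup>2 / (1 + d\<^sup>2) * ((1 + y)\<^sup>2 / (2 * (1 + x)\<^sup>2)) \<le> d\<^sup>2 / (1 + d\<^sup>2) * ((x - y)\<^sup>2 + 1)"
        by (intro mult_left_mono one_plus_le x y) auto
      moreover have "q * (1 + y)\<^sup>2 = d\<^sup>2 / (1 + d\<^sup>2) * ((1 + y)\<^sup>2 / (2 * (1 + x)\<^sup>2))" by (simp add: q_def)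
      ultimately have ge: "q * (1 + y)\<^sup>2 \<le> (x - y)\<^sup>2 + t\<^sup>2"
        using zero_le_power2[of t] by linarith
      have "pker lam t x y \<le> bmass lam * t * (x * y) powr lam * ((x - y)\<^sup>2 + t\<^sup>2) powr (- lam - 1)" by (intro pker_le lam t x y)
      also have "\<dots> \<le> bmass lam * t * (x * y) powr lam * (q * (1 + y)\<^sup>2) powr (- lam - 1)"
        using ge q y lam bmass_nonneg[OF lam] t by (intro mult_left_mono powr_mono2') auto
      also have "(q * (1 + y)\<^sup>2) powr (- lam - 1) = q powr (- lam - 1) * (1 + y) powr (- 2 * lam - 1 - 1)"
      proof -
        have "((1 + y)\<^sup>2) powr (- lam - 1) = (1 + y) powr (- 2 * lam - 1 - 1)"
          using y by (subst square_powr) (auto intro!: powr_exp_cong)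
        then show ?thesis by (simp only: powr_mult)
      qed
      also have "bmass lam * t * (x * y) powr lam * (q powr (- lam - 1) * (1 + y) powr (- 2 * lam - 1 - 1)) = t * K * (y powr lam * (1 + y) powr (- 2 * lam - 1 - 1))"
        unfolding K_def powr_mult[of x y] by (simp only: mult_ac)
      finally show ?thesis .
    qed
    have bound: "\<bar>Uker lam 0 f t x - f x\<bar> \<le> e1 * C1 + t * K * I" if t: "t > 0" for t
    proof -
      have int: "integrable lborel (\<lambda>y. pos y * (pker lam t x y * h y))"
        by (rule Uker_0(1)[OF ha lam _ _ x t]) auto
      have "ennreal \<bar>Uker lam 0 f t x - f x\<bar> \<le> (\<integral>\<^sub>+y. ennreal (norm (pos y * (pker lam t x y * h y))))"
        unfolding diff[OF t] using integral_norm_bound_ennreal[OF int] by simp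
      also have "\<dots> \<le> (\<integral>\<^sub>+y. ennreal e1 * (ennreal (pker lam t x y) * pos y) + ennreal (t * K) * ennreal (?g y))"
      proof (rule nn_integral_mono)
        fix y :: real
        consider "y \<le> 0" | "y > 0" "\<bar>y - x\<bar> < d" | "y > 0" "\<bar>y - x\<bar> \<ge> d" by linarith
        then show "ennreal (norm (pos y * (pker lam t x y * h y))) \<le> ennreal e1 * (ennreal (pker lam t x y) * pos y) + ennreal (t * K) * ennreal (?g y)"
        proof cases
          case 2
          have "ennreal (norm (pos y * (pker lam t x y * h y))) \<le> ennreal (e1 * pker lam t x y)"
            using 2 d(2)[OF 2(2)] pker_nonneg[OF lam t, of x y] by (intro ennreal_leI) (simp add: abs_mult mult.commute mult_right_mono)
          also have "\<dots> = ennreal e1 * (ennreal (pker lam t x y) * pos y)" using 2 e1 by (simp add: ennreal_mult')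
          also have "\<dots> \<le> \<dots> + ennreal (t * K) * ennreal (?g y)" by simp
          finally show ?thesis .
        next
          case 3
          have "\<bar>pker lam t x y * h y\<bar> \<le> t * K * (y powr lam * (1 + y) powr (- 2 * lam - 1 - 1)) * \<bar>h y\<bar>"
            using mult_right_mono[OF far[OF t 3], of "\<bar>h y\<bar>"] pker_nonneg[OF lam t, of x y] by (simp add: abs_mult)
          then have "ennreal (norm (pos y * (pker lam t x y * h y))) \<le> ennreal (t * K * ?g y)"
            using 3 by (intro ennreal_leI) (simp add: abs_mult mult_ac)
          also have "\<dots> = ennreal (t * K) * ennreal (?g y)" using t K by (intro ennreal_mult') auto
          also have "\<dots> \<le> ennreal e1 * (ennreal (pker lam t x y) * pos y) + \<dots>" by simp
          finally show ?thesis .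
        qed simp
      qed
      also have "\<dots> = ennreal e1 * (\<integral>\<^sub>+y. ennreal (pker lam t x y) * pos y) + ennreal (t * K) * (\<integral>\<^sub>+y. ennreal (?g y))"
      proof -
        have gm: "(\<lambda>y. ennreal (?g y)) \<in> borel_measurable lborel"
          using borel_measurable_integrable[OF gi] by (rule measurable_compose[OF _ measurable_ennreal])
        show ?thesis using gm by (subst nn_integral_add, measurable, simp, subst nn_integral_cmult, measurable, subst nn_integral_cmult, auto)
      qed
      also have "\<dots> \<le> ennreal e1 * ennreal C1 + ennreal (t * K) * ennreal I"
        unfolding I_def using nn_integral_eq_integral[OF gi] by (intro add_mono mult_left_mono C1(2) t x) auto
      also have "\<dots> = ennreal (e1 * C1 + t * K * I)"
        using e1 C1(1) t K I by (simp add: ennreal_mult'[symmetric] ennreal_plus[symmetric] del: ennreal_plus)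
      finally have Z: "ennreal \<bar>Uker lam 0 f t x - f x\<bar> \<le> ennreal (e1 * C1 + t * K * I)" .
      have "0 \<le> e1 * C1 + t * K * I" using e1 C1(1) t K I by (intro add_nonneg_nonneg mult_nonneg_nonneg) auto
      with Z show ?thesis by (simp only: ennreal_le_iff)
    qed
    have "K * I \<ge> 0" using K I by simp
    then have KI: "K * I + 1 > 0" by linarith
    define s where "s = eps / (2 * (K * I + 1))"
    have s: "s > 0" using eps KI by (simp add: s_def)
    have "eventually (\<lambda>t. t \<in> {0<..<s}) (at_right 0)" using s by (rule eventually_at_right_real)
    then show "eventually (\<lambda>t. dist (Uker lam 0 f t x) (f x) < eps) (at_right 0)"
    proof eventually_elim
      case (elim t)
      have a: "e1 * C1 < eps / 2"
      proof -
        have "e1 * C1 < e1 * (C1 + 1)" using e1 by simp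
        also have "\<dots> = eps / 2"
        proof -
          have "eps / (2 * D) * D = eps / 2" if "D > 0" for D :: real using that by simp
          from this[of "C1 + 1"] show ?thesis unfolding e1_def using C1(1) by simp
        qed
        finally show ?thesis .
      qed
      have "t * (K * I) \<le> s * (K * I + 1)" by (rule mult_mono) (use elim s \<open>K * I \<ge> 0\<close> in simp_all)
      also have "\<dots> = eps / 2"
      proof -
        have "eps / (2 * D) * D = eps / 2" if "D > 0" for D :: real using that by simp
        from this[OF KI] show ?thesis unfolding s_def .
      qed
      finally have "t * K * I \<le> eps / 2" by (simp only: mult.assoc)
      moreover have "\<bar>Uker lam 0 f t x - f x\<bar> \<le> e1 * C1 + t * K * I" by (rule bound) (use elim in simp)
      ultimately show ?case unfolding dist_real_def using a by linarith
    qed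
  qed
qed

section \<open>From Hoelder bounds to the fractional derivative\<close>

lemma abs_one_minus_powr_le:
  assumes "r > 0" "lam > 0" "0 < \<alpha>" "\<alpha> < (1::real)"
  shows "\<bar>1 - r powr lam\<bar> \<le> (2 + lam * 2 powr (lam + 1)) * \<bar>1 - r\<bar> powr \<alpha> * (1 + r powr lam)"
proof -
  define L where "L = lam * 2 powr (lam + 1)"
  have L: "L \<ge> 0" using assms by (simp add: L_def)
  show ?thesis
  proof (cases "\<bar>1 - r\<bar> \<ge> 1 / 2")
    case True
    have "(1 / 2) powr 1 \<le> (1 / 2) powr \<alpha>" using assms by (intro powr_mono') auto
    also have "\<dots> \<le> \<bar>1 - r\<bar> powr \<alpha>" using True assms by (intro powr_mono2) auto
    finally have "2 * (1 / 2) \<le> (2 + L) * \<bar>1 - r\<bar> powr \<alpha>" using L by (intro mult_mono) auto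
    then have "1 \<le> (2 + L) * \<bar>1 - r\<bar> powr \<alpha>" by simp
    then have A: "1 * (1 + r powr lam) \<le> (2 + L) * \<bar>1 - r\<bar> powr \<alpha> * (1 + r powr lam)" by (intro mult_right_mono) auto
    have "\<bar>1 - r powr lam\<bar> \<le> 1 * (1 + r powr lam)" by (simp add: abs_le_iff)
    from order_trans[OF this A] show ?thesis unfolding L_def .
  next
    case False
    then have "\<bar>1 - r\<bar> < 1 / 2" by simp
    then have r: "1 / 2 < r" "r < 3 / 2" unfolding abs_less_iff by linarith+
    have "norm (1 powr lam - r powr lam) \<le> L * norm (1 - r)"
    proof (rule field_differentiable_bound[of "{1/2<..<3/2}" "\<lambda>x. x powr lam" "\<lambda>x. lam * x powr (lam - 1)"])
      fix z :: real assume z: "z \<in> {1/2<..<3/2}"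
      show "((\<lambda>x. x powr lam) has_real_derivative lam * z powr (lam - 1)) (at z within {1/2<..<3/2})"
        using z by (auto intro!: derivative_eq_intros)
      have "z powr (lam - 1) = z powr lam * (1 / z)" using z by (simp add: powr_diff)
      also have "\<dots> \<le> 2 powr lam * 2" using z assms by (intro mult_mono powr_mono2) (auto simp: field_simps)
      also have "\<dots> = 2 powr (lam + 1)" by (simp add: powr_add)
      finally show "norm (lam * z powr (lam - 1)) \<le> L" using assms by (simp add: L_def abs_mult)
    qed (use r in auto)
    also have "\<dots> \<le> L * \<bar>1 - r\<bar> powr \<alpha>"
      using powr_mono'[of \<alpha> 1 "\<bar>1 - r\<bar>"] False assms L by (intro mult_left_mono) auto
    also have "\<dots> \<le> (2 + L) * \<bar>1 - r\<bar> powr \<alpha> * (1 + r powr lam)"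
    proof -
      have "(L * \<bar>1 - r\<bar> powr \<alpha>) * 1 \<le> ((2 + L) * \<bar>1 - r\<bar> powr \<alpha>) * (1 + r powr lam)"
        using L by (intro mult_mono mult_right_mono) auto
      then show ?thesis by simp
    qed
    finally show ?thesis by (simp add: L_def)
  qed
qed

text \<open>The difference is \<open>(f y - f x) + f x * (1 - (y / x) powr lam)\<close>. In the
  second term the bound on \<open>f x\<close> provides \<open>x powr \<alpha>\<close>, which
  combines with \<open>\<bar>1 - y / x\<bar> powr \<alpha>\<close> to
  \<open>\<bar>x - y\<bar> powr \<alpha>\<close>. The growth \<open>(y / x) powr lam\<close> is
  acceptable because the kernel integrates \<open>y powr lam\<close> exactly.\<close>

lemma holder_harmonic_difference:
  assumes "lam > 0" "0 < \<alpha>" "\<alpha> < (1::real)" "x > 0" "y > 0" "N \<ge> 0"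
    and "\<bar>f y - f x\<bar> \<le> N * \<bar>x - y\<bar> powr \<alpha>" "\<bar>f x\<bar> \<le> N * x powr \<alpha>"
  shows "\<bar>f y - f x / x powr lam * y powr lam\<bar> \<le> (3 + lam * 2 powr (lam + 1)) * N * (\<bar>x - y\<bar> powr \<alpha> * (1 + (y / x) powr lam))"
proof -
  define K where "K = 2 + lam * 2 powr (lam + 1)"
  have K: "K \<ge> 0" using assms by (simp add: K_def)
  have e: "f x / x powr lam * y powr lam = f x * (y / x) powr lam" by (simp add: powr_divide)
  have "x powr \<alpha> * \<bar>1 - (y / x) powr lam\<bar> \<le> x powr \<alpha> * (K * \<bar>1 - y / x\<bar> powr \<alpha> * (1 + (y / x) powr lam))"
    unfolding K_def using assms by (intro mult_left_mono abs_one_minus_powr_le) auto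
  also have "\<dots> = K * ((x * \<bar>1 - y / x\<bar>) powr \<alpha>) * (1 + (y / x) powr lam)" by (simp add: powr_mult mult_ac)
  also have "x * \<bar>1 - y / x\<bar> = \<bar>x - y\<bar>" using assms by (simp add: abs_if field_simps)
  finally have 1: "x powr \<alpha> * \<bar>1 - (y / x) powr lam\<bar> \<le> K * \<bar>x - y\<bar> powr \<alpha> * (1 + (y / x) powr lam)" .
  have "\<bar>f y - f x * (y / x) powr lam\<bar> \<le> \<bar>f y - f x\<bar> + \<bar>f x * (1 - (y / x) powr lam)\<bar>" by (simp add: algebra_simps)
  also have "\<dots> \<le> N * \<bar>x - y\<bar> powr \<alpha> + N * x powr \<alpha> * \<bar>1 - (y / x) powr lam\<bar>"
    unfolding abs_mult using assms by (intro add_mono mult_right_mono) auto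
  also have "\<dots> \<le> N * (\<bar>x - y\<bar> powr \<alpha> * (1 + (y / x) powr lam)) + N * (K * \<bar>x - y\<bar> powr \<alpha> * (1 + (y / x) powr lam))"
  proof (intro add_mono mult_left_mono)
    have "\<bar>x - y\<bar> powr \<alpha> * 1 \<le> \<bar>x - y\<bar> powr \<alpha> * (1 + (y / x) powr lam)" by (intro mult_left_mono) auto
    then show "\<bar>x - y\<bar> powr \<alpha> \<le> \<bar>x - y\<bar> powr \<alpha> * (1 + (y / x) powr lam)" by simp
    show "N * x powr \<alpha> * \<bar>1 - (y / x) powr lam\<bar> \<le> N * (K * \<bar>x - y\<bar> powr \<alpha> * (1 + (y / x) powr lam))"
      using mult_left_mono[OF 1 assms(6)] by (simp add: mult_ac)
  qed fact
  also have "\<dots> = (3 + lam * 2 powr (lam + 1)) * N * (\<bar>x - y\<bar> powr \<alpha> * (1 + (y / x) powr lam))"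
    by (simp add: K_def algebra_simps)
  finally show ?thesis unfolding e .
qed

text \<open>The extension of \<open>y powr lam\<close> is constant in \<open>t\<close>, and only its
  derivative of order \<open>m \<ge> 1\<close> enters.\<close>

lemma Vker_powr:
  assumes lam: "lam > 0" and b: "b > 0" and g: "g > 0" "real m = g + b" and tx: "t > 0" "x > 0"
  shows "Vker lam m g (\<lambda>y. y powr lam) t x = 0"
proof -
  define e where "e = min 1 b"
  have e: "0 < e" "e \<le> 1" "e \<le> b" using b by (auto simp: e_def)
  have f: "adm lam e (\<lambda>y. y powr lam)" using e lam by (intro adm_powr)
  interpret K: kernel_weight "PM lam" "wt lam x (\<lambda>y. y powr lam)" "qfp x" lam e
    by (rule kernel_weight_wt[OF f lam _ e(2) tx(2)]) (use e in simp)
  have m: "m \<noteq> 0" using g b by (intro notI) simp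
  have U: "Uker lam k (\<lambda>y. y powr lam) r x = (if k = 0 then x powr lam else 0)" if "r > 0" for r k
  proof (rule chain_unique[of "\<lambda>k r. Uker lam k (\<lambda>y. y powr lam) r x" "\<lambda>k r. if k = 0 then x powr lam else 0"])
    show "Uker lam 0 (\<lambda>y. y powr lam) r x = (if (0::nat) = 0 then x powr lam else 0)" if "r > 0" for r
      using Uker_0(2)[OF f lam _ e(2) tx(2) that] Uker_powr(2)[OF lam tx(2) that] e by simp
    show "((\<lambda>r. Uker lam k (\<lambda>y. y powr lam) r x) has_real_derivative Uker lam (Suc k) (\<lambda>y. y powr lam) r x) (at r)" if "r > 0" for k r
      by (rule Uker_deriv[OF f lam _ e(2) tx(2) that]) (use e in simp)
  qed (use that in auto)
  have "Vker lam m g (\<lambda>y. y powr lam) t x = (\<integral>\<^sub>Ls. pos s * (Uker lam m (\<lambda>y. y powr lam) (t + s) x * s powr (g - 1)))"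
    unfolding Vker_def Uker_def by (rule K.kint_tail[OF g(1) b e(3) g(2) tx(1), symmetric])
  also have "\<dots> = (\<integral>s. 0 \<partial>(lborel :: real measure))"
    using U m tx by (intro Bochner_Integration.integral_cong refl) (auto split: split_indicator)
  finally show ?thesis by simp
qed

text \<open>Once the multiple of \<open>y powr lam\<close> is subtracted, \<open>\<bar>x - y\<bar>
  powr \<alpha> \<le> (A + t\<^sup>2) powr (\<alpha> / 2)\<close> spends \<open>\<alpha>\<close> of
  the \<open>b\<close> orders of decay of \<open>kphi\<close>. The rest,
  \<open>\<epsilon> = b - \<alpha>\<close>, is dominated by Poisson kernels at times
  \<open>r > t\<close> with weight \<open>r powr (- \<epsilon> - 1)\<close>, whose integral is
  \<open>t powr (- \<epsilon>) / \<epsilon>\<close>.\<close>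

lemma Vker_holder_bound:
  assumes lam: "lam > 0" and b: "b > 0" and g: "g > 0" "real m = g + b" and a: "0 < \<alpha>" "\<alpha> < 1" "\<alpha> < b"
  shows "\<exists>C\<ge>0. \<forall>f N. adm lam 0 f \<longrightarrow> N \<ge> 0 \<longrightarrow> (\<forall>x>0. \<forall>y>0. \<bar>f y - f x\<bar> \<le> N * \<bar>x - y\<bar> powr \<alpha>) \<longrightarrow> (\<forall>x>0. \<bar>f x\<bar> \<le> N * x powr \<alpha>) \<longrightarrow>
     (\<forall>t>0. \<forall>x>0. \<bar>Vker lam m g f t x\<bar> \<le> C * N * t powr (\<alpha> - b))"
proof -
  note [measurable] = pker_measurable[OF lam]
  obtain C0 where C0: "C0 \<ge> 0" "\<And>A t. A \<ge> 0 \<Longrightarrow> t > 0 \<Longrightarrow> \<bar>kphi lam m g A t\<bar> \<le> C0 * (A + t\<^sup>2) powr (- lam - (1 + b) / 2)"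
    using kphi_bound[OF g(1) b lam g(2)] by blast
  obtain C1 where C1: "C1 \<ge> 0" "\<And>t x. t > 0 \<Longrightarrow> x > 0 \<Longrightarrow> (\<integral>\<^sub>0y. ennreal (pker lam t x y)) \<le> ennreal C1"
    using nn_integral_pker_le[OF lam] by blast
  define e where "e = min 1 b"
  have e: "0 < e" "e \<le> 1" "e \<le> b" using b by (auto simp: e_def)
  define \<epsilon> where "\<epsilon> = b - \<alpha>"
  have eps: "\<epsilon> > 0" using a by (simp add: \<epsilon>_def)
  define K where "K = 3 + lam * 2 powr (lam + 1)"
  have K: "K \<ge> 0" using lam by (simp add: K_def)
  define Q where "Q = 4 powr (\<epsilon> + 2 * lam + 2)"
  \<comment> \<open>\<open>C0\<close> bounds \<open>kphi\<close>, \<open>K\<close> comes from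
    \<open>holder_harmonic_difference\<close> and \<open>Q\<close> from the domination by Poisson
    kernels. \<open>C1 + 1\<close> bounds the kernel integrated against
    \<open>1 + (y / x) powr lam\<close>: at most \<open>C1\<close> for the constant, exactly 1 for
    the power.\<close>
  define C where "C = C0 * K * (Q * ((C1 + 1) / \<epsilon>))"
  have C: "C \<ge> 0" using C0 K C1 eps by (auto simp: C_def Q_def)
  have "\<bar>Vker lam m g f t x\<bar> \<le> C * N * t powr (\<alpha> - b)"
    if f: "adm lam 0 f" and N: "N \<ge> 0" and h1: "\<And>x y. x > 0 \<Longrightarrow> y > 0 \<Longrightarrow> \<bar>f y - f x\<bar> \<le> N * \<bar>x - y\<bar> powr \<alpha>"
      and h2: "\<And>x. x > 0 \<Longrightarrow> \<bar>f x\<bar> \<le> N * x powr \<alpha>" and t: "t > 0" and x: "x > 0" for f N t x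
  proof -
    have fe: "adm lam e f" using adm_mono[OF f] e by simp
    have pe: "adm lam e (\<lambda>y. y powr lam)" using e lam by (intro adm_powr)
    define c where "c = f x / x powr lam"
    define h where "h = (\<lambda>y. f y + (- c) * y powr lam)"
    define h1' where "h1' y = 1 + (y / x) powr lam" for y
    have he: "adm lam e h" unfolding h_def by (intro adm_add adm_cmult fe pe)
    interpret Kf: kernel_weight "PM lam" "wt lam x f" "qfp x" lam e by (rule kernel_weight_wt[OF fe lam _ e(2) x]) (use e in simp)
    interpret Kp: kernel_weight "PM lam" "wt lam x (\<lambda>y. y powr lam)" "qfp x" lam e by (rule kernel_weight_wt[OF pe lam _ e(2) x]) (use e in simp)
    interpret Kh: kernel_weight "PM lam" "wt lam x h" "qfp x" lam e by (rule kernel_weight_wt[OF he lam _ e(2) x]) (use e in simp)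
    have "Vker lam m g h t x = (\<integral>z. wt lam x f z * kphi lam m g (qfp x z) t - c * (wt lam x (\<lambda>y. y powr lam) z * kphi lam m g (qfp x z) t) \<partial>PM lam)"
      unfolding Vker_def by (intro Bochner_Integration.integral_cong refl) (simp add: wt_def h_def algebra_simps)
    also have "\<dots> = Vker lam m g f t x - c * Vker lam m g (\<lambda>y. y powr lam) t x"
      unfolding Vker_def using Kf.kphi_integrable[OF g(1) b e(3) g(2) t] Kp.kphi_integrable[OF g(1) b e(3) g(2) t]
      by (subst Bochner_Integration.integral_diff) auto
    finally have Vfh: "Vker lam m g f t x = Vker lam m g h t x" using Vker_powr[OF lam b g t x] by simp
    have hm: "(\<lambda>y. pos y * h1' y :: real) \<in> borel_measurable borel" unfolding h1'_def by measurable
    note [measurable] = wt_measurable[OF hm]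
    have "ennreal \<bar>Vker lam m g h t x\<bar> \<le> (\<integral>\<^sup>+z. ennreal (norm (wt lam x h z * kphi lam m g (qfp x z) t)) \<partial>PM lam)"
      unfolding Vker_def using integral_norm_bound_ennreal[OF Kh.kphi_integrable[OF g(1) b e(3) g(2) t]] by simp
    also have "\<dots> \<le> (\<integral>\<^sup>+z. ennreal (C0 * K * N) * ennreal (\<bar>wt lam x h1' z\<bar> * (qfp x z + t\<^sup>2) powr (- lam - (1 + \<epsilon>) / 2)) \<partial>PM lam)"
    proof (rule nn_integral_mono)
      fix z :: "real \<times> real"
      obtain y u where z: "z = (y, u)" by (cases z)
      show "ennreal (norm (wt lam x h z * kphi lam m g (qfp x z) t)) \<le> ennreal (C0 * K * N) * ennreal (\<bar>wt lam x h1' z\<bar> * (qfp x z + t\<^sup>2) powr (- lam - (1 + \<epsilon>) / 2))"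
      proof (cases "y > 0 \<and> -1 < u \<and> u < 1")
        case True
        then have y: "y > 0" by simp
        have A: "qfp x z \<ge> 0" using qf_nonneg[of x y u] x True by (simp add: qfp_def z)
        have xy: "\<bar>x - y\<bar> powr \<alpha> \<le> (qfp x z + t\<^sup>2) powr (\<alpha> / 2)"
        proof -
          have "(x - y)\<^sup>2 \<le> qfp x z + t\<^sup>2" using qf_ge[of x y u] x True zero_le_power2[of t] unfolding z qfp_def fst_conv snd_conv by linarith
          then have "((x - y)\<^sup>2) powr (\<alpha> / 2) \<le> (qfp x z + t\<^sup>2) powr (\<alpha> / 2)" using a by (intro powr_mono2) auto
          moreover have "((x - y)\<^sup>2) powr (\<alpha> / 2) = \<bar>x - y\<bar> powr \<alpha>"
            by (cases "x = y") (use square_powr[of "\<bar>x - y\<bar>" "\<alpha> / 2"] in auto)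
          ultimately show ?thesis by simp
        qed
        have "\<bar>h y\<bar> \<le> K * N * (\<bar>x - y\<bar> powr \<alpha> * h1' y)"
          using holder_harmonic_difference[OF lam a(1,2) x y N h1[OF x y] h2[OF x]] by (simp add: h_def c_def K_def h1'_def)
        also have "\<dots> \<le> K * N * ((qfp x z + t\<^sup>2) powr (\<alpha> / 2) * h1' y)"
          using xy K N by (intro mult_left_mono mult_right_mono) (auto simp: h1'_def)
        finally have hb: "\<bar>h y\<bar> \<le> K * N * ((qfp x z + t\<^sup>2) powr (\<alpha> / 2) * h1' y)" .
        let ?W = "2 * lam / pi * (x * y) powr lam"
        have "\<bar>wt lam x h z\<bar> * \<bar>kphi lam m g (qfp x z) t\<bar> \<le> (?W * (K * N * ((qfp x z + t\<^sup>2) powr (\<alpha> / 2) * h1' y))) * (C0 * (qfp x z + t\<^sup>2) powr (- lam - (1 + b) / 2))"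
        proof (intro mult_mono C0(2)[OF A t])
          have "\<bar>wt lam x h z\<bar> = ?W * \<bar>h y\<bar>" using True lam by (simp add: wt_def z abs_mult)
          also have "\<dots> \<le> ?W * (K * N * ((qfp x z + t\<^sup>2) powr (\<alpha> / 2) * h1' y))" using hb lam by (intro mult_left_mono) auto
          finally show "\<bar>wt lam x h z\<bar> \<le> ?W * (K * N * ((qfp x z + t\<^sup>2) powr (\<alpha> / 2) * h1' y))" .
          show "0 \<le> ?W * (K * N * ((qfp x z + t\<^sup>2) powr (\<alpha> / 2) * h1' y))" using lam K N by (auto simp: h1'_def intro!: mult_nonneg_nonneg)
        qed auto
        also have "\<dots> = C0 * K * N * (?W * h1' y * ((qfp x z + t\<^sup>2) powr (\<alpha> / 2) * (qfp x z + t\<^sup>2) powr (- lam - (1 + b) / 2)))"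
          by (simp only: mult_ac)
        also have "(qfp x z + t\<^sup>2) powr (\<alpha> / 2) * (qfp x z + t\<^sup>2) powr (- lam - (1 + b) / 2) = (qfp x z + t\<^sup>2) powr (- lam - (1 + \<epsilon>) / 2)"
          by (subst powr_add[symmetric]) (rule powr_exp_cong, simp add: \<epsilon>_def field_simps)
        also have "?W * h1' y = \<bar>wt lam x h1' z\<bar>" using True lam by (simp add: wt_def z abs_mult h1'_def)
        finally have "norm (wt lam x h z * kphi lam m g (qfp x z) t) \<le> C0 * K * N * (\<bar>wt lam x h1' z\<bar> * (qfp x z + t\<^sup>2) powr (- lam - (1 + \<epsilon>) / 2))"
          by (simp add: abs_mult)
        then show ?thesis using C0 K N by (subst ennreal_mult'[symmetric]) (auto intro!: ennreal_leI)
      qed (auto simp: wt_def z)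
    qed
    also have "\<dots> = ennreal (C0 * K * N) * (\<integral>\<^sup>+z. ennreal (\<bar>wt lam x h1' z\<bar> * (qfp x z + t\<^sup>2) powr (- lam - (1 + \<epsilon>) / 2)) \<partial>PM lam)"
      by (rule nn_integral_cmult) measurable
    also have "\<dots> \<le> ennreal (C0 * K * N) * (ennreal Q * ennreal ((C1 + 1) * (t powr (- \<epsilon>) / \<epsilon>)))"
    proof (rule mult_left_mono)
      have "(\<integral>\<^sup>+z. ennreal (\<bar>wt lam x h1' z\<bar> * (qfp x z + t\<^sup>2) powr (- lam - (1 + \<epsilon>) / 2)) \<partial>PM lam)
        \<le> ennreal Q * (\<integral>\<^sub>+z. ennreal \<bar>pos z * h1' z\<bar> * (\<integral>\<^sup>+r\<in>{t<..}. ennreal (r powr (- \<epsilon> - 1) * pker lam r x z) \<partial>lborel))"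
        unfolding Q_def by (rule nn_integral_wt_power_le[OF hm eps lam x t])
      also have "(\<integral>\<^sub>+z. ennreal \<bar>pos z * h1' z\<bar> * (\<integral>\<^sup>+r\<in>{t<..}. ennreal (r powr (- \<epsilon> - 1) * pker lam r x z) \<partial>lborel))
        = (\<integral>\<^sub>+z. (\<integral>\<^sub>+r. ennreal \<bar>pos z * h1' z\<bar> * (ennreal (r powr (- \<epsilon> - 1) * pker lam r x z) * indicator {t<..} r)))"
        by (rule nn_integral_cong, rule nn_integral_cmult[symmetric]) measurable
      also have "\<dots> = (\<integral>\<^sub>+r. (\<integral>\<^sub>+z. ennreal \<bar>pos z * h1' z\<bar> * (ennreal (r powr (- \<epsilon> - 1) * pker lam r x z) * indicator {t<..} r)))"
        unfolding h1'_def by (rule lborel_pair.Fubini') measurable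
      also have "\<dots> \<le> (\<integral>\<^sub>+r. ennreal (C1 + 1) * (ennreal (r powr (- \<epsilon> - 1)) * indicator {t<..} r))"
      proof (rule nn_integral_mono)
        fix r :: real
        show "(\<integral>\<^sub>+z. ennreal \<bar>pos z * h1' z\<bar> * (ennreal (r powr (- \<epsilon> - 1) * pker lam r x z) * indicator {t<..} r))
          \<le> ennreal (C1 + 1) * (ennreal (r powr (- \<epsilon> - 1)) * indicator {t<..} r)"
        proof (cases "r > t")
          case True
          then have r: "r > 0" using t by linarith
          have "(\<integral>\<^sub>+z. ennreal \<bar>pos z * h1' z\<bar> * (ennreal (r powr (- \<epsilon> - 1) * pker lam r x z) * indicator {t<..} r))
            = (\<integral>\<^sub>+z. ennreal (r powr (- \<epsilon> - 1)) * (ennreal (pker lam r x z) * pos z + ennreal (x powr (- lam)) * (ennreal (pker lam r x z * z powr lam) * pos z)))"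
          proof (rule nn_integral_cong)
            fix z :: real
            show "ennreal \<bar>pos z * h1' z\<bar> * (ennreal (r powr (- \<epsilon> - 1) * pker lam r x z) * indicator {t<..} r)
              = ennreal (r powr (- \<epsilon> - 1)) * (ennreal (pker lam r x z) * pos z + ennreal (x powr (- lam)) * (ennreal (pker lam r x z * z powr lam) * pos z))"
            proof (cases "z > 0")
              case z: True
              have pn: "pker lam r x z \<ge> 0" by (rule pker_nonneg[OF lam r])
              have "(z / x) powr lam = z powr lam * x powr (- lam)" by (simp add: powr_divide powr_minus_divide)
              then have e: "\<bar>h1' z\<bar> * (r powr (- \<epsilon> - 1) * pker lam r x z) = r powr (- \<epsilon> - 1) * (pker lam r x z + x powr (- lam) * (pker lam r x z * z powr lam))"
                by (simp add: h1'_def algebra_simps)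
              have "ennreal \<bar>h1' z\<bar> * ennreal (r powr (- \<epsilon> - 1) * pker lam r x z) = ennreal (\<bar>h1' z\<bar> * (r powr (- \<epsilon> - 1) * pker lam r x z))"
                by (rule ennreal_mult'[symmetric]) simp
              also have "\<dots> = ennreal (r powr (- \<epsilon> - 1)) * (ennreal (pker lam r x z) + ennreal (x powr (- lam)) * ennreal (pker lam r x z * z powr lam))"
                unfolding e using pn by (simp add: ennreal_mult' ennreal_plus)
              finally show ?thesis using True z by simp
            qed simp
          qed
          also have "\<dots> = ennreal (r powr (- \<epsilon> - 1)) * ((\<integral>\<^sub>0z. ennreal (pker lam r x z)) + ennreal (x powr (- lam)) * (\<integral>\<^sub>0z. ennreal (pker lam r x z * z powr lam)))"
            by (subst nn_integral_cmult, measurable, subst nn_integral_add, measurable, subst nn_integral_cmult, measurable)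
          also have "\<dots> \<le> ennreal (r powr (- \<epsilon> - 1)) * (ennreal C1 + ennreal (x powr (- lam)) * ennreal (x powr lam))"
            unfolding pker_powr_invariant[OF lam r x] by (intro mult_left_mono add_right_mono C1(2) r x) simp
          also have "ennreal (x powr (- lam)) * ennreal (x powr lam) = ennreal 1"
            using x by (simp add: ennreal_mult'[symmetric] powr_add[symmetric])
          also have "ennreal C1 + ennreal 1 = ennreal (C1 + 1)"
            using C1(1) by (intro ennreal_plus[symmetric]) auto
          finally show ?thesis using True by (simp add: mult.commute)
        qed simp
      qed
      also have "\<dots> = ennreal (C1 + 1) * ennreal (t powr (- \<epsilon>) / \<epsilon>)"
        using nn_integral_powr_inf[OF eps t] by (subst nn_integral_cmult) auto
      also have "\<dots> = ennreal ((C1 + 1) * (t powr (- \<epsilon>) / \<epsilon>))" using C1(1) by (intro ennreal_mult'[symmetric]) simp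
      finally show "(\<integral>\<^sup>+z. ennreal (\<bar>wt lam x h1' z\<bar> * (qfp x z + t\<^sup>2) powr (- lam - (1 + \<epsilon>) / 2)) \<partial>PM lam) \<le> ennreal Q * ennreal ((C1 + 1) * (t powr (- \<epsilon>) / \<epsilon>))"
        by (simp add: mult_left_mono)
    qed simp
    also have "\<dots> = ennreal (C0 * K * N * (Q * ((C1 + 1) * (t powr (- \<epsilon>) / \<epsilon>))))"
    proof -
      have "ennreal Q * ennreal ((C1 + 1) * (t powr (- \<epsilon>) / \<epsilon>)) = ennreal (Q * ((C1 + 1) * (t powr (- \<epsilon>) / \<epsilon>)))"
        by (rule ennreal_mult'[symmetric]) (simp add: Q_def)
      then show ?thesis using C0 K N by (simp add: ennreal_mult'[symmetric])
    qed
    also have "C0 * K * N * (Q * ((C1 + 1) * (t powr (- \<epsilon>) / \<epsilon>))) = C * N * t powr (\<alpha> - b)"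
      by (simp add: C_def \<epsilon>_def)
    finally have "ennreal \<bar>Vker lam m g h t x\<bar> \<le> ennreal (C * N * t powr (\<alpha> - b))" .
    then show ?thesis unfolding Vfh using C N by (simp add: ennreal_le_iff)
  qed
  note main = this
  show ?thesis
  proof (intro exI[of _ C] conjI allI impI)
    fix f :: "real \<Rightarrow> real" and N t x :: real
    assume f: "adm lam 0 f" and N: "0 \<le> N" and tx: "0 < t" "0 < x"
      and h1: "\<forall>x>0. \<forall>y>0. \<bar>f y - f x\<bar> \<le> N * \<bar>x - y\<bar> powr \<alpha>" and h2: "\<forall>x>0. \<bar>f x\<bar> \<le> N * x powr \<alpha>"
    show "\<bar>Vker lam m g f t x\<bar> \<le> C * N * t powr (\<alpha> - b)"
      by (rule main[OF f N _ _ tx]) (simp_all add: h1 h2)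
  qed (rule C)
qed

section \<open>From the fractional derivative back to Hoelder bounds\<close>

lemma nn_integral_min_powr_le:
  assumes "0 < \<alpha>" "\<alpha> < a" "D > (0::real)"
  shows "(\<integral>\<^sub>0s. ennreal (s powr (\<alpha> - 1) * min 1 ((D / s) powr a))) \<le> ennreal ((1 / \<alpha> + 1 / (a - \<alpha>)) * D powr \<alpha>)"
proof -
  have "(\<integral>\<^sub>0s. ennreal (s powr (\<alpha> - 1) * min 1 ((D / s) powr a)))
    \<le> (\<integral>\<^sub>+s. ennreal (s powr (\<alpha> - 1)) * indicator {0<..D} s + ennreal (D powr a) * (ennreal (s powr (- (a - \<alpha>) - 1)) * indicator {D<..} s))"
  proof (rule nn_integral_mono)
    fix s :: real
    consider "s \<le> 0" | "0 < s" "s \<le> D" | "s > D" by linarith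
    then show "ennreal (s powr (\<alpha> - 1) * min 1 ((D / s) powr a)) * pos s
      \<le> ennreal (s powr (\<alpha> - 1)) * indicator {0<..D} s + ennreal (D powr a) * (ennreal (s powr (- (a - \<alpha>) - 1)) * indicator {D<..} s)"
    proof cases
      case 2
      have "s powr (\<alpha> - 1) * min 1 ((D / s) powr a) \<le> s powr (\<alpha> - 1) * 1" by (intro mult_left_mono) auto
      then show ?thesis using 2 by (auto intro!: ennreal_leI)
    next
      case 3
      then have s: "s > 0" using assms by linarith
      have "s powr (\<alpha> - 1) * min 1 ((D / s) powr a) \<le> s powr (\<alpha> - 1) * (D / s) powr a" by (intro mult_left_mono) auto
      also have "\<dots> = D powr a * (s powr (\<alpha> - 1) / s powr a)" by (simp add: powr_divide)
      also have "s powr (\<alpha> - 1) / s powr a = s powr (- (a - \<alpha>) - 1)" by (subst powr_diff[symmetric]) (rule powr_exp_cong, simp)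
      finally show ?thesis using 3 s by (auto simp: ennreal_mult'[symmetric] intro!: ennreal_leI)
    qed simp
  qed
  also have "\<dots> = (\<integral>\<^sup>+s\<in>{0<..D}. ennreal (s powr (\<alpha> - 1)) \<partial>lborel) + ennreal (D powr a) * (\<integral>\<^sup>+s\<in>{D<..}. ennreal (s powr (- (a - \<alpha>) - 1)) \<partial>lborel)"
    by (subst nn_integral_add, measurable, subst nn_integral_cmult, measurable)
  also have "\<dots> = ennreal (D powr \<alpha> / \<alpha>) + ennreal (D powr a) * ennreal (D powr (- (a - \<alpha>)) / (a - \<alpha>))"
    using assms by (simp only: nn_integral_powr_0 nn_integral_powr_inf diff_gt_0_iff_gt)
  also have "ennreal (D powr a) * ennreal (D powr (- (a - \<alpha>)) / (a - \<alpha>)) = ennreal (D powr a * (D powr (- (a - \<alpha>)) / (a - \<alpha>)))"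
    by (rule ennreal_mult'[symmetric]) simp
  also have "ennreal (D powr \<alpha> / \<alpha>) + \<dots> = ennreal (D powr \<alpha> / \<alpha> + D powr a * (D powr (- (a - \<alpha>)) / (a - \<alpha>)))"
    using assms by (intro ennreal_plus[symmetric]) auto
  also have "D powr a * (D powr (- (a - \<alpha>)) / (a - \<alpha>)) = D powr \<alpha> / (a - \<alpha>)"
  proof -
    have "D powr a * D powr (- (a - \<alpha>)) = D powr \<alpha>" by (subst powr_add[symmetric]) (rule powr_exp_cong, simp)
    then show ?thesis by simp
  qed
  finally show ?thesis by (simp add: algebra_simps)
qed

text \<open>The bound on \<open>F\<close> decreases in its argument, so \<open>t + s\<close> may be
  replaced by \<open>s\<close>; the estimate is then uniform in \<open>t\<close>, as the limit at 0
  demands. The gain \<open>(D / s) powr a\<close> for \<open>s > D\<close> makes the integral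
  converge at infinity, and \<open>D\<close> is the scale of the result.\<close>

lemma tail_integral_bound:
  assumes "0 < \<alpha>" "\<alpha> < a" "\<alpha> < b" "D > (0::real)" "K \<ge> 0" "t > 0"
    and int: "integrable lborel (\<lambda>s. pos s * (F (t + s) * s powr (b - 1)))"
    and F: "\<And>s. s > 0 \<Longrightarrow> \<bar>F s\<bar> \<le> K * s powr (\<alpha> - b) * min 1 ((D / s) powr a)"
  shows "\<bar>\<integral>s. pos s * (F (t + s) * s powr (b - 1)) \<partial>lborel\<bar> \<le> K * (1 / \<alpha> + 1 / (a - \<alpha>)) * D powr \<alpha>"
proof -
  have "ennreal \<bar>\<integral>s. pos s * (F (t + s) * s powr (b - 1)) \<partial>lborel\<bar> \<le> (\<integral>\<^sub>+s. ennreal (norm (pos s * (F (t + s) * s powr (b - 1)))))"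
    using integral_norm_bound_ennreal[OF int] by simp
  also have "\<dots> \<le> (\<integral>\<^sub>+s. ennreal K * (ennreal (s powr (\<alpha> - 1) * min 1 ((D / s) powr a)) * pos s))"
  proof (rule nn_integral_mono)
    fix s :: real
    have "\<bar>F (t + s) * s powr (b - 1)\<bar> \<le> K * (s powr (\<alpha> - 1) * min 1 ((D / s) powr a))" if s: "s > 0"
    proof -
      have "\<bar>F (t + s)\<bar> \<le> K * (t + s) powr (\<alpha> - b) * min 1 ((D / (t + s)) powr a)" using s assms by (intro F) simp
      also have "\<dots> \<le> K * s powr (\<alpha> - b) * min 1 ((D / s) powr a)"
      proof -
        have p1: "(t + s) powr (\<alpha> - b) \<le> s powr (\<alpha> - b)" using assms s by (intro powr_mono2') auto
        have "(D / (t + s)) powr a \<le> (D / s) powr a" using assms s by (intro powr_mono2 divide_left_mono) auto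
        then have p2: "min 1 ((D / (t + s)) powr a) \<le> min 1 ((D / s) powr a)" by (rule min.mono[OF order_refl])
        show ?thesis using assms(5) by (intro mult_mono p1 p2) auto
      qed
      finally have "\<bar>F (t + s)\<bar> * s powr (b - 1) \<le> K * s powr (\<alpha> - b) * min 1 ((D / s) powr a) * s powr (b - 1)"
        by (intro mult_right_mono) auto
      also have "\<dots> = K * ((s powr (\<alpha> - b) * s powr (b - 1)) * min 1 ((D / s) powr a))" by (simp only: mult_ac)
      also have "s powr (\<alpha> - b) * s powr (b - 1) = s powr (\<alpha> - 1)" by (subst powr_add[symmetric]) (rule powr_exp_cong, simp)
      finally show ?thesis by (simp add: abs_mult)
    qed
    then show "ennreal (norm (pos s * (F (t + s) * s powr (b - 1)))) \<le> ennreal K * (ennreal (s powr (\<alpha> - 1) * min 1 ((D / s) powr a)) * pos s)"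
      using assms(5) by (auto simp: ennreal_mult'[symmetric] intro!: ennreal_leI split: split_indicator)
  qed
  also have "\<dots> = ennreal K * (\<integral>\<^sub>0s. ennreal (s powr (\<alpha> - 1) * min 1 ((D / s) powr a)))"
    by (rule nn_integral_cmult) measurable
  also have "\<dots> \<le> ennreal K * ennreal ((1 / \<alpha> + 1 / (a - \<alpha>)) * D powr \<alpha>)"
    using assms by (intro mult_left_mono nn_integral_min_powr_le) auto
  also have "\<dots> = ennreal (K * (1 / \<alpha> + 1 / (a - \<alpha>)) * D powr \<alpha>)" using assms(5) by (simp add: ennreal_mult'[symmetric] mult.assoc)
  finally have Z: "ennreal \<bar>\<integral>s. pos s * (F (t + s) * s powr (b - 1)) \<partial>lborel\<bar> \<le> ennreal (K * (1 / \<alpha> + 1 / (a - \<alpha>)) * D powr \<alpha>)" .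
  have "0 \<le> K * (1 / \<alpha> + 1 / (a - \<alpha>)) * D powr \<alpha>" using assms by (intro mult_nonneg_nonneg add_nonneg_nonneg) auto
  with Z show ?thesis by (simp only: ennreal_le_iff)
qed

lemma Vker_inversion:
  assumes f: "adm lam 0 f" and lam: "lam > 0" and b: "b > 0" and g: "g > 0" "real m = g + b" and tx: "t > 0" "x > 0"
  shows "(\<integral>\<^sub>Ls. pos s * (Vker lam m g f (t + s) x * s powr (b - 1))) = (-1) ^ m * Gamma b * Gamma g * Uker lam 0 f t x"
    and "integrable lborel (\<lambda>s. pos s * (Vker lam m g f (t + s) x * s powr (b - 1)))"
proof -
  interpret K: kernel_weight "PM lam" "wt lam x f" "qfp x" lam 0 by (rule kernel_weight_wt[OF f lam _ _ tx(2)]) auto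
  show "(\<integral>\<^sub>Ls. pos s * (Vker lam m g f (t + s) x * s powr (b - 1))) = (-1) ^ m * Gamma b * Gamma g * Uker lam 0 f t x"
    unfolding Vker_def Uker_def by (rule K.kint_inversion(1)[OF g(1) b refl g(2) tx(1)])
  show "integrable lborel (\<lambda>s. pos s * (Vker lam m g f (t + s) x * s powr (b - 1)))"
    unfolding Vker_def by (rule K.kint_inversion(2)[OF g(1) b refl g(2) tx(1)])
qed

text \<open>The test function \<open>\<phi>\<close> is \<open>pker\<close> or a difference of two such kernels.\<close>

lemma integral_against_bounded:
  fixes \<phi> V :: "real \<Rightarrow> real"
  assumes int: "integrable lborel (\<lambda>y. pos y * \<phi> y * V y)" and B: "B \<ge> 0" and C: "C \<ge> 0"
    and V: "AE y in lborel. y > 0 \<longrightarrow> \<bar>V y\<bar> \<le> B"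
    and \<phi>: "(\<integral>\<^sub>0y. ennreal \<bar>\<phi> y\<bar>) \<le> ennreal C"
    and [measurable]: "\<phi> \<in> borel_measurable borel"
  shows "\<bar>\<integral>y. pos y * \<phi> y * V y \<partial>lborel\<bar> \<le> C * B"
proof -
  have "ennreal \<bar>\<integral>y. pos y * \<phi> y * V y \<partial>lborel\<bar> \<le> (\<integral>\<^sub>+y. ennreal (norm (pos y * \<phi> y * V y)))"
    using integral_norm_bound_ennreal[OF int] by simp
  also have "\<dots> \<le> (\<integral>\<^sub>+y. ennreal B * (ennreal \<bar>\<phi> y\<bar> * pos y))"
  proof (rule nn_integral_mono_AE, use V in eventually_elim)
    fix y :: real assume "y > 0 \<longrightarrow> \<bar>V y\<bar> \<le> B"
    then show "ennreal (norm (pos y * \<phi> y * V y)) \<le> ennreal B * (ennreal \<bar>\<phi> y\<bar> * pos y)"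
      using B by (auto simp: ennreal_mult'[symmetric] abs_mult mult.commute intro!: ennreal_leI mult_right_mono split: split_indicator)
  qed
  also have "\<dots> = ennreal B * (\<integral>\<^sub>+y. (ennreal \<bar>\<phi> y\<bar> * pos y))" by (rule nn_integral_cmult) measurable
  also have "\<dots> \<le> ennreal B * ennreal C" by (intro mult_left_mono \<phi>) simp
  also have "\<dots> = ennreal (C * B)" using B by (simp add: ennreal_mult'[symmetric] mult.commute)
  finally have Z: "ennreal \<bar>\<integral>y. pos y * \<phi> y * V y \<partial>lborel\<bar> \<le> ennreal (C * B)" .
  have "0 \<le> C * B" using B C by simp
  with Z show ?thesis by (simp only: ennreal_le_iff)
qed

text \<open>By the semigroup law the value at time \<open>t + s\<close> is an integral of the values
  at time \<open>t\<close>, which does not see null sets: a bound almost everywhere becomes one at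
  every point.\<close>

lemma Vker_AE_bound:
  assumes lam: "lam > 0" and b: "b > 0" and g: "g > 0" "real m = g + b"
  shows "\<exists>C\<ge>0. \<forall>f t s x B. adm lam 0 f \<longrightarrow> t > 0 \<longrightarrow> s > 0 \<longrightarrow> x > 0 \<longrightarrow> B \<ge> 0 \<longrightarrow>
    (AE y in lborel. y > 0 \<longrightarrow> \<bar>Vker lam m g f t y\<bar> \<le> B) \<longrightarrow> \<bar>Vker lam m g f (t + s) x\<bar> \<le> C * B"
proof -
  note [measurable] = pker_measurable[OF lam]
  obtain C1 where C1: "C1 \<ge> 0" "\<And>t x. t > 0 \<Longrightarrow> x > 0 \<Longrightarrow> (\<integral>\<^sub>0y. ennreal (pker lam t x y)) \<le> ennreal C1"
    using nn_integral_pker_le[OF lam] by blast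
  show ?thesis
  proof (intro exI[of _ C1] conjI allI impI C1(1))
    fix f :: "real \<Rightarrow> real" and t s x B :: real
    assume f: "adm lam 0 f" and t: "t > 0" and s: "s > 0" and x: "x > 0" and B: "B \<ge> 0"
      and V: "AE y in lborel. y > 0 \<longrightarrow> \<bar>Vker lam m g f t y\<bar> \<le> B"
    show "\<bar>Vker lam m g f (t + s) x\<bar> \<le> C1 * B"
      unfolding Vker_semigroup(2)[OF f lam b g t s x]
    proof (rule integral_against_bounded[OF Vker_semigroup(1)[OF f lam b g t s x] B C1(1) V])
      show "(\<integral>\<^sub>0y. ennreal \<bar>pker lam s x y\<bar>) \<le> ennreal C1"
        using C1(2)[OF s x] pker_nonneg[OF lam s] by simp
    qed measurable
  qed
qed

text \<open>Half of the time is given to the kernel: with \<open>s = s / 2 + s / 2\<close>,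
  \<open>Vker\<close> at time \<open>s\<close> is an integral of \<open>Vker\<close> at time
  \<open>s / 2\<close>, and the small mass of the kernel, respectively its modulus of continuity,
  yields decay beyond \<open>s powr (\<alpha> - b)\<close>. Their exponents \<open>lam\<close> and
  \<open>min 1 lam\<close> exceed \<open>\<alpha>\<close>, so \<open>tail_integral_bound\<close>
  applies to the inversion formula with \<open>D = 2 * x\<close> and
  \<open>D = 2 * \<bar>x - y\<bar>\<close>, before \<open>t\<close> tends to 0.\<close>

lemma holder_of_Vker_bound:
  assumes lam: "lam > 0" and b: "b > 0" and g: "g > 0" "real m = g + b" and a: "0 < \<alpha>" "\<alpha> < 1" "\<alpha> < lam" "\<alpha> < b"
  shows "\<exists>C\<ge>0. \<forall>f N. adm lam 0 f \<longrightarrow> continuous_on {0<..} f \<longrightarrow> N \<ge> 0 \<longrightarrow> (\<forall>t>0. \<forall>x>0. \<bar>Vker lam m g f t x\<bar> \<le> N * t powr (\<alpha> - b)) \<longrightarrow>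
    (\<forall>x>0. \<bar>f x\<bar> \<le> C * N * x powr \<alpha>) \<and> (\<forall>x>0. \<forall>y>0. \<bar>f x - f y\<bar> \<le> C * N * \<bar>x - y\<bar> powr \<alpha>)"
proof -
  note [measurable] = pker_measurable[OF lam]
  obtain C1 where C1: "C1 \<ge> 0" "\<And>t x. t > 0 \<Longrightarrow> x > 0 \<Longrightarrow> (\<integral>\<^sub>0y. ennreal (pker lam t x y)) \<le> ennreal C1"
    using nn_integral_pker_le[OF lam] by blast
  define C2 where "C2 = C1 + (1 + bmass lam)"
  have C2: "C2 \<ge> 0" "C2 \<ge> C1" "C2 \<ge> 1 + bmass lam" using C1(1) bmass_nonneg[OF lam] by (auto simp: C2_def)
  have min2: "(\<integral>\<^sub>0y. ennreal \<bar>pker lam t x y\<bar>) \<le> ennreal (C2 * min 1 ((x / t) powr lam))" if t: "t > 0" and x: "x > 0" for t x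
  proof -
    have e: "(\<integral>\<^sub>0y. ennreal \<bar>pker lam t x y\<bar>) = (\<integral>\<^sub>0y. ennreal (pker lam t x y))"
      using pker_nonneg[OF lam t] by simp
    show ?thesis
    proof (cases "(x / t) powr lam \<ge> 1")
      case True
      have "ennreal C1 \<le> ennreal (C2 * min 1 ((x / t) powr lam))" using True C2 by (intro ennreal_leI) simp
      then show ?thesis unfolding e using C1(2)[OF t x] by (rule order_trans[rotated])
    next
      case False
      have "(1 + bmass lam) * (x / t) powr lam \<le> C2 * (x / t) powr lam" using C2 by (intro mult_right_mono) auto
      then have "ennreal ((1 + bmass lam) * (x / t) powr lam) \<le> ennreal (C2 * min 1 ((x / t) powr lam))" using False by (intro ennreal_leI) simp
      then show ?thesis unfolding e using nn_integral_pker_small[OF lam t x] by (rule order_trans[rotated])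
    qed
  qed
  obtain C3 where C3: "C3 \<ge> 0" "\<And>t x x'. t > 0 \<Longrightarrow> x > 0 \<Longrightarrow> x' > 0 \<Longrightarrow> (\<integral>\<^sub>0y. ennreal \<bar>pker lam t x y - pker lam t x' y\<bar>) \<le> ennreal (C3 * min 1 ((\<bar>x - x'\<bar> / t) powr min 1 lam))"
    using nn_integral_pker_diff[OF lam] by blast
  define G where "G = Gamma b * Gamma g"
  have G: "G > 0" using b g by (simp add: G_def Gamma_real_pos)
  \<comment> \<open>The price of evaluating the hypothesis at time \<open>s / 2\<close>; the factor
    \<open>2 powr \<alpha>\<close> below comes from the doubled scale \<open>D\<close>.\<close>
  define E where "E = (1 / 2) powr (\<alpha> - b)"
  have E: "E \<ge> 0" by (simp add: E_def)
  define c1 where "c1 = C2 * E * (1 / \<alpha> + 1 / (lam - \<alpha>)) * 2 powr \<alpha> / G"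
  define c2 where "c2 = C3 * E * (1 / \<alpha> + 1 / (min 1 lam - \<alpha>)) * 2 powr \<alpha> / G"
  have c: "c1 \<ge> 0" "c2 \<ge> 0" unfolding c1_def c2_def using C2 C3 E a G
    by (auto intro!: divide_nonneg_pos mult_nonneg_nonneg add_nonneg_nonneg simp: less_imp_le)
  have am: "\<alpha> < min 1 lam" using a by simp
  have main: "(\<bar>f x\<bar> \<le> c1 * N * x powr \<alpha>) \<and> (\<bar>f x - f y\<bar> \<le> c2 * N * \<bar>x - y\<bar> powr \<alpha>)"
    if f: "adm lam 0 f" and cont: "continuous_on {0<..} f" and N: "N \<ge> 0" and V: "\<And>t x. t > 0 \<Longrightarrow> x > 0 \<Longrightarrow> \<bar>Vker lam m g f t x\<bar> \<le> N * t powr (\<alpha> - b)"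
      and x: "x > 0" and y: "y > 0" for f N x y
  proof -
    have isC: "isCont f z" if "z > 0" for z using cont that by (simp add: continuous_on_eq_continuous_at)
    have half: "(s / 2) powr (\<alpha> - b) = E * s powr (\<alpha> - b)" for s :: real
      using powr_mult[of "1 / 2" s "\<alpha> - b"] by (simp add: E_def)
    have AEb: "AE y in lborel. y > 0 \<longrightarrow> \<bar>Vker lam m g f (s / 2) y\<bar> \<le> N * (E * s powr (\<alpha> - b))" if "s > 0" for s
      using V[of "s / 2"] that unfolding half by (intro AE_I2) auto
    have V1: "\<bar>Vker lam m g f s z\<bar> \<le> C2 * N * E * s powr (\<alpha> - b) * min 1 ((2 * z / s) powr lam)" if s: "s > 0" and z: "z > 0" for s z
    proof -
      have h: "s / 2 > 0" using s by simp
      have "\<bar>Vker lam m g f (s / 2 + s / 2) z\<bar> \<le> C2 * min 1 ((z / (s / 2)) powr lam) * (N * (E * s powr (\<alpha> - b)))"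
        unfolding Vker_semigroup(2)[OF f lam b g h h z]
        by (rule integral_against_bounded[OF Vker_semigroup(1)[OF f lam b g h h z] _ _ AEb[OF s] min2[OF h z]])
          (use N E C2 in \<open>auto intro!: mult_nonneg_nonneg\<close>)
      then show ?thesis by (simp add: mult_ac)
    qed
    have V2: "\<bar>Vker lam m g f s x - Vker lam m g f s y\<bar> \<le> C3 * N * E * s powr (\<alpha> - b) * min 1 ((2 * \<bar>x - y\<bar> / s) powr min 1 lam)" if s: "s > 0" for s
    proof -
      have h: "s / 2 > 0" using s by simp
      let ?p = "\<lambda>w. pker lam (s / 2) x w - pker lam (s / 2) y w"
      note ix = Vker_semigroup[OF f lam b g h h x] and iy = Vker_semigroup[OF f lam b g h h y]
      have eq: "pos w * ?p w * Vker lam m g f (s / 2) w = pos w * pker lam (s / 2) x w * Vker lam m g f (s / 2) w - pos w * pker lam (s / 2) y w * Vker lam m g f (s / 2) w" for w :: real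
        by (simp add: algebra_simps)
      have int: "integrable lborel (\<lambda>w. pos w * ?p w * Vker lam m g f (s / 2) w)"
        unfolding eq by (rule Bochner_Integration.integrable_diff[OF ix(1) iy(1)])
      have "Vker lam m g f (s / 2 + s / 2) x - Vker lam m g f (s / 2 + s / 2) y = (\<integral>\<^sub>Lw. pos w * ?p w * Vker lam m g f (s / 2) w)"
        unfolding eq ix(2) iy(2) by (rule Bochner_Integration.integral_diff[OF ix(1) iy(1), symmetric])
      moreover have "\<bar>\<integral>w. pos w * ?p w * Vker lam m g f (s / 2) w \<partial>lborel\<bar> \<le> C3 * min 1 ((\<bar>x - y\<bar> / (s / 2)) powr min 1 lam) * (N * (E * s powr (\<alpha> - b)))"
        by (rule integral_against_bounded[OF int _ _ AEb[OF s] C3(2)[OF h x y]])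
          (use N E C3 in \<open>auto intro!: mult_nonneg_nonneg\<close>)
      ultimately show ?thesis by (simp add: mult_ac)
    qed
    have U: "Uker lam 0 f t z = (-1) ^ m * (\<integral>\<^sub>Ls. pos s * (Vker lam m g f (t + s) z * s powr (b - 1))) / G" if "t > 0" "z > 0" for t z
      unfolding Vker_inversion(1)[OF f lam b g that] using Gamma_real_pos[OF b] Gamma_real_pos[OF g(1)] by (simp add: G_def power_mult_distrib[symmetric] mult.assoc[symmetric])
    have U1: "\<bar>Uker lam 0 f t x\<bar> \<le> c1 * N * x powr \<alpha>" if t: "t > 0" for t
    proof -
      have "\<bar>\<integral>s. pos s * (Vker lam m g f (t + s) x * s powr (b - 1)) \<partial>lborel\<bar> \<le> C2 * N * E * (1 / \<alpha> + 1 / (lam - \<alpha>)) * (2 * x) powr \<alpha>"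
        by (rule tail_integral_bound[OF a(1,3,4) _ _ t Vker_inversion(2)[OF f lam b g t x] V1[OF _ x]]) (use x C2 N E in auto)
      then have "\<bar>\<integral>s. pos s * (Vker lam m g f (t + s) x * s powr (b - 1)) \<partial>lborel\<bar> / G \<le> C2 * N * E * (1 / \<alpha> + 1 / (lam - \<alpha>)) * (2 * x) powr \<alpha> / G"
        using G by (intro divide_right_mono) auto
      also have "\<dots> = c1 * N * x powr \<alpha>" unfolding c1_def powr_mult by (simp add: mult_ac)
      finally show ?thesis unfolding U[OF t x] using G by (simp add: abs_mult power_abs)
    qed
    have U2: "\<bar>Uker lam 0 f t x - Uker lam 0 f t y\<bar> \<le> c2 * N * \<bar>x - y\<bar> powr \<alpha>" if t: "t > 0" and ne: "x \<noteq> y" for t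
    proof -
      have D: "2 * \<bar>x - y\<bar> > 0" using ne by simp
      note ix = Vker_inversion(2)[OF f lam b g t x] and iy = Vker_inversion(2)[OF f lam b g t y]
      have eq: "pos s * ((Vker lam m g f (t + s) x - Vker lam m g f (t + s) y) * s powr (b - 1)) = pos s * (Vker lam m g f (t + s) x * s powr (b - 1)) - pos s * (Vker lam m g f (t + s) y * s powr (b - 1))" for s :: real
        by (simp add: algebra_simps)
      have int: "integrable lborel (\<lambda>s. pos s * ((Vker lam m g f (t + s) x - Vker lam m g f (t + s) y) * s powr (b - 1)))"
        unfolding eq by (rule Bochner_Integration.integrable_diff[OF ix iy])
      let ?I = "\<integral>s. pos s * ((Vker lam m g f (t + s) x - Vker lam m g f (t + s) y) * s powr (b - 1)) \<partial>lborel"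
      have "\<bar>?I\<bar> \<le> C3 * N * E * (1 / \<alpha> + 1 / (min 1 lam - \<alpha>)) * (2 * \<bar>x - y\<bar>) powr \<alpha>"
        by (rule tail_integral_bound[where F="\<lambda>s. Vker lam m g f s x - Vker lam m g f s y", OF a(1) am a(4) D _ t int V2]) (use C3 N E in auto)
      then have "\<bar>?I\<bar> / G \<le> C3 * N * E * (1 / \<alpha> + 1 / (min 1 lam - \<alpha>)) * (2 * \<bar>x - y\<bar>) powr \<alpha> / G"
        using G by (intro divide_right_mono) auto
      also have "\<dots> = c2 * N * \<bar>x - y\<bar> powr \<alpha>" unfolding c2_def powr_mult by (simp add: mult_ac)
      finally have 1: "\<bar>?I\<bar> / G \<le> c2 * N * \<bar>x - y\<bar> powr \<alpha>" .
      have "?I = (\<integral>\<^sub>Ls. pos s * (Vker lam m g f (t + s) x * s powr (b - 1))) - (\<integral>\<^sub>Ls. pos s * (Vker lam m g f (t + s) y * s powr (b - 1)))"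
        unfolding eq by (rule Bochner_Integration.integral_diff[OF ix iy])
      then have "Uker lam 0 f t x - Uker lam 0 f t y = (-1) ^ m * ?I / G"
        unfolding U[OF t x] U[OF t y] by (simp add: right_diff_distrib diff_divide_distrib)
      then have "\<bar>Uker lam 0 f t x - Uker lam 0 f t y\<bar> = \<bar>?I\<bar> / G" using G by (simp add: abs_mult power_abs)
      with 1 show ?thesis by simp
    qed
    have ev: "eventually (\<lambda>t::real. t > 0) (at_right 0)" by (rule eventually_at_right_less)
    have L: "((\<lambda>t. Uker lam 0 f t z) \<longlongrightarrow> f z) (at_right 0)" if "z > 0" for z by (rule Uker_tendsto[OF f lam that isC[OF that]])
    have R1: "\<bar>f x\<bar> \<le> c1 * N * x powr \<alpha>"
      by (rule tendsto_upperbound[OF tendsto_rabs[OF L[OF x]]]) (use ev U1 in \<open>auto elim: eventually_mono\<close>)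
    have R2: "\<bar>f x - f y\<bar> \<le> c2 * N * \<bar>x - y\<bar> powr \<alpha>"
    proof (cases "x = y")
      case False
      show ?thesis
        by (rule tendsto_upperbound[OF tendsto_rabs[OF tendsto_diff[OF L[OF x] L[OF y]]]]) (use ev U2 False in \<open>auto elim: eventually_mono\<close>)
    qed simp
    show ?thesis using R1 R2 by blast
  qed
  show ?thesis
  proof (intro exI[of _ "c1 + c2"] conjI allI impI)
    fix f :: "real \<Rightarrow> real" and N x :: real
    assume f: "adm lam 0 f" "continuous_on {0<..} f" "0 \<le> N" and V: "\<forall>t>0. \<forall>x>0. \<bar>Vker lam m g f t x\<bar> \<le> N * t powr (\<alpha> - b)" and x: "x > 0"
    have m: "(\<bar>f x\<bar> \<le> c1 * N * x powr \<alpha>) \<and> (\<bar>f x - f y\<bar> \<le> c2 * N * \<bar>x - y\<bar> powr \<alpha>)" if "y > 0" for y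
      by (rule main[OF f _ x that]) (use V in simp)
    have le: "c1 * N * z \<le> (c1 + c2) * N * z" "c2 * N * z \<le> (c1 + c2) * N * z" if "z \<ge> 0" for z
      using c f(3) that by (auto intro!: mult_right_mono)
    show "\<bar>f x\<bar> \<le> (c1 + c2) * N * x powr \<alpha>" using m[OF x] le(1)[of "x powr \<alpha>"] by simp
    show "\<bar>f x - f y\<bar> \<le> (c1 + c2) * N * \<bar>x - y\<bar> powr \<alpha>" if "y > 0" for y using m[OF that] le(2)[of "\<bar>x - y\<bar> powr \<alpha>"] by simp
  qed (use c in simp)
qed

subsection \<open>The Carleson condition\<close>

text \<open>By the Harnack inequality the kernel at time \<open>T\<close> changes by a bounded
  factor over a distance \<open>T\<close>. The interval is taken to the right of \<open>y\<close>,
  which keeps it in the half line and makes \<open>(y / y') powr lam \<le> 1\<close>.\<close>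

lemma pker_average:
  assumes lam: "lam > 0" and T: "T > 0" and x: "x > 0" and y: "y > 0"
  shows "ennreal T * ennreal (pker lam T x y) \<le> ennreal (2 powr (2 * lam + 2)) * (\<integral>\<^sub>+y'. ennreal (pker lam T x y') * indicator {y<..<y+T} y')"
proof -
  note [measurable] = pker_measurable[OF lam]
  have "ennreal T * ennreal (pker lam T x y) = (\<integral>\<^sub>+y'. ennreal (pker lam T x y) * indicator {y<..<y+T} y')"
    using T by (subst nn_integral_cmult_indicator) (auto simp: mult.commute)
  also have "\<dots> \<le> (\<integral>\<^sub>+y'. ennreal (2 powr (2 * lam + 2)) * (ennreal (pker lam T x y') * indicator {y<..<y+T} y'))"
  proof (rule nn_integral_mono)
    fix y' :: real
    have "pker lam T x y \<le> 2 powr (2 * lam + 2) * pker lam T x y'" if y': "y < y'" "y' < y + T"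
    proof -
      have "pker lam T y x \<le> (y / y') powr lam * (1 + \<bar>y' - y\<bar> / T) powr (2 * lam + 2) * pker lam T y' x"
        using y y' lam T x by (intro pker_harnack) auto
      also have "\<dots> \<le> 1 * 2 powr (2 * lam + 2) * pker lam T y' x"
      proof (intro mult_mono)
        have "(y / y') powr lam \<le> 1 powr lam" using y y' lam by (intro powr_mono2) auto
        then show "(y / y') powr lam \<le> 1" by simp
        have "\<bar>y' - y\<bar> / T \<le> 1" using y' T by simp
        then show "(1 + \<bar>y' - y\<bar> / T) powr (2 * lam + 2) \<le> 2 powr (2 * lam + 2)" using lam T by (intro powr_mono2) auto
      qed (use pker_nonneg[OF lam T] in auto)
      finally show ?thesis by (simp add: pker_commute[of lam T x])
    qed
    then show "ennreal (pker lam T x y) * indicator {y<..<y+T} y' \<le> ennreal (2 powr (2 * lam + 2)) * (ennreal (pker lam T x y') * indicator {y<..<y+T} y')"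
      by (auto simp: ennreal_mult'[symmetric] intro!: ennreal_leI split: split_indicator)
  qed
  also have "\<dots> = ennreal (2 powr (2 * lam + 2)) * (\<integral>\<^sub>+y'. ennreal (pker lam T x y') * indicator {y<..<y+T} y')"
    by (rule nn_integral_cmult) measurable
  finally show ?thesis .
qed

text \<open>The kernel is replaced by its averages over \<open>(y, y + T)\<close> and the integrals
  are exchanged. Only integrals of \<open>\<phi>\<close> over intervals of length \<open>T\<close>
  remain, and these are what a Carleson condition bounds.\<close>

lemma nn_integral_pker_average:
  fixes \<phi> :: "real \<Rightarrow> ennreal"
  assumes lam: "lam > 0" and T: "T > 0" and x: "x > 0" and [measurable]: "\<phi> \<in> borel_measurable borel"
    and C1: "(\<integral>\<^sub>0y. ennreal (pker lam T x y)) \<le> ennreal C1"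
    and \<phi>: "\<And>a. a \<ge> 0 \<Longrightarrow> (\<integral>\<^sup>+y\<in>{a<..<a+T}. \<phi> y \<partial>lborel) \<le> B"
  shows "ennreal T * (\<integral>\<^sub>0y. ennreal (pker lam T x y) * \<phi> y) \<le> ennreal (2 powr (2 * lam + 2)) * (ennreal C1 * B)"
proof -
  note [measurable] = pker_measurable[OF lam]
  let ?c = "2 powr (2 * lam + 2)"
  let ?F = "\<lambda>y y'. indicator {y<..<y+T} y' * (\<phi> y * pos y)"
  have "ennreal T * (\<integral>\<^sub>0y. ennreal (pker lam T x y) * \<phi> y) = (\<integral>\<^sub>+y. ennreal T * (ennreal (pker lam T x y) * \<phi> y * pos y))"
    by (rule nn_integral_cmult[symmetric]) measurable
  also have "\<dots> \<le> (\<integral>\<^sub>+y. ennreal ?c * (\<integral>\<^sub>+y'. ennreal (pker lam T x y') * (?F y y')))"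
  proof (rule nn_integral_mono)
    fix y :: real
    show "ennreal T * (ennreal (pker lam T x y) * \<phi> y * pos y) \<le> ennreal ?c * (\<integral>\<^sub>+y'. ennreal (pker lam T x y') * (?F y y'))"
    proof (cases "y > 0")
      case True
      have "ennreal T * (ennreal (pker lam T x y) * \<phi> y * pos y) = (ennreal T * ennreal (pker lam T x y)) * \<phi> y"
        using True by (simp add: mult.assoc)
      also have "\<dots> \<le> (ennreal ?c * (\<integral>\<^sub>+y'. ennreal (pker lam T x y') * indicator {y<..<y+T} y')) * \<phi> y"
        by (intro mult_right_mono pker_average lam T x True) simp
      also have "\<dots> = ennreal ?c * (\<integral>\<^sub>+y'. ennreal (pker lam T x y') * indicator {y<..<y+T} y' * \<phi> y)"
        by (subst nn_integral_multc) (auto simp: mult.assoc)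
      finally show ?thesis using True by (simp add: mult.assoc)
    qed simp
  qed
  also have "\<dots> = ennreal ?c * (\<integral>\<^sub>+y. (\<integral>\<^sub>+y'. ennreal (pker lam T x y') * (?F y y')))"
  proof -
    have "(\<lambda>(y, y'). ennreal (pker lam T x y') * (?F y y')) \<in> borel_measurable (lborel \<Otimes>\<^sub>M lborel)"
      unfolding greaterThanLessThan_iff indicator_def by measurable
    then show ?thesis by (intro nn_integral_cmult lborel.borel_measurable_nn_integral)
  qed
  also have "(\<integral>\<^sub>+y. (\<integral>\<^sub>+y'. ennreal (pker lam T x y') * (?F y y')))
    = (\<integral>\<^sub>+y'. (\<integral>\<^sub>+y. ennreal (pker lam T x y') * (?F y y')))"
    by (rule lborel_pair.Fubini'[symmetric]) (unfold greaterThanLessThan_iff indicator_def, measurable)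
  also have "\<dots> \<le> (\<integral>\<^sub>+y'. (ennreal (pker lam T x y') * pos y') * B)"
  proof (rule nn_integral_mono)
    fix y' :: real
    show "(\<integral>\<^sub>+y. ennreal (pker lam T x y') * (?F y y')) \<le> (ennreal (pker lam T x y') * pos y') * B"
    proof (cases "y' > 0")
      case True
      \<comment> \<open>The set of \<open>y\<close> with \<open>y < y' < y + T\<close>, as seen from
        \<open>y'\<close>; if \<open>y' < T\<close> the interval is moved to start at 0 and still
        covers all positive \<open>y\<close> in question.\<close>
      let ?a = "max 0 (y' - T)"
      have "(\<integral>\<^sub>+y. ennreal (pker lam T x y') * (?F y y'))
        \<le> (\<integral>\<^sub>+y. ennreal (pker lam T x y') * (\<phi> y * indicator {?a<..<?a+T} y))"
        using True T by (intro nn_integral_mono mult_left_mono) (auto split: split_indicator)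
      also have "\<dots> = ennreal (pker lam T x y') * (\<integral>\<^sup>+y\<in>{?a<..<?a+T}. \<phi> y \<partial>lborel)" by (rule nn_integral_cmult) measurable
      also have "\<dots> \<le> ennreal (pker lam T x y') * B" by (intro mult_left_mono \<phi>) auto
      finally show ?thesis using True by simp
    next
      case False
      then have "(\<lambda>y. ennreal (pker lam T x y') * (?F y y')) = (\<lambda>y. 0)" by (auto split: split_indicator)
      then show ?thesis by (simp only: nn_integral_const) simp
    qed
  qed
  also have "\<dots> = (\<integral>\<^sub>0y'. ennreal (pker lam T x y')) * B" by (rule nn_integral_multc) measurable
  also have "\<dots> \<le> ennreal C1 * B" by (intro mult_right_mono C1) simp
  finally show ?thesis by (simp add: mult_left_mono)
qed

lemma Ioo_bounded_interval: "a \<ge> 0 \<Longrightarrow> a < b \<Longrightarrow> {a<..<b} \<in> bounded_intervals"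
  by (auto simp: bounded_intervals_def)

text \<open>The Carleson integral of a real function of \<open>(t, x)\<close>, without the phase and
  the factor \<open>1 / Gamma g\<close> of the fractional derivative and before division by the
  power of the length.\<close>

definition carl_int :: "(real \<Rightarrow> real \<Rightarrow> real) \<Rightarrow> real \<Rightarrow> real set \<Rightarrow> ennreal" where
  "carl_int V \<beta> I = (\<integral>\<^sup>+t\<in>{0<..<measure lborel I}. (\<integral>\<^sup>+x\<in>I. ennreal ((t powr \<beta> * \<bar>V t x\<bar>)\<^sup>2 / t) \<partial>lborel) \<partial>lborel)"

text \<open>For \<open>T / 4 < t < T / 2\<close> the time \<open>T - t\<close> lies between
  \<open>T / 2\<close> and \<open>T\<close>, so up to the factor \<open>L\<close> its kernel may be
  replaced by the one at \<open>T\<close>, which no longer depends on \<open>t\<close>. The integral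
  over \<open>t\<close> can then be done first, giving \<open>\<phi>\<close>, and
  \<open>nn_integral_pker_average\<close> reduces everything to Carleson integrals over intervals of
  length \<open>T\<close>.\<close>

lemma Vker_carleson_bound:
  assumes lam: "lam > 0" and b: "b > 0" and g: "g > 0" "real m = g + b"
  shows "\<exists>C\<ge>0. \<forall>f Q. adm lam 0 f \<longrightarrow> Q > 0 \<longrightarrow>
    (\<forall>I\<in>bounded_intervals. carl_int (Vker lam m g f) b I \<le> ennreal (Q * measure lborel I powr (1 + 2 * \<alpha>))) \<longrightarrow>
    (\<forall>t>0. \<forall>x>0. \<bar>Vker lam m g f t x\<bar> \<le> C * sqrt Q * t powr (\<alpha> - b))"
proof -
  note [measurable] = pker_measurable[OF lam]
  obtain C1 where C1: "C1 \<ge> 0" "\<And>t x. t > 0 \<Longrightarrow> x > 0 \<Longrightarrow> (\<integral>\<^sub>0y. ennreal (pker lam t x y)) \<le> ennreal C1"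
    using nn_integral_pker_le[OF lam] by blast
  define H where "H = 2 powr (2 * lam + 2)"
  define L where "L = 4 powr (lam + 1)"
  define C where "C = L * C1 * (1 + 4 * 4 powr (2 * b) * H)"
  have pos: "H > 0" "L > 0" "C \<ge> 0" using C1 by (auto simp: H_def L_def C_def)
  show ?thesis
  proof (intro exI[of _ C] conjI allI impI pos)
    fix f :: "real \<Rightarrow> real" and Q T x :: real
    assume f: "adm lam 0 f" and Q: "Q > 0" and T: "T > 0" and x: "x > 0"
      and carl: "\<forall>I\<in>bounded_intervals. carl_int (Vker lam m g f) b I \<le> ennreal (Q * measure lborel I powr (1 + 2 * \<alpha>))"
    have fm: "(\<lambda>y. pos y * f y :: real) \<in> borel_measurable borel" by (rule adm_measurable[OF f])
    note [measurable] = Vker_measurable[OF lam fm]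
    let ?V = "Vker lam m g f"
    let ?e = "\<lambda>t y. ennreal ((t powr b * \<bar>?V t y\<bar>)\<^sup>2 / t)"
    let ?E = "\<lambda>t. \<integral>\<^sub>0y. ennreal (pker lam T x y) * ennreal ((?V t y)\<^sup>2)"
    let ?p = "\<lambda>y. ennreal (pker lam T x y)"
    define \<phi> where "\<phi> y = (\<integral>\<^sup>+t\<in>{0<..<T}. ?e t y \<partial>lborel)" for y
    have [measurable]: "\<phi> \<in> borel_measurable borel" unfolding \<phi>_def by measurable
    \<comment> \<open>Bounds, on \<open>(T / 4, T / 2)\<close>, the factor
      \<open>t * t powr (- 2 * b)\<close> that turns the Carleson integrand back into the square of
      \<open>?V\<close>.\<close>
    define M where "M = 4 powr (2 * b) * T powr (1 - 2 * b)"
    define c where "c = sqrt Q * T powr (\<alpha> - b)"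
    have c: "c > 0" using Q T by (simp add: c_def)
    have M: "M \<ge> 0" by (simp add: M_def)
    have \<phi>I: "(\<integral>\<^sup>+y\<in>{a<..<a+T}. \<phi> y \<partial>lborel) \<le> ennreal (Q * T powr (1 + 2 * \<alpha>))" if a: "a \<ge> 0" for a
    proof -
      have "(\<integral>\<^sup>+y\<in>{a<..<a+T}. \<phi> y \<partial>lborel) = (\<integral>\<^sub>+y. (\<integral>\<^sub>+t. ?e t y * indicator {0<..<T} t * indicator {a<..<a+T} y))"
        unfolding \<phi>_def by (rule nn_integral_cong, rule nn_integral_multc[symmetric]) measurable
      also have "\<dots> = (\<integral>\<^sub>+t. (\<integral>\<^sub>+y. ?e t y * indicator {0<..<T} t * indicator {a<..<a+T} y))"
        by (rule lborel_pair.Fubini') measurable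
      also have "\<dots> = carl_int ?V b {a<..<a+T}"
        unfolding carl_int_def
      proof (rule nn_integral_cong)
        fix t :: real
        have "(\<integral>\<^sub>+y. ?e t y * indicator {0<..<T} t * indicator {a<..<a+T} y)
          = (\<integral>\<^sub>+y. ?e t y * indicator {a<..<a+T} y * indicator {0<..<T} t)" by (simp only: mult_ac)
        also have "\<dots> = (\<integral>\<^sub>+y. ?e t y * indicator {a<..<a+T} y) * indicator {0<..<T} t"
          by (rule nn_integral_multc) measurable
        finally show "(\<integral>\<^sub>+y. ?e t y * indicator {0<..<T} t * indicator {a<..<a+T} y)
          = (\<integral>\<^sup>+y\<in>{a<..<a+T}. ?e t y \<partial>lborel) * indicator {0<..<measure lborel {a<..<a+T}} t"
          using T by simp
      qed
      also have "\<dots> \<le> ennreal (Q * T powr (1 + 2 * \<alpha>))"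
        using carl Ioo_bounded_interval[OF a, of "a + T"] T by fastforce
      finally show ?thesis .
    qed
    have P: "ennreal T * (\<integral>\<^sub>0y. ?p y * \<phi> y) \<le> ennreal H * (ennreal C1 * ennreal (Q * T powr (1 + 2 * \<alpha>)))"
      unfolding H_def by (intro nn_integral_pker_average lam T x C1(2) \<phi>I) measurable
    have step: "ennreal \<bar>?V T x\<bar> \<le> ennreal (L * c * C1) + ennreal (L / c) * (?E t)"
      if t: "T / 4 < t" "t < T / 2" for t
    proof -
      have t0: "t > 0" and s: "T - t > 0" "T / 2 \<le> T - t" "T - t \<le> T" using t T by auto
      note sg = Vker_semigroup[OF f lam b g t0 s(1) x]
      have "ennreal \<bar>?V (t + (T - t)) x\<bar> \<le> (\<integral>\<^sub>+y. ennreal (norm (pos y * pker lam (T - t) x y * ?V t y)))"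
        unfolding sg(2) using integral_norm_bound_ennreal[OF sg(1)] by simp
      also have "\<dots> \<le> (\<integral>\<^sub>+y. ennreal (L * c) * (?p y * pos y) + ennreal (L / c) * (?p y * ennreal ((?V t y)\<^sup>2) * pos y))"
      proof (rule nn_integral_mono)
        fix y :: real
        show "ennreal (norm (pos y * pker lam (T - t) x y * ?V t y)) \<le> ennreal (L * c) * (?p y * pos y) + ennreal (L / c) * (?p y * ennreal ((?V t y)\<^sup>2) * pos y)"
        proof (cases "y > 0")
          case True
          let ?p = "pker lam T x y" and ?v = "?V t y"
          have p0: "?p \<ge> 0" "pker lam (T - t) x y \<ge> 0" by (rule pker_nonneg[OF lam T], rule pker_nonneg[OF lam s(1)])
          \<comment> \<open>in place of the Cauchy--Schwarz inequality; \<open>c\<close> has the size of the bound to be proved\<close>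
          have "\<bar>?v\<bar> \<le> c + ?v\<^sup>2 / c"
          proof (cases "\<bar>?v\<bar> \<le> c")
            case True
            have "0 \<le> ?v\<^sup>2 / c" using c by simp
            with True show ?thesis by linarith
          next
            case False
            then have "c * \<bar>?v\<bar> \<le> \<bar>?v\<bar> * \<bar>?v\<bar>" by (intro mult_right_mono) auto
            then have "\<bar>?v\<bar> \<le> ?v\<^sup>2 / c" using c by (simp add: le_divide_eq power2_eq_square mult.commute)
            then show ?thesis using c by linarith
          qed
          then have "pker lam (T - t) x y * \<bar>?v\<bar> \<le> (L * ?p) * (c + ?v\<^sup>2 / c)"
            using pker_time_compare[OF lam s(2,3) T x True] p0 pos c unfolding L_def by (intro mult_mono) auto
          also have "\<dots> = L * c * ?p + L / c * (?p * ?v\<^sup>2)" by (simp add: algebra_simps)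
          finally have "ennreal (pker lam (T - t) x y * \<bar>?v\<bar>) \<le> ennreal (L * c * ?p + L / c * (?p * ?v\<^sup>2))" by (rule ennreal_leI)
          also have "\<dots> = ennreal (L * c) * ennreal ?p + ennreal (L / c) * (ennreal ?p * ennreal (?v\<^sup>2))"
          proof -
            have "ennreal (L * c * ?p) = ennreal (L * c) * ennreal ?p" using pos c by (intro ennreal_mult') simp
            moreover have "ennreal (L / c * (?p * ?v\<^sup>2)) = ennreal (L / c) * ennreal (?p * ?v\<^sup>2)" using pos c by (intro ennreal_mult') simp
            moreover have "ennreal (?p * ?v\<^sup>2) = ennreal ?p * ennreal (?v\<^sup>2)" using p0 by (intro ennreal_mult') simp
            moreover have "ennreal (L * c * ?p + L / c * (?p * ?v\<^sup>2)) = ennreal (L * c * ?p) + ennreal (L / c * (?p * ?v\<^sup>2))"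
              using pos c p0 by (intro ennreal_plus) auto
            ultimately show ?thesis by simp
          qed
          finally show ?thesis using True p0 by (simp add: abs_mult)
        qed simp
      qed
      also have "\<dots> = ennreal (L * c) * (\<integral>\<^sub>0y. ?p y) + ennreal (L / c) * (?E t)"
        by (subst nn_integral_add, measurable, subst nn_integral_cmult, measurable, subst nn_integral_cmult, measurable)
      also have "ennreal (L * c) * (\<integral>\<^sub>0y. ?p y) \<le> ennreal (L * c) * ennreal C1"
        by (intro mult_left_mono C1(2) T x) simp
      also have "ennreal (L * c) * ennreal C1 = ennreal (L * c * C1)" using pos c by (intro ennreal_mult'[symmetric]) simp
      finally show ?thesis by (simp add: add_right_mono)
    qed
    let ?J = "\<integral>\<^sup>+t\<in>{T/4<..<T/2}. (?E t) \<partial>lborel"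
    have J: "?J \<le> ennreal M * (\<integral>\<^sub>0y. ?p y * \<phi> y)"
    proof -
      have "?J = (\<integral>\<^sub>+t. (\<integral>\<^sub>+y. ?p y * ennreal ((?V t y)\<^sup>2) * pos y * indicator {T/4<..<T/2} t))"
        by (rule nn_integral_cong, rule nn_integral_multc[symmetric]) measurable
      also have "\<dots> = (\<integral>\<^sub>+y. (\<integral>\<^sub>+t. ?p y * ennreal ((?V t y)\<^sup>2) * pos y * indicator {T/4<..<T/2} t))"
        by (rule lborel_pair.Fubini') measurable
      also have "\<dots> \<le> (\<integral>\<^sub>+y. ennreal M * (?p y * \<phi> y * pos y))"
      proof (rule nn_integral_mono)
        fix y :: real
        have "(\<integral>\<^sub>+t. ?p y * ennreal ((?V t y)\<^sup>2) * pos y * indicator {T/4<..<T/2} t)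
          \<le> (\<integral>\<^sub>+t. (ennreal M * (?p y * pos y)) * (?e t y * indicator {0<..<T} t))"
        proof (rule nn_integral_mono)
          fix t :: real
          have "ennreal ((?V t y)\<^sup>2) \<le> ennreal M * ?e t y" if t: "T / 4 < t" "t < T / 2"
          proof -
            have t0: "t > 0" using t T by linarith
            have "t * t powr (- 2 * b) \<le> T * (T / 4) powr (- 2 * b)" using t T b by (intro mult_mono powr_mono2') auto
            also have "\<dots> = M"
            proof -
              have "(T / 4) powr (- 2 * b) = T powr (- 2 * b) / 4 powr (- 2 * b)" by (rule powr_divide)
              also have "\<dots> = 4 powr (2 * b) * T powr (- 2 * b)" using divide_powr_minus[of "T powr (- 2 * b)" 4 "2 * b"] by simp
              finally have "T * (T / 4) powr (- 2 * b) = 4 powr (2 * b) * (T powr 1 * T powr (- 2 * b))" using T by simp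
              also have "T powr 1 * T powr (- 2 * b) = T powr (1 - 2 * b)" by (subst powr_add[symmetric]) (rule powr_exp_cong, simp)
              finally show ?thesis by (simp add: M_def)
            qed
            finally have "t * t powr (- 2 * b) \<le> M" .
            then have "(t * t powr (- 2 * b)) * ((t powr b * \<bar>?V t y\<bar>)\<^sup>2 / t) \<le> M * ((t powr b * \<bar>?V t y\<bar>)\<^sup>2 / t)"
              using t0 by (intro mult_right_mono) auto
            moreover have "(t * t powr (- 2 * b)) * ((t powr b * \<bar>?V t y\<bar>)\<^sup>2 / t) = (?V t y)\<^sup>2"
            proof -
              have "t powr (- 2 * b) * (t powr b)\<^sup>2 = 1"
                using t0 by (simp add: power2_eq_square powr_add[symmetric])
              moreover have "(t * t powr (- 2 * b)) * ((t powr b * \<bar>?V t y\<bar>)\<^sup>2 / t) = (t powr (- 2 * b) * (t powr b)\<^sup>2) * (?V t y)\<^sup>2"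
                using t0 by (simp add: power_mult_distrib)
              ultimately show ?thesis by simp
            qed
            ultimately show ?thesis using M by (simp add: ennreal_mult'[symmetric] ennreal_leI)
          qed
          then have "ennreal ((?V t y)\<^sup>2) * indicator {T/4<..<T/2} t \<le> ennreal M * (?e t y * indicator {0<..<T} t)"
            using T by (auto split: split_indicator)
          from mult_left_mono[OF this, of "?p y * pos y"]
          show "?p y * ennreal ((?V t y)\<^sup>2) * pos y * indicator {T/4<..<T/2} t
            \<le> (ennreal M * (?p y * pos y)) * (?e t y * indicator {0<..<T} t)"
            by (simp add: mult_ac)
        qed
        also have "\<dots> = (ennreal M * (?p y * pos y)) * \<phi> y"
          unfolding \<phi>_def by (rule nn_integral_cmult) measurable
        finally show "(\<integral>\<^sub>+t. ?p y * ennreal ((?V t y)\<^sup>2) * pos y * indicator {T/4<..<T/2} t)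
          \<le> ennreal M * (?p y * \<phi> y * pos y)" by (simp only: mult_ac)
      qed
      also have "\<dots> = ennreal M * (\<integral>\<^sub>+y. (?p y * \<phi> y * pos y))"
        by (rule nn_integral_cmult) measurable
      finally show ?thesis .
    qed
    have "ennreal \<bar>?V T x\<bar> * ennreal (T / 4) = (\<integral>\<^sub>+t. ennreal \<bar>?V T x\<bar> * indicator {T/4<..<T/2} t)"
      using T by (subst nn_integral_cmult_indicator) auto
    also have "\<dots> \<le> (\<integral>\<^sub>+t. ennreal (L * c * C1) * indicator {T/4<..<T/2} t + ennreal (L / c) * ((?E t) * indicator {T/4<..<T/2} t))"
    proof (rule nn_integral_mono)
      fix t :: real
      show "ennreal \<bar>?V T x\<bar> * indicator {T/4<..<T/2} t \<le> ennreal (L * c * C1) * indicator {T/4<..<T/2} t + ennreal (L / c) * ((?E t) * indicator {T/4<..<T/2} t)"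
        using step[of t] by (cases "t \<in> {T/4<..<T/2}") auto
    qed
    also have "\<dots> = ennreal (L * c * C1) * ennreal (T / 4) + ennreal (L / c) * ?J"
    proof -
      have "(\<integral>\<^sub>+t. ennreal (L * c * C1) * indicator {T/4<..<T/2} t) = ennreal (L * c * C1) * ennreal (T / 4)"
        using T by (subst nn_integral_cmult_indicator) auto
      then show ?thesis by (subst nn_integral_add, measurable, subst nn_integral_cmult, measurable)
    qed
    finally have S1: "ennreal \<bar>?V T x\<bar> * ennreal (T / 4) \<le> ennreal (L * c * C1) * ennreal (T / 4) + ennreal (L / c) * ?J" .
    let ?W = "Q * T powr (1 + 2 * \<alpha>)"
    have W: "?W \<ge> 0" using Q by simp
    have "ennreal T * (ennreal \<bar>?V T x\<bar> * ennreal (T / 4)) \<le> ennreal T * (ennreal (L * c * C1) * ennreal (T / 4) + ennreal (L / c) * (ennreal M * (\<integral>\<^sub>0y. ?p y * \<phi> y)))"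
      by (intro mult_left_mono order_trans[OF S1] add_left_mono J) simp_all
    also have "\<dots> = ennreal T * (ennreal (L * c * C1) * ennreal (T / 4)) + ennreal (L / c) * (ennreal M * (ennreal T * (\<integral>\<^sub>0y. ?p y * \<phi> y)))"
      by (simp only: distrib_left mult_ac)
    also have "\<dots> \<le> ennreal T * (ennreal (L * c * C1) * ennreal (T / 4)) + ennreal (L / c) * (ennreal M * (ennreal H * (ennreal C1 * ennreal ?W)))"
      by (intro add_left_mono mult_left_mono P) simp_all
    also have "\<dots> = ennreal (T * (L * c * C1 * (T / 4)) + L / c * (M * (H * (C1 * ?W))))"
    proof -
      have e1: "ennreal T * (ennreal (L * c * C1) * ennreal (T / 4)) = ennreal (T * (L * c * C1 * (T / 4)))"
        using T pos c C1 by (simp add: ennreal_mult'[symmetric])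
      have e2: "ennreal (L / c) * (ennreal M * (ennreal H * (ennreal C1 * ennreal ?W))) = ennreal (L / c * (M * (H * (C1 * ?W))))"
        using M pos c C1 W by (simp add: ennreal_mult'[symmetric] del: ennreal_mult)
      show ?thesis unfolding e1 e2 using T pos c C1 M W by (intro ennreal_plus[symmetric]) auto
    qed
    finally have Z: "ennreal (T * (\<bar>?V T x\<bar> * (T / 4))) \<le> ennreal (T * (L * c * C1 * (T / 4)) + L / c * (M * (H * (C1 * ?W))))"
      using T by (simp add: ennreal_mult'[symmetric])
    have "0 \<le> T * (L * c * C1 * (T / 4)) + L / c * (M * (H * (C1 * ?W)))" using T pos c C1 M W by auto
    with Z have R: "T * (\<bar>?V T x\<bar> * (T / 4)) \<le> T * (L * c * C1 * (T / 4)) + L / c * (M * (H * (C1 * ?W)))" by (simp only: ennreal_le_iff)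
    \<comment> \<open>Here the choice of \<open>c\<close> pays off: \<open>L / c\<close> times
      \<open>M * ?W\<close> is again of size \<open>c * T\<^sup>2\<close>, like the first
      term.\<close>
    have MW: "M * ?W = 4 powr (2 * b) * c\<^sup>2 * T\<^sup>2"
    proof -
      have "T powr (1 - 2 * b) * T powr (1 + 2 * \<alpha>) = (T powr (\<alpha> - b))\<^sup>2 * T\<^sup>2"
      proof -
        have "(T powr (\<alpha> - b))\<^sup>2 * T\<^sup>2 = T powr (\<alpha> - b) * T powr (\<alpha> - b) * (T powr 1 * T powr 1)" using T by (simp add: power2_eq_square)
        also have "\<dots> = T powr (1 - 2 * b) * T powr (1 + 2 * \<alpha>)" by (subst powr_add[symmetric])+ (rule powr_exp_cong, simp)
        finally show ?thesis ..
      qed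
      then show ?thesis using Q by (simp add: M_def c_def power_mult_distrib)
    qed
    have "L / c * (M * (H * (C1 * ?W))) = L / c * H * C1 * (M * ?W)" by (simp only: mult_ac)
    also have "\<dots> = L * H * C1 * 4 powr (2 * b) * c * T\<^sup>2" unfolding MW using c by (simp add: power2_eq_square)
    finally have "T * (\<bar>?V T x\<bar> * (T / 4)) \<le> T * (L * c * C1 * (T / 4)) + L * H * C1 * 4 powr (2 * b) * c * T\<^sup>2" using R by simp
    also have "\<dots> = (C * c) * (T\<^sup>2 / 4)" by (simp add: C_def power2_eq_square algebra_simps)
    finally have "\<bar>?V T x\<bar> * (T\<^sup>2 / 4) \<le> (C * c) * (T\<^sup>2 / 4)" by (simp add: power2_eq_square mult_ac)
    then have "\<bar>?V T x\<bar> \<le> C * c" using T by (simp add: mult_le_cancel_right)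
    then show "\<bar>?V T x\<bar> \<le> C * sqrt Q * T powr (\<alpha> - b)" by (simp add: c_def mult.assoc)
  qed
qed

text \<open>The squared bound leaves the integral of \<open>t powr (2 * \<alpha> - 1)\<close> over
  \<open>(0, ?L)\<close>, hence the factor \<open>1 / (2 * \<alpha>)\<close>. The hypothesis holds
  almost everywhere in the half plane, so the iterated integral is first turned into one over the
  product.\<close>

lemma carl_int_le:
  assumes Vm [measurable]: "case_prod V \<in> borel_measurable (borel \<Otimes>\<^sub>M borel)" and \<alpha>: "\<alpha> > 0" and N: "N \<ge> 0" and I: "I \<in> bounded_intervals"
    and ae: "AE z in (lborel :: (real \<times> real) measure). fst z > 0 \<longrightarrow> snd z > 0 \<longrightarrow> snd z powr (b - \<alpha>) * \<bar>V (snd z) (fst z)\<bar> \<le> N"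
  shows "carl_int V b I \<le> ennreal (N\<^sup>2 / (2 * \<alpha>) * measure lborel I powr (1 + 2 * \<alpha>))"
proof -
  let ?L = "measure lborel I"
  have II: "is_interval I" "bounded I" "I \<subseteq> {0<..}" "0 < ?L" using I by (auto simp: bounded_intervals_def)
  have [measurable]: "I \<in> sets borel" using II(1) by (rule real_interval_borel_measurable)
  have eI: "emeasure lborel I = ennreal ?L" using emeasure_bounded_finite[OF II(2)] by (simp add: emeasure_eq_ennreal_measure less_top)
  let ?G = "\<lambda>z. ennreal ((snd z powr b * \<bar>V (snd z) (fst z)\<bar>)\<^sup>2 / snd z) * (indicator I (fst z) * indicator {0<..<?L} (snd z))"
  let ?H = "\<lambda>z. ennreal (N\<^sup>2) * (ennreal (snd z powr (2 * \<alpha> - 1)) * indicator {0<..<?L} (snd z) * indicator I (fst z))"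
  have "carl_int V b I = (\<integral>\<^sub>+t. (\<integral>\<^sub>+x. ?G (x, t)))"
    unfolding carl_int_def
  proof (rule nn_integral_cong)
    fix t :: real
    have "(\<lambda>x. ennreal ((t powr b * \<bar>V t x\<bar>)\<^sup>2 / t) * indicator I x) \<in> borel_measurable lborel"
      by measurable
    then show "(\<integral>\<^sup>+x\<in>I. ennreal ((t powr b * \<bar>V t x\<bar>)\<^sup>2 / t) \<partial>lborel) * indicator {0<..<?L} t = (\<integral>\<^sub>+x. ?G (x, t))"
      by (subst nn_integral_multc[symmetric]) (auto simp: mult.assoc)
  qed
  also have "\<dots> = integral\<^sup>N (lborel \<Otimes>\<^sub>M lborel) ?G" by (rule lborel_pair.nn_integral_snd) measurable
  also have "\<dots> \<le> integral\<^sup>N (lborel \<Otimes>\<^sub>M lborel) ?H"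
  proof (rule nn_integral_mono_AE)
    show "AE z in lborel \<Otimes>\<^sub>M lborel. ?G z \<le> ?H z"
      unfolding lborel_prod using ae
    proof eventually_elim
      case (elim z)
      obtain x t where z: "z = (x, t)" by (cases z)
      have "(t powr b * \<bar>V t x\<bar>)\<^sup>2 / t \<le> N\<^sup>2 * t powr (2 * \<alpha> - 1)" if "x > 0" "t > 0"
      proof -
        have e: "t powr (b - \<alpha>) * \<bar>V t x\<bar> \<le> N" using elim that by (simp add: z)
        have "t powr b = t powr \<alpha> * t powr (b - \<alpha>)" by (subst powr_add[symmetric]) simp
        moreover have "t powr (2 * \<alpha> - 1) = (t powr \<alpha>)\<^sup>2 / t" using that by (simp add: powr_diff power2_eq_square powr_add[symmetric])
        ultimately have "(t powr b * \<bar>V t x\<bar>)\<^sup>2 / t = (t powr (b - \<alpha>) * \<bar>V t x\<bar>)\<^sup>2 * t powr (2 * \<alpha> - 1)"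
          by (simp add: power_mult_distrib)
        also have "\<dots> \<le> N\<^sup>2 * t powr (2 * \<alpha> - 1)" using e by (intro mult_right_mono power_mono) auto
        finally show ?thesis .
      qed
      then show ?case using II(3) by (auto simp: z ennreal_mult'[symmetric] intro!: ennreal_leI split: split_indicator)
    qed
  qed
  also have "\<dots> = (\<integral>\<^sub>+t. (\<integral>\<^sub>+x. ?H (x, t)))" by (rule lborel_pair.nn_integral_snd[symmetric]) measurable
  also have "\<dots> = (\<integral>\<^sub>+t. ennreal (N\<^sup>2) * ennreal ?L * (ennreal (t powr (2 * \<alpha> - 1)) * indicator {0<..<?L} t))"
  proof (rule nn_integral_cong)
    fix t :: real
    have "(\<integral>\<^sub>+x. ?H (x, t)) = (\<integral>\<^sub>+x. (ennreal (N\<^sup>2) * (ennreal (t powr (2 * \<alpha> - 1)) * indicator {0<..<?L} t)) * indicator I x)"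
      by (simp add: mult.assoc)
    also have "\<dots> = (ennreal (N\<^sup>2) * (ennreal (t powr (2 * \<alpha> - 1)) * indicator {0<..<?L} t)) * ennreal ?L"
      by (subst nn_integral_cmult_indicator) (auto simp: eI)
    finally show "(\<integral>\<^sub>+x. ?H (x, t)) = ennreal (N\<^sup>2) * ennreal ?L * (ennreal (t powr (2 * \<alpha> - 1)) * indicator {0<..<?L} t)" by (simp only: mult_ac)
  qed
  also have "\<dots> = ennreal (N\<^sup>2) * ennreal ?L * (\<integral>\<^sub>+t. ennreal (t powr (2 * \<alpha> - 1)) * indicator {0<..<?L} t)"
    by (rule nn_integral_cmult) measurable
  also have "(\<integral>\<^sub>+t. ennreal (t powr (2 * \<alpha> - 1)) * indicator {0<..<?L} t) \<le> (\<integral>\<^sup>+t\<in>{0<..?L}. ennreal (t powr (2 * \<alpha> - 1)) \<partial>lborel)"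
    by (intro nn_integral_mono mult_left_mono) (auto split: split_indicator)
  also have "\<dots> = ennreal (?L powr (2 * \<alpha>) / (2 * \<alpha>))" using nn_integral_powr_0[of "2 * \<alpha>" ?L] \<alpha> II by simp
  also have "ennreal (N\<^sup>2) * ennreal ?L * ennreal (?L powr (2 * \<alpha>) / (2 * \<alpha>)) = ennreal (N\<^sup>2 / (2 * \<alpha>) * ?L powr (1 + 2 * \<alpha>))"
    using II \<alpha> N by (simp add: ennreal_mult'[symmetric] powr_add mult_ac)
  finally show ?thesis by (simp add: mult_left_mono)
qed

subsection \<open>Hoelder and Campanato conditions\<close>

lemma ennreal_le_of_divide_le:
  assumes "X / ennreal y \<le> ennreal c" "y > 0" "c \<ge> 0"
  shows "X \<le> ennreal (c * y)"
proof -
  have "X = X / ennreal y * ennreal y"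
    using assms(2) by (simp add: ennreal_divide_times ennreal_times_divide[symmetric] mult_divide_eq_ennreal)
  also have "\<dots> \<le> ennreal c * ennreal y" by (intro mult_right_mono assms) simp
  also have "\<dots> = ennreal (c * y)" using assms by (simp add: ennreal_mult')
  finally show ?thesis .
qed

text \<open>The real-valued form of finiteness of \<open>holder_norm\<close>, with one constant for
  both of its parts; this is the common currency in which the four quantities are compared.\<close>

definition holder_bd :: "real \<Rightarrow> (real \<Rightarrow> real) \<Rightarrow> real \<Rightarrow> bool" where
  "holder_bd \<alpha> f N \<longleftrightarrow> (\<forall>x>0. \<forall>y>0. \<bar>f x - f y\<bar> \<le> N * \<bar>x - y\<bar> powr \<alpha>) \<and> (\<forall>x>0. \<bar>f x\<bar> \<le> N * x powr \<alpha>)"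

lemma holder_norm_le:
  assumes "holder_bd \<alpha> f N" and "N \<ge> 0"
  shows "holder_norm \<alpha> f \<le> ennreal (2 * N)"
proof -
  have A: "(SUP (x, y) \<in> {(x, y). 0 < x \<and> 0 < y \<and> x \<noteq> y}. ennreal (\<bar>f x - f y\<bar> / \<bar>x - y\<bar> powr \<alpha>)) \<le> ennreal N"
  proof (rule SUP_least, clarify)
    fix x y :: real assume "0 < x" "0 < y" "x \<noteq> y"
    then show "ennreal (\<bar>f x - f y\<bar> / \<bar>x - y\<bar> powr \<alpha>) \<le> ennreal N"
      using assms by (intro ennreal_leI) (simp add: holder_bd_def divide_le_eq)
  qed
  have B: "(SUP x\<in>{0<..}. ennreal (x powr (- \<alpha>) * \<bar>f x\<bar>)) \<le> ennreal N"
  proof (rule SUP_least)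
    fix x :: real assume "x \<in> {0<..}"
    then show "ennreal (x powr (- \<alpha>) * \<bar>f x\<bar>) \<le> ennreal N"
      using assms by (intro ennreal_leI) (simp add: holder_bd_def powr_minus divide_le_eq field_simps)
  qed
  have "holder_norm \<alpha> f \<le> ennreal N + ennreal N" unfolding holder_norm_def by (intro add_mono A B)
  also have "\<dots> = ennreal (2 * N)" using assms by (simp add: ennreal_plus[symmetric] del: ennreal_plus)
  finally show ?thesis .
qed

lemma holder_bd_of_norm:
  assumes "holder_norm \<alpha> f \<le> ennreal r" and "r \<ge> 0"
  shows "holder_bd \<alpha> f r"
  unfolding holder_bd_def
proof (intro conjI allI impI)
  fix x y :: real assume xy: "x > 0" "y > 0"
  show "\<bar>f x - f y\<bar> \<le> r * \<bar>x - y\<bar> powr \<alpha>"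
  proof (cases "x = y")
    case False
    have "ennreal (\<bar>f x - f y\<bar> / \<bar>x - y\<bar> powr \<alpha>) \<le> (SUP (x, y) \<in> {(x, y). 0 < x \<and> 0 < y \<and> x \<noteq> y}. ennreal (\<bar>f x - f y\<bar> / \<bar>x - y\<bar> powr \<alpha>))"
      using xy False by (intro SUP_upper2[of "(x, y)"]) auto
    also have "\<dots> \<le> holder_norm \<alpha> f" unfolding holder_norm_def by simp
    finally have "ennreal (\<bar>f x - f y\<bar> / \<bar>x - y\<bar> powr \<alpha>) \<le> ennreal r" using assms(1) by (rule order_trans)
    then have "\<bar>f x - f y\<bar> / \<bar>x - y\<bar> powr \<alpha> \<le> r" using assms(2) by (simp add: ennreal_le_iff)
    then show ?thesis using False by (simp add: divide_le_eq)
  qed simp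
next
  fix x :: real assume x: "x > 0"
  have "ennreal (x powr (- \<alpha>) * \<bar>f x\<bar>) \<le> (SUP x\<in>{0<..}. ennreal (x powr (- \<alpha>) * \<bar>f x\<bar>))"
    using x by (intro SUP_upper2[of x]) auto
  also have "\<dots> \<le> holder_norm \<alpha> f" unfolding holder_norm_def by simp
  finally have "ennreal (x powr (- \<alpha>) * \<bar>f x\<bar>) \<le> ennreal r" using assms(1) by (rule order_trans)
  then have "x powr (- \<alpha>) * \<bar>f x\<bar> \<le> r" using assms(2) by (simp add: ennreal_le_iff)
  then show "\<bar>f x\<bar> \<le> r * x powr \<alpha>" using x by (simp add: powr_minus field_simps)
qed

lemma bounded_intervalsD:
  assumes "I \<in> bounded_intervals"
  shows "I \<in> sets borel" "I \<subseteq> {0<..}" "measure lborel I > 0" "emeasure lborel I = ennreal (measure lborel I)"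
    "\<And>y z. y \<in> I \<Longrightarrow> z \<in> I \<Longrightarrow> \<bar>y - z\<bar> \<le> measure lborel I"
proof -
  have I: "is_interval I" "bounded I" "I \<subseteq> {0<..}" "0 < measure lborel I" using assms by (auto simp: bounded_intervals_def)
  show m: "I \<in> sets borel" using I(1) by (rule real_interval_borel_measurable)
  show "I \<subseteq> {0<..}" "measure lborel I > 0" by fact+
  have fin: "emeasure lborel I < \<infinity>" by (rule emeasure_bounded_finite[OF I(2)])
  then show "emeasure lborel I = ennreal (measure lborel I)" by (simp add: emeasure_eq_ennreal_measure less_top)
  have *: "z - y \<le> measure lborel I" if "y \<in> I" "z \<in> I" "y \<le> z" for y z
  proof -
    have "{y..z} \<subseteq> I" using I(1) that by (meson atLeastAtMost_iff is_interval_1 subsetI)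
    then have "measure lborel {y..z} \<le> measure lborel I"
      using fin m by (intro measure_mono_fmeasurable) (auto simp: fmeasurable_def)
    then show ?thesis using that by simp
  qed
  show "\<bar>y - z\<bar> \<le> measure lborel I" if "y \<in> I" "z \<in> I" for y z
    using *[of y z] *[of z y] that by linarith
qed

lemma average_diff_le:
  assumes I: "I \<in> bounded_intervals" and f: "set_integrable lborel I f"
    and c: "(\<integral>\<^sup>+y\<in>I. ennreal \<bar>f y - c\<bar> \<partial>lborel) \<le> ennreal (D * measure lborel I)" and D: "D \<ge> 0"
  shows "\<bar>average f I - c\<bar> \<le> D"
proof -
  note b = bounded_intervalsD[OF I]
  have c': "set_integrable lborel I (\<lambda>y. c)" using b by (auto simp: set_integrable_def intro!: integrable_mult_left integrable_real_indicator)
  have ic: "(LBINT y:I. c) = c * measure lborel I" using b by (simp add: set_lebesgue_integral_def)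
  have d: "set_integrable lborel I (\<lambda>y. f y - c)" using f c' by (rule set_integral_diff)
  have "average f I - c = (LBINT y:I. f y - c) / measure lborel I"
    using b(3) by (simp add: average_def set_integral_diff(2)[OF f c'] ic field_simps)
  moreover have "\<bar>LBINT y:I. f y - c\<bar> \<le> D * measure lborel I"
  proof -
    have "ennreal \<bar>LBINT y:I. f y - c\<bar> \<le> (\<integral>\<^sub>+y. ennreal (norm (indicator I y *\<^sub>R (f y - c))))"
      unfolding set_lebesgue_integral_def using integral_norm_bound_ennreal[OF d[unfolded set_integrable_def]] by simp
    also have "\<dots> = (\<integral>\<^sup>+y\<in>I. ennreal \<bar>f y - c\<bar> \<partial>lborel)"
      by (rule nn_integral_cong) (auto split: split_indicator)
    also note c
    finally show ?thesis using D b(3) by (simp add: ennreal_le_iff)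
  qed
  ultimately show ?thesis using b(3) by (simp add: abs_div_pos[symmetric] divide_le_eq)
qed

text \<open>Both conditions are one pointwise estimate, \<open>key\<close>: on \<open>I\<close> the
  function stays within \<open>N\<close> times the \<open>\<alpha>\<close>-th power of the length
  from its average, and on \<open>(0, b)\<close> within the same distance from 0.\<close>

lemma campanato_le:
  assumes H: "holder_bd \<alpha> f N" and N: "N > 0" and p: "p \<ge> 1" and \<alpha>: "\<alpha> > 0"
    and f: "\<And>I. I \<in> bounded_intervals \<Longrightarrow> set_integrable lborel I f"
  shows "M1 \<alpha> p f (N powr p)" "M2 \<alpha> p f (N powr p)"
proof -
  have key: "(\<integral>\<^sup>+y\<in>I. ennreal (\<bar>f y - c\<bar> powr p) \<partial>lborel) / ennreal (measure lborel I powr (1 + p * \<alpha>)) \<le> ennreal (N powr p)"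
    if I: "I \<in> bounded_intervals" and c: "\<And>y. y \<in> I \<Longrightarrow> \<bar>f y - c\<bar> \<le> N * measure lborel I powr \<alpha>" for I c
  proof -
    note b = bounded_intervalsD[OF I]
    let ?L = "measure lborel I"
    have "(\<integral>\<^sup>+y\<in>I. ennreal (\<bar>f y - c\<bar> powr p) \<partial>lborel) \<le> (\<integral>\<^sub>+y. ennreal ((N * ?L powr \<alpha>) powr p) * indicator I y)"
      using c p by (intro nn_integral_mono) (auto intro!: ennreal_leI powr_mono2 split: split_indicator)
    also have "\<dots> = ennreal ((N * ?L powr \<alpha>) powr p) * emeasure lborel I" using b by (subst nn_integral_cmult_indicator) auto
    also have "\<dots> = ennreal (N powr p * ?L powr (1 + p * \<alpha>))"
      using b(3) by (simp add: b(4) ennreal_mult'[symmetric] powr_mult powr_powr powr_add mult_ac)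
    finally have "(\<integral>\<^sup>+y\<in>I. ennreal (\<bar>f y - c\<bar> powr p) \<partial>lborel) / ennreal (?L powr (1 + p * \<alpha>)) \<le> ennreal (N powr p * ?L powr (1 + p * \<alpha>)) / ennreal (?L powr (1 + p * \<alpha>))"
      by (rule divide_right_mono_ennreal)
    also have "\<dots> = ennreal (N powr p)" using b(3) by (simp add: divide_ennreal)
    finally show ?thesis .
  qed
  show "M1 \<alpha> p f (N powr p)"
    unfolding M1_def
  proof
    fix I assume I: "I \<in> bounded_intervals"
    note b = bounded_intervalsD[OF I]
    let ?L = "measure lborel I"
    show "(\<integral>\<^sup>+y\<in>I. ennreal (\<bar>f y - average f I\<bar> powr p) \<partial>lborel) / ennreal (?L powr (1 + p * \<alpha>)) \<le> ennreal (N powr p)"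
    proof (rule key[OF I])
      fix y assume y: "y \<in> I"
      have "(\<integral>\<^sup>+z\<in>I. ennreal \<bar>f z - f y\<bar> \<partial>lborel) \<le> (\<integral>\<^sub>+z. ennreal (N * ?L powr \<alpha>) * indicator I z)"
      proof (rule nn_integral_mono)
        fix z
        have "\<bar>f z - f y\<bar> \<le> N * ?L powr \<alpha>" if z: "z \<in> I"
        proof -
          have "\<bar>f z - f y\<bar> \<le> N * \<bar>z - y\<bar> powr \<alpha>" using H b(2) y z by (auto simp: holder_bd_def)
          also have "\<dots> \<le> N * ?L powr \<alpha>" using N \<alpha> b(5)[OF z y] by (intro mult_left_mono powr_mono2) auto
          finally show ?thesis .
        qed
        then show "ennreal \<bar>f z - f y\<bar> * indicator I z \<le> ennreal (N * ?L powr \<alpha>) * indicator I z"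
          by (auto intro: ennreal_leI split: split_indicator)
      qed
      also have "\<dots> = ennreal (N * ?L powr \<alpha> * ?L)"
        using b N by (subst nn_integral_cmult_indicator) (auto simp: ennreal_mult'')
      finally have "\<bar>average f I - f y\<bar> \<le> N * ?L powr \<alpha>" using N by (intro average_diff_le[OF I f[OF I]]) auto
      then show "\<bar>f y - average f I\<bar> \<le> N * ?L powr \<alpha>" by (simp only: abs_minus_commute)
    qed
  qed
  show "M2 \<alpha> p f (N powr p)"
    unfolding M2_def
  proof (intro allI impI)
    fix b :: real assume b: "b > 0"
    have I: "{0<..<b} \<in> bounded_intervals" using b by (auto simp: bounded_intervals_def)
    have "(\<integral>\<^sup>+y\<in>{0<..<b}. ennreal (\<bar>f y - 0\<bar> powr p) \<partial>lborel) / ennreal (measure lborel {0<..<b} powr (1 + p * \<alpha>)) \<le> ennreal (N powr p)"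
    proof (rule key[OF I])
      fix y assume y: "y \<in> {0<..<b}"
      then have "\<bar>f y\<bar> \<le> N * y powr \<alpha>" using H by (auto simp: holder_bd_def)
      also have "\<dots> \<le> N * b powr \<alpha>" using N \<alpha> y by (intro mult_left_mono powr_mono2) auto
      finally show "\<bar>f y - 0\<bar> \<le> N * measure lborel {0<..<b} powr \<alpha>" using b by simp
    qed
    then show "(\<integral>\<^sup>+y\<in>{0<..<b}. ennreal (\<bar>f y\<bar> powr p) \<partial>lborel) / ennreal (measure lborel {0<..<b} powr (1 + p * \<alpha>)) \<le> ennreal (N powr p)" by simp
  qed
qed

text \<open>Young's inequality \<open>h \<le> c + c powr (1 - p) * h powr p\<close> takes the place of Jensen's.\<close>

lemma nn_integral_le_of_power_mean:
  assumes I: "I \<in> bounded_intervals" and C: "C > 0" and p: "p \<ge> 1" and h: "h \<in> borel_measurable borel" and "\<And>y. h y \<ge> 0"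
    and le: "(\<integral>\<^sup>+y\<in>I. ennreal (h y powr p) \<partial>lborel) / ennreal (measure lborel I powr (1 + p * \<alpha>)) \<le> ennreal C"
  shows "(\<integral>\<^sup>+y\<in>I. ennreal (h y) \<partial>lborel) \<le> ennreal (2 * C powr (1 / p) * measure lborel I powr \<alpha> * measure lborel I)"
proof -
  note b = bounded_intervalsD[OF I]
  note [measurable] = h b(1)
  let ?L = "measure lborel I"
  define c where "c = C powr (1 / p) * ?L powr \<alpha>"
  have c: "c > 0" using C b(3) by (simp add: c_def)
  have le': "(\<integral>\<^sup>+y\<in>I. ennreal (h y powr p) \<partial>lborel) \<le> ennreal (C * ?L powr (1 + p * \<alpha>))"
    using b(3) C by (intro ennreal_le_of_divide_le le) auto
  have "(\<integral>\<^sup>+y\<in>I. ennreal (h y) \<partial>lborel) \<le> (\<integral>\<^sub>+y. ennreal c * indicator I y + ennreal (c powr (1 - p)) * (ennreal (h y powr p) * indicator I y))"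
  proof (rule nn_integral_mono)
    fix y
    let ?a = "h y"
    have a: "?a \<ge> 0" by fact
    have "?a \<le> c + c powr (1 - p) * ?a powr p"
    proof (cases "?a \<le> c")
      case False
      have "?a = c powr (1 - p) * (?a * c powr (p - 1))" using c by (simp add: powr_add[symmetric] mult.left_commute)
      also have "\<dots> \<le> c powr (1 - p) * (?a * ?a powr (p - 1))" using False c p by (intro mult_left_mono powr_mono2) auto
      also have "?a * ?a powr (p - 1) = ?a powr p" using False c by (subst powr_mult_base) auto
      finally show ?thesis using c by linarith
    qed (simp add: add_increasing2)
    then have "ennreal ?a \<le> ennreal (c + c powr (1 - p) * ?a powr p)" by (rule ennreal_leI)
    also have "\<dots> = ennreal c + ennreal (c powr (1 - p)) * ennreal (?a powr p)" using c by (simp add: ennreal_mult')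
    finally show "ennreal ?a * indicator I y \<le> ennreal c * indicator I y + ennreal (c powr (1 - p)) * (ennreal (?a powr p) * indicator I y)"
      by (auto split: split_indicator)
  qed
  also have "\<dots> = (\<integral>\<^sub>+y. ennreal c * indicator I y) + (\<integral>\<^sub>+y. ennreal (c powr (1 - p)) * (ennreal (h y powr p) * indicator I y))"
    by (rule nn_integral_add) measurable
  also have "(\<integral>\<^sub>+y. ennreal (c powr (1 - p)) * (ennreal (h y powr p) * indicator I y)) = ennreal (c powr (1 - p)) * (\<integral>\<^sup>+y\<in>I. ennreal (h y powr p) \<partial>lborel)"
    by (rule nn_integral_cmult) measurable
  also have "(\<integral>\<^sub>+y. ennreal c * indicator I y) = ennreal (c * ?L)"
    using b c by (subst nn_integral_cmult_indicator) (auto simp: ennreal_mult'')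
  also have "ennreal (c * ?L) + ennreal (c powr (1 - p)) * (\<integral>\<^sup>+y\<in>I. ennreal (h y powr p) \<partial>lborel)
      \<le> ennreal (c * ?L) + ennreal (c powr (1 - p)) * ennreal (C * ?L powr (1 + p * \<alpha>))"
    by (intro add_left_mono mult_left_mono le') simp
  also have "C * ?L powr (1 + p * \<alpha>) = c powr p * ?L"
    using C b(3) p by (simp add: c_def powr_mult powr_powr powr_add mult_ac)
  also have "ennreal (c * ?L) + ennreal (c powr (1 - p)) * ennreal (c powr p * ?L) = ennreal (c * ?L + c powr (1 - p) * c powr p * ?L)"
    using c b(3) by (simp add: ennreal_mult'[symmetric] mult.assoc)
  also have "c * ?L + c powr (1 - p) * c powr p * ?L = 2 * c * ?L" using c by (simp add: powr_add[symmetric])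
  finally show ?thesis by (simp add: c_def mult_ac)
qed

lemma average_tendsto:
  fixes a b :: "nat \<Rightarrow> real"
  assumes f: "isCont f x" and ab: "\<And>k. {a k<..<b k} \<in> bounded_intervals" "\<And>k. a k < b k" "\<And>k. set_integrable lborel {a k<..<b k} f"
    and x: "\<And>k. x \<in> {a k..b k}" and l: "(\<lambda>k. b k - a k) \<longlonglongrightarrow> 0"
  shows "(\<lambda>k. average f {a k<..<b k}) \<longlonglongrightarrow> f x"
proof (rule LIMSEQ_I)
  fix e :: real assume e: "e > 0"
  obtain d where d: "d > 0" "\<And>y. \<bar>y - x\<bar> < d \<Longrightarrow> \<bar>f y - f x\<bar> < e / 2"
    using f e unfolding continuous_at_eps_delta dist_real_def by (metis half_gt_zero)
  obtain K where K: "\<And>k. k \<ge> K \<Longrightarrow> \<bar>b k - a k\<bar> < d" using LIMSEQ_D[OF l d(1)] by auto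
  show "\<exists>K. \<forall>k\<ge>K. norm (average f {a k<..<b k} - f x) < e"
  proof (intro exI[of _ K] allI impI)
    fix k assume k: "k \<ge> K"
    have "\<bar>average f {a k<..<b k} - f x\<bar> \<le> e / 2"
    proof (rule average_diff_le[OF ab(1) ab(3)])
      have "(\<integral>\<^sup>+y\<in>{a k<..<b k}. ennreal \<bar>f y - f x\<bar> \<partial>lborel) \<le> (\<integral>\<^sub>+y. ennreal (e / 2) * indicator {a k<..<b k} y)"
      proof (rule nn_integral_mono)
        fix y
        have "\<bar>f y - f x\<bar> \<le> e / 2" if "y \<in> {a k<..<b k}"
        proof -
          have "\<bar>y - x\<bar> < d" using that x[of k] K[OF k] by auto
          then show ?thesis using d(2) by (simp add: less_imp_le)
        qed
        then show "ennreal \<bar>f y - f x\<bar> * indicator {a k<..<b k} y \<le> ennreal (e / 2) * indicator {a k<..<b k} y"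
          by (auto intro: ennreal_leI split: split_indicator)
      qed
      also have "\<dots> = ennreal (e / 2 * measure lborel {a k<..<b k})"
        using ab(2)[of k] e by (subst nn_integral_cmult_indicator) (auto simp: ennreal_mult'[symmetric])
      finally show "(\<integral>\<^sup>+y\<in>{a k<..<b k}. ennreal \<bar>f y - f x\<bar> \<partial>lborel) \<le> ennreal (e / 2 * measure lborel {a k<..<b k})" .
    qed (use e in auto)
    then show "norm (average f {a k<..<b k} - f x) < e" using e by simp
  qed
qed

text \<open>Halving the interval changes the average by at most twice the mean oscillation, which is
  of order \<open>(l / 2 ^ k) powr \<alpha>\<close>. The geometric series with ratio
  \<open>q = 2 powr (- \<alpha>)\<close> gives the constant \<open>2 / (1 - q)\<close>, and the
  averages tend to \<open>f x\<close> by continuity. The intervals are only required to contain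
  \<open>x\<close> in their closure, so it may be a common endpoint.\<close>

lemma average_dyadic:
  fixes a b :: "nat \<Rightarrow> real"
  assumes f: "isCont f x" and l: "l > 0" and D: "D \<ge> 0" and \<alpha>: "\<alpha> > 0"
    and ab: "\<And>k. a k \<ge> 0" "\<And>k. b k - a k = l / 2 ^ k" "\<And>k. a k \<le> a (Suc k)" "\<And>k. b (Suc k) \<le> b k" "\<And>k. x \<in> {a k..b k}"
    and fi: "\<And>I. I \<in> bounded_intervals \<Longrightarrow> set_integrable lborel I f"
    and osc: "\<And>I. I \<in> bounded_intervals \<Longrightarrow> (\<integral>\<^sup>+y\<in>I. ennreal \<bar>f y - average f I\<bar> \<partial>lborel) \<le> ennreal (D * measure lborel I powr \<alpha> * measure lborel I)"
  shows "\<bar>f x - average f {a 0<..<b 0}\<bar> \<le> 2 / (1 - 2 powr (- \<alpha>)) * D * l powr \<alpha>"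
proof -
  have lt: "a k < b k" for k using ab(2)[of k] l by (smt (verit) divide_pos_pos zero_less_power)
  have I: "{a k<..<b k} \<in> bounded_intervals" for k using lt[of k] ab(1)[of k] by (auto simp: bounded_intervals_def)
  define q where "q = 2 powr (- \<alpha>)"
  have q: "0 < q" "q < 1" using \<alpha> by (auto simp: q_def powr_less_one)
  define S where "S = 2 / (1 - q)"
  have S: "S * (1 - q) = 2" "S > 0" using q by (simp_all add: S_def field_simps)
  let ?A = "\<lambda>k. average f {a k<..<b k}"
  have step: "\<bar>?A (Suc k) - ?A k\<bar> \<le> 2 * D * l powr \<alpha> * q ^ k" for k
  proof -
    have m: "measure lborel {a k<..<b k} = l / 2 ^ k" "measure lborel {a (Suc k)<..<b (Suc k)} = l / 2 ^ Suc k"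
      using lt[of k] lt[of "Suc k"] ab(2) by (simp_all del: power_Suc)
    have "(l / 2 ^ k) powr \<alpha> = l powr \<alpha> * q ^ k"
    proof -
      have "(2::real) ^ k = 2 powr real k" by (simp add: powr_realpow)
      moreover have "q ^ k = 2 powr (- \<alpha> * real k)" by (simp add: q_def powr_power mult.commute)
      moreover have "(l / 2 powr real k) powr \<alpha> = l powr \<alpha> * 2 powr (- \<alpha> * real k)"
        by (simp add: powr_divide powr_powr powr_minus_divide mult.commute)
      ultimately show ?thesis by simp
    qed
    then have e: "2 * D * l powr \<alpha> * q ^ k * measure lborel {a (Suc k)<..<b (Suc k)} = D * (l / 2 ^ k) powr \<alpha> * (l / 2 ^ k)"
      unfolding m by simp
    show ?thesis
    proof (rule average_diff_le[OF I fi[OF I]])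
      have "(\<integral>\<^sup>+y\<in>{a (Suc k)<..<b (Suc k)}. ennreal \<bar>f y - ?A k\<bar> \<partial>lborel) \<le> (\<integral>\<^sup>+y\<in>{a k<..<b k}. ennreal \<bar>f y - ?A k\<bar> \<partial>lborel)"
        using ab(3,4)[of k] by (intro nn_integral_mono) (auto split: split_indicator)
      also have "\<dots> \<le> ennreal (D * (l / 2 ^ k) powr \<alpha> * (l / 2 ^ k))" using osc[OF I, of k] unfolding m .
      finally show "(\<integral>\<^sup>+y\<in>{a (Suc k)<..<b (Suc k)}. ennreal \<bar>f y - ?A k\<bar> \<partial>lborel) \<le> ennreal (2 * D * l powr \<alpha> * q ^ k * measure lborel {a (Suc k)<..<b (Suc k)})"
        unfolding e .
      show "0 \<le> 2 * D * l powr \<alpha> * q ^ k" using D q by simp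
    qed
  qed
  \<comment> \<open>The partial geometric sum is kept in closed form as
    \<open>S * (1 - q ^ k)\<close>, which makes the induction close.\<close>
  have bd: "\<bar>?A k - ?A 0\<bar> \<le> S * D * l powr \<alpha> * (1 - q ^ k)" for k
  proof (induction k)
    case (Suc k)
    have "S * D * l powr \<alpha> * (1 - q ^ Suc k) = S * D * l powr \<alpha> * (1 - q ^ k) + (S * (1 - q)) * D * l powr \<alpha> * q ^ k"
      by (simp add: algebra_simps)
    then show ?case using step[of k] Suc unfolding S by linarith
  qed simp
  have bd': "\<bar>?A k - ?A 0\<bar> \<le> S * D * l powr \<alpha>" for k
  proof -
    have "S * D * l powr \<alpha> * (1 - q ^ k) \<le> S * D * l powr \<alpha> * 1" using S q D by (intro mult_left_mono) auto
    with bd[of k] show ?thesis by linarith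
  qed
  have "?A \<longlonglongrightarrow> f x"
  proof (rule average_tendsto[OF f I lt fi[OF I] ab(5)])
    have "(\<lambda>k. l * (1 / 2) ^ k) \<longlonglongrightarrow> l * 0" by (intro tendsto_mult LIMSEQ_power_zero tendsto_const) simp
    then show "(\<lambda>k. b k - a k) \<longlonglongrightarrow> 0" unfolding ab(2) by (simp add: power_divide)
  qed
  then have "(\<lambda>k. \<bar>?A k - ?A 0\<bar>) \<longlonglongrightarrow> \<bar>f x - ?A 0\<bar>" by (intro tendsto_intros)
  then show ?thesis using bd' unfolding S_def q_def by (intro LIMSEQ_le_const2) auto
qed

text \<open>For \<open>x < y\<close> the dyadic intervals shrink from \<open>(x, y)\<close> once to
  the left and once to the right endpoint; both chains start at the same average, which cancels in
  \<open>f x - f y\<close>. On \<open>(0, x)\<close> the chain to the right endpoint starts at an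
  average that \<open>M2\<close> controls, which bounds \<open>f x\<close> itself.\<close>

lemma holder_bd_of_campanato:
  assumes \<alpha>: "\<alpha> > 0" and p: "p \<ge> 1" and C: "C > 0" "M1 \<alpha> p f C" "M2 \<alpha> p f C" and cont: "continuous_on {0<..} f"
    and fm: "(\<lambda>y. pos y * f y) \<in> borel_measurable borel"
    and fi: "\<And>I. I \<in> bounded_intervals \<Longrightarrow> set_integrable lborel I f"
  shows "holder_bd \<alpha> f (2 * (4 / (1 - 2 powr (- \<alpha>)) + 1) * C powr (1 / p))"
proof -
  define D where "D = 2 * C powr (1 / p)"
  define S where "S = 2 / (1 - 2 powr (- \<alpha>))"
  have S: "S > 0" using \<alpha> by (simp add: S_def powr_less_one)
  have D: "D \<ge> 0" by (simp add: D_def)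
  have cst: "2 * (4 / (1 - 2 powr (- \<alpha>)) + 1) * C powr (1 / p) = 2 * (S * D) + D" by (simp add: S_def D_def algebra_simps)
  note [measurable] = fm
  have cm: "(\<integral>\<^sup>+y\<in>I. ennreal \<bar>f y - c\<bar> \<partial>lborel) \<le> ennreal (D * measure lborel I powr \<alpha> * measure lborel I)"
    if I: "I \<in> bounded_intervals" and le: "(\<integral>\<^sup>+y\<in>I. ennreal (\<bar>f y - c\<bar> powr p) \<partial>lborel) / ennreal (measure lborel I powr (1 + p * \<alpha>)) \<le> ennreal C" for I c
  proof -
    \<comment> \<open>Measurability on the whole line is known for \<open>pos y * f y\<close>, which
      agrees with \<open>f\<close> on \<open>I\<close>.\<close>
    define f0 where "f0 y = pos y * f y" for y
    have e: "y \<in> I \<Longrightarrow> f0 y = f y" for y using bounded_intervalsD(2)[OF I] by (auto simp: f0_def)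
    have [measurable]: "f0 \<in> borel_measurable borel" unfolding f0_def by measurable
    have "(\<integral>\<^sup>+y\<in>I. ennreal \<bar>f0 y - c\<bar> \<partial>lborel) \<le> ennreal (2 * C powr (1 / p) * measure lborel I powr \<alpha> * measure lborel I)"
    proof (rule nn_integral_le_of_power_mean[OF I C(1) p])
      have "(\<integral>\<^sup>+y\<in>I. ennreal (\<bar>f0 y - c\<bar> powr p) \<partial>lborel) = (\<integral>\<^sup>+y\<in>I. ennreal (\<bar>f y - c\<bar> powr p) \<partial>lborel)"
        by (rule nn_integral_cong) (auto simp: e split: split_indicator)
      then show "(\<integral>\<^sup>+y\<in>I. ennreal (\<bar>f0 y - c\<bar> powr p) \<partial>lborel) / ennreal (measure lborel I powr (1 + p * \<alpha>)) \<le> ennreal C"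
        using le by simp
    qed auto
    also have "(\<integral>\<^sup>+y\<in>I. ennreal \<bar>f0 y - c\<bar> \<partial>lborel) = (\<integral>\<^sup>+y\<in>I. ennreal \<bar>f y - c\<bar> \<partial>lborel)"
      by (rule nn_integral_cong) (auto simp: e split: split_indicator)
    finally show ?thesis by (simp add: D_def)
  qed
  have osc: "(\<integral>\<^sup>+y\<in>I. ennreal \<bar>f y - average f I\<bar> \<partial>lborel) \<le> ennreal (D * measure lborel I powr \<alpha> * measure lborel I)"
    if I: "I \<in> bounded_intervals" for I using cm[OF I] C(2) I unfolding M1_def by blast
  have iso: "isCont f x" if "x > 0" for x using cont that by (simp add: continuous_on_eq_continuous_at)
  have right: "\<bar>f x - average f {x<..<x + l}\<bar> \<le> S * D * l powr \<alpha>" if x: "x > 0" and l: "l > 0" for x l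
  proof -
    have "\<bar>f x - average f {x<..<x + l / 2 ^ 0}\<bar> \<le> 2 / (1 - 2 powr (- \<alpha>)) * D * l powr \<alpha>"
      using x l by (intro average_dyadic[where a = "\<lambda>_. x" and b = "\<lambda>k. x + l / 2 ^ k"] iso D \<alpha> fi osc) (auto simp: field_simps)
    then show ?thesis by (simp add: S_def)
  qed
  have left: "\<bar>f (x + l) - average f {x<..<x + l}\<bar> \<le> S * D * l powr \<alpha>" if x: "x \<ge> 0" and l: "l > 0" for x l
  proof -
    have p1: "l / 2 ^ k \<le> l" for k using l by (simp add: divide_le_eq)
    have "\<bar>f (x + l) - average f {(x + l) - l / 2 ^ 0<..<x + l}\<bar> \<le> 2 / (1 - 2 powr (- \<alpha>)) * D * l powr \<alpha>"
    proof (rule average_dyadic[where a = "\<lambda>k. (x + l) - l / 2 ^ k" and b = "\<lambda>k. x + l"])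
      show "0 \<le> x + l - l / 2 ^ k" for k using p1[of k] x by linarith
      show "(\<integral>\<^sup>+y\<in>I. ennreal \<bar>f y - average f I\<bar> \<partial>lborel) \<le> ennreal (D * measure lborel I powr \<alpha> * measure lborel I)"
        if "I \<in> bounded_intervals" for I by (rule osc[OF that])
    qed (use x l in \<open>auto intro!: iso D \<alpha> fi simp: field_simps\<close>)
    then show ?thesis by (simp add: S_def)
  qed
  have lt: "\<bar>f x - f y\<bar> \<le> 2 * (S * D) * \<bar>x - y\<bar> powr \<alpha>" if "0 < x" "x < y" for x y
    using right[of x "y - x"] left[of x "y - x"] that by (simp add: abs_minus_commute[of x y])
  have SD: "0 \<le> S * D" using S D by simp
  show ?thesis
    unfolding cst holder_bd_def
  proof (intro conjI allI impI)
    fix x y :: real assume xy: "x > 0" "y > 0"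
    have "\<bar>f x - f y\<bar> \<le> 2 * (S * D) * \<bar>x - y\<bar> powr \<alpha>"
      using lt[of x y] lt[of y x] xy SD by (cases x y rule: linorder_cases) (auto simp: abs_minus_commute)
    also have "\<dots> \<le> (2 * (S * D) + D) * \<bar>x - y\<bar> powr \<alpha>" using D by (intro mult_right_mono) auto
    finally show "\<bar>f x - f y\<bar> \<le> (2 * (S * D) + D) * \<bar>x - y\<bar> powr \<alpha>" .
  next
    fix x :: real assume x: "x > 0"
    have I: "{0<..<x} \<in> bounded_intervals" using x by (auto simp: bounded_intervals_def)
    have "\<bar>average f {0<..<x} - 0\<bar> \<le> D * x powr \<alpha>"
    proof (rule average_diff_le[OF I fi[OF I]])
      have "(\<integral>\<^sup>+y\<in>{0<..<x}. ennreal (\<bar>f y - 0\<bar> powr p) \<partial>lborel) / ennreal (measure lborel {0<..<x} powr (1 + p * \<alpha>)) \<le> ennreal C"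
        using C(3) x by (simp add: M2_def)
      from cm[OF I this] show "(\<integral>\<^sup>+y\<in>{0<..<x}. ennreal \<bar>f y - 0\<bar> \<partial>lborel) \<le> ennreal (D * x powr \<alpha> * measure lborel {0<..<x})"
        using x by simp
    qed (use D in simp)
    moreover have "\<bar>f x - average f {0<..<x}\<bar> \<le> S * D * x powr \<alpha>" using left[of 0 x] x by simp
    moreover have "S * D * x powr \<alpha> + D * x powr \<alpha> \<le> (2 * (S * D) + D) * x powr \<alpha>"
      using mult_nonneg_nonneg[OF SD, of "x powr \<alpha>"] by (simp add: algebra_simps)
    ultimately show "\<bar>f x\<bar> \<le> (2 * (S * D) + D) * x powr \<alpha>" by linarith
  qed
qed

lemma set_integrable_of_L_space:
  assumes f: "f \<in> L_space \<rho>" and I: "I \<in> bounded_intervals"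
  shows "set_integrable lborel I f"
proof -
  note b = bounded_intervalsD[OF I]
  obtain B where B: "\<And>x. x \<in> I \<Longrightarrow> \<bar>x\<bar> \<le> B" using I by (auto simp: bounded_intervals_def bounded_real)
  let ?e = "- 1 - 2 * \<rho>"
  have s: "set_integrable lborel I (\<lambda>x. f x * (1 + x) powr ?e)"
    using f b by (auto simp: L_space_def intro: set_integrable_subset)
  have [measurable]: "I \<in> sets borel" by (rule b)
  define g where "g x = indicator I x * (f x * (1 + x) powr ?e)" for x
  have g: "integrable lborel g" using s by (simp add: set_integrable_def g_def[abs_def])
  then have [measurable]: "g \<in> borel_measurable borel" by simp
  have fe: "indicator I x *\<^sub>R f x = g x * (1 + x) powr (- ?e)" for x
  proof (cases "x \<in> I")
    case True
    then have "0 < 1 + x" using b(2) by (auto intro: add_pos_pos)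
    then show ?thesis using True by (simp add: g_def powr_add[symmetric])
  qed (simp add: g_def)
  \<comment> \<open>The maximum with 1 covers both signs of the exponent.\<close>
  define K where "K = max 1 ((1 + B) powr (- ?e))"
  show ?thesis
    unfolding set_integrable_def
  proof (rule Bochner_Integration.integrable_bound[of lborel "\<lambda>x. K * g x"])
    show "integrable lborel (\<lambda>x. K * g x)" using g by simp
    show "(\<lambda>x. indicator I x *\<^sub>R f x) \<in> borel_measurable lborel" unfolding fe by measurable
    have "norm (indicator I x *\<^sub>R f x) \<le> norm (K * g x)" for x
    proof (cases "x \<in> I")
      case True
      then have x: "0 < x" "x \<le> B" using b(2) B[of x] by auto
      have "(1 + x) powr (- ?e) \<le> K"
      proof (cases "- ?e \<ge> 0")
        case True
        then have "(1 + x) powr (- ?e) \<le> (1 + B) powr (- ?e)" using x by (intro powr_mono2) auto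
        then show ?thesis by (simp add: K_def)
      next
        case False
        then have "(1 + x) powr (- ?e) \<le> (1 + x) powr 0" using x by (intro powr_mono) auto
        then show ?thesis using x by (simp add: K_def)
      qed
      then have "\<bar>g x\<bar> * (1 + x) powr (- ?e) \<le> \<bar>g x\<bar> * K" by (intro mult_left_mono) auto
      moreover have "K \<ge> 0" by (simp add: K_def)
      ultimately show ?thesis unfolding fe by (simp add: abs_mult mult.commute)
    qed (simp add: g_def)
    then show "AE x in lborel. norm (indicator I x *\<^sub>R f x) \<le> norm (K * g x)" by simp
  qed
qed

subsection \<open>Comparability of the four quantities\<close>

lemma Linf_norm_on_le:
  assumes [measurable]: "A \<in> sets borel" "u \<in> borel_measurable borel"
    and "\<And>x. x \<in> A \<Longrightarrow> cmod (g x) = u x" and "\<And>x. x \<in> A \<Longrightarrow> u x \<le> c"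
  shows "Linf_norm_on A g \<le> ennreal c"
  unfolding Linf_norm_on_def
proof (rule esssup_I)
  have "(\<lambda>x. ennreal (u x)) \<in> borel_measurable (restrict_space lborel A)" by (intro measurable_restrict_space1) measurable
  then show "(\<lambda>x. ennreal (cmod (g x))) \<in> borel_measurable (restrict_space lborel A)"
    using assms(3) by (subst measurable_cong[where g = "\<lambda>x. ennreal (u x)"]) (auto simp: space_restrict_space)
  show "AE x in restrict_space lborel A. ennreal (cmod (g x)) \<le> ennreal c"
    using assms(3,4) by (intro AE_I2) (auto simp: space_restrict_space intro: ennreal_leI)
qed

lemma AE_of_Linf_norm_on_le:
  assumes "Linf_norm_on A g \<le> ennreal c" "c \<ge> 0" and A: "A \<in> sets borel"
  shows "AE x in lborel. x \<in> A \<longrightarrow> cmod (g x) \<le> c"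
proof -
  have "AE x in restrict_space lborel A. ennreal (cmod (g x)) \<le> Linf_norm_on A g"
    unfolding Linf_norm_on_def by (rule esssup_AE)
  then have "AE x in lborel. x \<in> A \<longrightarrow> ennreal (cmod (g x)) \<le> Linf_norm_on A g"
    using A by (subst (asm) AE_restrict_space_iff) auto
  then show ?thesis
  proof eventually_elim
    case (elim x)
    have "cmod (g x) \<le> c" if "x \<in> A"
    proof -
      have "ennreal (cmod (g x)) \<le> ennreal c" using elim that assms(1) by (blast intro: order_trans)
      then show ?thesis using assms(2) by (simp add: ennreal_le_iff)
    qed
    then show ?case by blast
  qed
qed

lemma abs_powr: "\<bar>t powr p\<bar> = t powr p" for t :: real
  by simp

lemma powr_mult_powr: "t powr p * (c * t powr q) = c * t powr (p + q)" for t :: real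
  by (simp add: powr_add)

lemma holder_bd_mono: "holder_bd \<alpha> f N \<Longrightarrow> N \<le> N' \<Longrightarrow> holder_bd \<alpha> f N'"
  unfolding holder_bd_def by (meson mult_right_mono order_trans powr_ge_zero)

lemma ennreal_sqrt_le:
  assumes "X \<le> ennreal (c\<^sup>2)" "c \<ge> 0" shows "ennreal_sqrt X \<le> ennreal c"
proof -
  have fin: "X \<noteq> \<infinity>" using assms(1) by (metis ennreal_less_top infinity_ennreal_def leD top.not_eq_extremum)
  have "enn2real X \<le> c\<^sup>2" using assms by (simp add: enn2real_leI)
  then have "sqrt (enn2real X) \<le> c" using assms(2) by (metis real_sqrt_abs abs_of_nonneg real_sqrt_le_iff)
  then show ?thesis using fin by (simp add: ennreal_sqrt_def ennreal_leI)
qed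

lemma le_of_ennreal_sqrt_less:
  assumes "ennreal_sqrt X < ennreal r" "r > 0" shows "X \<le> ennreal (r\<^sup>2)"
proof -
  have fin: "X \<noteq> \<infinity>" using assms(1) by (auto simp: ennreal_sqrt_def)
  then have "sqrt (enn2real X) < r" using assms by (simp add: ennreal_sqrt_def ennreal_less_iff)
  then have "enn2real X < r\<^sup>2" using assms(2) by (metis real_sqrt_less_iff real_sqrt_abs abs_of_pos)
  then have "ennreal (enn2real X) \<le> ennreal (r\<^sup>2)" by (intro ennreal_leI) simp
  moreover have "ennreal (enn2real X) = X" using fin by (simp add: less_top)
  ultimately show ?thesis by simp
qed

lemma ennreal_sqrt_less_top: "ennreal_sqrt X < \<infinity> \<longleftrightarrow> X < \<infinity>"
  by (auto simp: ennreal_sqrt_def less_top)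

section \<open>Reduction to comparability with Hoelder constants\<close>

locale bessel_holder =
  fixes lam \<beta> \<alpha> :: real
  assumes lam: "0 < lam" and b: "0 < \<beta>" and a: "0 < \<alpha>" "\<alpha> < 1" "\<alpha> < min lam \<beta>"
begin

abbreviation "\<gamma> \<equiv> real (frac_order \<beta>) - \<beta>"

abbreviation "V \<equiv> Vker lam (frac_order \<beta>) \<gamma>"

definition "cls f \<longleftrightarrow> continuous_on {0<..} f \<and> f \<in> L_space (min lam \<beta> / 2)"

text \<open>States that \<open>A\<close> is equivalent to the best Hoelder constant without naming
  that infimum. The strict inequality with a real \<open>r\<close> excludes infinite values and lets
  an infimum such as \<open>campanato_const\<close> be approximated by an admissible
  constant.\<close>

definition "comparable C A \<longleftrightarrow> (\<forall>f. cls f \<longrightarrow> (\<forall>N>0. holder_bd \<alpha> f N \<longrightarrow> A f \<le> ennreal (C * N)) \<and>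
   (\<forall>r>0. A f < ennreal r \<longrightarrow> holder_bd \<alpha> f (C * r)))"

definition "V_bd f N \<longleftrightarrow> (\<forall>t>0. \<forall>x>0. \<bar>V f t x\<bar> \<le> N * t powr (\<alpha> - \<beta>))"

lemma g: "\<gamma> > 0" "real (frac_order \<beta>) = \<gamma> + \<beta>"
  using frac_order_iff[OF b, of "frac_order \<beta>"] by auto

lemma Gp: "Gamma \<gamma> > 0" using g by (intro Gamma_real_pos)

lemma a': "\<alpha> < lam" "\<alpha> < \<beta>" using a by auto

lemma cls_adm: "cls f \<Longrightarrow> adm lam 0 f" using L_space_adm[OF _ lam b] by (simp add: cls_def)

lemma V_measurable:
  "cls f \<Longrightarrow> h \<in> borel_measurable M \<Longrightarrow> k \<in> borel_measurable M \<Longrightarrow> (\<lambda>a. V f (h a) (k a)) \<in> borel_measurable M"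
  by (intro Vker_measurable lam adm_measurable[OF cls_adm])

lemma cmod_poisson_frac_deriv:
  assumes "cls f" "t > 0" "x > 0"
  shows "cmod (poisson_frac_deriv lam \<beta> f t x) = \<bar>V f t x\<bar> / Gamma \<gamma>"
  using assms lam b by (intro poisson_frac_deriv_eq[OF cls_adm]) auto

lemma V_bd_of_holder:
  obtains C where "C > 0" "\<And>f N. cls f \<Longrightarrow> N > 0 \<Longrightarrow> holder_bd \<alpha> f N \<Longrightarrow> V_bd f (C * N)"
proof -
  obtain C where C: "C \<ge> 0" "\<And>f N. adm lam 0 f \<Longrightarrow> N \<ge> 0 \<Longrightarrow> (\<forall>x>0. \<forall>y>0. \<bar>f y - f x\<bar> \<le> N * \<bar>x - y\<bar> powr \<alpha>) \<Longrightarrow> (\<forall>x>0. \<bar>f x\<bar> \<le> N * x powr \<alpha>) \<Longrightarrow>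
     (\<forall>t>0. \<forall>x>0. \<bar>V f t x\<bar> \<le> C * N * t powr (\<alpha> - \<beta>))"
    using Vker_holder_bound[OF lam b g a(1,2) a'(2)] by metis
  show ?thesis
  proof (rule that[of "C + 1"])
    fix f :: "real \<Rightarrow> real" and N :: real
    assume *: "cls f" "N > 0" "holder_bd \<alpha> f N"
    have h: "\<forall>x>0. \<forall>y>0. \<bar>f y - f x\<bar> \<le> N * \<bar>x - y\<bar> powr \<alpha>" "\<forall>x>0. \<bar>f x\<bar> \<le> N * x powr \<alpha>"
      using *(3) by (auto simp: holder_bd_def abs_minus_commute)
    show "V_bd f ((C + 1) * N)"
      unfolding V_bd_def
    proof (intro allI impI)
      fix t x :: real assume tx: "t > 0" "x > 0"
      have "\<bar>V f t x\<bar> \<le> C * N * t powr (\<alpha> - \<beta>)" using C(2)[OF cls_adm[OF *(1)] _ h] * tx by auto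
      also have "\<dots> \<le> (C + 1) * N * t powr (\<alpha> - \<beta>)" using * by (intro mult_right_mono) auto
      finally show "\<bar>V f t x\<bar> \<le> (C + 1) * N * t powr (\<alpha> - \<beta>)" .
    qed
  qed (use C in simp)
qed

lemma holder_of_V_bd:
  obtains C where "C > 0" "\<And>f N. cls f \<Longrightarrow> N \<ge> 0 \<Longrightarrow> V_bd f N \<Longrightarrow> holder_bd \<alpha> f (C * N)"
proof -
  obtain C where C: "C \<ge> 0" "\<And>f N. adm lam 0 f \<Longrightarrow> continuous_on {0<..} f \<Longrightarrow> N \<ge> 0 \<Longrightarrow> (\<forall>t>0. \<forall>x>0. \<bar>V f t x\<bar> \<le> N * t powr (\<alpha> - \<beta>)) \<Longrightarrow>
    (\<forall>x>0. \<bar>f x\<bar> \<le> C * N * x powr \<alpha>) \<and> (\<forall>x>0. \<forall>y>0. \<bar>f x - f y\<bar> \<le> C * N * \<bar>x - y\<bar> powr \<alpha>)"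
    using holder_of_Vker_bound[OF lam b g a(1,2) a'] by metis
  show ?thesis
  proof (rule that[of "C + 1"])
    fix f :: "real \<Rightarrow> real" and N :: real
    assume *: "cls f" "N \<ge> 0" "V_bd f N"
    have "holder_bd \<alpha> f (C * N)"
      using C(2)[OF cls_adm[OF *(1)] _ *(2)] * unfolding holder_bd_def cls_def V_bd_def by blast
    then show "holder_bd \<alpha> f ((C + 1) * N)" by (rule holder_bd_mono) (use * in \<open>simp add: algebra_simps\<close>)
  qed (use C in simp)
qed

lemma holder_of_carl_int:
  obtains C where "C > 0" "\<And>f r. cls f \<Longrightarrow> r > 0 \<Longrightarrow>
    (\<And>I. I \<in> bounded_intervals \<Longrightarrow> carl_int (V f) \<beta> I \<le> ennreal (r\<^sup>2 * measure lborel I powr (1 + 2 * \<alpha>))) \<Longrightarrow> holder_bd \<alpha> f (C * r)"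
proof -
  obtain C where C: "C > 0" "\<And>f N. cls f \<Longrightarrow> N \<ge> 0 \<Longrightarrow> V_bd f N \<Longrightarrow> holder_bd \<alpha> f (C * N)" using holder_of_V_bd by blast
  obtain D where D: "D \<ge> 0" "\<And>f Q. adm lam 0 f \<Longrightarrow> Q > 0 \<Longrightarrow>
    (\<forall>I\<in>bounded_intervals. carl_int (V f) \<beta> I \<le> ennreal (Q * measure lborel I powr (1 + 2 * \<alpha>))) \<Longrightarrow>
    (\<forall>t>0. \<forall>x>0. \<bar>V f t x\<bar> \<le> D * sqrt Q * t powr (\<alpha> - \<beta>))"
    using Vker_carleson_bound[OF lam b g, of \<alpha>] by metis
  show ?thesis
  proof (rule that[of "C * (D + 1)"])
    fix f r assume f: "cls f" and r: "(r::real) > 0"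
      and le: "\<And>I. I \<in> bounded_intervals \<Longrightarrow> carl_int (V f) \<beta> I \<le> ennreal (r\<^sup>2 * measure lborel I powr (1 + 2 * \<alpha>))"
    have "V_bd f (D * r)" using D(2)[OF cls_adm[OF f], of "r\<^sup>2"] le r by (simp add: V_bd_def)
    then have "holder_bd \<alpha> f (C * (D * r))" using D(1) r by (intro C(2)[OF f]) auto
    then show "holder_bd \<alpha> f (C * (D + 1) * r)" by (rule holder_bd_mono) (use C(1) r in \<open>simp add: algebra_simps\<close>)
  qed (use C D in simp)
qed

lemma comparable_mono:
  assumes "comparable C A" "C \<le> C'" shows "comparable C' A"
  unfolding comparable_def
proof (intro allI impI conjI)
  fix f N assume *: "cls f" "N > 0" "holder_bd \<alpha> f N"
  then have "A f \<le> ennreal (C * N)" using assms(1) by (auto simp: comparable_def)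
  also have "\<dots> \<le> ennreal (C' * N)" using assms * by (intro ennreal_leI mult_right_mono) auto
  finally show "A f \<le> ennreal (C' * N)" .
next
  fix f r assume *: "cls f" "r > 0" "A f < ennreal r"
  then have "holder_bd \<alpha> f (C * r)" using assms(1) by (auto simp: comparable_def)
  then show "holder_bd \<alpha> f (C' * r)" by (rule holder_bd_mono) (use assms * in \<open>simp add: mult_right_mono\<close>)
qed

lemma comparable_finite_iff:
  assumes "comparable C A" "C > 0" "cls f"
  shows "A f < \<infinity> \<longleftrightarrow> (\<exists>N>0. holder_bd \<alpha> f N)"
proof
  assume "A f < \<infinity>"
  then obtain r where r: "r \<ge> 0" "A f = ennreal r" by (cases "A f") auto
  then have "A f < ennreal (r + 1)" by (simp add: ennreal_less_iff)
  then have "holder_bd \<alpha> f (C * (r + 1))" using assms r by (auto simp: comparable_def)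
  then show "\<exists>N>0. holder_bd \<alpha> f N" using assms r by (intro exI[of _ "C * (r + 1)"]) auto
next
  assume "\<exists>N>0. holder_bd \<alpha> f N"
  then obtain N where "N > 0" "holder_bd \<alpha> f N" by blast
  then have "A f \<le> ennreal (C * N)" using assms by (auto simp: comparable_def)
  then show "A f < \<infinity>" by (simp add: le_less_trans)
qed

text \<open>\<open>B f\<close> is not strictly below itself, so it is raised by \<open>e\<close>,
  which then tends to 0. If \<open>B f\<close> is infinite, so is the right-hand side, because
  \<open>C * C > 0\<close>.\<close>

lemma comparable_le:
  assumes A: "comparable C A" and B: "comparable C B" and C: "C > 0" and f: "cls f"
  shows "A f \<le> ennreal (C * C) * B f"
proof (cases "B f")
  case (real s)
  have *: "A f \<le> ennreal (C * (C * (s + e)))" if e: "e > 0" for e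
  proof -
    have "B f < ennreal (s + e)" using real e by (simp add: ennreal_less_iff)
    then have "holder_bd \<alpha> f (C * (s + e))" using B f e real by (auto simp: comparable_def)
    then show ?thesis using A f C e real by (auto simp: comparable_def)
  qed
  obtain r where r: "r \<ge> 0" "A f = ennreal r" using *[of 1] by (cases "A f") (auto simp: top_unique)
  have "r \<le> C * C * s + e" if e: "e > 0" for e
  proof -
    have "r \<le> C * (C * (s + e / (C * C)))" using *[of "e / (C * C)"] r e C real by (simp add: ennreal_le_iff)
    also have "\<dots> = C * C * s + e" using C by (simp add: field_simps)
    finally show ?thesis .
  qed
  then have "r \<le> C * C * s" by (rule field_le_epsilon)
  then show ?thesis using r real C by (simp add: ennreal_mult'[symmetric] ennreal_leI)
next
  case top
  then show ?thesis using C by (simp add: ennreal_mult_top)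
qed

lemma comparable_holder_norm: "comparable 2 (holder_norm \<alpha>)"
  unfolding comparable_def
proof (intro allI impI conjI)
  fix f N assume "N > 0" "holder_bd \<alpha> f N"
  then show "holder_norm \<alpha> f \<le> ennreal (2 * N)" by (intro holder_norm_le) auto
next
  fix f r assume r: "(r::real) > 0" and "holder_norm \<alpha> f < ennreal r"
  then have "holder_bd \<alpha> f r" by (intro holder_bd_of_norm) auto
  then show "holder_bd \<alpha> f (2 * r)" by (rule holder_bd_mono) (use r in simp)
qed

lemma comparable_campanato:
  assumes p: "p \<ge> 1" shows "\<exists>C>0. comparable C (campanato_const \<alpha> p)"
proof -
  define S where "S = 4 / (1 - 2 powr (- \<alpha>))"
  define C where "C = 2 * (S + 1)"
  have "S \<ge> 0" unfolding S_def using a by (intro divide_nonneg_pos) (auto simp: powr_less_one)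
  then have C: "C \<ge> 1" by (simp add: C_def algebra_simps)
  have fi: "set_integrable lborel I f" if "cls f" "I \<in> bounded_intervals" for f I
    using that by (auto simp: cls_def intro: set_integrable_of_L_space)
  have "comparable C (campanato_const \<alpha> p)"
    unfolding comparable_def
  proof (intro allI impI conjI)
    fix f N assume *: "cls f" "(N::real) > 0" "holder_bd \<alpha> f N"
    have "campanato_const \<alpha> p f \<le> ennreal ((N powr p) powr (1 / p))"
      unfolding campanato_const_def using * campanato_le[OF *(3,2) p a(1) fi[OF *(1)]] by (intro INF_lower) auto
    also have "(N powr p) powr (1 / p) = N" using p * by (simp add: powr_powr)
    also have "ennreal N \<le> ennreal (C * N)" using C * by (intro ennreal_leI) simp
    finally show "campanato_const \<alpha> p f \<le> ennreal (C * N)" .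
  next
    fix f r assume *: "cls f" "(r::real) > 0" "campanato_const \<alpha> p f < ennreal r"
    obtain c where c: "0 < c" "M1 \<alpha> p f c" "M2 \<alpha> p f c" "ennreal (c powr (1 / p)) < ennreal r"
      using *(3) unfolding campanato_const_def INF_less_iff by blast
    have "holder_bd \<alpha> f (C * c powr (1 / p))"
      unfolding C_def S_def using * by (intro holder_bd_of_campanato a p c adm_measurable[OF cls_adm] fi) (auto simp: cls_def)
    then show "holder_bd \<alpha> f (C * r)"
      by (rule holder_bd_mono) (use c *(2) C in \<open>auto simp: ennreal_less_iff intro!: mult_left_mono\<close>)
  qed
  then show ?thesis using C by (intro exI[of _ C]) auto
qed

lemma campanato_finite_iff: "campanato_const \<alpha> p f < \<infinity> \<longleftrightarrow> (\<exists>C>0. M1 \<alpha> p f C \<and> M2 \<alpha> p f C)"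
  by (auto simp: campanato_const_def INF_less_iff)

lemma carleson_integral_eq:
  assumes f: "cls f" and I: "I \<in> bounded_intervals"
  shows "(\<integral>\<^sup>+t\<in>{0<..<measure lborel I}. (\<integral>\<^sup>+x\<in>I.
      ennreal ((cmod (of_real (t powr \<beta>) * poisson_frac_deriv lam \<beta> f t x))\<^sup>2 / t) \<partial>lborel) \<partial>lborel)
    = ennreal (1 / (Gamma \<gamma>)\<^sup>2) * carl_int (V f) \<beta> I"
proof -
  note bi = bounded_intervalsD[OF I]
  let ?c = "\<lambda>t x. ennreal ((cmod (of_real (t powr \<beta>) * poisson_frac_deriv lam \<beta> f t x))\<^sup>2 / t)"
  let ?v = "\<lambda>t x. ennreal ((t powr \<beta> * \<bar>V f t x\<bar>)\<^sup>2 / t)"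
  note [measurable] = V_measurable[OF f] bi(1)
  let ?F = "\<lambda>t. (\<integral>\<^sup>+x\<in>I. ?v t x \<partial>lborel) * indicator {0<..<measure lborel I} t"
  have eq: "(\<integral>\<^sup>+x\<in>I. ?c t x \<partial>lborel) * indicator {0<..<measure lborel I} t
    = ennreal (1 / (Gamma \<gamma>)\<^sup>2) * ((\<integral>\<^sup>+x\<in>I. ?v t x \<partial>lborel) * indicator {0<..<measure lborel I} t)" for t
  proof (cases "t > 0")
    case True
    have "(\<integral>\<^sup>+x\<in>I. ?c t x \<partial>lborel)
      = (\<integral>\<^sub>+x. ennreal (1 / (Gamma \<gamma>)\<^sup>2) * (?v t x * indicator I x))"
    proof (rule nn_integral_cong)
      fix x
      have "(cmod (of_real (t powr \<beta>) * poisson_frac_deriv lam \<beta> f t x))\<^sup>2 / t = 1 / (Gamma \<gamma>)\<^sup>2 * ((t powr \<beta> * \<bar>V f t x\<bar>)\<^sup>2 / t)" if "x \<in> I"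
      proof -
        have x: "x > 0" using that bi(2) by auto
        show ?thesis by (simp only: norm_mult norm_of_real cmod_poisson_frac_deriv[OF f True x] abs_powr power_mult_distrib power_divide times_divide_eq_right times_divide_eq_left divide_divide_eq_left mult_1 mult_1_right mult.commute)
      qed
      then show "?c t x * indicator I x
        = ennreal (1 / (Gamma \<gamma>)\<^sup>2) * (?v t x * indicator I x)"
        by (cases "x \<in> I") (simp_all only: ennreal_mult'[symmetric] indicator_simps simp_thms mult_1_right mult_zero_right zero_le_divide_1_iff zero_le_power2)
    qed
    also have "\<dots> = ennreal (1 / (Gamma \<gamma>)\<^sup>2) * (\<integral>\<^sup>+x\<in>I. ?v t x \<partial>lborel)"
      by (rule nn_integral_cmult) measurable
    finally show ?thesis by (simp only: mult.assoc)
  qed simp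
  have "?F \<in> borel_measurable lborel" by measurable
  then show ?thesis unfolding carl_int_def eq by (rule nn_integral_cmult)
qed

text \<open>The first constant collects \<open>C1\<close> from the pointwise bound,
  \<open>1 / (2 * \<alpha>)\<close> from \<open>carl_int_le\<close> and
  \<open>1 / Gamma \<gamma>\<close> from the fractional derivative; the square root of
  \<open>2 * \<alpha>\<close> appears because the Carleson quantity is quadratic.\<close>

lemma comparable_carleson: "\<exists>C>0. comparable C (\<lambda>f. ennreal_sqrt (carleson lam \<beta> \<alpha> f))"
proof -
  obtain C1 where C1: "C1 > 0" "\<And>f N. cls f \<Longrightarrow> N > 0 \<Longrightarrow> holder_bd \<alpha> f N \<Longrightarrow> V_bd f (C1 * N)" using V_bd_of_holder by blast
  obtain C2 where C2: "C2 > 0" "\<And>f r. cls f \<Longrightarrow> r > 0 \<Longrightarrow>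
    (\<And>I. I \<in> bounded_intervals \<Longrightarrow> carl_int (V f) \<beta> I \<le> ennreal (r\<^sup>2 * measure lborel I powr (1 + 2 * \<alpha>))) \<Longrightarrow> holder_bd \<alpha> f (C2 * r)"
    using holder_of_carl_int by blast
  let ?G = "Gamma \<gamma>"
  note Gp = Gp
  define D1 where "D1 = C1 / (?G * sqrt (2 * \<alpha>))"
  have D1: "D1 > 0" using C1 Gp a by (simp add: D1_def)
  have D1s: "D1\<^sup>2 = 1 / ?G\<^sup>2 * (C1\<^sup>2 / (2 * \<alpha>))" using a by (simp add: D1_def power_divide power_mult_distrib)
  define D2 where "D2 = C2 * ?G"
  have "comparable (max D1 D2) (\<lambda>f. ennreal_sqrt (carleson lam \<beta> \<alpha> f))"
    unfolding comparable_def
  proof (intro allI impI conjI)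
    fix f N assume *: "cls f" "(N::real) > 0" "holder_bd \<alpha> f N"
    note [measurable] = V_measurable[OF *(1)]
    have "carleson lam \<beta> \<alpha> f \<le> ennreal ((D1 * N)\<^sup>2)"
      unfolding carleson_def
    proof (rule SUP_least)
      fix I assume I: "I \<in> bounded_intervals"
      let ?L = "measure lborel I"
      have L: "?L > 0" by (rule bounded_intervalsD[OF I])
      have cl: "carl_int (V f) \<beta> I \<le> ennreal ((C1 * N)\<^sup>2 / (2 * \<alpha>) * ?L powr (1 + 2 * \<alpha>))"
      proof (rule carl_int_le[OF _ a(1) _ I])
        show "case_prod (V f) \<in> borel_measurable (borel \<Otimes>\<^sub>M borel)" by measurable
        have "snd z powr (\<beta> - \<alpha>) * \<bar>V f (snd z) (fst z)\<bar> \<le> C1 * N" if z: "fst z > 0" "snd z > 0" for z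
        proof -
          have "snd z powr (\<beta> - \<alpha>) * \<bar>V f (snd z) (fst z)\<bar> \<le> snd z powr (\<beta> - \<alpha>) * (C1 * N * snd z powr (\<alpha> - \<beta>))"
            using C1(2)[OF *] z by (intro mult_left_mono) (auto simp: V_bd_def)
          also have "\<dots> = C1 * N" using z by (simp add: powr_mult_powr)
          finally show ?thesis .
        qed
        then show "AE z in lborel. 0 < fst z \<longrightarrow> 0 < snd z \<longrightarrow> snd z powr (\<beta> - \<alpha>) * \<bar>V f (snd z) (fst z)\<bar> \<le> C1 * N"
          by simp
      qed (use C1 * in simp)
      have "ennreal (1 / ?G\<^sup>2) * carl_int (V f) \<beta> I \<le> ennreal (1 / ?G\<^sup>2) * ennreal ((C1 * N)\<^sup>2 / (2 * \<alpha>) * ?L powr (1 + 2 * \<alpha>))"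
        by (intro mult_left_mono cl) simp
      also have "\<dots> = ennreal ((D1 * N)\<^sup>2 * ?L powr (1 + 2 * \<alpha>))"
        by (simp add: ennreal_mult'[symmetric] power_mult_distrib D1s)
      finally have "ennreal (1 / ?G\<^sup>2) * carl_int (V f) \<beta> I / ennreal (?L powr (1 + 2 * \<alpha>)) \<le> ennreal ((D1 * N)\<^sup>2 * ?L powr (1 + 2 * \<alpha>)) / ennreal (?L powr (1 + 2 * \<alpha>))"
        by (rule divide_right_mono_ennreal)
      also have "\<dots> = ennreal ((D1 * N)\<^sup>2)" using L by (simp add: divide_ennreal)
      finally show "(\<integral>\<^sup>+t\<in>{0<..<?L}. (\<integral>\<^sup>+x\<in>I. ennreal ((cmod (of_real (t powr \<beta>) * poisson_frac_deriv lam \<beta> f t x))\<^sup>2 / t) \<partial>lborel) \<partial>lborel)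
        / ennreal (?L powr (1 + 2 * \<alpha>)) \<le> ennreal ((D1 * N)\<^sup>2)"
        unfolding carleson_integral_eq[OF *(1) I] .
    qed
    then have "ennreal_sqrt (carleson lam \<beta> \<alpha> f) \<le> ennreal (D1 * N)" using D1 * by (intro ennreal_sqrt_le) auto
    also have "\<dots> \<le> ennreal (max D1 D2 * N)" using * by (intro ennreal_leI mult_right_mono) auto
    finally show "ennreal_sqrt (carleson lam \<beta> \<alpha> f) \<le> ennreal (max D1 D2 * N)" .
  next
    fix f r assume *: "cls f" "(r::real) > 0" "ennreal_sqrt (carleson lam \<beta> \<alpha> f) < ennreal r"
    have c: "carleson lam \<beta> \<alpha> f \<le> ennreal (r\<^sup>2)" using * by (intro le_of_ennreal_sqrt_less)
    have "holder_bd \<alpha> f (C2 * (?G * r))"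
    proof (rule C2(2)[OF *(1)])
      show "?G * r > 0" using Gp * by simp
      fix I assume I: "I \<in> bounded_intervals"
      let ?L = "measure lborel I"
      have L: "?L > 0" by (rule bounded_intervalsD[OF I])
      have "ennreal (1 / ?G\<^sup>2) * carl_int (V f) \<beta> I / ennreal (?L powr (1 + 2 * \<alpha>)) \<le> carleson lam \<beta> \<alpha> f"
        unfolding carleson_def carleson_integral_eq[OF *(1) I, symmetric] using I by (intro SUP_upper)
      also note c
      finally have "ennreal (1 / ?G\<^sup>2) * carl_int (V f) \<beta> I \<le> ennreal (r\<^sup>2 * ?L powr (1 + 2 * \<alpha>))"
        using L by (intro ennreal_le_of_divide_le) auto
      then have "ennreal (?G\<^sup>2) * (ennreal (1 / ?G\<^sup>2) * carl_int (V f) \<beta> I) \<le> ennreal (?G\<^sup>2) * ennreal (r\<^sup>2 * ?L powr (1 + 2 * \<alpha>))"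
        by (rule mult_left_mono) simp
      also have "ennreal (?G\<^sup>2) * (ennreal (1 / ?G\<^sup>2) * carl_int (V f) \<beta> I) = carl_int (V f) \<beta> I"
        using Gp by (simp add: mult.assoc[symmetric] ennreal_mult'[symmetric])
      also have "ennreal (?G\<^sup>2) * ennreal (r\<^sup>2 * ?L powr (1 + 2 * \<alpha>)) = ennreal ((?G * r)\<^sup>2 * ?L powr (1 + 2 * \<alpha>))"
        by (simp add: ennreal_mult'[symmetric] power_mult_distrib mult.assoc)
      finally show "carl_int (V f) \<beta> I \<le> ennreal ((?G * r)\<^sup>2 * ?L powr (1 + 2 * \<alpha>))" .
    qed
    then show "holder_bd \<alpha> f (max D1 D2 * r)"
    proof (rule holder_bd_mono)
      have "D2 * r \<le> max D1 D2 * r" using * by (intro mult_right_mono) auto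
      then show "C2 * (?G * r) \<le> max D1 D2 * r" by (simp add: D2_def mult.assoc)
    qed
  qed
  then show ?thesis using D1 by (intro exI[of _ "max D1 D2"]) auto
qed

text \<open>A bound almost everywhere in the half plane says nothing about a single time. Instead of
  selecting good times, it is integrated: \<open>carl_int_le\<close> turns it into the Carleson
  condition, which already implies the Hoelder bound.\<close>

lemma comparable_poisson_Linf: "\<exists>C>0. comparable C (poisson_Linf lam \<beta> \<alpha>)"
proof -
  obtain C1 where C1: "C1 > 0" "\<And>f N. cls f \<Longrightarrow> N > 0 \<Longrightarrow> holder_bd \<alpha> f N \<Longrightarrow> V_bd f (C1 * N)" using V_bd_of_holder by blast
  obtain C2 where C2: "C2 > 0" "\<And>f r. cls f \<Longrightarrow> r > 0 \<Longrightarrow>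
    (\<And>I. I \<in> bounded_intervals \<Longrightarrow> carl_int (V f) \<beta> I \<le> ennreal (r\<^sup>2 * measure lborel I powr (1 + 2 * \<alpha>))) \<Longrightarrow> holder_bd \<alpha> f (C2 * r)"
    using holder_of_carl_int by blast
  let ?G = "Gamma \<gamma>"
  note Gp = Gp
  define D1 where "D1 = C1 / ?G"
  have D1: "D1 > 0" using C1 Gp by (simp add: D1_def)
  define D2 where "D2 = C2 * (?G / sqrt (2 * \<alpha>))"
  have set: "{0<..} \<times> {0<..} \<in> sets (borel :: (real \<times> real) measure)" by (simp add: borel_Times)
  have cm: "cmod (of_real (t powr (\<beta> - \<alpha>)) * poisson_frac_deriv lam \<beta> f t x) = t powr (\<beta> - \<alpha>) * \<bar>V f t x\<bar> / ?G"
    if "cls f" "t > 0" "x > 0" for f t x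
    by (simp only: norm_mult norm_of_real cmod_poisson_frac_deriv[OF that] abs_powr times_divide_eq_right)
  have "comparable (max D1 D2) (poisson_Linf lam \<beta> \<alpha>)"
    unfolding comparable_def
  proof (intro allI impI conjI)
    fix f N assume *: "cls f" "(N::real) > 0" "holder_bd \<alpha> f N"
    note [measurable] = V_measurable[OF *(1)]
    have "poisson_Linf lam \<beta> \<alpha> f \<le> ennreal (D1 * N)"
      unfolding poisson_Linf_def
    proof (rule Linf_norm_on_le[OF set, where u = "\<lambda>z. snd z powr (\<beta> - \<alpha>) * \<bar>V f (snd z) (fst z)\<bar> / ?G"])
      show "(\<lambda>z. snd z powr (\<beta> - \<alpha>) * \<bar>V f (snd z) (fst z)\<bar> / ?G) \<in> borel_measurable borel"
        unfolding borel_prod[symmetric] by measurable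
      fix z :: "real \<times> real" assume z: "z \<in> {0<..} \<times> {0<..}"
      then show "cmod (case z of (x, t) \<Rightarrow> of_real (t powr (\<beta> - \<alpha>)) * poisson_frac_deriv lam \<beta> f t x) = snd z powr (\<beta> - \<alpha>) * \<bar>V f (snd z) (fst z)\<bar> / ?G"
        using cm[OF *(1)] by auto
      have "snd z powr (\<beta> - \<alpha>) * \<bar>V f (snd z) (fst z)\<bar> \<le> snd z powr (\<beta> - \<alpha>) * (C1 * N * snd z powr (\<alpha> - \<beta>))"
        using C1(2)[OF *] z by (intro mult_left_mono) (auto simp: V_bd_def)
      also have "\<dots> = C1 * N" using z by (auto simp: powr_mult_powr)
      finally show "snd z powr (\<beta> - \<alpha>) * \<bar>V f (snd z) (fst z)\<bar> / ?G \<le> D1 * N" using Gp by (simp add: D1_def divide_right_mono)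
    qed
    also have "\<dots> \<le> ennreal (max D1 D2 * N)" using * by (intro ennreal_leI mult_right_mono) auto
    finally show "poisson_Linf lam \<beta> \<alpha> f \<le> ennreal (max D1 D2 * N)" .
  next
    fix f r assume *: "cls f" "(r::real) > 0" "poisson_Linf lam \<beta> \<alpha> f < ennreal r"
    note [measurable] = V_measurable[OF *(1)]
    have ae: "AE z in lborel. z \<in> {0<..} \<times> {0<..} \<longrightarrow> cmod (case z of (x, t) \<Rightarrow> of_real (t powr (\<beta> - \<alpha>)) * poisson_frac_deriv lam \<beta> f t x) \<le> r"
      using *(2,3) set unfolding poisson_Linf_def by (intro AE_of_Linf_norm_on_le) auto
    have "holder_bd \<alpha> f (C2 * (?G * r / sqrt (2 * \<alpha>)))"
    proof (rule C2(2)[OF *(1)])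
      show "?G * r / sqrt (2 * \<alpha>) > 0" using Gp * a by simp
      fix I assume I: "I \<in> bounded_intervals"
      have "carl_int (V f) \<beta> I \<le> ennreal ((?G * r)\<^sup>2 / (2 * \<alpha>) * measure lborel I powr (1 + 2 * \<alpha>))"
      proof (intro carl_int_le a I)
      show "case_prod (V f) \<in> borel_measurable (borel \<Otimes>\<^sub>M borel)" by measurable
      show "AE z in lborel. 0 < fst z \<longrightarrow> 0 < snd z \<longrightarrow> snd z powr (\<beta> - \<alpha>) * \<bar>V f (snd z) (fst z)\<bar> \<le> ?G * r"
        using ae
      proof eventually_elim
        case (elim z)
        then show ?case using cm[OF *(1), of "snd z" "fst z"] Gp by (cases z) (auto simp: divide_le_eq mult.commute)
      qed
      qed (use Gp * in auto)
      then show "carl_int (V f) \<beta> I \<le> ennreal ((?G * r / sqrt (2 * \<alpha>))\<^sup>2 * measure lborel I powr (1 + 2 * \<alpha>))"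
        using a by (simp add: power_divide)
    qed
    then show "holder_bd \<alpha> f (max D1 D2 * r)"
    proof (rule holder_bd_mono)
      have "D2 * r \<le> max D1 D2 * r" using * by (intro mult_right_mono) auto
      then show "C2 * (?G * r / sqrt (2 * \<alpha>)) \<le> max D1 D2 * r" by (simp add: D2_def mult.assoc)
    qed
  qed
  then show ?thesis using D1 by (intro exI[of _ "max D1 D2"]) auto
qed

text \<open>Here the bound holds at every time, but only for almost every \<open>x\<close>. With
  \<open>t = t / 2 + t / 2\<close>, \<open>Vker_AE_bound\<close> makes it hold everywhere, at the
  cost of a factor that contains \<open>(1 / 2) powr (\<alpha> - \<beta>)\<close>.\<close>

lemma holder_iff_slices:
  assumes f: "cls f"
  shows "(\<exists>N>0. holder_bd \<alpha> f N) \<longleftrightarrow>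
    (\<exists>C\<ge>0. \<forall>t>0. Linf_norm_on {0<..} (\<lambda>x. of_real (t powr \<beta>) * poisson_frac_deriv lam \<beta> f t x) \<le> ennreal (C * t powr \<alpha>))"
    (is "?H \<longleftrightarrow> ?S")
proof
  let ?G = "Gamma \<gamma>"
  note Gp = Gp
  note [measurable] = V_measurable[OF f]
  have cm: "cmod (of_real (t powr \<beta>) * poisson_frac_deriv lam \<beta> f t x) = t powr \<beta> * \<bar>V f t x\<bar> / ?G" if "t > 0" "x > 0" for t x
    by (simp only: norm_mult norm_of_real cmod_poisson_frac_deriv[OF f that] abs_powr times_divide_eq_right)
  {
    assume ?H
    then obtain N where N: "N > 0" "holder_bd \<alpha> f N" by blast
    obtain C1 where C1: "C1 > 0" "\<And>f N. cls f \<Longrightarrow> N > 0 \<Longrightarrow> holder_bd \<alpha> f N \<Longrightarrow> V_bd f (C1 * N)" using V_bd_of_holder by blast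
    show ?S
    proof (intro exI[of _ "C1 * N / ?G"] conjI allI impI)
      fix t :: real assume t: "t > 0"
      show "Linf_norm_on {0<..} (\<lambda>x. of_real (t powr \<beta>) * poisson_frac_deriv lam \<beta> f t x) \<le> ennreal (C1 * N / ?G * t powr \<alpha>)"
      proof (rule Linf_norm_on_le[where u = "\<lambda>x. t powr \<beta> * \<bar>V f t x\<bar> / ?G"])
        fix x :: real assume "x \<in> {0<..}"
        then have x: "x > 0" by simp
        show "cmod (of_real (t powr \<beta>) * poisson_frac_deriv lam \<beta> f t x) = t powr \<beta> * \<bar>V f t x\<bar> / ?G" by (rule cm[OF t x])
        have "t powr \<beta> * \<bar>V f t x\<bar> \<le> t powr \<beta> * (C1 * N * t powr (\<alpha> - \<beta>))"
          using C1(2)[OF f N] x t by (intro mult_left_mono) (auto simp: V_bd_def)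
        also have "\<dots> = C1 * N * t powr \<alpha>" by (simp add: powr_mult_powr)
        finally show "t powr \<beta> * \<bar>V f t x\<bar> / ?G \<le> C1 * N / ?G * t powr \<alpha>" using Gp by (simp add: divide_right_mono)
      qed measurable
    qed (use C1 N Gp in simp)
  next
    assume ?S
    then obtain C where C: "C \<ge> 0" "\<And>t. t > 0 \<Longrightarrow> Linf_norm_on {0<..} (\<lambda>x. of_real (t powr \<beta>) * poisson_frac_deriv lam \<beta> f t x) \<le> ennreal (C * t powr \<alpha>)" by blast
    obtain C2 where C2: "C2 > 0" "\<And>f N. cls f \<Longrightarrow> N \<ge> 0 \<Longrightarrow> V_bd f N \<Longrightarrow> holder_bd \<alpha> f (C2 * N)" using holder_of_V_bd by blast
    obtain C4 where C4: "C4 \<ge> 0" "\<forall>f t s x B. adm lam 0 f \<longrightarrow> t > 0 \<longrightarrow> s > 0 \<longrightarrow> x > 0 \<longrightarrow> B \<ge> 0 \<longrightarrow>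
      (AE y in lborel. y > 0 \<longrightarrow> \<bar>V f t y\<bar> \<le> B) \<longrightarrow> \<bar>V f (t + s) x\<bar> \<le> C4 * B"
      using Vker_AE_bound[OF lam b g] by (elim exE conjE) (rule that)
    have ae: "AE y in lborel. y > 0 \<longrightarrow> \<bar>V f t y\<bar> \<le> ?G * C * t powr (\<alpha> - \<beta>)" if t: "t > 0" for t
    proof -
      have "AE x in lborel. x \<in> {0<..} \<longrightarrow> cmod (of_real (t powr \<beta>) * poisson_frac_deriv lam \<beta> f t x) \<le> C * t powr \<alpha>"
        by (rule AE_of_Linf_norm_on_le[OF C(2)[OF t]]) (use C in auto)
      then show ?thesis
      proof eventually_elim
        case (elim x)
        have "\<bar>V f t x\<bar> \<le> ?G * C * t powr (\<alpha> - \<beta>)" if x: "x > 0"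
        proof -
          have "t powr \<beta> * \<bar>V f t x\<bar> \<le> ?G * C * t powr \<alpha>" using elim cm[OF t x] x by (simp add: pos_divide_le_eq[OF Gp] mult.assoc mult.left_commute[of _ ?G] mult.commute[of _ ?G])
          then have "t powr (- \<beta>) * (t powr \<beta> * \<bar>V f t x\<bar>) \<le> t powr (- \<beta>) * (?G * C * t powr \<alpha>)" by (rule mult_left_mono) simp
          moreover have "t powr (- \<beta>) * (t powr \<beta> * \<bar>V f t x\<bar>) = \<bar>V f t x\<bar>" using t by (simp add: powr_minus)
          moreover have "t powr (- \<beta>) * (?G * C * t powr \<alpha>) = ?G * C * t powr (\<alpha> - \<beta>)"
            using powr_mult_powr[of t "- \<beta>" "?G * C" \<alpha>] by simp
          ultimately show ?thesis by linarith
        qed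
        then show ?case by blast
      qed
    qed
    define N where "N = C4 * (?G * C * (1/2) powr (\<alpha> - \<beta>))"
    have N0: "N \<ge> 0" using C C4 Gp by (simp add: N_def)
    have "\<bar>V f t x\<bar> \<le> N * t powr (\<alpha> - \<beta>)" if "t > 0" "x > 0" for t x
    proof -
      have "\<bar>V f (t / 2 + t / 2) x\<bar> \<le> C4 * (?G * C * (t / 2) powr (\<alpha> - \<beta>))"
        using that C Gp by (intro C4(2)[rule_format] cls_adm[OF f] ae) auto
      also have "\<dots> = N * t powr (\<alpha> - \<beta>)" using powr_mult[of t "1/2" "\<alpha> - \<beta>"] by (simp add: N_def)
      finally show ?thesis by simp
    qed
    then have h: "holder_bd \<alpha> f (C2 * N)" by (intro C2(2)[OF f N0]) (simp add: V_bd_def)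
    \<comment> \<open>The summand 1 keeps the constant positive even if \<open>C2 * N\<close> is
      zero.\<close>
    have "holder_bd \<alpha> f (C2 * N + 1)" using h by (rule holder_bd_mono) simp
    then show ?H using C2(1) N0 by (intro exI[of _ "C2 * N + 1"]) (auto intro: add_nonneg_pos)
  }
qed

end

theorem theorem4p7:
  fixes lam \<beta> \<alpha> :: real
  assumes "0 < lam" and "0 < \<beta>" and "0 < \<alpha>" and "\<alpha> < 1" and "\<alpha> < min lam \<beta>"
  shows "(\<forall>f. continuous_on {0<..} f \<and> f \<in> L_space (min lam \<beta> / 2) \<longrightarrow>
           (f \<in> holder_space \<alpha>
              \<longleftrightarrow> (\<forall>p\<ge>1. \<exists>C>0. M1 \<alpha> p f C \<and> M2 \<alpha> p f C)) \<and>
           (f \<in> holder_space \<alpha>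
              \<longleftrightarrow> (\<exists>C\<ge>0. \<forall>t>0.
                    Linf_norm_on {0<..}
                      (\<lambda>x. of_real (t powr \<beta>) * poisson_frac_deriv lam \<beta> f t x)
                    \<le> ennreal (C * t powr \<alpha>))) \<and>
           (f \<in> holder_space \<alpha> \<longleftrightarrow> carleson lam \<beta> \<alpha> f < \<infinity>)) \<and>
         (\<forall>p\<ge>1. \<exists>K>0. \<forall>f. continuous_on {0<..} f \<and> f \<in> L_space (min lam \<beta> / 2) \<longrightarrow>
           (let Q = {holder_norm \<alpha> f, campanato_const \<alpha> p f,
                     poisson_Linf lam \<beta> \<alpha> f, ennreal_sqrt (carleson lam \<beta> \<alpha> f)}
            in \<forall>A\<in>Q. \<forall>B\<in>Q. A \<le> ennreal K * B))"
proof -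
  interpret bessel_holder lam \<beta> \<alpha> using assms by unfold_locales
  obtain Cc where Cc: "Cc > 0" "comparable Cc (\<lambda>f. ennreal_sqrt (carleson lam \<beta> \<alpha> f))" using comparable_carleson by blast
  obtain Cl where Cl: "Cl > 0" "comparable Cl (poisson_Linf lam \<beta> \<alpha>)" using comparable_poisson_Linf by blast
  show ?thesis
    unfolding cls_def[symmetric]
  proof (intro conjI allI impI)
    fix f assume f: "cls f"
    have "f \<in> holder_space \<alpha> \<longleftrightarrow> holder_norm \<alpha> f < \<infinity>" using f by (simp add: holder_space_def cls_def)
    then have H: "f \<in> holder_space \<alpha> \<longleftrightarrow> (\<exists>N>0. holder_bd \<alpha> f N)"
      using comparable_finite_iff[OF comparable_holder_norm _ f] by simp
    have M: "(\<exists>C>0. M1 \<alpha> p f C \<and> M2 \<alpha> p f C) \<longleftrightarrow> (\<exists>N>0. holder_bd \<alpha> f N)" if "p \<ge> 1" for p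
      unfolding campanato_finite_iff[symmetric] using comparable_campanato[OF that] comparable_finite_iff[OF _ _ f] by blast
    show "f \<in> holder_space \<alpha> \<longleftrightarrow> (\<forall>p\<ge>1. \<exists>C>0. M1 \<alpha> p f C \<and> M2 \<alpha> p f C)"
      unfolding H using M by (metis order_refl)
    show "f \<in> holder_space \<alpha> \<longleftrightarrow> (\<exists>C\<ge>0. \<forall>t>0. Linf_norm_on {0<..} (\<lambda>x. of_real (t powr \<beta>) * poisson_frac_deriv lam \<beta> f t x) \<le> ennreal (C * t powr \<alpha>))"
      unfolding H by (rule holder_iff_slices[OF f])
    show "f \<in> holder_space \<alpha> \<longleftrightarrow> carleson lam \<beta> \<alpha> f < \<infinity>"
      unfolding H using comparable_finite_iff[OF Cc(2,1) f] by (simp only: ennreal_sqrt_less_top)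
  next
    fix p :: real assume "1 \<le> p"
    then obtain Cp where Cp: "Cp > 0" "comparable Cp (campanato_const \<alpha> p)" using comparable_campanato by blast
    \<comment> \<open>One constant serves all four functionals, so \<open>comparable_le\<close>
      yields the same \<open>K = C * C\<close> for every pair.\<close>
    define C where "C = 2 + Cc + Cl + Cp"
    have C: "C > 0" "2 \<le> C" "Cc \<le> C" "Cl \<le> C" "Cp \<le> C" using Cc Cl Cp by (auto simp: C_def)
    have cmp: "comparable C (holder_norm \<alpha>)" "comparable C (campanato_const \<alpha> p)" "comparable C (poisson_Linf lam \<beta> \<alpha>)" "comparable C (\<lambda>f. ennreal_sqrt (carleson lam \<beta> \<alpha> f))"
      using comparable_mono[OF comparable_holder_norm C(2)] comparable_mono[OF Cp(2) C(5)] comparable_mono[OF Cl(2) C(4)] comparable_mono[OF Cc(2) C(3)] by auto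
    show "\<exists>K>0. \<forall>f. cls f \<longrightarrow> (let Q = {holder_norm \<alpha> f, campanato_const \<alpha> p f, poisson_Linf lam \<beta> \<alpha> f, ennreal_sqrt (carleson lam \<beta> \<alpha> f)}
            in \<forall>A\<in>Q. \<forall>B\<in>Q. A \<le> ennreal K * B)"
    proof (intro exI[of _ "C * C"] conjI allI impI)
      fix f assume f: "cls f"
      let ?S = "{holder_norm \<alpha>, campanato_const \<alpha> p, poisson_Linf lam \<beta> \<alpha>, \<lambda>f. ennreal_sqrt (carleson lam \<beta> \<alpha> f)}"
      have "comparable C A" if "A \<in> ?S" for A using that cmp by blast
      then have "A f \<le> ennreal (C * C) * B f" if "A \<in> ?S" "B \<in> ?S" for A B
        using that by (intro comparable_le[OF _ _ C(1) f])
      then have "\<forall>A\<in>(\<lambda>A. A f) ` ?S. \<forall>B\<in>(\<lambda>A. A f) ` ?S. A \<le> ennreal (C * C) * B" by blast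
      then show "let Q = {holder_norm \<alpha> f, campanato_const \<alpha> p f, poisson_Linf lam \<beta> \<alpha> f, ennreal_sqrt (carleson lam \<beta> \<alpha> f)}
            in \<forall>A\<in>Q. \<forall>B\<in>Q. A \<le> ennreal (C * C) * B"
        by (simp only: Let_def image_insert image_empty)
    qed (use C in simp)
  qed
qed

end
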